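(* There exists a nonempty open set $\mathcal{O}\subset Y$ such that for every $V\in\mathcal{O}$ there exists an excited state $\phi$ of the equation $$\partial_{tt}u-\Delta u-Vu+u^5=0 \quad\text{on } \mathbb{R}\times\mathbb{R}^3$$ which is stable.
   Context: Fix $\beta>2$. Let $Y$ be the space of radial functions $V\in C(\mathbb{R}^3)$ with $\|V\|_Y:=\sup_{x\in\mathbb{R}^3}(1+|x|)^{\beta}|V(x)|<\infty$, with the norm $\|\cdot\|_Y$. All functions are real valued. A steady state is a function $\phi\in\dot H^1(\mathbb{R}^3)$ solving $-\Delta\phi-V\phi+\phi^5=0$ in the sense of distributions. A ground state is a steady state which is a global minimizer over $\dot H^1(\mathbb{R}^3)$ of $$J(\phi)=\int_{\mathbb{R}^3}\Big[\frac{|\nabla\phi|^2}{2}-\frac{V\phi^2}{2}+\frac{\phi^6}{6}\Big]dx;$$ when $-\Delta-V$ has negative eigenvalues the ground states are $Q$ and $-Q$ for some $Q>0$. An excited state is a steady state that is not a ground state. The linearized operator around a steady state $\phi$ is $\mathcal{L}_\phi=-\Delta-V+5\phi^4$. The steady state $\phi$ is called stable if $\mathcal{L}_\phi$ has no negative eigenvalues, no zero eigenvalue and no zero resonance (a zero resonance being a nonzero $\psi\in\dot H^1(\mathbb{R}^3)\setminus L^2(\mathbb{R}^3)$ with $\mathcal{L}_\phi\psi=0$). By dispersive estimates, this spectral stability implies asymptotic stability of $(\phi,0)$, and the two notions are not distinguished. *)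

theory Defs
  imports "HOL-Analysis.Analysis"
begin

section \<open>Potentials: the normed space $Y$\<close>

definition radial :: "(real ^ 3 \<Rightarrow> real) \<Rightarrow> bool"
  where "radial V \<longleftrightarrow> (\<forall>x y. norm x = norm y \<longrightarrow> V x = V y)"

definition Y :: "real \<Rightarrow> (real ^ 3 \<Rightarrow> real) set"
  where "Y \<beta> = {V. radial V \<and> continuous_on UNIV V
                  \<and> bdd_above (range (\<lambda>x. (1 + norm x) powr \<beta> * \<bar>V x\<bar>))}"

definition Y_norm :: "real \<Rightarrow> (real ^ 3 \<Rightarrow> real) \<Rightarrow> real"
  where "Y_norm \<beta> V = (SUP x. (1 + norm x) powr \<beta> * \<bar>V x\<bar>)"

text \<open>The value outside \<^term>\<open>Y \<beta>\<close> is irrelevant; it is set to \<open>0\<close> because \<^locale>\<open>Metric_space\<close>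
  asks for nonnegativity and symmetry on the whole type.\<close>

definition Y_dist :: "real \<Rightarrow> (real ^ 3 \<Rightarrow> real) \<Rightarrow> (real ^ 3 \<Rightarrow> real) \<Rightarrow> real"
  where "Y_dist \<beta> V W = (if V \<in> Y \<beta> \<and> W \<in> Y \<beta> then Y_norm \<beta> (\<lambda>x. V x - W x) else 0)"

abbreviation Y_topology :: "real \<Rightarrow> (real ^ 3 \<Rightarrow> real) topology"
  where "Y_topology \<beta> \<equiv> Metric_space.mtopology (Y \<beta>) (Y_dist \<beta>)"

lemma Y_diff:
  assumes "V \<in> Y \<beta>" "W \<in> Y \<beta>"
  shows "(\<lambda>x. V x - W x) \<in> Y \<beta>"
proof -
  obtain A B where A: "\<And>x. (1 + norm x) powr \<beta> * \<bar>V x\<bar> \<le> A"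
    and B: "\<And>x. (1 + norm x) powr \<beta> * \<bar>W x\<bar> \<le> B"
    using assms unfolding Y_def bdd_above_def by auto
  have "(1 + norm x) powr \<beta> * \<bar>V x - W x\<bar> \<le> A + B" for x
  proof -
    have "(1 + norm x) powr \<beta> * \<bar>V x - W x\<bar> \<le> (1 + norm x) powr \<beta> * (\<bar>V x\<bar> + \<bar>W x\<bar>)"
      by (intro mult_left_mono) auto
    with A[of x] B[of x] show ?thesis by (simp add: distrib_left)
  qed
  then have "bdd_above (range (\<lambda>x. (1 + norm x) powr \<beta> * \<bar>V x - W x\<bar>))"
    by (intro bdd_aboveI2)
  moreover have "radial (\<lambda>x. V x - W x)"
    unfolding radial_def
  proof (intro allI impI)
    fix x y :: "real ^ 3"
    assume "norm x = norm y"
    then have "V x = V y" "W x = W y"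
      using assms unfolding Y_def radial_def by blast+
    then show "V x - W x = V y - W y" by simp
  qed
  moreover have "continuous_on UNIV (\<lambda>x. V x - W x)"
    using assms by (auto simp: Y_def intro: continuous_intros)
  ultimately show ?thesis by (simp add: Y_def)
qed

lemma Y_norm_upper: "V \<in> Y \<beta> \<Longrightarrow> (1 + norm x) powr \<beta> * \<bar>V x\<bar> \<le> Y_norm \<beta> V"
  unfolding Y_norm_def by (rule cSUP_upper) (auto simp: Y_def)

lemma Y_norm_least: "(\<And>x. (1 + norm x) powr \<beta> * \<bar>V x\<bar> \<le> c) \<Longrightarrow> Y_norm \<beta> V \<le> c"
  unfolding Y_norm_def by (rule cSUP_least) auto

lemma Metric_space_Y: "Metric_space (Y \<beta>) (Y_dist \<beta>)"
proof
  fix V W :: "real ^ 3 \<Rightarrow> real"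
  have nonneg: "0 \<le> Y_norm \<beta> U" if "U \<in> Y \<beta>" for U
    using Y_norm_upper[OF that, of 0] by simp
  show "0 \<le> Y_dist \<beta> V W"
    using nonneg Y_diff unfolding Y_dist_def by auto
  show "Y_dist \<beta> V W = Y_dist \<beta> W V"
    unfolding Y_dist_def Y_norm_def by (simp add: abs_minus_commute)
  show "Y_dist \<beta> V W = 0 \<longleftrightarrow> V = W" if "V \<in> Y \<beta>" "W \<in> Y \<beta>"
  proof
    assume "Y_dist \<beta> V W = 0"
    have "V x - W x = 0" for x
    proof (rule ccontr)
      assume "V x - W x \<noteq> 0"
      moreover have "1 + norm x > 0"
        using norm_ge_zero[of x] by linarith
      ultimately have "(1 + norm x) powr \<beta> * \<bar>V x - W x\<bar> > 0"
        by (intro mult_pos_pos) auto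
      moreover have "(1 + norm x) powr \<beta> * \<bar>V x - W x\<bar> \<le> 0"
        using Y_norm_upper[OF Y_diff[OF that], of x] that \<open>Y_dist \<beta> V W = 0\<close>
        by (simp add: Y_dist_def)
      ultimately show False by linarith
    qed
    then show "V = W" by (simp add: fun_eq_iff)
  qed (simp add: Y_dist_def Y_norm_def)
  show "Y_dist \<beta> V U \<le> Y_dist \<beta> V W + Y_dist \<beta> W U"
    if m: "V \<in> Y \<beta>" "W \<in> Y \<beta>" "U \<in> Y \<beta>" for U
  proof -
    have "(1 + norm x) powr \<beta> * \<bar>V x - U x\<bar>
        \<le> Y_norm \<beta> (\<lambda>x. V x - W x) + Y_norm \<beta> (\<lambda>x. W x - U x)" for x
    proof -
      have "(1 + norm x) powr \<beta> * \<bar>V x - U x\<bar>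
          \<le> (1 + norm x) powr \<beta> * (\<bar>V x - W x\<bar> + \<bar>W x - U x\<bar>)"
        by (intro mult_left_mono) auto
      with Y_norm_upper[OF Y_diff[OF m(1,2)], of x] Y_norm_upper[OF Y_diff[OF m(2,3)], of x]
      show ?thesis by (simp add: distrib_left)
    qed
    from Y_norm_least[OF this] show ?thesis using m by (simp add: Y_dist_def)
  qed
qed

section \<open>Test functions, weak gradients and function spaces\<close>

definition partial :: "3 \<Rightarrow> (real ^ 3 \<Rightarrow> real) \<Rightarrow> real ^ 3 \<Rightarrow> real"
  where "partial i f x = frechet_derivative f (at x) (axis i 1)"

definition laplacian :: "(real ^ 3 \<Rightarrow> real) \<Rightarrow> real ^ 3 \<Rightarrow> real"
  where "laplacian f x = (\<Sum>i\<in>UNIV. partial i (partial i f) x)"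

primrec C_k :: "nat \<Rightarrow> (real ^ 3 \<Rightarrow> real) \<Rightarrow> bool" where
  "C_k 0 f \<longleftrightarrow> continuous_on UNIV f"
| "C_k (Suc k) f \<longleftrightarrow> (\<forall>x. f differentiable (at x)) \<and> (\<forall>i. C_k k (partial i f))"

definition test_function :: "(real ^ 3 \<Rightarrow> real) \<Rightarrow> bool"
  where "test_function \<eta> \<longleftrightarrow> (\<forall>k. C_k k \<eta>) \<and> compact (closure {x. \<eta> x \<noteq> 0})"

text \<open>Elements of the function spaces below are represented by Borel functions; equality in
  these spaces is equality almost everywhere.\<close>

definition in_Lp :: "nat \<Rightarrow> (real ^ 3 \<Rightarrow> 'b::euclidean_space) \<Rightarrow> bool"
  where "in_Lp p f \<longleftrightarrow> f \<in> borel_measurable lborel \<and> integrable lborel (\<lambda>x. norm (f x) ^ p)"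

definition locally_integrable :: "(real ^ 3 \<Rightarrow> 'b::euclidean_space) \<Rightarrow> bool"
  where "locally_integrable f \<longleftrightarrow>
    f \<in> borel_measurable lborel \<and> (\<forall>K. compact K \<longrightarrow> set_integrable lborel K f)"

definition has_weak_gradient :: "(real ^ 3 \<Rightarrow> real) \<Rightarrow> (real ^ 3 \<Rightarrow> real ^ 3) \<Rightarrow> bool"
  where "has_weak_gradient u g \<longleftrightarrow> locally_integrable u \<and> locally_integrable g \<and>
    (\<forall>\<eta> i. test_function \<eta> \<longrightarrow>
       (\<integral>x. u x * partial i \<eta> x \<partial>lborel) = - (\<integral>x. g x $ i * \<eta> x \<partial>lborel))"

text \<open>The weak gradient is unique up to null sets, so the choice below is immaterial
  under an integral.\<close>

definition weak_gradient :: "(real ^ 3 \<Rightarrow> real) \<Rightarrow> real ^ 3 \<Rightarrow> real ^ 3"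
  where "weak_gradient u = (SOME g. has_weak_gradient u g)"

text \<open>In dimension three the homogeneous Sobolev space $\dot H^1$ (the completion of the test
  functions in the norm $\|\nabla u\|_{L^2}$) is realized, by the Sobolev embedding, as the space
  of functions in $L^6$ with weak gradient in $L^2$.\<close>

definition in_Hdot1 :: "(real ^ 3 \<Rightarrow> real) \<Rightarrow> bool"
  where "in_Hdot1 u \<longleftrightarrow> in_Lp 6 u \<and> (\<exists>g. has_weak_gradient u g \<and> in_Lp 2 g)"

definition in_H2 :: "(real ^ 3 \<Rightarrow> real) \<Rightarrow> bool"
  where "in_H2 u \<longleftrightarrow> in_Lp 2 u \<and>
    (\<exists>g. has_weak_gradient u g \<and> in_Lp 2 g \<and>
       (\<forall>i. \<exists>h. has_weak_gradient (\<lambda>x. g x $ i) h \<and> in_Lp 2 h))"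

definition ae_zero :: "(real ^ 3 \<Rightarrow> real) \<Rightarrow> bool"
  where "ae_zero u \<longleftrightarrow> (AE x in lborel. u x = 0)"

section \<open>Steady states\<close>

definition steady_state :: "(real ^ 3 \<Rightarrow> real) \<Rightarrow> (real ^ 3 \<Rightarrow> real) \<Rightarrow> bool"
  where "steady_state V \<phi> \<longleftrightarrow> in_Hdot1 \<phi> \<and>
    (\<forall>\<eta>. test_function \<eta> \<longrightarrow>
       (\<integral>x. - \<phi> x * laplacian \<eta> x - V x * \<phi> x * \<eta> x + \<phi> x ^ 5 * \<eta> x \<partial>lborel) = 0)"

definition J :: "(real ^ 3 \<Rightarrow> real) \<Rightarrow> (real ^ 3 \<Rightarrow> real) \<Rightarrow> real"
  where "J V \<phi> =
    (\<integral>x. (norm (weak_gradient \<phi> x))\<^sup>2 / 2 - V x * (\<phi> x)\<^sup>2 / 2 + \<phi> x ^ 6 / 6 \<partial>lborel)"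

definition ground_state :: "(real ^ 3 \<Rightarrow> real) \<Rightarrow> (real ^ 3 \<Rightarrow> real) \<Rightarrow> bool"
  where "ground_state V \<phi> \<longleftrightarrow> steady_state V \<phi> \<and> (\<forall>\<psi>. in_Hdot1 \<psi> \<longrightarrow> J V \<phi> \<le> J V \<psi>)"

definition excited_state :: "(real ^ 3 \<Rightarrow> real) \<Rightarrow> (real ^ 3 \<Rightarrow> real) \<Rightarrow> bool"
  where "excited_state V \<phi> \<longleftrightarrow> steady_state V \<phi> \<and> \<not> ground_state V \<phi>"

section \<open>The linearized operator and stability\<close>

text \<open>$\mathcal L_\phi \psi = \mu \psi$ in the sense of distributions, where
  $\mathcal L_\phi = -\Delta - V + 5 \phi^4$. For $\phi \in \dot H^1$, all products are locally
  integrable when $\psi \in H^2$ (which embeds in $L^\infty$) or $\psi \in \dot H^1$.\<close>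

definition linearized_eq ::
    "(real ^ 3 \<Rightarrow> real) \<Rightarrow> (real ^ 3 \<Rightarrow> real) \<Rightarrow> real \<Rightarrow> (real ^ 3 \<Rightarrow> real) \<Rightarrow> bool"
  where "linearized_eq V \<phi> \<mu> \<psi> \<longleftrightarrow>
    (\<forall>\<eta>. test_function \<eta> \<longrightarrow>
       (\<integral>x. - \<psi> x * laplacian \<eta> x - V x * \<psi> x * \<eta> x + 5 * \<phi> x ^ 4 * \<psi> x * \<eta> x \<partial>lborel)
       = (\<integral>x. \<mu> * \<psi> x * \<eta> x \<partial>lborel))"

text \<open>For V in Y, steady states are bounded by elliptic regularity, so the linearized operator is self-adjoint in $L^2$ with domain $H^2$.\<close>

definition eigenvalue :: "(real ^ 3 \<Rightarrow> real) \<Rightarrow> (real ^ 3 \<Rightarrow> real) \<Rightarrow> real \<Rightarrow> bool"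
  where "eigenvalue V \<phi> \<mu> \<longleftrightarrow> (\<exists>\<psi>. in_H2 \<psi> \<and> \<not> ae_zero \<psi> \<and> linearized_eq V \<phi> \<mu> \<psi>)"

definition zero_resonance :: "(real ^ 3 \<Rightarrow> real) \<Rightarrow> (real ^ 3 \<Rightarrow> real) \<Rightarrow> bool"
  where "zero_resonance V \<phi> \<longleftrightarrow>
    (\<exists>\<psi>. in_Hdot1 \<psi> \<and> \<not> in_Lp 2 \<psi> \<and> \<not> ae_zero \<psi> \<and> linearized_eq V \<phi> 0 \<psi>)"

definition stable :: "(real ^ 3 \<Rightarrow> real) \<Rightarrow> (real ^ 3 \<Rightarrow> real) \<Rightarrow> bool"
  where "stable V \<phi> \<longleftrightarrow>
    \<not> (\<exists>\<mu><0. eigenvalue V \<phi> \<mu>) \<and> \<not> eigenvalue V \<phi> 0 \<and> \<not> zero_resonance V \<phi>"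

end

theory Submission
  imports Defs
begin

text \<open>
  Stereographic projection of the three-sphere turns its first zonal harmonic \<open>z\<close> into a
  sign-changing function \<open>\<phi>0 = 6 z (1 + \<bar>x\<bar>\<^sup>2) powr (- 1 / 2)\<close> which is a steady state for the explicit
  potential \<open>V0 = - \<Delta>\<phi>0 / \<phi>0 + \<phi>0\<^sup>4\<close>. The factor 6 makes the term \<open>5 \<phi>0\<^sup>4\<close> of the linearization large
  enough for \<open>- \<Delta> - V0 + 5 \<phi>0\<^sup>4\<close> to have a positive strict supersolution \<open>h\<close>, which decays like
  \<open>1 / \<bar>x\<bar>\<close>. For \<open>V\<close> close to \<open>V0\<close> the functions \<open>\<phi>0 - \<epsilon> h\<close> and \<open>\<phi>0 + \<epsilon> h\<close> are then a sub- and a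
  supersolution, so that monotone iteration, in terms of \<open>w r = r \<phi> r\<close> on the half-line, gives
  a radial steady state \<open>\<phi>\<close> between them, and \<open>h\<close> is still a supersolution of the linearization at
  \<open>\<phi>\<close>. Picone's identity with \<open>h\<close>, applied to mollifications, excludes negative and zero modes
  and zero resonances.

  The state \<open>\<phi>\<close> changes sign at a simple zero of its radial profile and is therefore not a
  minimizer: with \<open>\<zeta> = (1 + \<bar>x\<bar>\<^sup>2) powr (- 1 / 2)\<close>, passing from \<open>\<phi>\<close> to \<open>sqrt (\<phi>\<^sup>2 + t\<^sup>2 \<zeta>\<^sup>2)\<close> lowers
  the Dirichlet energy near the nodal sphere by a multiple of \<open>t\<close>, at a cost of order \<open>t\<^sup>2\<close>
  elsewhere.
\<close>

section \<open>Integration by parts on Euclidean space\<close>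

text \<open>The obstacle is built into every sign-changing state:
  \<open>- \<Delta> - V + \<phi>^4\<close> annihilates \<phi>, and an operator of this kind with a
  sign-changing null function of finite energy has negative directions. Only the extra
  \<open>4 \<phi>^4\<close> can restore positivity, and it vanishes on the nodal sphere. What saves
  the construction is that the amplitude is free: since \<open>V0\<close> absorbs \<phi>0^4, a
  larger factor confines the remaining well to a thinner shell around that sphere, and a barrier
  that is concave there pays for it.

  Moving the potential costs an error of decay \<open>\<beta> + 1\<close>, slower than the decay 5
  of the gain coming from the sphere once \<beta> is at most 5/2. Hence the barrier has a correction
  of decay \<open>\<beta> - 1\<close>. The condition \<beta> > 2 gives the Laplacian of that
  correction the right sign, and it also keeps the flux of the gradient of \<phi> bounded, which
  puts \<phi> into the energy space.

  Zero resonances lie in L^6 but not in L^2, so the cutoff argument behind Picone's identity has to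
  work at the scaling-critical exponent, where the cutoff error is at first sight only
  bounded.\<close>

lemma distr_lborel_reflect:
  fixes c :: "'a::euclidean_space"
  shows "distr lborel borel (\<lambda>x. c - x) = (lborel :: 'a measure)"
  using lborel_affine[of "-1" c] by (simp add: density_1)

lemma
  fixes f :: "'a::euclidean_space \<Rightarrow> 'b::{banach, second_countable_topology}"
  assumes [measurable]: "f \<in> borel_measurable borel"
  shows lborel_integral_translate: "(\<integral>x. f (c + x) \<partial>lborel) = (\<integral>x. f x \<partial>lborel)"
    and lborel_integral_reflect: "(\<integral>x. f (c - x) \<partial>lborel) = (\<integral>x. f x \<partial>lborel)"
    and lborel_integrable_translate: "integrable lborel (\<lambda>x. f (c + x)) \<longleftrightarrow> integrable lborel f"
    and lborel_integrable_reflect: "integrable lborel (\<lambda>x. f (c - x)) \<longleftrightarrow> integrable lborel f"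
proof -
  show "(\<integral>x. f (c + x) \<partial>lborel) = (\<integral>x. f x \<partial>lborel)"
    by (subst (2) lborel_distr_plus[symmetric, of c], subst integral_distr) auto
  show "(\<integral>x. f (c - x) \<partial>lborel) = (\<integral>x. f x \<partial>lborel)"
    by (subst (2) distr_lborel_reflect[symmetric, of c], subst integral_distr) auto
  show "integrable lborel (\<lambda>x. f (c + x)) \<longleftrightarrow> integrable lborel f"
    by (subst (2) lborel_distr_plus[symmetric, of c], subst integrable_distr_eq) auto
  show "integrable lborel (\<lambda>x. f (c - x)) \<longleftrightarrow> integrable lborel f"
    by (subst (2) distr_lborel_reflect[symmetric, of c], subst integrable_distr_eq) auto
qed

text \<open>Weaker than continuity on purpose: second derivatives of a radial function may be
  discontinuous at the origin, and indicators of boxes occur as weights. With Borel measurability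
  and compact support it still gives integrability.\<close>

definition loc_bounded :: "('a::real_normed_vector \<Rightarrow> real) \<Rightarrow> bool"
  where "loc_bounded f \<longleftrightarrow> (\<forall>R. \<exists>B. \<forall>x. norm x \<le> R \<longrightarrow> \<bar>f x\<bar> \<le> B)"

lemma loc_boundedE:
  assumes "loc_bounded f"
  obtains B where "B > 0" "\<And>x. norm x \<le> R \<Longrightarrow> \<bar>f x\<bar> \<le> B"
proof -
  obtain B where B: "\<And>x. norm x \<le> R \<Longrightarrow> \<bar>f x\<bar> \<le> B"
    using assms unfolding loc_bounded_def by blast
  show ?thesis
    by (rule that[of "max B 1"]) (use B in \<open>auto simp: le_max_iff_disj\<close>)
qed

lemma loc_bounded_bounded: "(\<And>x. \<bar>f x\<bar> \<le> B) \<Longrightarrow> loc_bounded f"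
  unfolding loc_bounded_def by blast

lemma loc_bounded_continuous:
  fixes f :: "'a::euclidean_space \<Rightarrow> real"
  assumes "continuous_on UNIV f"
  shows "loc_bounded f"
  unfolding loc_bounded_def
proof
  fix R
  have "compact (f ` cball 0 R)"
    using assms by (intro compact_continuous_image) (auto intro: continuous_on_subset)
  then have "bounded (f ` cball 0 R)" by (rule compact_imp_bounded)
  then obtain B where "\<forall>y\<in>f ` cball 0 R. norm y \<le> B"
    unfolding bounded_iff ..
  then show "\<exists>B. \<forall>x. norm x \<le> R \<longrightarrow> \<bar>f x\<bar> \<le> B"
    by (intro exI[of _ B]) simp
qed

lemma loc_bounded_const: "loc_bounded (\<lambda>x. c)"
  unfolding loc_bounded_def by blast

lemma loc_bounded_add:
  assumes "loc_bounded f" "loc_bounded g"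
  shows "loc_bounded (\<lambda>x. f x + g x)"
  unfolding loc_bounded_def
proof
  fix R
  obtain A where "\<And>x. norm x \<le> R \<Longrightarrow> \<bar>f x\<bar> \<le> A"
    using loc_boundedE[OF assms(1)] by blast
  moreover obtain B where "\<And>x. norm x \<le> R \<Longrightarrow> \<bar>g x\<bar> \<le> B"
    using loc_boundedE[OF assms(2)] by blast
  ultimately show "\<exists>B. \<forall>x. norm x \<le> R \<longrightarrow> \<bar>f x + g x\<bar> \<le> B"
    by (intro exI[of _ "A + B"]) (meson abs_triangle_ineq add_mono order_trans)
qed

lemma loc_bounded_mult:
  fixes f g :: "'a::real_normed_vector \<Rightarrow> real"
  assumes "loc_bounded f" "loc_bounded g"
  shows "loc_bounded (\<lambda>x. f x * g x)"
  unfolding loc_bounded_def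
proof
  fix R
  obtain A where "\<And>x. norm x \<le> R \<Longrightarrow> \<bar>f x\<bar> \<le> A"
    using loc_boundedE[OF assms(1)] by blast
  moreover obtain B where "\<And>x. norm x \<le> R \<Longrightarrow> \<bar>g x\<bar> \<le> B"
    using loc_boundedE[OF assms(2)] by blast
  ultimately show "\<exists>B. \<forall>x. norm x \<le> R \<longrightarrow> \<bar>f x * g x\<bar> \<le> B"
    by (intro exI[of _ "A * B"]) (simp add: abs_mult mult_mono')
qed

lemma loc_bounded_uminus: "loc_bounded f \<Longrightarrow> loc_bounded (\<lambda>x. - f x)"
  unfolding loc_bounded_def by simp

lemma loc_bounded_diff: "loc_bounded f \<Longrightarrow> loc_bounded g \<Longrightarrow> loc_bounded (\<lambda>x. f x - g x)"
  using loc_bounded_add[of f "\<lambda>x. - g x"] loc_bounded_uminus[of g] by simp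

lemma loc_bounded_power: "loc_bounded f \<Longrightarrow> loc_bounded (\<lambda>x. f x ^ n)"
  by (induction n) (simp_all add: loc_bounded_const loc_bounded_mult)

lemma loc_bounded_sum:
  "(\<And>i. i \<in> I \<Longrightarrow> loc_bounded (f i)) \<Longrightarrow> loc_bounded (\<lambda>x. \<Sum>i\<in>I. f i x)"
  by (induction I rule: infinite_finite_induct) (simp_all add: loc_bounded_const loc_bounded_add)

lemmas loc_bounded_intros = loc_bounded_const loc_bounded_add loc_bounded_mult loc_bounded_uminus
  loc_bounded_diff loc_bounded_power loc_bounded_sum

lemma integrable_compact_support:
  fixes f :: "'a::euclidean_space \<Rightarrow> real"
  assumes [measurable]: "f \<in> borel_measurable borel" and "loc_bounded f"
    and supp: "\<And>x. norm x > R \<Longrightarrow> f x = 0"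
  shows "integrable lborel f"
proof -
  obtain B where B: "\<And>x. norm x \<le> R \<Longrightarrow> \<bar>f x\<bar> \<le> B"
    using loc_boundedE[OF \<open>loc_bounded f\<close>] by blast
  have "integrable lborel (\<lambda>x. B * indicator (cball 0 R) x)"
    by (intro integrable_mult_right integrable_real_indicator)
       (use emeasure_lborel_cball_finite in \<open>auto simp: top.not_eq_extremum\<close>)
  then show ?thesis
  proof (rule Bochner_Integration.integrable_bound)
    show "AE x in lborel. norm (f x) \<le> norm (B * indicator (cball 0 R) x)"
    proof (intro always_eventually allI)
      fix x show "norm (f x) \<le> norm (B * indicator (cball 0 R) x)"
        using B[of x] supp[of x] by (cases "norm x \<le> R") (auto simp: indicator_def)
    qed
  qed auto
qed

text \<open>The integral of \<open>F (x + t e)\<close> does not depend on \<open>t\<close>; differentiate it at \<open>t = 0\<close>.\<close>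

lemma integral_directional_derivative_eq_0:
  fixes F F' :: "'a::euclidean_space \<Rightarrow> real" and e :: 'a
  assumes [measurable]: "F \<in> borel_measurable borel" "F' \<in> borel_measurable borel"
    and N: "N \<in> null_sets lborel"
    and deriv: "\<And>x t. x \<notin> N \<Longrightarrow> ((\<lambda>t. F (x + t *\<^sub>R e)) has_real_derivative F' (x + t *\<^sub>R e)) (at t)"
    and bdd: "loc_bounded F" "loc_bounded F'"
    and supp: "\<And>x. norm x > R \<Longrightarrow> F x = 0"
  shows "(\<integral>x. F' x \<partial>lborel) = 0"
proof -
  define D where "D n x = (F (inverse (Suc n) *\<^sub>R e + x) - F x) * Suc n" for n :: nat and x
  have D_meas [measurable]: "D n \<in> borel_measurable borel" for n
    unfolding D_def by measurable
  have F_int: "integrable lborel F"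
    using supp bdd by (intro integrable_compact_support) auto
  \<comment> \<open>The mean value point lies within \<open>norm e\<close> of a point that is itself
    within \<open>R + norm e\<close> of the origin, hence this radius.\<close>
  obtain B where "B > 0" and B: "\<And>x. norm x \<le> R + 2 * norm e \<Longrightarrow> \<bar>F' x\<bar> \<le> B"
    using loc_boundedE[OF bdd(2)] by blast
  have notin: "AE x in lborel. x \<notin> N"
    using N by (rule AE_not_in)
  have D_bound: "\<bar>D n x\<bar> \<le> B * indicator (cball 0 (R + norm e)) x" if "x \<notin> N" for n x
  proof -
    define s where "s = inverse (real (Suc n))"
    have s: "0 < s" "s \<le> 1" by (auto simp: s_def field_simps)
    have D_s: "D n x = (F (x + s *\<^sub>R e) - F x) / s"
      unfolding D_def s_def by (simp add: field_simps)
    have ns: "norm (r *\<^sub>R e) \<le> norm e" if "0 \<le> r" "r \<le> 1" for r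
      using that by (simp add: mult_left_le_one_le)
    show ?thesis
    proof (cases "norm x \<le> R + norm e")
      case True
      obtain r where r: "0 < r" "r < s" "F (x + s *\<^sub>R e) - F (x + 0 *\<^sub>R e) = (s - 0) * F' (x + r *\<^sub>R e)"
        using MVT2[OF s(1), of "\<lambda>t. F (x + t *\<^sub>R e)" "\<lambda>t. F' (x + t *\<^sub>R e)"] deriv[OF \<open>x \<notin> N\<close>] by auto
      have "norm (x + r *\<^sub>R e) \<le> R + 2 * norm e"
        using norm_triangle_ineq[of x "r *\<^sub>R e"] ns[of r] r s True by linarith
      then have "\<bar>F' (x + r *\<^sub>R e)\<bar> \<le> B" by (rule B)
      then show ?thesis using True r s by (simp add: D_s)
    next
      case False
      have "norm (x + s *\<^sub>R e) > R"
        using norm_triangle_ineq4[of "x + s *\<^sub>R e" "s *\<^sub>R e"] ns[of s] s False by simp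
      moreover have "norm x > R" using False norm_ge_zero[of e] by linarith
      ultimately show ?thesis using supp \<open>B > 0\<close> by (simp add: D_s)
    qed
  qed
  have lim: "(\<lambda>n. D n x) \<longlonglongrightarrow> F' x" if "x \<notin> N" for x
  proof -
    have "((\<lambda>h. (F (x + h *\<^sub>R e) - F x) / h) \<longlongrightarrow> F' x) (at 0)"
      using deriv[OF that, of 0] by (simp add: DERIV_def)
    moreover have "filterlim (\<lambda>n. inverse (real (Suc n))) (at 0) sequentially"
      using LIMSEQ_inverse_real_of_nat by (auto simp: filterlim_at)
    ultimately have "(\<lambda>n. (F (x + inverse (real (Suc n)) *\<^sub>R e) - F x) / inverse (real (Suc n))) \<longlonglongrightarrow> F' x"
      by (rule filterlim_compose)
    then show ?thesis by (simp add: D_def add.commute divide_inverse)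
  qed
  have "(\<lambda>n. \<integral>x. D n x \<partial>lborel) \<longlonglongrightarrow> (\<integral>x. F' x \<partial>lborel)"
  proof (rule integral_dominated_convergence[where w = "\<lambda>x. B * indicator (cball 0 (R + norm e)) x"])
    show "integrable lborel (\<lambda>x. B * indicator (cball 0 (R + norm e)) x)"
      by (intro integrable_mult_right integrable_real_indicator)
         (use emeasure_lborel_cball_finite in \<open>auto simp: top.not_eq_extremum\<close>)
    show "AE x in lborel. (\<lambda>n. D n x) \<longlonglongrightarrow> F' x"
      using notin lim by (auto elim: eventually_mono)
    show "AE x in lborel. norm (D n x) \<le> B * indicator (cball 0 (R + norm e)) x" for n
      using notin D_bound by (auto elim: eventually_mono)
  qed auto
  moreover have "(\<integral>x. D n x \<partial>lborel) = 0" for n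
    unfolding D_def using F_int
    by (simp add: lborel_integral_translate lborel_integrable_translate)
  ultimately show ?thesis by (simp add: LIMSEQ_const_iff)
qed

section \<open>Test functions: partial derivatives, support and integration by parts\<close>

lemma partial_DERIV:
  assumes "\<And>x. f differentiable (at x)"
  shows "((\<lambda>t. f (x + t *\<^sub>R axis i 1)) has_real_derivative partial i f (x + t *\<^sub>R axis i 1)) (at t)"
proof -
  let ?D = "frechet_derivative f (at (x + t *\<^sub>R axis i 1))"
  have f: "(f has_derivative ?D) (at (x + t *\<^sub>R axis i 1))"
    using assms frechet_derivative_works by blast
  have g: "((\<lambda>t. x + t *\<^sub>R axis i 1) has_derivative (\<lambda>h. h *\<^sub>R axis i 1)) (at t)"
    by (auto intro!: derivative_eq_intros)
  have "((\<lambda>t. f (x + t *\<^sub>R axis i 1)) has_derivative (\<lambda>h. ?D (h *\<^sub>R axis i 1))) (at t)"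
    using has_derivative_compose[OF g f] .
  moreover have "?D (h *\<^sub>R axis i 1) = partial i f (x + t *\<^sub>R axis i 1) * h" for h
    using linear_cmul[OF has_derivative_linear[OF f]] by (simp add: partial_def)
  ultimately show ?thesis
    by (simp add: has_field_derivative_def)
qed

lemma C_k_continuous: "C_k k f \<Longrightarrow> continuous_on UNIV f"
  by (cases k) (auto intro: differentiable_imp_continuous_on simp: differentiable_on_def
      differentiable_at_withinI)

lemma partial_eq_0:
  assumes "open S" "x \<in> S" "\<And>y. y \<in> S \<Longrightarrow> f y = 0"
  shows "partial i f x = 0"
proof -
  have "((\<lambda>_. 0::real) has_derivative (\<lambda>_. 0)) (at x)" by simp
  then have "(f has_derivative (\<lambda>_. 0)) (at x)"
    by (rule has_derivative_transform_within_open[OF _ assms(1,2)]) (simp add: assms(3))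
  then show ?thesis
    unfolding partial_def by (simp add: frechet_derivative_at[symmetric])
qed

lemma test_functionI:
  assumes "\<And>k. C_k k f" "\<And>x. norm x > R \<Longrightarrow> f x = 0"
  shows "test_function f"
  unfolding test_function_def
proof (intro conjI allI assms(1))
  have "closure {x. f x \<noteq> 0} \<subseteq> cball 0 R"
    using assms(2) by (intro closure_minimal) (auto simp: not_less[symmetric])
  then show "compact (closure {x. f x \<noteq> 0})"
    using closed_subset compact_Int_closed[OF compact_cball, of "closure {x. f x \<noteq> 0}"]
    by (metis closed_closure inf.absorb2)
qed

lemma test_function_support:
  assumes "test_function f"
  obtains R where "R > 0" "\<And>x. norm x > R \<Longrightarrow> f x = 0"
proof -
  have "bounded (closure {x. f x \<noteq> 0})"
    using assms compact_imp_bounded unfolding test_function_def by blast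
  then obtain R where "R > 0" "\<And>x. x \<in> closure {x. f x \<noteq> 0} \<Longrightarrow> norm x \<le> R"
    using bounded_pos by blast
  moreover have "{x. f x \<noteq> 0} \<subseteq> closure {x. f x \<noteq> 0}" by (rule closure_subset)
  ultimately show ?thesis using that by (force simp: not_le[symmetric])
qed

lemma test_function_differentiable: "test_function f \<Longrightarrow> f differentiable (at x)"
  unfolding test_function_def using C_k.simps(2) by blast

lemma test_function_continuous: "test_function f \<Longrightarrow> continuous_on UNIV f"
  unfolding test_function_def using C_k_continuous by blast

lemma test_function_loc_bounded: "test_function f \<Longrightarrow> loc_bounded f"
  using test_function_continuous loc_bounded_continuous by blast

lemma test_function_measurable: "test_function f \<Longrightarrow> f \<in> borel_measurable borel"
  using test_function_continuous borel_measurable_continuous_onI by blast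

lemma test_function_partial:
  assumes "test_function f"
  shows "test_function (partial i f)"
proof -
  obtain R where R: "\<And>x. norm x > R \<Longrightarrow> f x = 0"
    using test_function_support[OF assms] by blast
  show ?thesis
  proof (rule test_functionI)
    show "C_k k (partial i f)" for k
      using assms C_k.simps(2)[of k f] unfolding test_function_def by blast
    have op: "open {x :: real ^ 3. norm x > R}"
      by (intro open_Collect_less continuous_intros)
    show "partial i f x = 0" if "norm x > R" for x
      by (rule partial_eq_0[OF op]) (use that R in auto)
  qed
qed

lemma test_function_bounded:
  assumes "test_function f"
  obtains B where "B > 0" "\<And>x. \<bar>f x\<bar> \<le> B"
proof -
  obtain R where R: "\<And>x. norm x > R \<Longrightarrow> f x = 0"
    using test_function_support[OF assms] by blast
  obtain B where B: "B > 0" "\<And>x. norm x \<le> R \<Longrightarrow> \<bar>f x\<bar> \<le> B"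
    using test_function_loc_bounded[OF assms] loc_boundedE by metis
  show ?thesis
  proof (rule that[OF B(1)])
    show "\<bar>f x\<bar> \<le> B" for x
      using B R[of x] by (cases "norm x \<le> R") auto
  qed
qed

lemma integrable_mult_test_function:
  assumes "f \<in> borel_measurable borel" "loc_bounded f" "test_function \<eta>"
  shows "integrable lborel (\<lambda>x. f x * \<eta> x)"
proof -
  obtain R where R: "\<And>x. norm x > R \<Longrightarrow> \<eta> x = 0"
    using test_function_support[OF assms(3)] by blast
  show ?thesis
    by (rule integrable_compact_support[where R = R])
       (use assms test_function_loc_bounded test_function_measurable R in
        \<open>auto intro!: loc_bounded_mult\<close>)
qed

text \<open>The null set \<open>N\<close> allows for radial functions that are not differentiable at
  the origin: with \<open>N\<close> the coordinate line through the origin in direction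
  \<open>i\<close>, every parallel line starting outside \<open>N\<close> avoids the singular point
  for all \<open>t\<close>.\<close>

lemma integration_by_parts:
  fixes f f' :: "real ^ 3 \<Rightarrow> real"
  assumes [measurable]: "f \<in> borel_measurable borel" "f' \<in> borel_measurable borel"
    and bdd: "loc_bounded f" "loc_bounded f'"
    and N: "N \<in> null_sets lborel"
    and deriv: "\<And>x t. x \<notin> N \<Longrightarrow>
      ((\<lambda>t. f (x + t *\<^sub>R axis i 1)) has_real_derivative f' (x + t *\<^sub>R axis i 1)) (at t)"
    and \<eta>: "test_function \<eta>"
  shows "(\<integral>x. f x * partial i \<eta> x \<partial>lborel) = - (\<integral>x. f' x * \<eta> x \<partial>lborel)"
proof -
  note [measurable] = test_function_measurable[OF \<eta>] test_function_measurable[OF test_function_partial[OF \<eta>]]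
  note lb = test_function_loc_bounded[OF \<eta>] test_function_loc_bounded[OF test_function_partial[OF \<eta>]]
  obtain R where R: "\<And>x. norm x > R \<Longrightarrow> \<eta> x = 0"
    using test_function_support[OF \<eta>] by blast
  have "(\<integral>x. f' x * \<eta> x + f x * partial i \<eta> x \<partial>lborel) = 0"
  proof (rule integral_directional_derivative_eq_0[where F = "\<lambda>x. f x * \<eta> x" and e = "axis i 1", OF _ _ N])
    show "((\<lambda>t. f (x + t *\<^sub>R axis i 1) * \<eta> (x + t *\<^sub>R axis i 1)) has_real_derivative
        f' (x + t *\<^sub>R axis i 1) * \<eta> (x + t *\<^sub>R axis i 1) + f (x + t *\<^sub>R axis i 1) * partial i \<eta> (x + t *\<^sub>R axis i 1)) (at t)"
      if "x \<notin> N" for x t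
      by (rule derivative_eq_intros deriv[OF that] partial_DERIV[OF test_function_differentiable[OF \<eta>]] refl)+
         (simp add: mult.commute)
  qed (use bdd lb R in \<open>auto intro!: loc_bounded_mult loc_bounded_add\<close>)
  moreover have "integrable lborel (\<lambda>x. f' x * \<eta> x)" "integrable lborel (\<lambda>x. f x * partial i \<eta> x)"
    using bdd \<eta> test_function_partial by (auto intro!: integrable_mult_test_function)
  ultimately show ?thesis by simp
qed

lemma loc_bounded_imp_locally_integrable:
  fixes f :: "real ^ 3 \<Rightarrow> real"
  assumes [measurable]: "f \<in> borel_measurable borel" and "loc_bounded f"
  shows "locally_integrable f"
  unfolding locally_integrable_def
proof (intro conjI allI impI)
  fix K :: "(real ^ 3) set" assume "compact K"
  then obtain R where R: "\<And>x. x \<in> K \<Longrightarrow> norm x \<le> R"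
    using compact_imp_bounded[of K] unfolding bounded_iff by blast
  have [measurable]: "K \<in> sets borel" using \<open>compact K\<close> by (simp add: borel_compact)
  have "loc_bounded (indicator K :: _ \<Rightarrow> real)"
    by (rule loc_bounded_bounded[of _ 1]) (auto simp: indicator_def)
  then show "set_integrable lborel K f"
    unfolding set_integrable_def real_scaleR_def using assms R
    by (intro integrable_compact_support[where R = R] loc_bounded_mult)
       (auto simp: not_le[symmetric] split: split_indicator)
qed auto

section \<open>Mollifiers\<close>

text \<open>The classical smooth flat function exp (-1/s), together with the negative powers of
  \<open>s\<close> that its derivatives produce; up to polynomial factors the family is closed under
  differentiation.\<close>

definition bump_profile :: "nat \<Rightarrow> real \<Rightarrow> real"
  where "bump_profile n s = (if s > 0 then inverse s ^ n * exp (- inverse s) else 0)"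

text \<open>Raises the index at the price of a factor \<open>s\<close>, so that all terms of a
  derivative can be written with the common index \<open>n + 2\<close>.\<close>

lemma bump_profile_Suc: "s * bump_profile (Suc n) s = bump_profile n s"
  by (simp add: bump_profile_def)

lemma bump_profile_tendsto_0: "(bump_profile n \<longlongrightarrow> 0) (at 0)"
proof -
  have "((\<lambda>s. inverse s ^ n / exp (inverse s)) \<longlongrightarrow> (0::real)) (at_right 0)"
    using filterlim_compose[OF tendsto_power_div_exp_0 filterlim_inverse_at_top_right] .
  then have "(bump_profile n \<longlongrightarrow> 0) (at_right 0)"
    by (rule Lim_transform_eventually)
       (auto simp: eventually_at_right_field bump_profile_def exp_minus divide_inverse intro!: exI[of _ 1])
  moreover have "(bump_profile n \<longlongrightarrow> 0) (at_left 0)"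
    by (rule Lim_transform_eventually[OF tendsto_const])
       (auto simp: eventually_at_left_field bump_profile_def intro!: exI[of _ "-1"])
  ultimately show ?thesis
    by (simp add: filterlim_split_at)
qed

lemma bump_profile_DERIV:
  "(bump_profile n has_real_derivative
     (1 - of_nat n * s) * bump_profile (n + 2) s) (at s)"
proof (cases s "0 :: real" rule: linorder_cases)
  case less
  have "((\<lambda>_. 0) has_real_derivative 0) (at s)" by simp
  then have "(bump_profile n has_real_derivative 0) (at s)"
    by (rule DERIV_cong_ev[THEN iffD1, rotated -1])
       (use less in \<open>auto simp: bump_profile_def eventually_nhds intro!: exI[of _ "{..<0}"]\<close>)
  then show ?thesis using less by (simp add: bump_profile_def)
next
  case equal
  \<comment> \<open>The difference quotient at 0 is again a member of the family, with index
    \<open>n + 1\<close>.\<close>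
  have "((\<lambda>h. bump_profile (Suc n) h) \<longlongrightarrow> 0) (at 0)"
    by (rule bump_profile_tendsto_0)
  then have "((\<lambda>h. (bump_profile n (0 + h) - bump_profile n 0) / h) \<longlongrightarrow> 0) (at 0)"
    by (rule Lim_transform_eventually)
       (auto simp: eventually_at_filter bump_profile_def field_simps)
  then show ?thesis using equal by (simp add: DERIV_def bump_profile_def)
next
  case greater
  have "((\<lambda>s. inverse s ^ n) has_real_derivative
      of_nat n * (inverse s ^ (n - 1) * (- (inverse s * inverse s)))) (at s)"
    using greater by (auto intro!: derivative_eq_intros)
  moreover have "of_nat n * (inverse s ^ (n - 1) * (- (inverse s * inverse s))) = - of_nat n * inverse s ^ (n + 1)"
    by (cases n) (auto simp: algebra_simps)
  ultimately have "((\<lambda>s. inverse s ^ n) has_real_derivative - of_nat n * inverse s ^ (n + 1)) (at s)"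
    by (rule DERIV_cong)
  moreover have "((\<lambda>s. exp (- inverse s)) has_real_derivative exp (- inverse s) * (inverse s * inverse s)) (at s)"
    using greater by (auto intro!: derivative_eq_intros)
  ultimately have "((\<lambda>s. inverse s ^ n * exp (- inverse s)) has_real_derivative
      inverse s ^ n * (exp (- inverse s) * (inverse s * inverse s)) + - of_nat n * inverse s ^ (n + 1) * exp (- inverse s)) (at s)"
    by (rule DERIV_mult')
  moreover have "inverse s ^ n * (exp (- inverse s) * (inverse s * inverse s)) + - of_nat n * inverse s ^ (n + 1) * exp (- inverse s)
      = (1 - of_nat n * s) * bump_profile (n + 2) s"
    using greater by (simp add: bump_profile_def field_simps power2_eq_square)
  ultimately have "((\<lambda>s. inverse s ^ n * exp (- inverse s)) has_real_derivative
      (1 - of_nat n * s) * bump_profile (n + 2) s) (at s)" by simp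
  then show ?thesis
    by (rule DERIV_cong_ev[THEN iffD1, rotated -1])
       (use greater in \<open>auto simp: bump_profile_def eventually_nhds intro!: exI[of _ "{0<..}"]\<close>)
qed

lemma real_polynomial_function_directional_derivative:
  fixes p :: "'a::real_normed_vector \<Rightarrow> real"
  assumes "real_polynomial_function p"
  shows "\<exists>q. real_polynomial_function q \<and> (\<forall>x. \<exists>D. (p has_derivative D) (at x) \<and> D e = q x)"
  using assms
proof induction
  case (linear f)
  then show ?case
    by (intro exI[of _ "\<lambda>_. f e"]) (auto intro: bounded_linear_imp_has_derivative)
next
  case (const c)
  then show ?case by (intro exI[of _ "\<lambda>_. 0"]) (auto intro!: exI[of _ "\<lambda>_. 0"])
next
  case (add f g)
  obtain f' where f': "real_polynomial_function f'" "\<And>x. \<exists>D. (f has_derivative D) (at x) \<and> D e = f' x"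
    using add.IH(1) by blast
  obtain g' where g': "real_polynomial_function g'" "\<And>x. \<exists>D. (g has_derivative D) (at x) \<and> D e = g' x"
    using add.IH(2) by blast
  have "\<exists>D. ((\<lambda>x. f x + g x) has_derivative D) (at x) \<and> D e = f' x + g' x" for x
  proof -
    obtain A where "(f has_derivative A) (at x)" "A e = f' x" using f'(2) by blast
    moreover obtain B where "(g has_derivative B) (at x)" "B e = g' x" using g'(2) by blast
    ultimately show ?thesis
      by (intro exI[of _ "\<lambda>h. A h + B h"]) (auto intro: has_derivative_add)
  qed
  with f' g' show ?case by (intro exI[of _ "\<lambda>x. f' x + g' x"]) auto
next
  case (mult f g)
  obtain f' where f': "real_polynomial_function f'" "\<And>x. \<exists>D. (f has_derivative D) (at x) \<and> D e = f' x"
    using mult.IH(1) by blast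
  obtain g' where g': "real_polynomial_function g'" "\<And>x. \<exists>D. (g has_derivative D) (at x) \<and> D e = g' x"
    using mult.IH(2) by blast
  have "\<exists>D. ((\<lambda>x. f x * g x) has_derivative D) (at x) \<and> D e = f x * g' x + f' x * g x" for x
  proof -
    obtain A where "(f has_derivative A) (at x)" "A e = f' x" using f'(2) by blast
    moreover obtain B where "(g has_derivative B) (at x)" "B e = g' x" using g'(2) by blast
    ultimately show ?thesis
      by (intro exI[of _ "\<lambda>h. f x * B h + A h * g x"]) (auto intro: has_derivative_mult)
  qed
  with f' g' mult.hyps show ?case by (intro exI[of _ "\<lambda>x. f x * g' x + f' x * g x"]) auto
qed

text \<open>One partial derivative replaces \<open>n\<close> by \<open>n + 2\<close> and
  \<open>p\<close> by another polynomial, so the induction on \<open>k\<close> closes once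
  \<open>p\<close> and \<open>n\<close> are both arbitrary.\<close>

lemma C_k_bump:
  fixes p :: "real ^ 3 \<Rightarrow> real"
  assumes "real_polynomial_function p"
  shows "C_k k (\<lambda>x. p x * bump_profile n (1 - x \<bullet> x))"
  using assms
proof (induction k arbitrary: p n)
  case (0 p n)
  have "continuous_on UNIV p"
    using 0 continuous_on_polymonial_function real_polynomial_function_eq by blast
  moreover have "continuous_on UNIV (bump_profile n)"
    by (intro continuous_at_imp_continuous_on ballI DERIV_isCont[OF bump_profile_DERIV])
  ultimately show ?case
    by (auto intro!: continuous_intros continuous_on_compose2[of UNIV "bump_profile n"])
next
  case (Suc k p n)
  let ?f = "\<lambda>x. p x * bump_profile n (1 - x \<bullet> x)"
  have poly_inner: "real_polynomial_function (\<lambda>x :: real ^ 3. x $ j)" for j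
    by (intro real_polynomial_function.intros(1) bounded_linear_vec_nth)
  have D: "\<exists>q. real_polynomial_function q \<and>
      (\<forall>x. \<exists>D. (?f has_derivative D) (at x) \<and> D (axis i 1) = q x * bump_profile (n + 2) (1 - x \<bullet> x))" for i
  proof -
    obtain p' where p': "real_polynomial_function p'"
        "\<And>x. \<exists>D. (p has_derivative D) (at x) \<and> D (axis i 1) = p' x"
      using real_polynomial_function_directional_derivative[OF Suc.prems] by blast
    define s where "s x = 1 + (- 1) * (\<Sum>j\<in>UNIV. x $ j * x $ j)" for x :: "real ^ 3"
    have s: "s x = 1 - x \<bullet> x" for x by (simp add: s_def inner_vec_def)
    have s_poly: "real_polynomial_function s"
      unfolding s_def
      by (intro real_polynomial_function.intros(2-4) real_polynomial_function_sum poly_inner) auto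
    \<comment> \<open>The factor \<open>s x * s x\<close> on \<open>p'\<close> comes from rewriting
      index \<open>n\<close> as index \<open>n + 2\<close>; the other term is the chain rule through
      \<open>1 - x \<bullet> x\<close>.\<close>
    define q where "q x = p' x * (s x * s x) + p x * ((1 + (- of_nat n) * s x) * ((- 2) * x $ i))" for x
    have "real_polynomial_function q"
      unfolding q_def by (intro real_polynomial_function.intros(2-4) s_poly poly_inner p' Suc.prems)
    moreover have "\<exists>D. (?f has_derivative D) (at x) \<and> D (axis i 1) = q x * bump_profile (n + 2) (1 - x \<bullet> x)" for x
    proof -
      obtain A where A: "(p has_derivative A) (at x)" "A (axis i 1) = p' x" using p'(2) by blast
      have "((\<lambda>x. 1 - x \<bullet> x) has_derivative (\<lambda>h. - (2 * (x \<bullet> h)))) (at x)"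
        by (auto intro!: derivative_eq_intros simp: inner_commute)
      from DERIV_compose_FDERIV[OF bump_profile_DERIV this]
      have "((\<lambda>x. bump_profile n (1 - x \<bullet> x)) has_derivative
          (\<lambda>h. - (2 * (x \<bullet> h)) * ((1 - of_nat n * s x) * bump_profile (n + 2) (s x)))) (at x)"
        by (simp add: s)
      from has_derivative_mult[OF A(1) this]
      have "(?f has_derivative (\<lambda>h. p x * (- (2 * (x \<bullet> h)) * ((1 - of_nat n * s x) * bump_profile (n + 2) (s x)))
          + A h * bump_profile n (s x))) (at x)"
        by (simp add: s)
      note deriv = this
      have "bump_profile n (s x) = s x * (s x * bump_profile (n + 2) (s x))"
        by (simp add: bump_profile_Suc)
      then have "p x * (- (2 * (x \<bullet> axis i 1)) * ((1 - of_nat n * s x) * bump_profile (n + 2) (s x)))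
          + A (axis i 1) * bump_profile n (s x) = q x * bump_profile (n + 2) (1 - x \<bullet> x)"
        by (simp add: A(2) q_def s[symmetric] inner_axis algebra_simps)
      with deriv show ?thesis by blast
    qed
    ultimately show ?thesis by - (rule exI[of _ q], intro conjI allI)
  qed
  show ?case
    unfolding C_k.simps
  proof (intro conjI allI)
    show "?f differentiable (at x)" for x
      using D unfolding differentiable_def by blast
    fix i
    obtain q where q: "real_polynomial_function q"
      "\<And>x. \<exists>D. (?f has_derivative D) (at x) \<and> D (axis i 1) = q x * bump_profile (n + 2) (1 - x \<bullet> x)"
      using D by blast
    have "partial i ?f = (\<lambda>x. q x * bump_profile (n + 2) (1 - x \<bullet> x))"
      unfolding partial_def using q(2) by (metis (no_types, lifting) frechet_derivative_at)
    then show "C_k k (partial i ?f)" using Suc.IH[OF q(1)] by simp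
  qed
qed

lemma partial_affine:
  assumes "f differentiable (at (a *\<^sub>R x + b))"
  shows "(\<lambda>x. c * f (a *\<^sub>R x + b)) differentiable (at x)"
    and "partial i (\<lambda>x. c * f (a *\<^sub>R x + b)) x = (c * a) * partial i f (a *\<^sub>R x + b)"
proof -
  let ?D = "frechet_derivative f (at (a *\<^sub>R x + b))"
  have f: "(f has_derivative ?D) (at (a *\<^sub>R x + b))"
    using assms frechet_derivative_works by blast
  have "((\<lambda>x. a *\<^sub>R x + b) has_derivative (\<lambda>h. a *\<^sub>R h)) (at x)"
    by (auto intro!: derivative_eq_intros)
  from has_derivative_compose[OF this f]
  have "((\<lambda>x. c * f (a *\<^sub>R x + b)) has_derivative (\<lambda>h. c * ?D (a *\<^sub>R h))) (at x)"
    by (rule has_derivative_mult_right)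
  then have *: "((\<lambda>x. c * f (a *\<^sub>R x + b)) has_derivative (\<lambda>h. (c * a) * ?D h)) (at x)"
    using linear_cmul[OF has_derivative_linear[OF f]] by (simp add: mult.assoc)
  from * show "(\<lambda>x. c * f (a *\<^sub>R x + b)) differentiable (at x)"
    unfolding differentiable_def by blast
  from * show "partial i (\<lambda>x. c * f (a *\<^sub>R x + b)) x = (c * a) * partial i f (a *\<^sub>R x + b)"
    unfolding partial_def by (simp add: frechet_derivative_at[symmetric])
qed

lemma C_k_affine: "C_k k f \<Longrightarrow> C_k k (\<lambda>x. c * f (a *\<^sub>R x + b))"
proof (induction k arbitrary: f c)
  case 0
  then show ?case
    by (auto intro!: continuous_intros continuous_on_compose2[of UNIV f])
next
  case (Suc k)
  then have "partial i (\<lambda>x. c * f (a *\<^sub>R x + b)) = (\<lambda>x. (c * a) * partial i f (a *\<^sub>R x + b))" for i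
    by (auto simp: partial_affine)
  moreover have "(\<lambda>x. c * f (a *\<^sub>R x + b)) differentiable (at x)" for x
    using Suc.prems by (intro partial_affine) auto
  ultimately show ?case using Suc by auto
qed

lemma test_function_reflect:
  assumes "test_function \<rho>"
  shows "test_function (\<lambda>y. \<rho> (x - y))"
proof -
  obtain R where R: "\<And>y. norm y > R \<Longrightarrow> \<rho> y = 0"
    using test_function_support[OF assms] by blast
  show ?thesis
  proof (rule test_functionI[where R = "R + norm x"])
    show "C_k k (\<lambda>y. \<rho> (x - y))" for k
      using C_k_affine[of k \<rho> 1 "- 1" x] assms by (simp add: test_function_def)
    show "\<rho> (x - y) = 0" if "norm y > R + norm x" for y
      using that norm_triangle_ineq2[of y x] by (intro R) (simp add: norm_minus_commute)
  qed
qed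

lemma partial_reflect:
  assumes "test_function \<rho>"
  shows "partial i (\<lambda>y. \<rho> (x - y)) y = - partial i \<rho> (x - y)"
  using partial_affine(2)[where f = \<rho> and a = "- 1" and x = y and b = x and c = 1 and i = i] test_function_differentiable[OF assms] by simp

lemma laplacian_reflect:
  assumes "test_function \<rho>"
  shows "laplacian (\<lambda>y. \<rho> (x - y)) y = laplacian \<rho> (x - y)"
proof -
  have "partial i (partial i (\<lambda>y. \<rho> (x - y))) y = partial i (partial i \<rho>) (x - y)" for i
  proof -
    have "partial i (\<lambda>y. \<rho> (x - y)) = (\<lambda>y. (- 1) * partial i \<rho> ((- 1) *\<^sub>R y + x))"
      by (auto simp: partial_reflect[OF assms])
    then show ?thesis
      using partial_affine(2)[where f = "partial i \<rho>" and a = "- 1" and x = y and b = x and c = "- 1" and i = i]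
        test_function_differentiable[OF test_function_partial[OF assms]] by simp
  qed
  then show ?thesis by (simp add: laplacian_def)
qed

definition mollifier :: "real \<Rightarrow> (real ^ 3 \<Rightarrow> real) \<Rightarrow> bool"
  where "mollifier \<epsilon> \<rho> \<longleftrightarrow> test_function \<rho> \<and> (\<forall>x. \<rho> x \<ge> 0) \<and>
    (\<forall>x. norm x > \<epsilon> \<longrightarrow> \<rho> x = 0) \<and> (\<integral>x. \<rho> x \<partial>lborel) = 1"

lemma mollifier_exists:
  assumes "\<epsilon> > 0"
  shows "\<exists>\<rho>. mollifier \<epsilon> \<rho>"
proof -
  define \<rho> where "\<rho> x = bump_profile 0 (1 - (inverse \<epsilon> *\<^sub>R x) \<bullet> (inverse \<epsilon> *\<^sub>R x))" for x :: "real ^ 3"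
  have supp: "\<rho> x = 0" if "norm x > \<epsilon>" for x
  proof -
    have "(norm x)\<^sup>2 \<ge> \<epsilon>\<^sup>2" using that assms by (intro power_mono) auto
    then have "inverse \<epsilon> * (inverse \<epsilon> * (x \<bullet> x)) \<ge> 1"
      using assms by (simp add: power2_norm_eq_inner[symmetric] field_simps power2_eq_square)
    then show ?thesis by (simp add: \<rho>_def bump_profile_def)
  qed
  have \<rho>: "test_function \<rho>"
  proof (rule test_functionI[OF _ supp])
    show "C_k k \<rho>" for k
      using C_k_affine[OF C_k_bump[OF real_polynomial_function.intros(2)[of 1], of k 0], of 1 "inverse \<epsilon>" 0]
      unfolding \<rho>_def by simp
  qed
  have nonneg: "\<rho> x \<ge> 0" for x by (simp add: \<rho>_def bump_profile_def)
  have int: "integrable lborel \<rho>"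
    by (rule integrable_compact_support[OF test_function_measurable test_function_loc_bounded supp])
       (use \<rho> in auto)
  define I where "I = (\<integral>x. \<rho> x \<partial>lborel)"
  \<comment> \<open>Otherwise \<rho> would vanish almost everywhere, hence everywhere by continuity,
    whereas its value at 0 is \<open>exp (- 1)\<close>.\<close>
  have "I \<noteq> 0"
  proof
    assume "I = 0"
    then have "AE x in lborel. \<rho> x = 0"
      using integral_nonneg_eq_0_iff_AE[OF int] nonneg by (simp add: I_def)
    then have "AE x\<in>UNIV in lebesgue. x \<in> {x. \<rho> x = 0}"
      by (simp add: AE_completion)
    moreover have "closed {x. \<rho> x = 0}"
      using test_function_continuous[OF \<rho>] by (intro closed_Collect_eq) auto
    ultimately have "0 \<in> {x. \<rho> x = 0}"
      using mem_closed_if_AE_lebesgue_open[of UNIV "{x. \<rho> x = 0}" 0] by simp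
    then show False by (simp add: \<rho>_def bump_profile_def)
  qed
  moreover have "I \<ge> 0" unfolding I_def by (rule Bochner_Integration.integral_nonneg[OF nonneg])
  ultimately have "I > 0" by simp
  have "mollifier \<epsilon> (\<lambda>x. inverse I * \<rho> x)"
    unfolding mollifier_def
  proof (intro conjI allI impI)
    show "test_function (\<lambda>x. inverse I * \<rho> x)"
    proof (rule test_functionI)
      show "C_k k (\<lambda>x. inverse I * \<rho> x)" for k
        using C_k_affine[of k \<rho> "inverse I" 1 0] \<rho> by (simp add: test_function_def)
    qed (use supp in auto)
  qed (use \<open>I > 0\<close> nonneg supp int in \<open>auto simp: I_def[symmetric]\<close>)
  then show ?thesis by blast
qed

section \<open>The fundamental lemma of the calculus of variations\<close>

lemma locally_integrable_measurable: "locally_integrable f \<Longrightarrow> f \<in> borel_measurable borel"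
  by (simp add: locally_integrable_def)

lemma integrable_locally_integrable_mult:
  fixes f g :: "real ^ 3 \<Rightarrow> real"
  assumes f: "locally_integrable f" and [measurable]: "g \<in> borel_measurable borel"
    and "loc_bounded g" and supp: "\<And>x. norm x > R \<Longrightarrow> g x = 0"
  shows "integrable lborel (\<lambda>x. f x * g x)"
proof -
  note [measurable] = locally_integrable_measurable[OF f]
  obtain B where "B > 0" and B: "\<And>x. norm x \<le> R \<Longrightarrow> \<bar>g x\<bar> \<le> B"
    using loc_boundedE[OF \<open>loc_bounded g\<close>] by blast
  have "integrable lborel (\<lambda>x. B * (indicator (cball 0 R) x * f x))"
    using f compact_cball[of 0 R] unfolding locally_integrable_def set_integrable_def by auto
  then show ?thesis
  proof (rule Bochner_Integration.integrable_bound)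
    have "\<bar>f x * g x\<bar> \<le> \<bar>B * (indicator (cball 0 R) x * f x)\<bar>" for x
    proof (cases "norm x \<le> R")
      case True
      then have "\<bar>f x\<bar> * \<bar>g x\<bar> \<le> \<bar>f x\<bar> * B" by (intro mult_left_mono B) auto
      then show ?thesis using True \<open>B > 0\<close> by (simp add: abs_mult mult.commute)
    qed (use supp[of x] in simp)
    then show "AE x in lborel. norm (f x * g x) \<le> norm (B * (indicator (cball 0 R) x * f x))"
      by simp
  qed auto
qed

lemma locally_integrable_abs: "locally_integrable f \<Longrightarrow> locally_integrable (\<lambda>x. \<bar>f x :: real\<bar>)"
  unfolding locally_integrable_def using set_integrable_abs by fastforce

lemma locally_integrable_mult_loc_bounded:
  fixes f g :: "real ^ 3 \<Rightarrow> real"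
  assumes f: "locally_integrable f" and [measurable]: "g \<in> borel_measurable borel"
    and "loc_bounded g"
  shows "locally_integrable (\<lambda>x. f x * g x)"
  unfolding locally_integrable_def
proof (intro conjI allI impI)
  note [measurable] = locally_integrable_measurable[OF f]
  show "(\<lambda>x. f x * g x) \<in> borel_measurable lborel" by measurable
  fix K :: "(real ^ 3) set" assume "compact K"
  then obtain R where R: "\<And>x. x \<in> K \<Longrightarrow> norm x \<le> R"
    using compact_imp_bounded[of K] unfolding bounded_iff by blast
  have [measurable]: "K \<in> sets borel" using \<open>compact K\<close> by (simp add: borel_compact)
  have "integrable lborel (\<lambda>x. f x * (g x * indicator K x))"
  proof (rule integrable_locally_integrable_mult[where R = R, OF f])
    have "loc_bounded (indicator K :: _ \<Rightarrow> real)"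
      by (rule loc_bounded_bounded[of _ 1]) (auto simp: indicator_def)
    then show "loc_bounded (\<lambda>x. g x * indicator K x)"
      using \<open>loc_bounded g\<close> by (intro loc_bounded_mult)
    show "g x * indicator K x = 0" if "norm x > R" for x
      using R[of x] that by (auto split: split_indicator)
  qed measurable
  then show "set_integrable lborel K (\<lambda>x. f x * g x)"
    unfolding set_integrable_def by (simp add: mult_ac)
qed

definition convolution :: "(real ^ 3 \<Rightarrow> real) \<Rightarrow> (real ^ 3 \<Rightarrow> real) \<Rightarrow> real ^ 3 \<Rightarrow> real"
  where "convolution f \<rho> x = (\<integral>y. f y * \<rho> (x - y) \<partial>lborel)"

lemma convolution_measurable [measurable]:
  assumes [measurable]: "f \<in> borel_measurable borel" "\<rho> \<in> borel_measurable borel"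
  shows "convolution f \<rho> \<in> borel_measurable borel"
  unfolding convolution_def
  by (intro lborel.borel_measurable_lebesgue_integral) measurable

lemma integrable_convolution:
  assumes "locally_integrable f" "test_function \<rho>"
  shows "integrable lborel (\<lambda>y. f y * \<rho> (x - y))"
proof -
  note t = test_function_reflect[OF assms(2), of x]
  obtain R where "\<And>y. norm y > R \<Longrightarrow> \<rho> (x - y) = 0"
    using test_function_support[OF t] by blast
  then show ?thesis
    using assms(1) t by (intro integrable_locally_integrable_mult[where R = R])
      (auto intro: test_function_measurable test_function_loc_bounded)
qed

lemma convolution_loc_bounded:
  assumes f: "locally_integrable f" and \<rho>: "test_function \<rho>"
  shows "loc_bounded (convolution f \<rho>)"
  unfolding loc_bounded_def
proof
  fix R
  obtain S where "S > 0" and S: "\<And>y. norm y > S \<Longrightarrow> \<rho> y = 0"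
    using test_function_support[OF \<rho>] by blast
  obtain B where "B > 0" and B: "\<And>x. \<bar>\<rho> x\<bar> \<le> B"
    using test_function_bounded[OF \<rho>] by blast
  have int: "integrable lborel (\<lambda>y. B * (indicator (cball 0 (R + S)) y * \<bar>f y\<bar>))"
    using locally_integrable_abs[OF f] compact_cball[of 0 "R + S"]
    unfolding locally_integrable_def set_integrable_def by auto
  have "\<bar>convolution f \<rho> x\<bar> \<le> (\<integral>y. B * (indicator (cball 0 (R + S)) y * \<bar>f y\<bar>) \<partial>lborel)"
    if "norm x \<le> R" for x
  proof -
    have "norm (convolution f \<rho> x) \<le> (\<integral>y. norm (f y * \<rho> (x - y)) \<partial>lborel)"
      unfolding convolution_def by (rule integral_norm_bound)
    also have "\<dots> \<le> (\<integral>y. B * (indicator (cball 0 (R + S)) y * \<bar>f y\<bar>) \<partial>lborel)"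
    proof (rule integral_mono[OF _ int])
      show "integrable lborel (\<lambda>y. norm (f y * \<rho> (x - y)))"
        using integrable_convolution[OF f \<rho>] by simp
      fix y
      show "norm (f y * \<rho> (x - y)) \<le> B * (indicator (cball 0 (R + S)) y * \<bar>f y\<bar>)"
      proof (cases "norm y \<le> R + S")
        case True
        have "\<bar>f y\<bar> * \<bar>\<rho> (x - y)\<bar> \<le> \<bar>f y\<bar> * B" by (intro mult_left_mono B) auto
        then show ?thesis using True by (simp add: abs_mult mult.commute)
      next
        case False
        then have "norm (x - y) > S"
          using norm_triangle_ineq2[of y x] that by (simp add: norm_minus_commute)
        then show ?thesis using S \<open>B > 0\<close> by simp
      qed
    qed
    finally show ?thesis by simp
  qed
  then show "\<exists>B. \<forall>x. norm x \<le> R \<longrightarrow> \<bar>convolution f \<rho> x\<bar> \<le> B" by blast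
qed

text \<open>The derivative falls on \<rho> alone, so local integrability of \<open>f\<close> is
  enough: the difference quotients of \<rho> are bounded by the supremum of its partial derivative
  and live in one ball, which gives a dominating function.\<close>

lemma convolution_DERIV:
  assumes f: "locally_integrable f" and \<rho>: "test_function \<rho>"
  shows "((\<lambda>t. convolution f \<rho> (x + t *\<^sub>R axis i 1)) has_real_derivative
    convolution f (partial i \<rho>) (x + t *\<^sub>R axis i 1)) (at t)"
proof -
  let ?e = "axis i (1 :: real) :: real ^ 3"
  note \<rho>' = test_function_partial[OF \<rho>, of i]
  note [measurable] = locally_integrable_measurable[OF f] test_function_measurable[OF \<rho>]
    test_function_measurable[OF \<rho>']
  note deriv = partial_DERIV[OF test_function_differentiable[OF \<rho>], of _ i]
  define z where "z = x + t *\<^sub>R ?e"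
  obtain S where "S > 0" and S: "\<And>y. norm y > S \<Longrightarrow> \<rho> y = 0"
    using test_function_support[OF \<rho>] by blast
  obtain B where "B > 0" and B: "\<And>x. \<bar>partial i \<rho> x\<bar> \<le> B"
    using test_function_bounded[OF \<rho>'] by blast
  have "((\<lambda>h. (convolution f \<rho> (x + (t + h) *\<^sub>R ?e) - convolution f \<rho> (x + t *\<^sub>R ?e)) / h) \<longlongrightarrow>
      convolution f (partial i \<rho>) (x + t *\<^sub>R ?e)) (at 0)"
    unfolding tendsto_at_iff_sequentially
  proof (intro allI impI)
    fix X :: "nat \<Rightarrow> real" assume X: "\<forall>n. X n \<in> UNIV - {0}" "X \<longlonglongrightarrow> 0"
    obtain M where M: "\<And>n. \<bar>X n\<bar> \<le> M"
      using convergent_imp_Bseq[OF convergentI[OF X(2)]] unfolding Bseq_def by auto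
    define q where "q n y = (\<rho> (z + X n *\<^sub>R ?e - y) - \<rho> (z - y)) / X n" for n y
    have q_bound: "\<bar>q n y\<bar> \<le> B" for n y
    proof -
      have "\<bar>\<rho> ((z - y) + X n *\<^sub>R ?e) - \<rho> ((z - y) + 0 *\<^sub>R ?e)\<bar> \<le> B * \<bar>X n - 0\<bar>"
        using field_differentiable_bound[of UNIV "\<lambda>s. \<rho> ((z - y) + s *\<^sub>R ?e)"
            "\<lambda>s. partial i \<rho> ((z - y) + s *\<^sub>R ?e)" B "X n" 0] deriv B by (simp add: has_field_derivative_at_within)
      then show ?thesis using X(1) by (simp add: q_def field_simps)
    qed
    \<comment> \<open>\<open>M\<close> bounds all increments \<open>X n\<close>, so that a single
      ball contains the supports of all quotients.\<close>
    have q_supp: "q n y = 0" if "norm y > S + M + norm z" for n y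
    proof -
      have "norm (X n *\<^sub>R ?e) \<le> M" using M by simp
      moreover have "M \<ge> 0" using M[of 0] by simp
      moreover have "norm y \<le> norm (z + X n *\<^sub>R ?e - y) + norm z + norm (X n *\<^sub>R ?e)"
        using norm_triangle_ineq4[of "z + X n *\<^sub>R ?e" "z + X n *\<^sub>R ?e - y"]
          norm_triangle_ineq[of z "X n *\<^sub>R ?e"] by simp
      moreover have "norm y \<le> norm (z - y) + norm z"
        using norm_triangle_ineq4[of z "z - y"] by simp
      ultimately have "norm (z + X n *\<^sub>R ?e - y) > S" "norm (z - y) > S" using that by linarith+
      then show ?thesis using S by (simp add: q_def)
    qed
    have lim: "(\<lambda>n. \<integral>y. f y * q n y \<partial>lborel) \<longlonglongrightarrow> (\<integral>y. f y * partial i \<rho> (z - y) \<partial>lborel)"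
    proof (rule integral_dominated_convergence)
      show "integrable lborel (\<lambda>y. B * (indicator (cball 0 (S + M + norm z)) y * \<bar>f y\<bar>))"
        using locally_integrable_abs[OF f] compact_cball[of 0 "S + M + norm z"]
        unfolding locally_integrable_def set_integrable_def by auto
      show "AE y in lborel. (\<lambda>n. f y * q n y) \<longlonglongrightarrow> f y * partial i \<rho> (z - y)"
      proof (intro always_eventually allI tendsto_mult_left)
        fix y
        have "((\<lambda>h. (\<rho> ((z - y) + h *\<^sub>R ?e) - \<rho> (z - y)) / h) \<longlongrightarrow> partial i \<rho> (z - y)) (at 0)"
          using deriv[of "z - y" 0] by (simp add: DERIV_def)
        then show "(\<lambda>n. q n y) \<longlonglongrightarrow> partial i \<rho> (z - y)"
          unfolding tendsto_at_iff_sequentially using X by (auto simp: q_def o_def algebra_simps)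
      qed
      show "AE y in lborel. norm (f y * q n y) \<le> B * (indicator (cball 0 (S + M + norm z)) y * \<bar>f y\<bar>)" for n
      proof (intro always_eventually allI)
        fix y
        have "\<bar>f y\<bar> * \<bar>q n y\<bar> \<le> \<bar>f y\<bar> * B" by (intro mult_left_mono q_bound) auto
        then show "norm (f y * q n y) \<le> B * (indicator (cball 0 (S + M + norm z)) y * \<bar>f y\<bar>)"
          using q_supp[of y n] \<open>B > 0\<close> by (cases "norm y \<le> S + M + norm z") (auto simp: abs_mult mult.commute)
      qed
    qed (auto simp: q_def)
    have "(convolution f \<rho> (x + (t + X n) *\<^sub>R ?e) - convolution f \<rho> (x + t *\<^sub>R ?e)) / X n = (\<integral>y. f y * q n y \<partial>lborel)" for n
    proof -
      have "(\<integral>y. f y * q n y \<partial>lborel) = (\<integral>y. (f y * \<rho> (z + X n *\<^sub>R ?e - y) - f y * \<rho> (z - y)) / X n \<partial>lborel)"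
        by (simp add: q_def algebra_simps diff_divide_distrib)
      also have "\<dots> = (convolution f \<rho> (z + X n *\<^sub>R ?e) - convolution f \<rho> z) / X n"
        unfolding convolution_def using integrable_convolution[OF f \<rho>] by simp
      finally show ?thesis by (simp add: z_def algebra_simps)
    qed
    then show "((\<lambda>h. (convolution f \<rho> (x + (t + h) *\<^sub>R ?e) - convolution f \<rho> (x + t *\<^sub>R ?e)) / h) \<circ> X)
        \<longlonglongrightarrow> convolution f (partial i \<rho>) (x + t *\<^sub>R ?e)"
      using lim by (simp add: o_def convolution_def z_def)
  qed
  then show ?thesis by (simp add: DERIV_def)
qed

lemma null_sets_frontier_box: "cbox a b - box a b \<in> null_sets (lborel :: 'a::euclidean_space measure)"
proof -
  have "negligible (cbox a b - box a b)"
    by (rule negligible_frontier_interval)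
  then show ?thesis
    by (simp add: negligible_iff_null_sets null_sets_completion_iff)
qed

lemma mollifier_shift_integral:
  assumes "mollifier \<epsilon> \<rho>"
  shows "(\<integral>x. \<rho> (x - y) \<partial>lborel) = 1" "integrable lborel (\<lambda>x. \<rho> (x - y))"
proof -
  have \<rho>: "test_function \<rho>" and 1: "(\<integral>x. \<rho> x \<partial>lborel) = 1"
    using assms by (auto simp: mollifier_def)
  note [measurable] = test_function_measurable[OF \<rho>]
  have "integrable lborel \<rho>" using 1 not_integrable_integral_eq by force
  then show "(\<integral>x. \<rho> (x - y) \<partial>lborel) = 1" "integrable lborel (\<lambda>x. \<rho> (x - y))"
    using lborel_integral_translate[of \<rho> "- y"] lborel_integrable_translate[of \<rho> "- y"] 1 by simp_all
qed

text \<open>By duality the smoothing of \<open>f\<close> becomes a smoothing of the indicator of the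
  box. The smoothed indicator is exact at every point whose \<epsilon>-ball does not meet both the
  box and its complement.\<close>

lemma mollified_box:
  fixes a b y :: "real ^ 3"
  assumes \<rho>: "mollifier \<epsilon> \<rho>"
  defines "g \<equiv> \<lambda>y. \<integral>x. indicator (box a b) x * \<rho> (x - y) \<partial>lborel"
  shows "g \<in> borel_measurable borel" "0 \<le> g y" "g y \<le> 1"
    "cball y \<epsilon> \<subseteq> box a b \<Longrightarrow> g y = 1" "cball y \<epsilon> \<inter> box a b = {} \<Longrightarrow> g y = 0"
proof -
  have t: "test_function \<rho>" and nonneg: "\<And>x. \<rho> x \<ge> 0" and supp: "\<And>x. norm x > \<epsilon> \<Longrightarrow> \<rho> x = 0"
    using \<rho> by (auto simp: mollifier_def)
  note [measurable] = test_function_measurable[OF t]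
  note shift = mollifier_shift_integral[OF \<rho>]
  show "g \<in> borel_measurable borel"
    unfolding g_def by (intro lborel.borel_measurable_lebesgue_integral) measurable
  have int: "integrable lborel (\<lambda>x. indicator (box a b) x * \<rho> (x - y))"
    by (rule Bochner_Integration.integrable_bound[OF shift(2)[of y]])
       (auto simp: indicator_def)
  show "0 \<le> g y" unfolding g_def by (rule Bochner_Integration.integral_nonneg) (simp add: nonneg)
  have "g y \<le> (\<integral>x. \<rho> (x - y) \<partial>lborel)"
    unfolding g_def by (rule integral_mono[OF int shift(2)]) (simp add: nonneg indicator_def)
  then show "g y \<le> 1" using shift(1) by simp
  have supp': "\<rho> (x - y) = 0" if "x \<notin> cball y \<epsilon>" for x
    using that by (intro supp) (simp add: dist_norm norm_minus_commute)
  {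
    assume "cball y \<epsilon> \<subseteq> box a b"
    then have "(\<lambda>x. indicator (box a b) x * \<rho> (x - y)) = (\<lambda>x. \<rho> (x - y))"
      using supp' by (auto simp: indicator_def fun_eq_iff simp del: mem_cball)
    then show "g y = 1" using shift(1) by (simp only: g_def)
  next
    assume "cball y \<epsilon> \<inter> box a b = {}"
    then have "(\<lambda>x. indicator (box a b) x * \<rho> (x - y)) = (\<lambda>x. 0)"
      using supp' by (auto simp: indicator_def fun_eq_iff simp del: mem_cball)
    then show "g y = 0" by (simp add: g_def)
  }
qed

text \<open>Fubini; the bound on \<open>g\<close> and the unit mass of the nonnegative \<rho>
  provide the integrability that it needs.\<close>

lemma integral_mult_convolution:
  fixes f g :: "real ^ 3 \<Rightarrow> real"
  assumes f: "locally_integrable f" and \<rho>: "mollifier \<epsilon> \<rho>"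
    and [measurable]: "g \<in> borel_measurable borel"
    and bdd: "\<And>x. \<bar>g x\<bar> \<le> B" and supp: "\<And>x. norm x > R \<Longrightarrow> g x = 0"
  shows "(\<integral>x. g x * convolution f \<rho> x \<partial>lborel) = (\<integral>y. f y * (\<integral>x. g x * \<rho> (x - y) \<partial>lborel) \<partial>lborel)"
    and "integrable lborel (\<lambda>y. f y * (\<integral>x. g x * \<rho> (x - y) \<partial>lborel))"
    and "integrable lborel (\<lambda>x. g x * \<rho> (x - y))"
proof -
  have t: "test_function \<rho>" and nonneg: "\<And>x. \<rho> x \<ge> 0" and \<rho>_supp: "\<And>x. norm x > \<epsilon> \<Longrightarrow> \<rho> x = 0"
    using \<rho> by (auto simp: mollifier_def)
  note [measurable] = test_function_measurable[OF t] locally_integrable_measurable[OF f]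
  note shift = mollifier_shift_integral[OF \<rho>]
  have "B \<ge> 0" using bdd[of 0] by linarith
  have bound: "\<bar>a x * \<rho> (x - y)\<bar> \<le> B * \<rho> (x - y)" if "\<And>x. \<bar>a x\<bar> \<le> B" for a :: "real ^ 3 \<Rightarrow> real" and x y
    using that[of x] nonneg by (simp add: abs_mult mult_right_mono)
  have int: "integrable lborel (\<lambda>x. a x * \<rho> (x - y))"
    if [measurable]: "a \<in> borel_measurable borel" and "\<And>x. \<bar>a x\<bar> \<le> B" for a :: "real ^ 3 \<Rightarrow> real" and y
  proof (rule Bochner_Integration.integrable_bound[of lborel "\<lambda>x. B * \<rho> (x - y)"])
    show "AE x in lborel. norm (a x * \<rho> (x - y)) \<le> norm (B * \<rho> (x - y))"
      using bound[OF that(2), where y = y] nonneg \<open>B \<ge> 0\<close> by (intro always_eventually) auto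
  qed (use shift(2) in auto)
  show "integrable lborel (\<lambda>x. g x * \<rho> (x - y))" using bdd by (intro int) auto
  define G where "G a y = (\<integral>x. a x * \<rho> (x - y) \<partial>lborel)" for a y
  have G: "integrable lborel (\<lambda>y. f y * G a y)" if f: "locally_integrable f" and [measurable]: "a \<in> borel_measurable borel"
    and a: "\<And>x. \<bar>a x\<bar> \<le> B" "\<And>x. norm x > R \<Longrightarrow> a x = 0" for a f
  proof (rule integrable_locally_integrable_mult[OF f])
    show "G a \<in> borel_measurable borel"
      unfolding G_def by (intro lborel.borel_measurable_lebesgue_integral) measurable
    have "\<bar>G a y\<bar> \<le> B" for y
    proof -
      have "norm (G a y) \<le> (\<integral>x. norm (a x * \<rho> (x - y)) \<partial>lborel)"
        unfolding G_def by (rule integral_norm_bound)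
      also have "\<dots> \<le> (\<integral>x. B * \<rho> (x - y) \<partial>lborel)"
        using int[OF that(2) a(1)] shift(2) bound[OF a(1)] by (intro integral_mono) auto
      finally show ?thesis using shift(1) by simp
    qed
    then show "loc_bounded (G a)" by (rule loc_bounded_bounded)
    show "G a y = 0" if "norm y > R + \<epsilon>" for y
    proof -
      have "a x * \<rho> (x - y) = 0" for x
      proof (cases "norm x > R")
        case False
        then have "norm (x - y) > \<epsilon>"
          using that norm_triangle_ineq2[of y x] by (simp add: norm_minus_commute)
        then show ?thesis by (simp add: \<rho>_supp)
      qed (simp add: a(2))
      then show ?thesis unfolding G_def by (simp only: Bochner_Integration.integral_zero)
    qed
  qed
  show "integrable lborel (\<lambda>y. f y * (\<integral>x. g x * \<rho> (x - y) \<partial>lborel))"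
    using G[OF f _ bdd supp] by (simp add: G_def)
  let ?F = "\<lambda>y x. f y * (g x * \<rho> (x - y))"
  have "integrable (lborel \<Otimes>\<^sub>M lborel) (\<lambda>(y, x). ?F y x)"
  proof (rule lborel_pair.Fubini_integrable)
    have "(\<integral>x. norm (?F y x) \<partial>lborel) = \<bar>f y\<bar> * G (\<lambda>x. \<bar>g x\<bar>) y" for y
    proof -
      have "norm (?F y x) = \<bar>f y\<bar> * (\<bar>g x\<bar> * \<rho> (x - y))" for x
        using nonneg by (simp add: abs_mult)
      then show ?thesis by (simp add: G_def)
    qed
    moreover have "integrable lborel (\<lambda>y. \<bar>f y\<bar> * G (\<lambda>x. \<bar>g x\<bar>) y)"
      using bdd supp by (intro G locally_integrable_abs[OF f]) auto
    ultimately show "integrable lborel (\<lambda>y. \<integral>x. norm (case (y, x) of (y, x) \<Rightarrow> ?F y x) \<partial>lborel)" by simp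
    show "AE y in lborel. integrable lborel (\<lambda>x. case (y, x) of (y, x) \<Rightarrow> ?F y x)"
      using bdd by (intro always_eventually allI) (auto intro!: int)
  qed measurable
  from lborel_pair.Fubini_integral[OF this]
  have "(\<integral>x. \<integral>y. ?F y x \<partial>lborel \<partial>lborel) = (\<integral>y. \<integral>x. ?F y x \<partial>lborel \<partial>lborel)" .
  moreover have "(\<integral>y. ?F y x \<partial>lborel) = g x * convolution f \<rho> x" for x
    by (simp add: convolution_def mult.left_commute[of "f _"])
  ultimately show "(\<integral>x. g x * convolution f \<rho> x \<partial>lborel) = (\<integral>y. f y * (\<integral>x. g x * \<rho> (x - y) \<partial>lborel) \<partial>lborel)"
    by simp
qed

text \<open>Replaces any pointwise or L^1 convergence of mollifications. After the smoothing is
  moved to the indicator, dominated convergence applies, because the smoothed indicator is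
  eventually exact off the boundary of the box, a null set.\<close>

lemma integral_convolution_box_tendsto:
  assumes f: "locally_integrable f" and \<rho>: "\<And>n. mollifier (\<epsilon> n) (\<rho> n)" and \<epsilon>: "\<epsilon> \<longlonglongrightarrow> 0"
  shows "(\<lambda>n. \<integral>x. indicator (box a b) x * convolution f (\<rho> n) x \<partial>lborel)
    \<longlonglongrightarrow> (\<integral>x. indicator (box a b) x * f x \<partial>lborel)"
proof -
  note [measurable] = locally_integrable_measurable[OF f]
  define g where "g n y = (\<integral>x. indicator (box a b) x * \<rho> n (x - y) \<partial>lborel)" for n y
  note g = mollified_box[OF \<rho>, where a = a and b = b, folded g_def]
  obtain R where R: "\<And>x. x \<in> box a b \<Longrightarrow> norm x \<le> R"
    using bounded_box[of a b] unfolding bounded_iff by blast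
  obtain M where M: "\<And>n. \<bar>\<epsilon> n\<bar> \<le> M"
    using convergent_imp_Bseq[OF convergentI[OF \<epsilon>]] unfolding Bseq_def by auto
  have g_supp: "g n y = 0" if "norm y > R + M" for n y
  proof (rule g(5))
    show "cball y (\<epsilon> n) \<inter> box a b = {}"
    proof (rule ccontr)
      assume "\<not> ?thesis"
      then obtain x where "x \<in> box a b" "dist y x \<le> \<epsilon> n" by auto
      then show False using R[of x] that M[of n] norm_triangle_ineq2[of y x] by (simp add: dist_norm)
    qed
  qed
  have "(\<lambda>n. \<integral>y. f y * g n y \<partial>lborel) \<longlonglongrightarrow> (\<integral>y. f y * indicator (box a b) y \<partial>lborel)"
  proof (rule integral_dominated_convergence)
    show "(\<lambda>y. f y * indicator (box a b) y) \<in> borel_measurable lborel" by measurable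
    show "(\<lambda>y. f y * g n y) \<in> borel_measurable lborel" for n using g(1)[of n] by measurable
    show "integrable lborel (\<lambda>y. indicator (cball 0 (R + M)) y * \<bar>f y\<bar>)"
      using locally_integrable_abs[OF f] compact_cball[of 0 "R + M"]
      unfolding locally_integrable_def set_integrable_def by auto
    show "AE y in lborel. norm (f y * g n y) \<le> indicator (cball 0 (R + M)) y * \<bar>f y\<bar>" for n
    proof (intro always_eventually allI)
      fix y
      have "\<bar>f y\<bar> * \<bar>g n y\<bar> \<le> \<bar>f y\<bar> * 1" using g(2,3)[of n y] by (intro mult_left_mono) auto
      then show "norm (f y * g n y) \<le> indicator (cball 0 (R + M)) y * \<bar>f y\<bar>"
        using g_supp[of y n] by (cases "norm y \<le> R + M") (auto simp: abs_mult)
    qed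
    have "AE y in lborel. y \<notin> cbox a b - box a b"
      using null_sets_frontier_box by (rule AE_not_in)
    then show "AE y in lborel. (\<lambda>n. f y * g n y) \<longlonglongrightarrow> f y * indicator (box a b) y"
    proof (rule eventually_mono)
      fix y assume y: "y \<notin> cbox a b - box a b"
      have small: "\<exists>N. \<forall>n\<ge>N. cball y (\<epsilon> n) \<subseteq> U" if "open U" "y \<in> U" for U
      proof -
        obtain d where d: "d > 0" "ball y d \<subseteq> U" using \<open>open U\<close> \<open>y \<in> U\<close> openE by blast
        obtain N where "\<And>n. n \<ge> N \<Longrightarrow> \<bar>\<epsilon> n\<bar> < d" using LIMSEQ_D[OF \<epsilon> d(1)] by auto
        then have "cball y (\<epsilon> n) \<subseteq> ball y d" if "n \<ge> N" for n using that by fastforce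
        then show ?thesis using d(2) by blast
      qed
      show "(\<lambda>n. f y * g n y) \<longlonglongrightarrow> f y * indicator (box a b) y"
      proof (cases "y \<in> box a b")
        case True
        with small[OF open_box] obtain N where "\<forall>n\<ge>N. cball y (\<epsilon> n) \<subseteq> box a b" by blast
        then have "eventually (\<lambda>n. f y * g n y = f y * indicator (box a b) y) sequentially"
          unfolding eventually_sequentially using g(4) True by (intro exI[of _ N]) simp
        then show ?thesis by (rule tendsto_eventually)
      next
        case False
        with y have "y \<in> - cbox a b" by simp
        with small[of "- cbox a b"] obtain N where "\<forall>n\<ge>N. cball y (\<epsilon> n) \<subseteq> - cbox a b"
          by (auto simp: open_closed)
        then have "\<forall>n\<ge>N. cball y (\<epsilon> n) \<inter> box a b = {}" using box_subset_cbox[of a b] by blast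
        then have "eventually (\<lambda>n. f y * g n y = f y * indicator (box a b) y) sequentially"
          unfolding eventually_sequentially using g(5) False by (intro exI[of _ N]) simp
        then show ?thesis by (rule tendsto_eventually)
      qed
    qed
  qed
  moreover have "(\<integral>x. indicator (box a b) x * convolution f (\<rho> n) x \<partial>lborel) = (\<integral>y. f y * g n y \<partial>lborel)" for n
    unfolding g_def
    by (rule integral_mult_convolution(1)[OF f \<rho>, where B = 1 and R = R])
       (use R in \<open>auto simp: not_le[symmetric] indicator_def\<close>)
  ultimately show ?thesis by (simp add: mult.commute)
qed

text \<open>Boxes are an intersection-stable generator of the Borel sets, so inside a fixed box the
  integral vanishes over every Borel set, in particular over the sets where \<open>f\<close> has a
  fixed sign.\<close>

lemma AE_zero_of_box_integrals:
  fixes f :: "real ^ 3 \<Rightarrow> real"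
  assumes f: "locally_integrable f"
    and box: "\<And>a b. (\<integral>x. indicator (box a b) x * f x \<partial>lborel) = 0"
  shows "AE x in lborel. f x = 0"
proof -
  note [measurable] = locally_integrable_measurable[OF f]
  have *: "AE x in lborel. x \<in> box u v \<longrightarrow> f x = 0" for u v
  proof -
    have int: "set_integrable lborel A f" if "A \<subseteq> box u v" "A \<in> sets borel" for A
    proof -
      have "set_integrable lborel (cbox u v) f"
        using f compact_cbox unfolding locally_integrable_def by blast
      then show ?thesis
        by (rule set_integrable_subset) (use that box_subset_cbox[of u v] in auto)
    qed
    \<comment> \<open>Intersecting with one bounded box keeps all integrals finite, which
      complements and countable unions require for a function that is only locally
      integrable.\<close>
    have zero: "(LINT x:A \<inter> box u v|lborel. f x) = 0" if "A \<in> sets borel" for A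
    proof -
      let ?G = "range (\<lambda>(a :: real ^ 3, b). box a b)"
      have G: "sigma_sets UNIV ?G = sets borel"
        by (subst borel_eq_box) simp
      have "Int_stable ?G"
        by (auto simp: Int_stable_def box_Int_box)
      moreover have "?G \<subseteq> Pow UNIV" by simp
      moreover have "A \<in> sigma_sets UNIV ?G" using that G by simp
      ultimately show ?thesis
      proof (induction rule: sigma_sets_induct_disjoint)
        case (basic A)
        then obtain a b where "A \<inter> box u v = box a b" by (auto simp: box_Int_box)
        then show ?case using box by (simp add: set_lebesgue_integral_def)
      next
        case empty
        then show ?case by (simp add: set_lebesgue_integral_def)
      next
        case (compl A)
        then have [measurable]: "A \<in> sets borel" using G by simp
        have "(UNIV - A) \<inter> box u v \<union> A \<inter> box u v = box u v" by blast
        then have "(LINT x:box u v|lborel. f x) = (LINT x:(UNIV - A) \<inter> box u v|lborel. f x) + (LINT x:A \<inter> box u v|lborel. f x)"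
          by (subst set_integral_Un[symmetric]) (auto intro!: int)
        moreover have "(LINT x:box u v|lborel. f x) = 0"
          using box by (simp add: set_lebesgue_integral_def)
        ultimately show ?case using compl by simp
      next
        case (union A)
        then have [measurable]: "A i \<in> sets borel" for i using G by auto
        have eq: "(\<Union>i. A i) \<inter> box u v = (\<Union>i. A i \<inter> box u v)" by blast
        have "(LINT x:(\<Union>i. A i \<inter> box u v)|lborel. f x) = (\<Sum>i. LINT x:A i \<inter> box u v|lborel. f x)"
          using union(1) by (intro lebesgue_integral_countable_add int) (auto simp: disjoint_family_on_def)
        then show ?case unfolding eq by (simp add: union(3))
      qed
    qed
    \<comment> \<open>The sign \<open>s\<close> treats the positive and the negative part at
      once.\<close>
    have pos: "AE x in lborel. x \<in> box u v \<longrightarrow> \<not> s * f x > 0" if s: "s = 1 \<or> s = - 1" for s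
    proof -
      define A where "A = {x. s * f x > 0}"
      have [measurable]: "A \<in> sets borel" unfolding A_def by measurable
      have i: "integrable lborel (\<lambda>x. indicator (A \<inter> box u v) x * (s * f x))"
        using int[of "A \<inter> box u v"] unfolding set_integrable_def
        by (simp add: mult.left_commute[of _ s])
      have "(\<integral>x. indicator (A \<inter> box u v) x * (s * f x) \<partial>lborel) = s * (LINT x:A \<inter> box u v|lborel. f x)"
        unfolding set_lebesgue_integral_def by (simp add: mult.left_commute[of _ s])
      then have "(\<integral>x. indicator (A \<inter> box u v) x * (s * f x) \<partial>lborel) = 0"
        using zero[of A] by simp
      then have "AE x in lborel. indicator (A \<inter> box u v) x * (s * f x) = 0"
        using integral_nonneg_eq_0_iff_AE[OF i] by (auto simp: A_def indicator_def)
      then show ?thesis by (rule eventually_mono) (auto simp: A_def)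
    qed
    have "AE x in lborel. x \<in> box u v \<longrightarrow> \<not> f x > 0" "AE x in lborel. x \<in> box u v \<longrightarrow> \<not> f x < 0"
      using pos[of 1] pos[of "- 1"] by simp_all
    then show ?thesis by eventually_elim auto
  qed
  have "AE x in lborel. \<forall>n :: nat. x \<in> box (- (real n *\<^sub>R One)) (real n *\<^sub>R One) \<longrightarrow> f x = 0"
    unfolding AE_all_countable using * by blast
  then show ?thesis
  proof (rule eventually_mono)
    fix x assume "\<forall>n :: nat. x \<in> box (- (real n *\<^sub>R One)) (real n *\<^sub>R One) \<longrightarrow> f x = 0"
    moreover have "x \<in> (\<Union>n::nat. box (- (real n *\<^sub>R One)) (real n *\<^sub>R One))"
      unfolding UN_box_eq_UNIV by simp
    ultimately show "f x = 0" by blast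
  qed
qed

text \<open>The convolution at \<open>x\<close> is a pairing with a reflected mollifier, which is a
  test function; so all mollifications vanish identically, and with them the box integrals in the
  limit.\<close>

lemma fundamental_lemma:
  assumes f: "locally_integrable f" and "\<And>\<eta>. test_function \<eta> \<Longrightarrow> (\<integral>x. f x * \<eta> x \<partial>lborel) = 0"
  shows "AE x in lborel. f x = 0"
proof (rule AE_zero_of_box_integrals[OF f])
  fix a b
  have "\<exists>\<rho>. mollifier (inverse (real (Suc n))) \<rho>" for n
    by (intro mollifier_exists) simp
  then obtain \<rho> where \<rho>: "\<And>n. mollifier (inverse (real (Suc n))) (\<rho> n)" by metis
  have "convolution f (\<rho> n) x = 0" for n x
    unfolding convolution_def using \<rho>[of n] by (intro assms test_function_reflect) (simp add: mollifier_def)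
  then show "(\<integral>x. indicator (box a b) x * f x \<partial>lborel) = 0"
    using integral_convolution_box_tendsto[OF f \<rho> LIMSEQ_inverse_real_of_nat, of a b]
    by (simp add: LIMSEQ_const_iff)
qed

section \<open>Uniqueness of weak gradients\<close>

lemma locally_integrable_component:
  fixes g :: "real ^ 3 \<Rightarrow> real ^ 3"
  assumes "locally_integrable g"
  shows "locally_integrable (\<lambda>x. g x $ i)"
  unfolding locally_integrable_def
proof (intro conjI allI impI)
  have [measurable]: "g \<in> borel_measurable borel"
    using assms by (simp add: locally_integrable_def)
  have "(\<lambda>x. g x \<bullet> axis i 1) \<in> borel_measurable lborel" by measurable
  then show "(\<lambda>x. g x $ i) \<in> borel_measurable lborel" by (simp add: inner_axis)
  fix K :: "(real ^ 3) set" assume "compact K"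
  then have "integrable lborel (\<lambda>x. indicator K x *\<^sub>R g x)"
    using assms by (simp add: locally_integrable_def set_integrable_def)
  then have "integrable lborel (\<lambda>x. (indicator K x *\<^sub>R g x) \<bullet> axis i 1)"
    by (rule integrable_inner_left)
  then show "set_integrable lborel K (\<lambda>x. g x $ i)"
    by (simp add: set_integrable_def inner_axis)
qed

lemma weak_gradient_unique:
  assumes g: "has_weak_gradient u g" and g': "has_weak_gradient u g'"
  shows "AE x in lborel. g x = g' x"
proof -
  have "AE x in lborel. g x $ i - g' x $ i = 0" for i
  proof (rule fundamental_lemma)
    have li: "locally_integrable (\<lambda>x. g x $ i)" "locally_integrable (\<lambda>x. g' x $ i)"
      using g g' unfolding has_weak_gradient_def by (auto intro: locally_integrable_component)
    then show "locally_integrable (\<lambda>x. g x $ i - g' x $ i)"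
      unfolding locally_integrable_def using set_integral_diff(1)[of lborel _ "\<lambda>x. g x $ i" "\<lambda>x. g' x $ i"]
      by auto
    fix \<eta> :: "real ^ 3 \<Rightarrow> real" assume \<eta>: "test_function \<eta>"
    obtain R where R: "\<And>x. norm x > R \<Longrightarrow> \<eta> x = 0"
      using test_function_support[OF \<eta>] by blast
    note int = integrable_locally_integrable_mult[OF _ test_function_measurable[OF \<eta>] test_function_loc_bounded[OF \<eta>] R]
    have "(\<integral>x. u x * partial i \<eta> x \<partial>lborel) = - (\<integral>x. g x $ i * \<eta> x \<partial>lborel)"
      "(\<integral>x. u x * partial i \<eta> x \<partial>lborel) = - (\<integral>x. g' x $ i * \<eta> x \<partial>lborel)"
      using g g' \<eta> unfolding has_weak_gradient_def by blast+
    then have "(\<integral>x. g x $ i * \<eta> x \<partial>lborel) = (\<integral>x. g' x $ i * \<eta> x \<partial>lborel)"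
      by linarith
    then show "(\<integral>x. (g x $ i - g' x $ i) * \<eta> x \<partial>lborel) = 0"
      using int[OF li(1)] int[OF li(2)] by (simp add: left_diff_distrib)
  qed
  then have "AE x in lborel. \<forall>i. g x $ i - g' x $ i = 0"
    by (simp add: AE_all_countable)
  then show ?thesis by (rule eventually_mono) (simp add: vec_eq_iff)
qed

text \<open>Makes the choice operator in the energy harmless: the energy can be computed with any
  explicit weak gradient.\<close>

lemma AE_weak_gradient:
  assumes "has_weak_gradient u g"
  shows "AE x in lborel. weak_gradient u x = g x"
  using weak_gradient_unique[OF _ assms] assms someI[of "has_weak_gradient u"]
  unfolding weak_gradient_def by blast

section \<open>A positivity criterion for Schroedinger operators\<close>

text \<open>With \<open>q = \<nabla>h / h\<close>, the field \<open>\<xi>\<^sup>2 (u \<nabla>u - u\<^sup>2 q)\<close> has divergence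
  \<open>2 \<xi> u \<nabla>\<xi> \<bullet> a + \<xi>\<^sup>2 \<bar>a\<bar>\<^sup>2 + \<xi>\<^sup>2 (u \<Delta>u - u\<^sup>2 \<Delta>h / h)\<close>, where \<open>a = \<nabla>u - u q\<close>.\<close>

lemma picone_inequality:
  fixes u U \<xi> :: "real ^ 3 \<Rightarrow> real" and u1 u2 \<xi>1 q q' :: "3 \<Rightarrow> real ^ 3 \<Rightarrow> real"
  assumes [measurable]: "u \<in> borel_measurable borel" "\<And>i. u1 i \<in> borel_measurable borel"
      "\<And>i. u2 i \<in> borel_measurable borel" "\<xi> \<in> borel_measurable borel" "\<And>i. \<xi>1 i \<in> borel_measurable borel"
      "\<And>i. q i \<in> borel_measurable borel" "\<And>i. q' i \<in> borel_measurable borel" "U \<in> borel_measurable borel"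
    and lb: "loc_bounded u" "\<And>i. loc_bounded (u1 i)" "\<And>i. loc_bounded (u2 i)" "loc_bounded \<xi>"
      "\<And>i. loc_bounded (\<xi>1 i)" "\<And>i. loc_bounded (q i)" "\<And>i. loc_bounded (q' i)" "loc_bounded U"
    and deriv: "\<And>i x t. ((\<lambda>t. u (x + t *\<^sub>R axis i 1)) has_real_derivative u1 i (x + t *\<^sub>R axis i 1)) (at t)"
      "\<And>i x t. ((\<lambda>t. u1 i (x + t *\<^sub>R axis i 1)) has_real_derivative u2 i (x + t *\<^sub>R axis i 1)) (at t)"
      "\<And>i x t. ((\<lambda>t. \<xi> (x + t *\<^sub>R axis i 1)) has_real_derivative \<xi>1 i (x + t *\<^sub>R axis i 1)) (at t)"
      "\<And>i x t. ((\<lambda>t. q i (x + t *\<^sub>R axis i 1)) has_real_derivative q' i (x + t *\<^sub>R axis i 1)) (at t)"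
    and supp: "\<And>x. norm x > R \<Longrightarrow> \<xi> x = 0" "\<And>i x. norm x > R \<Longrightarrow> \<xi>1 i x = 0"
  shows "(\<integral>x. (\<xi> x)\<^sup>2 * ((U x - (\<Sum>i\<in>UNIV. q' i x + (q i x)\<^sup>2)) * (u x)\<^sup>2) \<partial>lborel)
    \<le> (\<integral>x. (u x)\<^sup>2 * (\<Sum>i\<in>UNIV. (\<xi>1 i x)\<^sup>2) \<partial>lborel)
      + (\<integral>x. (\<xi> x)\<^sup>2 * (\<bar>u x\<bar> * \<bar>(\<Sum>i\<in>UNIV. u2 i x) - U x * u x\<bar>) \<partial>lborel)"
proof -
  define F where "F i x = (\<xi> x * \<xi> x) * (u x * u1 i x - u x * u x * q i x)" for i x
  define F' where "F' i x = 2 * \<xi> x * \<xi>1 i x * (u x * u1 i x - u x * u x * q i x)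
      + (\<xi> x * \<xi> x) * (u1 i x * u1 i x + u x * u2 i x - 2 * u x * u1 i x * q i x - u x * u x * q' i x)" for i x
  have F_meas [measurable]: "F i \<in> borel_measurable borel" "F' i \<in> borel_measurable borel" for i
    unfolding F_def F'_def by measurable
  have lbF: "loc_bounded (F i)" "loc_bounded (F' i)" for i
    unfolding F_def F'_def using lb by (intro loc_bounded_intros; simp)+
  have zero: "(\<integral>x. F' i x \<partial>lborel) = 0" for i
  proof (rule integral_directional_derivative_eq_0[where F = "F i" and N = "{}" and e = "axis i 1" and R = R])
    fix x :: "real ^ 3" and t :: real
    let ?z = "x + t *\<^sub>R axis i 1"
    show "((\<lambda>t. F i (x + t *\<^sub>R axis i 1)) has_real_derivative F' i ?z) (at t)"
      unfolding F_def F'_def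
      by (rule derivative_eq_intros deriv refl)+ (simp add: algebra_simps)
  qed (use lbF supp in \<open>auto simp: F_def\<close>)
  define E where "E x = (\<Sum>i\<in>UNIV. u2 i x) - U x * u x" for x
  have E_meas [measurable]: "E \<in> borel_measurable borel" unfolding E_def by measurable
  define K where "K x = U x - (\<Sum>i\<in>UNIV. q' i x + (q i x)\<^sup>2)" for x
  have K_meas [measurable]: "K \<in> borel_measurable borel" unfolding K_def by measurable
  have lbE: "loc_bounded E" "loc_bounded K"
    unfolding E_def K_def power2_eq_square using lb by (intro loc_bounded_intros; simp)+
  have lb_abs: "loc_bounded (\<lambda>x. \<bar>f x\<bar>)" if "loc_bounded f" for f :: "real ^ 3 \<Rightarrow> real"
    using that by (simp add: loc_bounded_def)
  have int1: "integrable lborel (\<lambda>x. (\<xi> x)\<^sup>2 * (K x * (u x)\<^sup>2))"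
    by (rule integrable_compact_support[where R = R])
       (use lb lbE supp in \<open>auto intro!: loc_bounded_mult loc_bounded_power\<close>)
  have int2: "integrable lborel (\<lambda>x. (u x)\<^sup>2 * (\<Sum>i\<in>UNIV. (\<xi>1 i x)\<^sup>2))"
    by (rule integrable_compact_support[where R = R])
       (use lb lbE supp in \<open>auto intro!: loc_bounded_mult loc_bounded_power loc_bounded_sum\<close>)
  have int3: "integrable lborel (\<lambda>x. (\<xi> x)\<^sup>2 * (\<bar>u x\<bar> * \<bar>E x\<bar>))"
    by (rule integrable_compact_support[where R = R])
       (use lb lbE supp in \<open>auto intro!: loc_bounded_mult loc_bounded_power lb_abs\<close>)
  have intF: "integrable lborel (F' i)" for i
    by (rule integrable_compact_support[where R = R])
       (use lbF supp in \<open>auto simp: F'_def\<close>)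
  have pointwise: "(\<xi> x)\<^sup>2 * (K x * (u x)\<^sup>2) - (u x)\<^sup>2 * (\<Sum>i\<in>UNIV. (\<xi>1 i x)\<^sup>2) - (\<xi> x)\<^sup>2 * (\<bar>u x\<bar> * \<bar>E x\<bar>)
      \<le> (\<Sum>i\<in>UNIV. F' i x)" for x
  proof -
    have "F' i x \<ge> (\<xi> x)\<^sup>2 * (u x * u2 i x - (u x)\<^sup>2 * (q' i x + (q i x)\<^sup>2)) - (u x)\<^sup>2 * (\<xi>1 i x)\<^sup>2" for i
    proof -
      \<comment> \<open>Completing the square: the cross term between the cutoff derivative and
        \<open>u1 - u q\<close> costs exactly \<open>u^2 \<xi>1^2\<close>, with constant 1.\<close>
      have "F' i x - ((\<xi> x)\<^sup>2 * (u x * u2 i x - (u x)\<^sup>2 * (q' i x + (q i x)\<^sup>2)) - (u x)\<^sup>2 * (\<xi>1 i x)\<^sup>2)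
          = (\<xi> x * (u1 i x - u x * q i x) + u x * \<xi>1 i x)\<^sup>2"
        unfolding F'_def by algebra
      then show ?thesis by (metis diff_ge_0_iff_ge zero_le_power2)
    qed
    then have "(\<Sum>i\<in>UNIV. (\<xi> x)\<^sup>2 * (u x * u2 i x - (u x)\<^sup>2 * (q' i x + (q i x)\<^sup>2)) - (u x)\<^sup>2 * (\<xi>1 i x)\<^sup>2)
        \<le> (\<Sum>i\<in>UNIV. F' i x)" by (intro sum_mono)
    also have "(\<Sum>i\<in>UNIV. (\<xi> x)\<^sup>2 * (u x * u2 i x - (u x)\<^sup>2 * (q' i x + (q i x)\<^sup>2)) - (u x)\<^sup>2 * (\<xi>1 i x)\<^sup>2)
        = (\<xi> x)\<^sup>2 * (u x * (\<Sum>i\<in>UNIV. u2 i x) - (u x)\<^sup>2 * (\<Sum>i\<in>UNIV. q' i x + (q i x)\<^sup>2))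
          - (u x)\<^sup>2 * (\<Sum>i\<in>UNIV. (\<xi>1 i x)\<^sup>2)"
      by (simp add: sum_subtractf sum_distrib_left right_diff_distrib)
    also have "\<dots> = (\<xi> x)\<^sup>2 * (K x * (u x)\<^sup>2) - (u x)\<^sup>2 * (\<Sum>i\<in>UNIV. (\<xi>1 i x)\<^sup>2) + (\<xi> x)\<^sup>2 * (u x * E x)"
      unfolding K_def E_def by algebra
    finally have 1: "(\<xi> x)\<^sup>2 * (K x * (u x)\<^sup>2) - (u x)\<^sup>2 * (\<Sum>i\<in>UNIV. (\<xi>1 i x)\<^sup>2) + (\<xi> x)\<^sup>2 * (u x * E x)
        \<le> (\<Sum>i\<in>UNIV. F' i x)" .
    have "u x * E x \<ge> - (\<bar>u x\<bar> * \<bar>E x\<bar>)" by (simp flip: abs_mult)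
    then have "(\<xi> x)\<^sup>2 * (u x * E x) \<ge> (\<xi> x)\<^sup>2 * (- (\<bar>u x\<bar> * \<bar>E x\<bar>))"
      by (intro mult_left_mono) auto
    with 1 show ?thesis by simp
  qed
  have "(\<integral>x. (\<xi> x)\<^sup>2 * (K x * (u x)\<^sup>2) - (u x)\<^sup>2 * (\<Sum>i\<in>UNIV. (\<xi>1 i x)\<^sup>2) - (\<xi> x)\<^sup>2 * (\<bar>u x\<bar> * \<bar>E x\<bar>) \<partial>lborel)
      \<le> (\<integral>x. (\<Sum>i\<in>UNIV. F' i x) \<partial>lborel)"
    by (intro integral_mono pointwise Bochner_Integration.integrable_diff Bochner_Integration.integrable_sum
        int1 int2 int3 intF)
  also have "\<dots> = 0" using intF zero by simp
  finally show ?thesis using int1 int2 int3 by (simp add: K_def E_def)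
qed

text \<open>Only first derivatives of the cutoff enter Picone's identity, so a squared truncated
  polynomial will do; the square makes it continuously differentiable across the sphere of radius
  \<open>R\<close>.\<close>

definition cutoff :: "real \<Rightarrow> real ^ 3 \<Rightarrow> real"
  where "cutoff R x = (max 0 (1 - (x \<bullet> x) / R\<^sup>2))\<^sup>2"

definition cutoff_partial :: "real \<Rightarrow> 3 \<Rightarrow> real ^ 3 \<Rightarrow> real"
  where "cutoff_partial R i x = - (4 * x $ i / R\<^sup>2) * max 0 (1 - (x \<bullet> x) / R\<^sup>2)"

lemma DERIV_max_0_square: "((\<lambda>s. (max 0 s)\<^sup>2) has_real_derivative 2 * max 0 s) (at (s :: real))"
proof (cases s "0 :: real" rule: linorder_cases)
  case less
  have "((\<lambda>_. 0) has_real_derivative 0) (at s)" by simp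
  then have "((\<lambda>s. (max 0 s)\<^sup>2) has_real_derivative 0) (at s)"
    by (rule has_field_derivative_transform_within_open[of _ _ _ "{..<0}"]) (use less in auto)
  then show ?thesis using less by simp
next
  case equal
  have "((\<lambda>h :: real. max 0 h * (max 0 h / h)) \<longlongrightarrow> 0) (at 0)"
  proof (rule Lim_null_comparison[where g = "\<lambda>h. \<bar>h\<bar>"])
    show "eventually (\<lambda>h :: real. norm (max 0 h * (max 0 h / h)) \<le> \<bar>h\<bar>) (at 0)"
      by (auto simp: eventually_at_filter max_def)
    show "((\<lambda>h :: real. \<bar>h\<bar>) \<longlongrightarrow> 0) (at 0)" by (rule tendsto_rabs_zero) (rule tendsto_ident_at)
  qed
  then show ?thesis using equal by (simp add: DERIV_def power2_eq_square)
next
  case greater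
  have "((\<lambda>s. s\<^sup>2) has_real_derivative 2 * s) (at s)" by (auto intro!: derivative_eq_intros)
  then have "((\<lambda>s. (max 0 s)\<^sup>2) has_real_derivative 2 * s) (at s)"
    by (rule has_field_derivative_transform_within_open[of _ _ _ "{0<..}"]) (use greater in auto)
  then show ?thesis using greater by simp
qed

lemma inner_line_DERIV:
  "((\<lambda>t. (x + t *\<^sub>R axis i 1) \<bullet> (x + t *\<^sub>R axis i 1)) has_real_derivative
    2 * (x + t *\<^sub>R axis i 1 :: real ^ 3) $ i) (at t)"
proof -
  have "(x + t *\<^sub>R axis i 1) \<bullet> (x + t *\<^sub>R axis i 1) = x \<bullet> x + 2 * t * x $ i + t\<^sup>2" for t
    by (simp add: inner_simps inner_axis inner_axis' inner_axis_axis power2_eq_square algebra_simps)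
  then show ?thesis by (auto intro!: derivative_eq_intros)
qed

lemma component_line_DERIV:
  "((\<lambda>t. (x + t *\<^sub>R axis i 1 :: real ^ 3) $ i) has_real_derivative 1) (at t)"
  by (auto intro!: derivative_eq_intros simp: axis_def)

lemma cutoff_DERIV:
  assumes "R > 0"
  shows "((\<lambda>t. cutoff R (x + t *\<^sub>R axis i 1)) has_real_derivative
    cutoff_partial R i (x + t *\<^sub>R axis i 1)) (at t)"
proof -
  let ?z = "x + t *\<^sub>R axis i 1"
  have "((\<lambda>t. 1 - ((x + t *\<^sub>R axis i 1) \<bullet> (x + t *\<^sub>R axis i 1)) / R\<^sup>2) has_real_derivative - (2 * ?z $ i / R\<^sup>2)) (at t)"
    using DERIV_diff[OF DERIV_const[of 1] DERIV_cdivide[OF inner_line_DERIV[of x i t], of "R\<^sup>2"]] by simp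
  note deriv = DERIV_chain2[OF DERIV_max_0_square this]
  have "2 * M * (- (2 * w / r)) = - (4 * w / r) * M" for M w r :: real by simp
  then show ?thesis
    unfolding cutoff_def cutoff_partial_def by (intro DERIV_cong[OF deriv])
qed

lemma cutoff_continuous: "R > 0 \<Longrightarrow> continuous_on UNIV (cutoff R)" "R > 0 \<Longrightarrow> continuous_on UNIV (cutoff_partial R i)"
  unfolding cutoff_def cutoff_partial_def by (auto intro!: continuous_intros)

lemma cutoff_support:
  assumes "R > 0" "norm x > R"
  shows "cutoff R x = 0" "cutoff_partial R i x = 0"
proof -
  have "R\<^sup>2 \<le> (norm x)\<^sup>2" using assms by (intro power_mono) auto
  then have "1 - (x \<bullet> x) / R\<^sup>2 \<le> 0" using assms by (simp add: power2_norm_eq_inner field_simps)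
  then show "cutoff R x = 0" "cutoff_partial R i x = 0"
    by (simp_all add: cutoff_def cutoff_partial_def max_def)
qed

text \<open>The gradient bound keeps its factor \<open>(norm x)^2\<close>. At a fixed point it is
  therefore of smaller order than \<open>1 / R^2\<close>, and this is what gives decay in the
  critical L^6 case.\<close>

lemma cutoff_bounds:
  assumes "R > 0"
  shows "0 \<le> cutoff R x" "cutoff R x \<le> 1"
    "(\<Sum>i\<in>UNIV. (cutoff_partial R i x)\<^sup>2) \<le> 16 * (norm x)\<^sup>2 / R ^ 4"
    "norm x \<le> R / 2 \<Longrightarrow> 1 / 4 \<le> (cutoff R x)\<^sup>2"
proof -
  define m where "m = max 0 (1 - (x \<bullet> x) / R\<^sup>2)"
  have m: "0 \<le> m" "m \<le> 1" by (auto simp: m_def)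
  then have m2: "m\<^sup>2 \<le> 1" by (simp add: power_le_one)
  show "0 \<le> cutoff R x" "cutoff R x \<le> 1" using m2 by (auto simp: cutoff_def m_def)
  have "cutoff_partial R i x = - (4 * x $ i / R\<^sup>2) * m" for i
    by (simp add: cutoff_partial_def m_def)
  then have "(cutoff_partial R i x)\<^sup>2 = 16 * m\<^sup>2 / R ^ 4 * (x $ i * x $ i)" for i
    by (simp add: power2_eq_square power4_eq_xxxx mult_ac)
  then have "(\<Sum>i\<in>UNIV. (cutoff_partial R i x)\<^sup>2) = (\<Sum>i\<in>UNIV. 16 * m\<^sup>2 / R ^ 4 * (x $ i * x $ i))"
    by simp
  also have "\<dots> = 16 * m\<^sup>2 / R ^ 4 * (norm x)\<^sup>2"
    by (simp add: power2_norm_eq_inner inner_vec_def sum_distrib_left sum_divide_distrib)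
  also have "\<dots> \<le> 16 * (norm x)\<^sup>2 / R ^ 4"
    using m2 mult_right_mono[OF m2, of "16 * (norm x)\<^sup>2 / R ^ 4"] assms by (simp add: field_simps)
  finally show "(\<Sum>i\<in>UNIV. (cutoff_partial R i x)\<^sup>2) \<le> 16 * (norm x)\<^sup>2 / R ^ 4" .
  assume "norm x \<le> R / 2"
  then have "(norm x)\<^sup>2 \<le> (R / 2)\<^sup>2" by (intro power_mono) auto
  then have "(x \<bullet> x) / R\<^sup>2 \<le> 1 / 4" using assms by (simp add: power2_norm_eq_inner field_simps)
  then have "m \<ge> 3 / 4" unfolding m_def by linarith
  then have "m ^ 4 \<ge> (3 / 4) ^ 4" by (intro power_mono) auto
  then show "1 / 4 \<le> (cutoff R x)\<^sup>2"
    by (simp add: cutoff_def m_def[symmetric] power_mult[symmetric] power_divide)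
qed

section \<open>Pointwise and integral inequalities for mollified functions\<close>

lemma convolution_mono:
  assumes "mollifier \<epsilon> \<rho>" "locally_integrable f" "locally_integrable g"
    "\<And>y. norm (x - y) \<le> \<epsilon> \<Longrightarrow> f y \<le> g y"
  shows "convolution f \<rho> x \<le> convolution g \<rho> x"
  unfolding convolution_def
proof (rule integral_mono)
  fix y show "f y * \<rho> (x - y) \<le> g y * \<rho> (x - y)"
    using assms by (cases "norm (x - y) \<le> \<epsilon>") (auto simp: mollifier_def mult_right_mono)
qed (use assms integrable_convolution in \<open>auto simp: mollifier_def\<close>)

lemma mollifier_reflect_integral:
  assumes "mollifier \<epsilon> \<rho>"
  shows "(\<integral>y. \<rho> (x - y) \<partial>lborel) = 1" "integrable lborel (\<lambda>y. \<rho> (x - y))"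
proof -
  have 1: "(\<integral>x. \<rho> x \<partial>lborel) = 1" using assms by (auto simp: mollifier_def)
  note [measurable] = test_function_measurable[of \<rho>]
  have "integrable lborel \<rho>" using 1 not_integrable_integral_eq by force
  then show "(\<integral>y. \<rho> (x - y) \<partial>lborel) = 1" "integrable lborel (\<lambda>y. \<rho> (x - y))"
    using 1 assms by (simp_all add: lborel_integral_reflect lborel_integrable_reflect mollifier_def test_function_measurable)
qed

lemma convolution_abs_le:
  assumes \<rho>: "mollifier \<epsilon> \<rho>" and f: "locally_integrable f"
  shows "\<bar>convolution f \<rho> x\<bar> \<le> convolution (\<lambda>y. \<bar>f y\<bar>) \<rho> x"
proof -
  have "norm (convolution f \<rho> x) \<le> (\<integral>y. norm (f y * \<rho> (x - y)) \<partial>lborel)"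
    unfolding convolution_def by (rule integral_norm_bound)
  also have "\<dots> = convolution (\<lambda>y. \<bar>f y\<bar>) \<rho> x"
    using \<rho> by (simp add: convolution_def mollifier_def abs_mult)
  finally show ?thesis by simp
qed

text \<open>Jensen's inequality, from \<open>a\<^sup>2 \<ge> 2 a b - b\<^sup>2\<close> with \<open>b\<close> the convolution itself.\<close>

lemma convolution_square_le:
  assumes \<rho>: "mollifier \<epsilon> \<rho>" and f: "locally_integrable f" and f2: "locally_integrable (\<lambda>x. (f x)\<^sup>2)"
  shows "(convolution f \<rho> x)\<^sup>2 \<le> convolution (\<lambda>y. (f y)\<^sup>2) \<rho> x"
proof -
  define b where "b = convolution f \<rho> x"
  have t: "test_function \<rho>" and nonneg: "\<And>x. \<rho> x \<ge> 0" using \<rho> by (auto simp: mollifier_def)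
  have "(\<integral>y. 2 * b * (f y * \<rho> (x - y)) - b\<^sup>2 * \<rho> (x - y) \<partial>lborel) \<le> (\<integral>y. (f y)\<^sup>2 * \<rho> (x - y) \<partial>lborel)"
  proof (rule integral_mono)
    fix y
    have "0 \<le> (f y - b)\<^sup>2 * \<rho> (x - y)" using nonneg by simp
    then show "2 * b * (f y * \<rho> (x - y)) - b\<^sup>2 * \<rho> (x - y) \<le> (f y)\<^sup>2 * \<rho> (x - y)"
      by (simp add: power2_eq_square algebra_simps)
  qed (use integrable_convolution[OF f t] integrable_convolution[OF f2 t] mollifier_reflect_integral[OF \<rho>] in auto)
  moreover have "(\<integral>y. f y * \<rho> (x - y) \<partial>lborel) = b" by (simp add: b_def convolution_def)
  ultimately show ?thesis
    using integrable_convolution[OF f t, of x] mollifier_reflect_integral[OF \<rho>, of x]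
    by (simp add: convolution_def[of "\<lambda>y. f y * f y"] b_def[symmetric] power2_eq_square)
qed

text \<open>A weighted integral of the mollification is bounded by one of \<open>f\<close> itself if
  the new weight dominates the old one after a displacement by at most \<epsilon>.\<close>

lemma integral_convolution_le:
  fixes f g g' :: "real ^ 3 \<Rightarrow> real"
  assumes \<rho>: "mollifier \<epsilon> \<rho>" and f: "locally_integrable f" "\<And>x. f x \<ge> 0"
    and g: "g \<in> borel_measurable borel" "\<And>x. \<bar>g x\<bar> \<le> B" "\<And>x. norm x > R \<Longrightarrow> g x = 0"
    and g': "integrable lborel (\<lambda>y. f y * g' y)" "\<And>x y. norm (x - y) \<le> \<epsilon> \<Longrightarrow> g x \<le> g' y"
  shows "(\<integral>x. g x * convolution f \<rho> x \<partial>lborel) \<le> (\<integral>y. f y * g' y \<partial>lborel)"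
proof -
  have nonneg: "\<And>x. \<rho> x \<ge> 0" and supp: "\<And>x. norm x > \<epsilon> \<Longrightarrow> \<rho> x = 0"
    using \<rho> by (auto simp: mollifier_def)
  have "(\<integral>x. g x * \<rho> (x - y) \<partial>lborel) \<le> g' y" for y
  proof -
    have "(\<integral>x. g x * \<rho> (x - y) \<partial>lborel) \<le> (\<integral>x. g' y * \<rho> (x - y) \<partial>lborel)"
    proof (rule integral_mono)
      show "g x * \<rho> (x - y) \<le> g' y * \<rho> (x - y)" for x
        using g'(2)[of x y] nonneg supp[of "x - y"] by (cases "norm (x - y) \<le> \<epsilon>") (auto simp: mult_right_mono)
      show "integrable lborel (\<lambda>x. g x * \<rho> (x - y))"
        by (rule integral_mult_convolution(3)[OF f(1) \<rho> g(1,2)]) (rule g(3))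
    qed (use mollifier_shift_integral[OF \<rho>] in auto)
    then show ?thesis using mollifier_shift_integral[OF \<rho>] by simp
  qed
  then have "(\<integral>y. f y * (\<integral>x. g x * \<rho> (x - y) \<partial>lborel) \<partial>lborel) \<le> (\<integral>y. f y * g' y \<partial>lborel)"
    using f(2) g'(1) by (intro integral_mono mult_left_mono integral_mult_convolution(2)[OF f(1) \<rho> g(1,2)] g(3))
  moreover have "(\<integral>x. g x * convolution f \<rho> x \<partial>lborel) = (\<integral>y. f y * (\<integral>x. g x * \<rho> (x - y) \<partial>lborel) \<partial>lborel)"
    by (rule integral_mult_convolution(1)[OF f(1) \<rho> g(1,2)]) (rule g(3))
  ultimately show ?thesis by simp
qed

section \<open>Weighted tails of functions in L^2 or L^6\<close>

lemma locally_integrable_dominated: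
  fixes f g :: "real ^ 3 \<Rightarrow> real"
  assumes [measurable]: "f \<in> borel_measurable borel" and g: "integrable lborel g"
    and le: "\<And>x. \<bar>f x\<bar> \<le> 1 + g x"
  shows "locally_integrable f"
  unfolding locally_integrable_def
proof (intro conjI allI impI)
  fix K :: "(real ^ 3) set" assume "compact K"
  then have [measurable]: "K \<in> sets borel" by (simp add: borel_compact)
  have "integrable lborel (indicator K :: _ \<Rightarrow> real)"
    using emeasure_compact_finite[OF \<open>compact K\<close>] by (intro integrable_real_indicator) auto
  then have "integrable lborel (\<lambda>x. indicator K x + \<bar>g x\<bar>)" using g by auto
  then show "set_integrable lborel K f"
    unfolding set_integrable_def
  proof (rule Bochner_Integration.integrable_bound)
    have "\<bar>indicator K x * f x\<bar> \<le> \<bar>indicator K x + \<bar>g x\<bar>\<bar>" for x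
      using le[of x] by (auto simp: indicator_def)
    then show "AE x in lborel. norm (indicator K x *\<^sub>R f x) \<le> norm (indicator K x + \<bar>g x\<bar>)" by simp
  qed auto
qed auto

text \<open>Eigenfunctions come with L^2 and resonances with L^6; \<open>a^k \<le> 1 + a^p\<close>
  for \<open>k \<le> p\<close> serves both cases, so that they can share all later
  arguments.\<close>

lemma Lp_2_6_locally_integrable:
  assumes "in_Lp 2 \<psi> \<or> in_Lp 6 (\<psi> :: real ^ 3 \<Rightarrow> real)"
  shows "locally_integrable \<psi>" "locally_integrable (\<lambda>x. (\<psi> x)\<^sup>2)"
proof -
  have [measurable]: "\<psi> \<in> borel_measurable borel" using assms by (auto simp: in_Lp_def)
  define p :: nat where "p = (if in_Lp 2 \<psi> then 2 else 6)"
  have int: "integrable lborel (\<lambda>x. \<bar>\<psi> x\<bar> ^ p)"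
    using assms by (auto simp: in_Lp_def p_def)
  have le: "a ^ k \<le> 1 + a ^ p" if "a \<ge> 0" "k \<le> p" for a :: real and k
  proof (cases "a \<le> 1")
    case True
    then have "a ^ k \<le> 1" using that by (simp add: power_le_one)
    then show ?thesis using that by (smt (verit) zero_le_power)
  next
    case False
    then have "a ^ k \<le> a ^ p" using that by (intro power_increasing) auto
    then show ?thesis by simp
  qed
  have p: "1 \<le> p" "2 \<le> p" by (auto simp: p_def)
  show "locally_integrable \<psi>"
    by (rule locally_integrable_dominated[OF _ int]) (use le[OF abs_ge_zero p(1)] in auto)
  show "locally_integrable (\<lambda>x. (\<psi> x)\<^sup>2)"
    by (rule locally_integrable_dominated[OF _ int]) (use le[OF abs_ge_zero p(2)] in auto)
qed

text \<open>Dominates the squared gradient of the cutoff at radius \<open>n\<close> even after a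
  displacement of length at most 1, the largest mollification radius in use; this is the origin of
  the two \<open>+ 1\<close>.\<close>

definition tail_weight :: "nat \<Rightarrow> real ^ 3 \<Rightarrow> real"
  where "tail_weight n y = (if norm y \<le> real n + 1 then 16 * (norm y + 1)\<^sup>2 / real n ^ 4 else 0)"

lemma tail_weight_measurable [measurable]: "tail_weight n \<in> borel_measurable borel"
  unfolding tail_weight_def by measurable

lemma tail_weight_nonneg: "0 \<le> tail_weight n y"
  by (simp add: tail_weight_def)

lemma tail_weight_le:
  assumes "n > 0"
  shows "tail_weight n y \<le> 144 / (real n)\<^sup>2"
proof (cases "norm y \<le> real n + 1")
  case True
  \<comment> \<open>Here \<open>norm y + 1\<close> is at most \<open>n + 2\<close>, hence at most
    \<open>3 n\<close>; and 144 = 16 * 9.\<close>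
  have "(norm y + 1)\<^sup>2 \<le> (3 * real n)\<^sup>2" using True assms by (intro power_mono) auto
  then have "16 * (norm y + 1)\<^sup>2 / real n ^ 4 \<le> 16 * (3 * real n)\<^sup>2 / real n ^ 4"
    by (intro divide_right_mono mult_left_mono) auto
  also have "\<dots> = 144 / (real n)\<^sup>2" using assms by (simp add: field_simps power2_eq_square power4_eq_xxxx)
  finally show ?thesis using True by (simp add: tail_weight_def)
qed (simp add: tail_weight_def)

lemma tail_weight_tendsto: "(\<lambda>n. (real n)\<^sup>2 * tail_weight n y) \<longlonglongrightarrow> 0"
proof -
  have "(\<lambda>n. 16 * (norm y + 1)\<^sup>2 * (1 / real n)\<^sup>2) \<longlonglongrightarrow> 16 * (norm y + 1)\<^sup>2 * 0\<^sup>2"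
    by (intro tendsto_intros lim_1_over_n)
  then have lim: "(\<lambda>n. 16 * (norm y + 1)\<^sup>2 * (1 / real n)\<^sup>2) \<longlonglongrightarrow> 0" by simp
  show ?thesis
  proof (rule Lim_null_comparison[OF _ lim])
    show "\<forall>\<^sub>F n in sequentially. norm ((real n)\<^sup>2 * tail_weight n y) \<le> 16 * (norm y + 1)\<^sup>2 * (1 / real n)\<^sup>2"
    proof (intro always_eventually allI)
      fix n
      have "(real n)\<^sup>2 * (16 * c / real n ^ 4) = 16 * c * (1 / real n)\<^sup>2" for c
        by (cases "n = 0") (simp_all add: power2_eq_square power4_eq_xxxx)
      then show "norm ((real n)\<^sup>2 * tail_weight n y) \<le> 16 * (norm y + 1)\<^sup>2 * (1 / real n)\<^sup>2"
        by (simp add: tail_weight_def)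
    qed
  qed
qed

text \<open>Young's inequality with a free parameter, by comparing \<open>a\<close> with
  \<open>b / l\<close>. For \<open>a = \<psi>^2\<close> and \<open>b = 1 / r\<close> it separates
  \<psi>^6 from \<open>1 / r^3\<close>, the reciprocal order of the volume of the ball.\<close>

lemma weight_young:
  fixes a b l :: real
  assumes "a \<ge> 0" "b \<ge> 0" "l > 0"
  shows "a * b\<^sup>2 \<le> l\<^sup>2 * a ^ 3 + b ^ 3 / l"
proof (cases "a \<le> b / l")
  case True
  then have "a * b\<^sup>2 \<le> b / l * b\<^sup>2" by (intro mult_right_mono) auto
  moreover have "0 \<le> l\<^sup>2 * a ^ 3" using assms by simp
  ultimately show ?thesis by (simp add: power3_eq_cube power2_eq_square)
next
  case False
  then have "b \<le> l * a" using assms by (simp add: field_simps)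
  then have "a * b\<^sup>2 \<le> a * (l * a)\<^sup>2" using assms by (intro mult_left_mono power_mono) auto
  moreover have "0 \<le> b ^ 3 / l" using assms by simp
  ultimately show ?thesis by (simp add: power3_eq_cube power2_eq_square mult_ac)
qed

text \<open>For L^2 the weight itself is O(1/n^2). For L^6, Hoelder's inequality on the ball would
  only bound the integrals. Smallness comes from \<open>n^2\<close> times the weight, which is
  bounded and tends to 0 pointwise, while the volume term is made small by the parameter of
  \<open>weight_young\<close>.\<close>

lemma tail_integral_tendsto:
  assumes \<psi>: "in_Lp 2 \<psi> \<or> in_Lp 6 (\<psi> :: real ^ 3 \<Rightarrow> real)"
  shows "(\<lambda>n. \<integral>y. (\<psi> y)\<^sup>2 * tail_weight n y \<partial>lborel) \<longlonglongrightarrow> 0"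
proof -
  have [measurable]: "\<psi> \<in> borel_measurable borel" using \<psi> by (auto simp: in_Lp_def)
  note L2 = Lp_2_6_locally_integrable(2)[OF \<psi>]
  have tw_lb: "loc_bounded (tail_weight n)" for n
  proof (cases "n = 0")
    case True
    then show ?thesis by (auto intro!: loc_bounded_bounded[of _ 0] simp: tail_weight_def)
  next
    case False
    then show ?thesis using tail_weight_le[of n] tail_weight_nonneg[of n]
      by (intro loc_bounded_bounded[of _ "144 / (real n)\<^sup>2"]) simp
  qed
  have int: "integrable lborel (\<lambda>y. (\<psi> y)\<^sup>2 * tail_weight n y)" for n
    by (rule integrable_locally_integrable_mult[OF L2 _ tw_lb, where R = "real n + 1"])
       (auto simp: tail_weight_def)
  have wlim: "(\<lambda>n. (real (Suc n))\<^sup>2 * tail_weight (Suc n) y) \<longlonglongrightarrow> 0" for y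
    using LIMSEQ_Suc[OF tail_weight_tendsto[of y]] by simp
  have wle: "(real (Suc n))\<^sup>2 * tail_weight (Suc n) y \<le> 144" for n y
    using tail_weight_le[of "Suc n" y] by (simp add: field_simps del: of_nat_Suc)
  have dct: "(\<lambda>n. \<integral>y. f y * ((real (Suc n))\<^sup>2 * tail_weight (Suc n) y) \<partial>lborel) \<longlonglongrightarrow> 0"
    if f: "integrable lborel f" "\<And>x. f x \<ge> 0" for f
  proof -
    have [measurable]: "f \<in> borel_measurable borel" using f by auto
    have "(\<lambda>n. \<integral>y. f y * ((real (Suc n))\<^sup>2 * tail_weight (Suc n) y) \<partial>lborel) \<longlonglongrightarrow> (\<integral>y. f y * 0 \<partial>lborel)"
    proof (rule integral_dominated_convergence)
      show "integrable lborel (\<lambda>y. f y * 144)" using f by auto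
      show "AE y in lborel. (\<lambda>n. f y * ((real (Suc n))\<^sup>2 * tail_weight (Suc n) y)) \<longlonglongrightarrow> f y * 0"
        by (intro always_eventually allI tendsto_mult_left wlim)
      show "AE y in lborel. norm (f y * ((real (Suc n))\<^sup>2 * tail_weight (Suc n) y)) \<le> f y * 144" for n
      proof (intro always_eventually allI)
        fix y
        have "f y * ((real (Suc n))\<^sup>2 * tail_weight (Suc n) y) \<le> f y * 144"
          by (intro mult_left_mono wle f)
        then show "norm (f y * ((real (Suc n))\<^sup>2 * tail_weight (Suc n) y)) \<le> f y * 144"
          using f(2)[of y] tail_weight_nonneg[of "Suc n" y] by (simp add: abs_mult)
      qed
    qed auto
    then show ?thesis by simp
  qed
  have "(\<lambda>n. \<integral>y. (\<psi> y)\<^sup>2 * tail_weight (Suc n) y \<partial>lborel) \<longlonglongrightarrow> 0"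
    using \<psi>
  proof
    assume "in_Lp 2 \<psi>"
    then have i2: "integrable lborel (\<lambda>y. (\<psi> y)\<^sup>2)" by (simp add: in_Lp_def)
    from dct[OF i2] have lim: "(\<lambda>n. \<integral>y. (\<psi> y)\<^sup>2 * ((real (Suc n))\<^sup>2 * tail_weight (Suc n) y) \<partial>lborel) \<longlonglongrightarrow> 0" by simp
    show ?thesis
    proof (rule Lim_null_comparison[OF always_eventually lim], intro allI)
      fix n
      have "(\<psi> y)\<^sup>2 * tail_weight (Suc n) y * 1 \<le> (\<psi> y)\<^sup>2 * tail_weight (Suc n) y * (real (Suc n))\<^sup>2" for y
        using tail_weight_nonneg[of "Suc n" y] by (intro mult_left_mono) auto
      then have "(\<integral>y. (\<psi> y)\<^sup>2 * tail_weight (Suc n) y \<partial>lborel)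
          \<le> (\<integral>y. (\<psi> y)\<^sup>2 * ((real (Suc n))\<^sup>2 * tail_weight (Suc n) y) \<partial>lborel)"
        using int[of "Suc n"] integrable_mult_right[OF int[of "Suc n"], of "(real (Suc n))\<^sup>2"]
        by (intro integral_mono) (simp_all only: mult_ac mult_1_left)
      moreover have "0 \<le> (\<integral>y. (\<psi> y)\<^sup>2 * tail_weight (Suc n) y \<partial>lborel)"
        by (rule Bochner_Integration.integral_nonneg) (simp add: tail_weight_nonneg)
      ultimately show "norm (\<integral>y. (\<psi> y)\<^sup>2 * tail_weight (Suc n) y \<partial>lborel)
          \<le> (\<integral>y. (\<psi> y)\<^sup>2 * ((real (Suc n))\<^sup>2 * tail_weight (Suc n) y) \<partial>lborel)" by simp
    qed
  next
    assume "in_Lp 6 \<psi>"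
    then have i6: "integrable lborel (\<lambda>y. (\<psi> y) ^ 6)" by (simp add: in_Lp_def power_even_abs)
    define D where "D n = (\<integral>y. (\<psi> y) ^ 6 * ((real (Suc n))\<^sup>2 * tail_weight (Suc n) y) \<partial>lborel)" for n
    have D: "D \<longlonglongrightarrow> 0" unfolding D_def using dct[OF i6] by simp
    have D_int: "integrable lborel (\<lambda>y. (\<psi> y) ^ 6 * ((real (Suc n))\<^sup>2 * tail_weight (Suc n) y))" for n
    proof (rule Bochner_Integration.integrable_bound[of _ "\<lambda>y. (\<psi> y) ^ 6 * 144"])
      show "AE y in lborel. norm ((\<psi> y) ^ 6 * ((real (Suc n))\<^sup>2 * tail_weight (Suc n) y)) \<le> norm ((\<psi> y) ^ 6 * 144)"
        using wle[of n] tail_weight_nonneg[of "Suc n"]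
        by (intro always_eventually allI) (simp add: abs_mult mult_left_mono del: of_nat_Suc)
    qed (use i6 in auto)
    define v where "v = unit_ball_vol (real DIM(real ^ 3))"
    have "v \<ge> 0" by (simp add: v_def)
    \<comment> \<open>1152 = 144 * 8, the 8 coming from \<open>(r + 1)^3 \<le> (2 r)^3\<close> in
      the volume of the ball. The second term is uniform in \<open>n\<close>.\<close>
    have bound: "(\<integral>y. (\<psi> y)\<^sup>2 * tail_weight (Suc n) y \<partial>lborel) \<le> l\<^sup>2 * D n + 1152 * v / l" if "l > 0" for l n
    proof -
      define r where "r = real (Suc n)"
      have r: "r \<ge> 1" by (simp add: r_def)
      let ?w = "\<lambda>y. r\<^sup>2 * tail_weight (Suc n) y"
      have wle': "?w y \<le> 144 * indicator (cball 0 (r + 1)) y" for y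
        using wle[of n y] by (cases "norm y \<le> r + 1") (auto simp: r_def tail_weight_def)
      have pt: "(\<psi> y)\<^sup>2 * tail_weight (Suc n) y \<le> l\<^sup>2 * ((\<psi> y) ^ 6 * ?w y) + 144 / (l * r ^ 3) * indicator (cball 0 (r + 1)) y" for y
      proof -
        have "(\<psi> y)\<^sup>2 * (1 / r)\<^sup>2 \<le> l\<^sup>2 * ((\<psi> y)\<^sup>2) ^ 3 + (1 / r) ^ 3 / l"
          using r \<open>l > 0\<close> by (intro weight_young) auto
        then have "(\<psi> y)\<^sup>2 * (1 / r)\<^sup>2 * ?w y \<le> (l\<^sup>2 * ((\<psi> y)\<^sup>2) ^ 3 + (1 / r) ^ 3 / l) * ?w y"
          using tail_weight_nonneg by (intro mult_right_mono) auto
        also have "\<dots> = l\<^sup>2 * ((\<psi> y) ^ 6 * ?w y) + (1 / r) ^ 3 / l * ?w y"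
          by (simp add: distrib_right power_mult[symmetric])
        also have "(1 / r) ^ 3 / l * ?w y \<le> (1 / r) ^ 3 / l * (144 * indicator (cball 0 (r + 1)) y)"
          using r \<open>l > 0\<close> by (intro mult_left_mono wle') auto
        also have "(\<psi> y)\<^sup>2 * (1 / r)\<^sup>2 * ?w y = (\<psi> y)\<^sup>2 * tail_weight (Suc n) y"
          using r by (simp add: field_simps)
        finally show ?thesis by (simp add: power_divide mult_ac)
      qed
      have ind: "integrable lborel (indicator (cball 0 (r + 1)) :: real ^ 3 \<Rightarrow> real)"
        using emeasure_lborel_cball_finite[of "0 :: real ^ 3"] by (intro integrable_real_indicator) (auto simp: top.not_eq_extremum)
      have "(\<integral>y. (\<psi> y)\<^sup>2 * tail_weight (Suc n) y \<partial>lborel)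
          \<le> (\<integral>y. l\<^sup>2 * ((\<psi> y) ^ 6 * ?w y) + 144 / (l * r ^ 3) * indicator (cball 0 (r + 1)) y \<partial>lborel)"
        using int[of "Suc n"] D_int[of n] ind pt
        by (intro integral_mono) (auto simp: r_def)
      also have "\<dots> = l\<^sup>2 * D n + 144 / (l * r ^ 3) * measure lborel (cball 0 (r + 1) :: (real ^ 3) set)"
        using D_int[of n] ind by (simp add: D_def r_def)
      also have "measure lborel (cball 0 (r + 1) :: (real ^ 3) set) = v * (r + 1) ^ 3"
        using content_cball[of "r + 1" "0 :: real ^ 3"] r by (simp add: v_def)
      also have "144 / (l * r ^ 3) * (v * (r + 1) ^ 3) \<le> 144 / (l * r ^ 3) * (v * (2 * r) ^ 3)"
        using r \<open>l > 0\<close> \<open>v \<ge> 0\<close> by (intro mult_left_mono power_mono) auto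
      also have "\<dots> = 1152 * v / l" using r by (simp add: field_simps power3_eq_cube)
      finally show ?thesis by simp
    qed
    show ?thesis
    proof (rule LIMSEQ_I)
      fix e :: real assume "e > 0"
      \<comment> \<open>Chosen first, so that the volume term is below \<open>e / 2\<close>; the
        summand 1 covers the possibility \<open>v = 0\<close>. Only then is \<open>n\<close> made
        large.\<close>
      define l where "l = (2304 * v + 1) / e"
      have "l > 0" using \<open>e > 0\<close> \<open>v \<ge> 0\<close> by (simp add: l_def)
      have "1152 * v / l < e / 2"
        using \<open>e > 0\<close> \<open>v \<ge> 0\<close> by (simp add: l_def field_simps)
      have "(\<lambda>n. l\<^sup>2 * D n) \<longlonglongrightarrow> l\<^sup>2 * 0" by (intro tendsto_intros D)
      then obtain N where N: "\<And>n. n \<ge> N \<Longrightarrow> \<bar>l\<^sup>2 * D n\<bar> < e / 2"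
        using LIMSEQ_D[of _ "l\<^sup>2 * 0" "e / 2"] \<open>e > 0\<close> by force
      have "norm ((\<integral>y. (\<psi> y)\<^sup>2 * tail_weight (Suc n) y \<partial>lborel) - 0) < e" if "n \<ge> N" for n
      proof -
        have "0 \<le> (\<integral>y. (\<psi> y)\<^sup>2 * tail_weight (Suc n) y \<partial>lborel)"
          by (rule Bochner_Integration.integral_nonneg) (simp add: tail_weight_nonneg)
        then show ?thesis
          using bound[OF \<open>l > 0\<close>, of n] N[OF that] \<open>1152 * v / l < e / 2\<close> by simp
      qed
      then show "\<exists>N. \<forall>n\<ge>N. norm ((\<integral>y. (\<psi> y)\<^sup>2 * tail_weight (Suc n) y \<partial>lborel) - 0) < e" by blast
    qed
  qed
  then show ?thesis by (rule LIMSEQ_imp_Suc)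
qed

lemma laplacian_convolution:
  assumes "locally_integrable \<psi>" "test_function \<rho>"
  shows "(\<Sum>i\<in>UNIV. convolution \<psi> (partial i (partial i \<rho>)) x)
    = (\<integral>y. \<psi> y * laplacian (\<lambda>y. \<rho> (x - y)) y \<partial>lborel)"
proof -
  have "(\<integral>y. \<psi> y * laplacian (\<lambda>y. \<rho> (x - y)) y \<partial>lborel)
      = (\<integral>y. (\<Sum>i\<in>UNIV. \<psi> y * partial i (partial i \<rho>) (x - y)) \<partial>lborel)"
    by (simp add: laplacian_reflect[OF assms(2)] laplacian_def sum_distrib_left)
  also have "\<dots> = (\<Sum>i\<in>UNIV. convolution \<psi> (partial i (partial i \<rho>)) x)"
    unfolding convolution_def using assms
    by (intro Bochner_Integration.integral_sum integrable_convolution test_function_partial)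
  finally show ?thesis by simp
qed

text \<open>With \<open>q\<close> the logarithmic gradient of a positive \<open>h\<close>, the
  hypothesis \<open>pos\<close> says that \<Delta>h / h < U, so \<open>h\<close> is a strict
  supersolution. Picone's identity for mollifications of \<psi> bounds a positively weighted
  integral of \<psi>^2 by a cutoff error and a mollification error, and both vanish in the limit. No
  regularity of \<psi> beyond integrability is used.\<close>

theorem positivity_criterion:
  fixes \<psi> U :: "real ^ 3 \<Rightarrow> real" and q q' :: "3 \<Rightarrow> real ^ 3 \<Rightarrow> real"
  assumes \<psi>: "in_Lp 2 \<psi> \<or> in_Lp 6 \<psi>" and U: "continuous_on UNIV U"
    and q: "\<And>i. continuous_on UNIV (q i)" "\<And>i. continuous_on UNIV (q' i)"
      "\<And>i x t. ((\<lambda>t. q i (x + t *\<^sub>R axis i 1)) has_real_derivative q' i (x + t *\<^sub>R axis i 1)) (at t)"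
    and pos: "\<And>x. (\<Sum>i\<in>UNIV. q' i x + (q i x)\<^sup>2) < U x"
    and weak: "\<And>\<eta>. test_function \<eta> \<Longrightarrow>
      (\<integral>x. \<psi> x * laplacian \<eta> x \<partial>lborel) = (\<integral>x. U x * \<psi> x * \<eta> x \<partial>lborel)"
  shows "ae_zero \<psi>"
proof -
  note L1 = Lp_2_6_locally_integrable(1)[OF \<psi>] and L2 = Lp_2_6_locally_integrable(2)[OF \<psi>]
  note Labs = locally_integrable_abs[OF L1]
  have weight_measurable:
    "(\<lambda>x :: real ^ 3. indicator (cball 0 r) x * (16 * (norm x)\<^sup>2 / c)) \<in> borel_measurable borel"
    "(\<lambda>x :: real ^ 3. c * indicator (cball 0 r) x :: real) \<in> borel_measurable borel" for r c :: real
  proof -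
    have [measurable]: "cball 0 r \<in> sets (borel :: (real ^ 3) measure)" by simp
    show "(\<lambda>x :: real ^ 3. indicator (cball 0 r) x * (16 * (norm x)\<^sup>2 / c)) \<in> borel_measurable borel"
      by measurable
    show "(\<lambda>x :: real ^ 3. c * indicator (cball 0 r) x :: real) \<in> borel_measurable borel"
      by measurable
  qed
  have [measurable]: "\<psi> \<in> borel_measurable borel" using locally_integrable_measurable[OF L1] .
  have [measurable]: "U \<in> borel_measurable borel" using U by (rule borel_measurable_continuous_onI)
  define K where "K x = U x - (\<Sum>i\<in>UNIV. q' i x + (q i x)\<^sup>2)" for x
  have K_pos: "K x > 0" for x using pos by (simp add: K_def)
  have K_cont: "continuous_on UNIV K" unfolding K_def by (intro continuous_intros U q)
  have [measurable]: "K \<in> borel_measurable borel" using K_cont by (rule borel_measurable_continuous_onI)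
  define \<epsilon> where "\<epsilon> n = inverse (real (Suc n))" for n
  have \<epsilon>: "\<epsilon> n > 0" "\<epsilon> n \<le> 1" for n by (auto simp: \<epsilon>_def field_simps)
  have \<epsilon>_lim: "\<epsilon> \<longlonglongrightarrow> 0" unfolding \<epsilon>_def by (rule LIMSEQ_inverse_real_of_nat)
  have "\<exists>\<rho>. mollifier (\<epsilon> n) \<rho>" for n using \<epsilon> by (intro mollifier_exists)
  then obtain \<rho> where \<rho>: "\<And>n. mollifier (\<epsilon> n) (\<rho> n)" by metis
  have t: "test_function (\<rho> n)" for n using \<rho> by (simp add: mollifier_def)
  note t1 = test_function_partial[OF t] and t2 = test_function_partial[OF test_function_partial[OF t]]
  note [measurable] = test_function_measurable[OF t] test_function_measurable[OF t1] test_function_measurable[OF t2]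
  define u where "u n = convolution \<psi> (\<rho> n)" for n
  define S where "S n = convolution (\<lambda>y. (\<psi> y)\<^sup>2) (\<rho> n)" for n
  have [measurable]: "u n \<in> borel_measurable borel" "S n \<in> borel_measurable borel" for n
    unfolding u_def S_def by measurable
  have lbu: "loc_bounded (u n)" "loc_bounded (S n)" for n
    unfolding u_def S_def by (intro convolution_loc_bounded L1 L2 t)+
  have u2: "(u n x)\<^sup>2 \<le> S n x" for n x
    unfolding u_def S_def by (rule convolution_square_le[OF \<rho> L1 L2])
  \<comment> \<open>Commutator error: mollification commutes with the Laplacian but not with
    multiplication by \<open>U\<close>. By uniform continuity of \<open>U\<close> it is small on
    each fixed ball.\<close>
  define e where "e n x = (\<Sum>i\<in>UNIV. convolution \<psi> (partial i (partial i (\<rho> n))) x) - U x * u n x" for n x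
  have [measurable]: "e n \<in> borel_measurable borel" for n unfolding e_def by measurable
  have lbe: "loc_bounded (e n)" for n
    unfolding e_def
    by (intro loc_bounded_diff loc_bounded_sum loc_bounded_mult convolution_loc_bounded L1 t2 lbu
        loc_bounded_continuous U)
  have UL: "locally_integrable (\<lambda>y. (U y - c) * \<psi> y)" for c
    using locally_integrable_mult_loc_bounded[OF L1, of "\<lambda>y. U y - c"]
    by (simp add: mult.commute loc_bounded_diff loc_bounded_continuous U loc_bounded_const)
  have e_eq: "e n x = convolution (\<lambda>y. (U y - U x) * \<psi> y) (\<rho> n) x" for n x
  proof -
    have "(\<Sum>i\<in>UNIV. convolution \<psi> (partial i (partial i (\<rho> n))) x)
        = (\<integral>y. U y * \<psi> y * \<rho> n (x - y) \<partial>lborel)"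
      unfolding laplacian_convolution[OF L1 t] by (intro weak test_function_reflect t)
    moreover have "(\<integral>y. (U y - U x) * \<psi> y * \<rho> n (x - y) \<partial>lborel)
        = (\<integral>y. U y * \<psi> y * \<rho> n (x - y) \<partial>lborel) - (\<integral>y. U x * (\<psi> y * \<rho> n (x - y)) \<partial>lborel)"
      using integrable_convolution[OF UL[of 0] t] integrable_convolution[OF L1 t]
      by (subst Bochner_Integration.integral_diff[symmetric]) (auto simp: algebra_simps)
    ultimately show ?thesis by (simp add: e_def u_def convolution_def)
  qed
  define A where "A n = (\<integral>y. (\<psi> y)\<^sup>2 * tail_weight n y \<partial>lborel)" for n
  have A_lim: "A \<longlonglongrightarrow> 0" unfolding A_def by (rule tail_integral_tendsto[OF \<psi>])
  \<comment> \<open>This local mass multiplies the commutator error. For \<psi> in L^6 it may grow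
    with \<open>n\<close>, so the admissible oscillation \<omega> of \<open>U\<close> has to depend
    on \<open>n\<close>.\<close>
  define B where "B n = (\<integral>y. (\<psi> y)\<^sup>2 * indicator (cball 0 (real n + 1)) y \<partial>lborel)" for n
  have B_nonneg: "B n \<ge> 0" for n unfolding B_def by (rule Bochner_Integration.integral_nonneg) simp

  \<comment> \<open>Order of limits: \<open>n\<close> and \<omega> are fixed while the mollification
    radius tends to 0. The term \<open>A n\<close> is the cutoff error.\<close>
  have energy: "eventually (\<lambda>j. (\<integral>x. (cutoff (real n) x)\<^sup>2 * (K x * (u j x)\<^sup>2) \<partial>lborel) \<le> A n + \<omega> * B n) sequentially"
    if n: "n > 0" and \<omega>: "\<omega> > 0" for n :: nat and \<omega> :: real
  proof -
    have n': "real n > 0" using n by simp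
    have "uniformly_continuous_on (cball 0 (real n + 1)) U"
      using U by (intro compact_uniformly_continuous) (auto intro: continuous_on_subset)
    then obtain d where "d > 0" and d: "\<And>x y. norm x \<le> real n + 1 \<Longrightarrow> norm y \<le> real n + 1 \<Longrightarrow> dist y x < d \<Longrightarrow> dist (U y) (U x) < \<omega>"
      unfolding uniformly_continuous_on_def using \<omega> by (metis mem_cball_0)
    have "eventually (\<lambda>j. \<epsilon> j < d) sequentially"
      using order_tendstoD(2)[OF \<epsilon>_lim \<open>d > 0\<close>] .
    then show ?thesis
    proof (rule eventually_mono)
      fix j assume j: "\<epsilon> j < d"
      have e_bound: "\<bar>u j x\<bar> * \<bar>e j x\<bar> \<le> \<omega> * S j x" if "norm x \<le> real n" for x
      proof -
        have a: "\<bar>u j x\<bar> \<le> convolution (\<lambda>y. \<bar>\<psi> y\<bar>) (\<rho> j) x"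
          unfolding u_def by (rule convolution_abs_le[OF \<rho> L1])
        have "\<bar>e j x\<bar> \<le> convolution (\<lambda>y. \<bar>(U y - U x) * \<psi> y\<bar>) (\<rho> j) x"
          unfolding e_eq by (rule convolution_abs_le[OF \<rho> UL])
        also have "\<dots> \<le> convolution (\<lambda>y. \<bar>\<omega> * \<psi> y\<bar>) (\<rho> j) x"
        proof (rule convolution_mono[OF \<rho>])
          fix y assume y: "norm (x - y) \<le> \<epsilon> j"
          have "norm y \<le> real n + 1"
            using y \<epsilon>(2)[of j] that norm_triangle_ineq2[of y x] by (simp add: norm_minus_commute)
          then have "\<bar>U y - U x\<bar> < \<omega>"
            using d[of x y] y j that by (simp add: dist_norm norm_minus_commute)
          then show "\<bar>(U y - U x) * \<psi> y\<bar> \<le> \<bar>\<omega> * \<psi> y\<bar>"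
            using \<omega> by (simp add: abs_mult mult_right_mono)
        qed (use locally_integrable_abs[OF UL] locally_integrable_abs[OF locally_integrable_mult_loc_bounded[OF L1, of "\<lambda>_. \<omega>"]]
            in \<open>auto simp: mult.commute loc_bounded_const\<close>)
        also have "\<dots> = \<omega> * convolution (\<lambda>y. \<bar>\<psi> y\<bar>) (\<rho> j) x"
          using \<omega> by (simp add: convolution_def abs_mult mult.assoc)
        finally have "\<bar>u j x\<bar> * \<bar>e j x\<bar> \<le> convolution (\<lambda>y. \<bar>\<psi> y\<bar>) (\<rho> j) x * (\<omega> * convolution (\<lambda>y. \<bar>\<psi> y\<bar>) (\<rho> j) x)"
          using a by (intro mult_mono) auto
        also have "\<dots> = \<omega> * (convolution (\<lambda>y. \<bar>\<psi> y\<bar>) (\<rho> j) x)\<^sup>2" by (simp add: power2_eq_square)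
        also have "\<dots> \<le> \<omega> * S j x"
          using convolution_square_le[OF \<rho> Labs, of j x] L2 \<omega> by (intro mult_left_mono) (auto simp: S_def)
        finally show ?thesis .
      qed
      note cc = cutoff_continuous[OF n']
      note lbc = loc_bounded_continuous[OF cc(1)] loc_bounded_continuous[OF cc(2)]
      have [measurable]: "cutoff (real n) \<in> borel_measurable borel" "\<And>i. cutoff_partial (real n) i \<in> borel_measurable borel"
        using cc by (auto intro: borel_measurable_continuous_onI)
      have "(\<integral>x. (cutoff (real n) x)\<^sup>2 * (K x * (u j x)\<^sup>2) \<partial>lborel)
        \<le> (\<integral>x. (u j x)\<^sup>2 * (\<Sum>i\<in>UNIV. (cutoff_partial (real n) i x)\<^sup>2) \<partial>lborel)
          + (\<integral>x. (cutoff (real n) x)\<^sup>2 * (\<bar>u j x\<bar> * \<bar>e j x\<bar>) \<partial>lborel)"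
        unfolding K_def e_def
      proof (rule picone_inequality[where R = "real n" and ?u1.0 = "\<lambda>i. convolution \<psi> (partial i (\<rho> j))"])
        show "q i \<in> borel_measurable borel" "q' i \<in> borel_measurable borel" for i
          using q by (auto intro: borel_measurable_continuous_onI)
        show "loc_bounded (q i)" "loc_bounded (q' i)" for i
          using q by (auto intro: loc_bounded_continuous)
        show "loc_bounded (convolution \<psi> (partial i (\<rho> j)))" for i
          by (intro convolution_loc_bounded L1 t1)
        show "loc_bounded (convolution \<psi> (partial i (partial i (\<rho> j))))" for i
          by (intro convolution_loc_bounded L1 t2)
        show "loc_bounded (cutoff (real n))" "loc_bounded (cutoff_partial (real n) i)" for i
          using cc by (auto intro: loc_bounded_continuous)
        show "((\<lambda>t. u j (x + t *\<^sub>R axis i 1)) has_real_derivative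
            convolution \<psi> (partial i (\<rho> j)) (x + t *\<^sub>R axis i 1)) (at t)" for i x t
          unfolding u_def by (rule convolution_DERIV[OF L1 t])
        show "((\<lambda>t. convolution \<psi> (partial i (\<rho> j)) (x + t *\<^sub>R axis i 1)) has_real_derivative
            convolution \<psi> (partial i (partial i (\<rho> j))) (x + t *\<^sub>R axis i 1)) (at t)" for i x t
          by (rule convolution_DERIV[OF L1 t1])
        show "((\<lambda>t. cutoff (real n) (x + t *\<^sub>R axis i 1)) has_real_derivative
            cutoff_partial (real n) i (x + t *\<^sub>R axis i 1)) (at t)" for i x t
          by (rule cutoff_DERIV[OF n'])
        show "cutoff (real n) x = 0" "cutoff_partial (real n) i x = 0" if "norm x > real n" for x i
          using cutoff_support[OF n' that] by auto
      qed (use lbu q(3) U loc_bounded_continuous in \<open>auto intro: loc_bounded_continuous\<close>)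
      also have "(\<integral>x. (u j x)\<^sup>2 * (\<Sum>i\<in>UNIV. (cutoff_partial (real n) i x)\<^sup>2) \<partial>lborel) \<le> A n"
      proof -
        define g where "g x = indicator (cball 0 (real n)) x * (16 * (norm x)\<^sup>2 / real n ^ 4)" for x :: "real ^ 3"
        have [measurable]: "g \<in> borel_measurable borel" unfolding g_def by (rule weight_measurable)
        have g_bound: "\<bar>g x\<bar> \<le> 16 * (real n)\<^sup>2 / real n ^ 4" for x
          by (auto simp: g_def indicator_def intro!: divide_right_mono power_mono)
        have g_supp: "g x = 0" if "norm x > real n" for x using that by (simp add: g_def)
        have g_lb: "loc_bounded g" by (rule loc_bounded_bounded[OF g_bound])
        have "(\<integral>x. (u j x)\<^sup>2 * (\<Sum>i\<in>UNIV. (cutoff_partial (real n) i x)\<^sup>2) \<partial>lborel) \<le> (\<integral>x. g x * S j x \<partial>lborel)"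
        proof (rule integral_mono)
          show "integrable lborel (\<lambda>x. (u j x)\<^sup>2 * (\<Sum>i\<in>UNIV. (cutoff_partial (real n) i x)\<^sup>2))"
            by (rule integrable_compact_support[where R = "real n"])
               (use lbu lbc cutoff_support[OF n'] in \<open>auto intro!: loc_bounded_mult loc_bounded_power loc_bounded_sum\<close>)
          show "integrable lborel (\<lambda>x. g x * S j x)"
            by (rule integrable_compact_support[where R = "real n"])
               (use lbu g_lb g_supp in \<open>auto intro!: loc_bounded_mult\<close>)
          fix x
          have "(\<Sum>i\<in>UNIV. (cutoff_partial (real n) i x)\<^sup>2) \<le> g x"
            using cutoff_bounds(3)[OF n', of x] cutoff_support[OF n', of x]
            by (cases "norm x \<le> real n") (auto simp: g_def)
          then have "(u j x)\<^sup>2 * (\<Sum>i\<in>UNIV. (cutoff_partial (real n) i x)\<^sup>2) \<le> S j x * g x"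
            by (intro mult_mono u2) (auto intro: sum_nonneg order_trans[OF _ u2])
          then show "(u j x)\<^sup>2 * (\<Sum>i\<in>UNIV. (cutoff_partial (real n) i x)\<^sup>2) \<le> g x * S j x" by (simp add: mult.commute)
        qed
        also have "\<dots> \<le> A n"
          unfolding S_def A_def
        proof (rule integral_convolution_le[OF \<rho> L2 _ _ g_bound, where R = "real n"])
          show "integrable lborel (\<lambda>y. (\<psi> y)\<^sup>2 * tail_weight n y)"
          proof (rule integrable_locally_integrable_mult[OF L2, where R = "real n + 1"])
            show "loc_bounded (tail_weight n)" using tail_weight_le[OF n] tail_weight_nonneg[of n]
              by (intro loc_bounded_bounded[of _ "144 / (real n)\<^sup>2"]) simp
          qed (auto simp: tail_weight_def)
          fix x y :: "real ^ 3" assume xy: "norm (x - y) \<le> \<epsilon> j"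
          have y: "norm x \<le> norm y + 1" "norm y \<le> norm x + 1"
            using xy \<epsilon>(2)[of j] norm_triangle_ineq2[of y x] norm_triangle_ineq2[of x y]
            by (simp_all add: norm_minus_commute)
          show "g x \<le> tail_weight n y"
          proof (cases "norm x \<le> real n")
            case True
            have "16 * (norm x)\<^sup>2 / real n ^ 4 \<le> 16 * (norm y + 1)\<^sup>2 / real n ^ 4"
              using y by (intro divide_right_mono mult_left_mono power_mono) auto
            then show ?thesis using True y by (simp add: g_def tail_weight_def)
          next
            case False
            then show ?thesis by (simp add: g_def tail_weight_nonneg)
          qed
        qed (auto simp: g_supp)
        finally show ?thesis .
      qed
      also have "(\<integral>x. (cutoff (real n) x)\<^sup>2 * (\<bar>u j x\<bar> * \<bar>e j x\<bar>) \<partial>lborel) \<le> \<omega> * B n"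
      proof -
        define g where "g x = \<omega> * indicator (cball 0 (real n)) x" for x :: "real ^ 3"
        have [measurable]: "g \<in> borel_measurable borel" unfolding g_def by (rule weight_measurable)
        have g_bound: "\<bar>g x\<bar> \<le> \<omega>" for x
          using \<omega> by (auto simp: g_def indicator_def)
        have g_supp: "g x = 0" if "norm x > real n" for x using that by (simp add: g_def)
        have g_lb: "loc_bounded g" by (rule loc_bounded_bounded[OF g_bound])
        have lb_abs: "loc_bounded (\<lambda>x. \<bar>f x\<bar>)" if "loc_bounded f" for f :: "real ^ 3 \<Rightarrow> real"
          using that by (simp add: loc_bounded_def)
        have "(\<integral>x. (cutoff (real n) x)\<^sup>2 * (\<bar>u j x\<bar> * \<bar>e j x\<bar>) \<partial>lborel) \<le> (\<integral>x. g x * S j x \<partial>lborel)"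
        proof (rule integral_mono)
          show "integrable lborel (\<lambda>x. (cutoff (real n) x)\<^sup>2 * (\<bar>u j x\<bar> * \<bar>e j x\<bar>))"
            by (rule integrable_compact_support[where R = "real n"])
               (use lbu lbe lbc cutoff_support[OF n'] in \<open>auto intro!: loc_bounded_mult loc_bounded_power lb_abs\<close>)
          show "integrable lborel (\<lambda>x. g x * S j x)"
            by (rule integrable_compact_support[where R = "real n"])
               (use lbu g_lb g_supp in \<open>auto intro!: loc_bounded_mult\<close>)
          fix x
          show "(cutoff (real n) x)\<^sup>2 * (\<bar>u j x\<bar> * \<bar>e j x\<bar>) \<le> g x * S j x"
          proof (cases "norm x \<le> real n")
            case True
            have "(cutoff (real n) x)\<^sup>2 \<le> 1" using cutoff_bounds[OF n', of x] by (simp add: power_le_one)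
            then have "(cutoff (real n) x)\<^sup>2 * (\<bar>u j x\<bar> * \<bar>e j x\<bar>) \<le> 1 * (\<bar>u j x\<bar> * \<bar>e j x\<bar>)"
              by (intro mult_right_mono) auto
            also have "\<dots> \<le> g x * S j x" using e_bound[OF True] True by (simp add: g_def)
            finally show ?thesis .
          next
            case False
            then show ?thesis using cutoff_support[OF n', of x] by (simp add: g_def)
          qed
        qed
        also have "\<dots> \<le> (\<integral>y. (\<psi> y)\<^sup>2 * (\<omega> * indicator (cball 0 (real n + 1)) y) \<partial>lborel)"
          unfolding S_def
        proof (rule integral_convolution_le[OF \<rho> L2 _ _ g_bound, where R = "real n"])
          show "integrable lborel (\<lambda>y. (\<psi> y)\<^sup>2 * (\<omega> * indicator (cball 0 (real n + 1)) y))"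
            by (rule integrable_locally_integrable_mult[OF L2 _ loc_bounded_bounded[of _ \<omega>], where R = "real n + 1"])
               (use \<omega> in \<open>auto simp: indicator_def\<close>)
          fix x y :: "real ^ 3" assume xy: "norm (x - y) \<le> \<epsilon> j"
          have y: "norm y \<le> norm x + 1"
            using xy \<epsilon>(2)[of j] norm_triangle_ineq2[of y x] by (simp add: norm_minus_commute)
          then show "g x \<le> \<omega> * indicator (cball 0 (real n + 1)) y"
            using \<omega> by (auto simp: g_def indicator_def)
        qed (auto simp: g_supp)
        also have "\<dots> = \<omega> * B n" by (simp add: B_def mult.left_commute[of _ \<omega>])
        finally show ?thesis .
      qed
      finally show "(\<integral>x. (cutoff (real n) x)\<^sup>2 * (K x * (u j x)\<^sup>2) \<partial>lborel) \<le> A n + \<omega> * B n" by simp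
    qed
  qed

  have "(\<integral>x. indicator (box a b) x * \<psi> x \<partial>lborel) = 0" for a b
  proof -
    define I where "I = (\<integral>x. indicator (box a b) x * \<psi> x \<partial>lborel)"
    obtain R0 where "R0 > 0" and R0: "\<And>x. x \<in> box a b \<Longrightarrow> norm x \<le> R0"
      using bounded_box[of a b] unfolding bounded_pos by blast
    have "\<exists>x\<in>cball 0 R0. \<forall>y\<in>cball 0 R0. K x \<le> K y"
      using \<open>R0 > 0\<close> by (intro continuous_attains_inf continuous_on_subset[OF K_cont]) auto
    then obtain x0 where x0: "x0 \<in> cball 0 R0" "\<And>x. x \<in> cball 0 R0 \<Longrightarrow> K x0 \<le> K x" by blast
    define k where "k = K x0"
    have "k > 0" using K_pos by (simp add: k_def)
    define v where "v = measure lborel (box a b)"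
    have ind: "integrable lborel (indicator (box a b) :: _ \<Rightarrow> real)"
      by (intro integrable_real_indicator)
         (use emeasure_lborel_box_finite[of a b] in \<open>auto simp: top.not_eq_extremum\<close>)
    have box_lb: "loc_bounded (indicator (box a b) :: _ \<Rightarrow> real)"
      by (rule loc_bounded_bounded[of _ 1]) (auto simp: indicator_def)
    have box_supp: "indicator (box a b) x = (0 :: real)" if "norm x > R0" for x
      using R0[of x] that by (auto simp: indicator_def)
    \<comment> \<open>The parameter \<open>l\<close> enters through
      \<open>\<bar>u\<bar> \<le> l / 2 * u^2 + 1 / (2 l)\<close>, in place of the Cauchy-Schwarz
      inequality. Since \<open>n\<close> is at least \<open>2 * R0\<close>, the box lies where the
      squared cutoff is at least 1/4.\<close>
    have bnd: "\<bar>I\<bar> \<le> 2 * l / k * (A n + 1 / real n) + v / (2 * l)" if l: "l > 0" and n: "n > 0" "real n \<ge> 2 * R0" for l :: real and n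
    proof -
      have n': "real n > 0" using n by simp
      \<comment> \<open>Makes \<open>\<omega> * B n\<close> at most \<open>1 / n\<close>; the
        \<open>+ 1\<close> keeps the denominator positive.\<close>
      define \<omega> where "\<omega> = 1 / (real n * (B n + 1))"
      have "\<omega> > 0" using n B_nonneg[of n] by (simp add: \<omega>_def)
      have "\<omega> * B n = 1 / real n * (B n / (B n + 1))" by (simp add: \<omega>_def)
      also have "\<dots> \<le> 1 / real n * 1"
        using B_nonneg[of n] by (intro mult_left_mono) auto
      finally have "\<omega> * B n \<le> 1 / real n" by simp
      have "eventually (\<lambda>j. \<bar>\<integral>x. indicator (box a b) x * u j x \<partial>lborel\<bar> \<le> 2 * l / k * (A n + 1 / real n) + v / (2 * l)) sequentially"
        using energy[OF n(1) \<open>\<omega> > 0\<close>]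
      proof (rule eventually_mono)
        fix j assume en: "(\<integral>x. (cutoff (real n) x)\<^sup>2 * (K x * (u j x)\<^sup>2) \<partial>lborel) \<le> A n + \<omega> * B n"
        have [measurable]: "cutoff (real n) \<in> borel_measurable borel"
          using cutoff_continuous[OF n'] by (auto intro: borel_measurable_continuous_onI)
        have i2: "integrable lborel (\<lambda>x. indicator (box a b) x * (u j x)\<^sup>2)"
          by (rule integrable_compact_support[where R = R0])
             (use lbu box_supp box_lb in \<open>auto intro!: loc_bounded_mult loc_bounded_power\<close>)
        have "k / 4 * (\<integral>x. indicator (box a b) x * (u j x)\<^sup>2 \<partial>lborel) = (\<integral>x. k / 4 * (indicator (box a b) x * (u j x)\<^sup>2) \<partial>lborel)"
          by simp
        also have "\<dots> \<le> (\<integral>x. (cutoff (real n) x)\<^sup>2 * (K x * (u j x)\<^sup>2) \<partial>lborel)"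
        proof (rule integral_mono)
          show "integrable lborel (\<lambda>x. k / 4 * (indicator (box a b) x * (u j x)\<^sup>2))" using i2 by simp
          show "integrable lborel (\<lambda>x. (cutoff (real n) x)\<^sup>2 * (K x * (u j x)\<^sup>2))"
            by (rule integrable_compact_support[where R = "real n"])
               (use lbu loc_bounded_continuous[OF cutoff_continuous(1)[OF n']] cutoff_support[OF n']
                loc_bounded_continuous[OF K_cont] in \<open>auto intro!: loc_bounded_mult loc_bounded_power\<close>)
          fix x
          show "k / 4 * (indicator (box a b) x * (u j x)\<^sup>2) \<le> (cutoff (real n) x)\<^sup>2 * (K x * (u j x)\<^sup>2)"
          proof (cases "x \<in> box a b")
            case True
            then have "norm x \<le> R0" by (rule R0)
            then have "1 / 4 * (k * (u j x)\<^sup>2) \<le> (cutoff (real n) x)\<^sup>2 * (K x * (u j x)\<^sup>2)"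
              using n x0(2)[of x] \<open>k > 0\<close> by (intro mult_mono cutoff_bounds(4)[OF n']) (auto simp: k_def)
            then show ?thesis using True by simp
          next
            case False
            then show ?thesis using less_imp_le[OF K_pos[of x]] by simp
          qed
        qed
        also have "\<dots> \<le> A n + 1 / real n" using en \<open>\<omega> * B n \<le> 1 / real n\<close> by simp
        finally have 1: "(\<integral>x. indicator (box a b) x * (u j x)\<^sup>2 \<partial>lborel) \<le> 4 / k * (A n + 1 / real n)"
          using \<open>k > 0\<close> by (simp add: field_simps)
        have "norm (\<integral>x. indicator (box a b) x * u j x \<partial>lborel) \<le> (\<integral>x. norm (indicator (box a b) x * u j x) \<partial>lborel)"
          by (rule integral_norm_bound)
        also have "\<dots> \<le> (\<integral>x. l / 2 * (indicator (box a b) x * (u j x)\<^sup>2) + 1 / (2 * l) * indicator (box a b) x \<partial>lborel)"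
        proof (rule integral_mono)
          show "integrable lborel (\<lambda>x. norm (indicator (box a b) x * u j x))"
            by (intro integrable_norm integrable_compact_support[where R = R0])
               (use lbu box_supp box_lb in \<open>auto intro!: loc_bounded_mult\<close>)
          show "integrable lborel (\<lambda>x. l / 2 * (indicator (box a b) x * (u j x)\<^sup>2) + 1 / (2 * l) * indicator (box a b) x)"
            using i2 ind by simp
          fix x
          have "\<bar>u j x\<bar> \<le> l / 2 * (u j x)\<^sup>2 + 1 / (2 * l)"
          proof -
            have "0 \<le> (l * \<bar>u j x\<bar> - 1)\<^sup>2" by simp
            then have "2 * l * \<bar>u j x\<bar> \<le> l\<^sup>2 * (u j x)\<^sup>2 + 1"
              by (simp add: power2_eq_square algebra_simps)
            then show ?thesis using l by (simp add: field_simps power2_eq_square)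
          qed
          then show "norm (indicator (box a b) x * u j x) \<le> l / 2 * (indicator (box a b) x * (u j x)\<^sup>2) + 1 / (2 * l) * indicator (box a b) x"
            by (auto simp: indicator_def)
        qed
        also have "\<dots> = l / 2 * (\<integral>x. indicator (box a b) x * (u j x)\<^sup>2 \<partial>lborel) + 1 / (2 * l) * v"
          using i2 ind by (simp add: v_def)
        also have "\<dots> \<le> l / 2 * (4 / k * (A n + 1 / real n)) + 1 / (2 * l) * v"
          using 1 l by (intro add_right_mono mult_left_mono) auto
        also have "l / 2 * (4 / k * (A n + 1 / real n)) + 1 / (2 * l) * v = 2 * l / k * (A n + 1 / real n) + v / (2 * l)"
        proof -
          have "l / 2 * (4 / k * X) + 1 / (2 * l) * v = 2 * l / k * X + v / (2 * l)" for X by simp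
          then show ?thesis .
        qed
        finally show "\<bar>\<integral>x. indicator (box a b) x * u j x \<partial>lborel\<bar> \<le> 2 * l / k * (A n + 1 / real n) + v / (2 * l)"
          unfolding real_norm_def .
      qed
      moreover have "(\<lambda>j. \<bar>\<integral>x. indicator (box a b) x * u j x \<partial>lborel\<bar>) \<longlonglongrightarrow> \<bar>I\<bar>"
        unfolding u_def I_def by (intro tendsto_rabs integral_convolution_box_tendsto[OF L1 \<rho> \<epsilon>_lim])
      ultimately show ?thesis
        using tendsto_upperbound trivial_limit_sequentially by blast
    qed
    have "\<bar>I\<bar> \<le> v / (2 * l)" if l: "l > 0" for l
    proof -
      have "(\<lambda>n. 2 * l / k * (A n + 1 / real n) + v / (2 * l)) \<longlonglongrightarrow> 2 * l / k * (0 + 0) + v / (2 * l)"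
        by (intro tendsto_intros A_lim lim_1_over_n)
      moreover have "\<exists>N. \<forall>n\<ge>N. \<bar>I\<bar> \<le> 2 * l / k * (A n + 1 / real n) + v / (2 * l)"
      proof -
        obtain N :: nat where N: "real N \<ge> 2 * R0" using real_arch_simple by blast
        then have "N > 0" using \<open>R0 > 0\<close> by (cases N) auto
        have "\<bar>I\<bar> \<le> 2 * l / k * (A n + 1 / real n) + v / (2 * l)" if "n \<ge> N" for n
          using that N \<open>N > 0\<close> by (intro bnd l) (auto intro: order_trans)
        then show ?thesis by blast
      qed
      ultimately show ?thesis using LIMSEQ_le_const by fastforce
    qed
    note * = this
    show "I = 0"
    proof (rule ccontr)
      assume "I \<noteq> 0"
      moreover have "v \<ge> 0" by (simp add: v_def)
      \<comment> \<open>For this \<open>l\<close> the bound reads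
        \<open>\<bar>I\<bar> * v / (v + 1)\<close>, which is less than
        \<open>\<bar>I\<bar>\<close>.\<close>
      ultimately have "(v + 1) / (2 * \<bar>I\<bar>) > 0" by simp
      from *[OF this] show False using \<open>I \<noteq> 0\<close> \<open>v \<ge> 0\<close> by (simp add: field_simps)
    qed
  qed
  then show ?thesis unfolding ae_zero_def by (rule AE_zero_of_box_integrals[OF L1])
qed

section \<open>Monotone iteration on the half-line\<close>

lemma exp_mult_set_integral:
  assumes "m > 0"
  shows "set_integrable lborel {..r} (\<lambda>s. exp (m * s) :: real)"
    and "(LINT s:{..r}|lborel. exp (m * s)) = exp (m * r) / m"
proof -
  have "(\<integral>\<^sup>+x. ennreal (exp (- m * x)) * indicator {- r ..} x \<partial>lborel) = 0 - (- exp (- m * (- r)) / m)"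
  proof (rule nn_integral_FTC_atLeast)
    show "DERIV (\<lambda>x. - exp (- m * x) / m) x :> exp (- m * x)" for x
      using assms by (auto intro!: derivative_eq_intros)
    have "((\<lambda>x. - (exp (- (m * x)) / m)) \<longlongrightarrow> - (0 / m)) at_top"
      by (intro tendsto_intros filterlim_compose[OF exp_at_bot] filterlim_uminus_at_bot_at_top[THEN filterlim_compose]
          filterlim_tendsto_pos_mult_at_top[OF tendsto_const assms] filterlim_ident)
         (use assms in auto)
    then show "((\<lambda>x. - exp (- m * x) / m) \<longlongrightarrow> 0) at_top" by simp
  qed auto
  moreover have "(\<integral>\<^sup>+x. ennreal (exp (m * x)) * indicator {..r} x \<partial>lborel)
      = (\<integral>\<^sup>+x. ennreal (exp (- m * x)) * indicator {- r ..} x \<partial>lborel)"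
    by (subst nn_integral_real_affine[where c = "- 1" and t = 0])
       (auto intro!: nn_integral_cong simp: indicator_def)
  ultimately have n: "(\<integral>\<^sup>+x. ennreal (indicator {..r} x * exp (m * x)) \<partial>lborel) = ennreal (exp (m * r) / m)"
    by (simp add: ennreal_mult' ennreal_indicator mult.commute)
  show "set_integrable lborel {..r} (\<lambda>s. exp (m * s) :: real)"
    unfolding set_integrable_def real_scaleR_def
    by (rule integrableI_nn_integral_finite[OF _ _ n]) auto
  show "(LINT s:{..r}|lborel. exp (m * s)) = exp (m * r) / m"
    unfolding set_lebesgue_integral_def real_scaleR_def
    using assms by (subst integral_eq_nn_integral) (auto simp: n)
qed

text \<open>The ingredient of variation of constants. The exponential is integrated from minus
  infinity, where it decays, so bounded \<open>F\<close> suffices.\<close>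

definition exp_integral :: "real \<Rightarrow> (real \<Rightarrow> real) \<Rightarrow> real \<Rightarrow> real"
  where "exp_integral m F r = (LINT s:{..r}|lborel. exp (m * s) * F s)"

lemma exp_integral_bound:
  assumes m: "m > 0" and [measurable]: "F \<in> borel_measurable borel" and C: "\<And>s. \<bar>F s\<bar> \<le> C"
  shows "set_integrable lborel {..r} (\<lambda>s. exp (m * s) * F s)"
    and "\<bar>exp_integral m F r\<bar> \<le> C * (exp (m * r) / m)"
proof -
  have le: "\<bar>exp (m * s) * F s\<bar> \<le> C * exp (m * s)" for s
    using mult_right_mono[OF C[of s], of "exp (m * s)"] by (simp add: abs_mult mult.commute)
  have i: "set_integrable lborel {..r} (\<lambda>s. C * exp (m * s))"
    using exp_mult_set_integral(1)[OF m] by simp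
  show int: "set_integrable lborel {..r} (\<lambda>s. exp (m * s) * F s)"
  proof (rule set_integrable_bound[OF i])
    show "set_borel_measurable lborel {..r} (\<lambda>s. exp (m * s) * F s)"
      unfolding set_borel_measurable_def by measurable
    show "AE s in lborel. s \<in> {..r} \<longrightarrow> norm (exp (m * s) * F s) \<le> norm (C * exp (m * s))"
    proof (intro always_eventually allI impI)
      fix s show "norm (exp (m * s) * F s) \<le> norm (C * exp (m * s))"
        using le[of s] by simp
    qed
  qed
  have "norm (exp_integral m F r) \<le> (LINT s:{..r}|lborel. norm (exp (m * s) * F s))"
    unfolding exp_integral_def by (rule set_integral_norm_bound[OF int])
  also have "\<dots> \<le> (LINT s:{..r}|lborel. C * exp (m * s))"
    using le by (intro set_integral_mono set_integrable_norm[OF int] i) auto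
  also have "\<dots> = C * (exp (m * r) / m)" using exp_mult_set_integral(2)[OF m] by simp
  finally show "\<bar>exp_integral m F r\<bar> \<le> C * (exp (m * r) / m)" by simp
qed

lemma exp_integral_diff:
  assumes m: "m > 0" and [measurable]: "F \<in> borel_measurable borel" and C: "\<And>s. \<bar>F s\<bar> \<le> C" and "a \<le> r"
  shows "set_integrable lborel {a..r} (\<lambda>s. exp (m * s) * F s)"
    and "exp_integral m F r = exp_integral m F a + (LINT s:{a..r}|lborel. exp (m * s) * F s)"
proof -
  note int = exp_integral_bound(1)[OF assms(1-3)]
  show i: "set_integrable lborel {a..r} (\<lambda>s. exp (m * s) * F s)"
    by (rule set_integrable_subset[OF int[of r]]) auto
  have "{..r} = {..a} \<union> {a..r}" using \<open>a \<le> r\<close> by auto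
  then show "exp_integral m F r = exp_integral m F a + (LINT s:{a..r}|lborel. exp (m * s) * F s)"
    unfolding exp_integral_def
  proof (simp only:, intro set_integral_Un_AE int i)
    show "AE x in lborel. \<not> (x \<in> {..a} \<and> x \<in> {a..r})"
      using AE_lborel_singleton[of a] by eventually_elim auto
  qed auto
qed

lemma exp_integral_continuous:
  assumes m: "m > 0" and [measurable]: "F \<in> borel_measurable borel" and C: "\<And>s. \<bar>F s\<bar> \<le> C"
  shows "continuous_on UNIV (exp_integral m F)"
proof (rule continuous_at_imp_continuous_on, rule ballI)
  fix x :: real
  define a where "a = x - 1"
  let ?f = "\<lambda>s. exp (m * s) * F s"
  have "continuous_on {a..x + 1} (\<lambda>r. integral {a..r} ?f)"
    using set_borel_integral_eq_integral(1)[OF exp_integral_diff(1)[OF assms, of a "x + 1"]]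
    by (intro indefinite_integral_continuous_1) (simp add: a_def)
  then have "continuous_on {a..x + 1} (\<lambda>r. exp_integral m F a + integral {a..r} ?f)"
    by (intro continuous_intros)
  moreover have "exp_integral m F r = exp_integral m F a + integral {a..r} ?f" if "r \<in> {a..x + 1}" for r
    using exp_integral_diff[OF assms, of a r] that by (simp add: set_borel_integral_eq_integral(2))
  ultimately have "continuous_on {a..x + 1} (exp_integral m F)"
    by (rule continuous_on_eq[OF _ sym])
  then show "isCont (exp_integral m F) x"
    by (rule continuous_on_interior) (simp add: a_def)
qed

lemma exp_integral_DERIV:
  assumes m: "m > 0" and F: "continuous_on UNIV F" and C: "\<And>s. \<bar>F s\<bar> \<le> C"
  shows "(exp_integral m F has_real_derivative exp (m * x) * F x) (at x)"
proof -
  have Fm: "F \<in> borel_measurable borel" using F by (rule borel_measurable_continuous_onI)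
  define a where "a = x - 1"
  let ?f = "\<lambda>s. exp (m * s) * F s"
  have "((\<lambda>r. integral {a..r} ?f) has_real_derivative ?f x) (at x within {a..x + 1})"
    by (rule integral_has_real_derivative)
       (auto simp: a_def intro!: continuous_intros continuous_on_subset[OF F])
  then have "((\<lambda>r. integral {a..r} ?f) has_real_derivative ?f x) (at x)"
    using at_within_interior[of x "{a..x + 1}"] by (simp add: a_def)
  then have "((\<lambda>r. exp_integral m F a + integral {a..r} ?f) has_real_derivative ?f x) (at x)"
    by (auto intro!: derivative_eq_intros)
  then show ?thesis
  proof (rule has_field_derivative_transform_within_open[where S = "{a<..<x + 1}"])
    show "exp_integral m F a + integral {a..r} ?f = exp_integral m F r" if "r \<in> {a<..<x + 1}" for r
      using exp_integral_diff[OF m Fm C, where a = a and r = r] that by (simp add: set_borel_integral_eq_integral(2))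
  qed (auto simp: a_def)
qed

lemma exp_integral_tendsto:
  assumes m: "m > 0" and [measurable]: "\<And>n. F n \<in> borel_measurable borel" "G \<in> borel_measurable borel"
    and C: "\<And>n s. \<bar>F n s\<bar> \<le> C" and lim: "\<And>s. (\<lambda>n. F n s) \<longlonglongrightarrow> G s"
  shows "(\<lambda>n. exp_integral m (F n) r) \<longlonglongrightarrow> exp_integral m G r"
  unfolding exp_integral_def set_lebesgue_integral_def
proof (rule integral_dominated_convergence)
  show "integrable lborel (\<lambda>s. C * (indicator {..r} s *\<^sub>R exp (m * s)))"
    using exp_mult_set_integral(1)[OF m, of r] unfolding set_integrable_def by auto
  show "AE s in lborel. (\<lambda>n. indicator {..r} s *\<^sub>R (exp (m * s) * F n s)) \<longlonglongrightarrow> indicator {..r} s *\<^sub>R (exp (m * s) * G s)"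
    by (intro always_eventually allI tendsto_intros lim)
  show "AE s in lborel. norm (indicator {..r} s *\<^sub>R (exp (m * s) * F n s)) \<le> C * (indicator {..r} s *\<^sub>R exp (m * s))" for n
  proof (intro always_eventually allI)
    fix s
    have "exp (m * s) * \<bar>F n s\<bar> \<le> exp (m * s) * C" by (intro mult_left_mono C) auto
    then show "norm (indicator {..r} s *\<^sub>R (exp (m * s) * F n s)) \<le> C * (indicator {..r} s *\<^sub>R exp (m * s))"
      by (auto simp: indicator_def abs_mult mult.commute)
  qed
qed auto

text \<open>For odd \<open>F\<close> this is the odd bounded solution of \<open>- w'' + m\<^sup>2 w = F\<close>.\<close>

definition resolvent :: "real \<Rightarrow> (real \<Rightarrow> real) \<Rightarrow> real \<Rightarrow> real"
  where "resolvent m F r = (exp (- m * r) * exp_integral m F r - exp (m * r) * exp_integral m F (- r)) / (2 * m)"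

definition resolvent_deriv :: "real \<Rightarrow> (real \<Rightarrow> real) \<Rightarrow> real \<Rightarrow> real"
  where "resolvent_deriv m F r = - (exp (- m * r) * exp_integral m F r + exp (m * r) * exp_integral m F (- r)) / 2"

lemma resolvent_odd: "resolvent m F (- r) = - resolvent m F r"
  by (simp add: resolvent_def minus_divide_left mult.commute)

lemma resolvent_bound:
  assumes m: "m > 0" and F: "F \<in> borel_measurable borel" and C: "\<And>s. \<bar>F s\<bar> \<le> C"
  shows "\<bar>resolvent m F r\<bar> \<le> C / m\<^sup>2"
proof -
  have *: "\<bar>exp (- m * r) * exp_integral m F r\<bar> \<le> C / m" for r
  proof -
    have "exp (- m * r) * \<bar>exp_integral m F r\<bar> \<le> exp (- m * r) * (C * (exp (m * r) / m))"
      by (intro mult_left_mono exp_integral_bound(2)[OF assms]) auto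
    also have "\<dots> = C / m * (exp (- m * r) * exp (m * r))" by simp
    also have "\<dots> = C / m" by (simp flip: exp_add)
    finally show ?thesis by (simp add: abs_mult)
  qed
  have "\<bar>exp (- m * r) * exp_integral m F r - exp (m * r) * exp_integral m F (- r)\<bar> \<le> C / m + C / m"
    using *[of r] *[of "- r"] by simp
  then have "\<bar>exp (- m * r) * exp_integral m F r - exp (m * r) * exp_integral m F (- r)\<bar> / (2 * m)
      \<le> (C / m + C / m) / (2 * m)"
    using m by (intro divide_right_mono) auto
  then have "\<bar>resolvent m F r\<bar> \<le> (C / m + C / m) / (2 * m)"
    unfolding resolvent_def using m by (simp only: abs_divide abs_mult abs_of_pos abs_numeral)
  also have "\<dots> = C / m\<^sup>2" using m by (simp add: field_simps power2_eq_square)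
  finally show ?thesis .
qed

lemma resolvent_continuous:
  assumes "m > 0" "F \<in> borel_measurable borel" "\<And>s. \<bar>F s\<bar> \<le> C"
  shows "continuous_on UNIV (resolvent m F)"
  unfolding resolvent_def using assms(1)
  by (auto intro!: continuous_intros exp_integral_continuous[OF assms]
      continuous_on_compose2[OF exp_integral_continuous[OF assms]])

text \<open>For odd \<open>F\<close> the value \<open>- exp_integral m F (- r)\<close> is the
  integral of \<open>exp (- m s) * F s\<close> over \<open>s \<ge> r\<close>. Thus
  \<open>resolvent\<close> is convolution with the Green kernel
  \<open>exp (- m \<bar>r - s\<bar>) / (2 m)\<close>, and the boundary terms of the two halves
  cancel in the first derivative.\<close>

lemma resolvent_DERIV:
  assumes m: "m > 0" and F: "continuous_on UNIV F" and C: "\<And>s. \<bar>F s\<bar> \<le> C" and odd: "\<And>s. F (- s) = - F s"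
  shows "(resolvent m F has_real_derivative resolvent_deriv m F r) (at r)"
    and "(resolvent_deriv m F has_real_derivative m\<^sup>2 * resolvent m F r - F r) (at r)"
proof -
  note d = exp_integral_DERIV[OF m F C]
  have d1: "(exp_integral m F has_real_derivative exp (m * r) * F r) (at r)" by (rule d)
  have d2: "((\<lambda>r. exp_integral m F (- r)) has_real_derivative exp (- m * r) * F r) (at r)"
    using DERIV_chain2[where f = "exp_integral m F" and g = uminus and x = r, OF d DERIV_minus[OF DERIV_ident]]
    by (simp add: odd)
  have d3: "((\<lambda>r. exp (- m * r)) has_real_derivative - m * exp (- m * r)) (at r)"
    by (auto intro!: derivative_eq_intros)
  have d4: "((\<lambda>r. exp (m * r)) has_real_derivative m * exp (m * r)) (at r)"
    by (auto intro!: derivative_eq_intros)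
  have e: "exp (- m * r) * exp (m * r) = 1" by (simp flip: exp_add)
  define E where "E = exp (m * r)"
  define E' where "E' = exp (- m * r)"
  have e: "E' * E = 1" by (simp add: E_def E'_def flip: exp_add)
  define A where "A = exp_integral m F r"
  define A' where "A' = exp_integral m F (- r)"
  have "(resolvent m F has_real_derivative
      ((- m * E' * A + E * F r * E') - (m * E * A' + E' * F r * E)) / (2 * m)) (at r)"
    unfolding resolvent_def E_def E'_def A_def A'_def
    by (rule DERIV_cdivide DERIV_diff DERIV_mult d1 d2 d3 d4)+
  moreover have "((- m * E' * A + E * F r * E') - (m * E * A' + E' * F r * E)) / (2 * m) = resolvent_deriv m F r"
    using m by (simp add: resolvent_deriv_def E_def E'_def A_def A'_def field_simps)
  ultimately show "(resolvent m F has_real_derivative resolvent_deriv m F r) (at r)" by simp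
  have "(resolvent_deriv m F has_real_derivative
      - ((- m * E' * A + E * F r * E') + (m * E * A' + E' * F r * E)) / 2) (at r)"
    unfolding resolvent_deriv_def E_def E'_def A_def A'_def
    by (rule DERIV_cdivide DERIV_minus DERIV_add DERIV_mult d1 d2 d3 d4)+
  moreover have "- ((- m * E' * A + E * F r * E') + (m * E * A' + E' * F r * E)) / 2 = m\<^sup>2 * resolvent m F r - F r"
  proof -
    have "- ((- m * E' * A + E * F r * E') + (m * E * A' + E' * F r * E)) / 2
        = m * (E' * A - E * A') / 2 - (E' * E) * F r" by (simp add: field_simps)
    also have "\<dots> = m * (E' * A - E * A') / 2 - F r" by (simp add: e)
    also have "\<dots> = m\<^sup>2 * resolvent m F r - F r"
      using m by (simp add: resolvent_def E_def E'_def A_def A'_def power2_eq_square)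
    finally show ?thesis .
  qed
  ultimately show "(resolvent_deriv m F has_real_derivative m\<^sup>2 * resolvent m F r - F r) (at r)"
    by (rule DERIV_cong)
qed

text \<open>The operator factors: \<open>p s = exp (- m s) (v' s + m v s)\<close> is nonincreasing.
  A negative value of \<open>v\<close> forces \<open>p < 0\<close> at an earlier point, by the mean
  value theorem for \<open>exp (m s) * v s\<close>, which starts at 0. From there on
  \<open>p\<close> stays below a negative constant, and \<open>v\<close> falls exponentially,
  against boundedness.\<close>

lemma half_line_maximum_principle:
  fixes v v' v'' :: "real \<Rightarrow> real"
  assumes m: "m > 0" and d: "\<And>r. (v has_real_derivative v' r) (at r)" "\<And>r. (v' has_real_derivative v'' r) (at r)"
    and v0: "v 0 = 0" and bdd: "\<And>r. r > 0 \<Longrightarrow> \<bar>v r\<bar> \<le> M" and le: "\<And>r. r > 0 \<Longrightarrow> v'' r \<le> m\<^sup>2 * v r"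
    and "r > 0"
  shows "v r \<ge> 0"
proof (rule ccontr)
  assume neg: "\<not> v r \<ge> 0"
  define p where "p s = exp (- m * s) * (v' s + m * v s)" for s
  define g where "g s = exp (m * s) * v s" for s
  have dp: "(p has_real_derivative exp (- m * s) * (v'' s - m\<^sup>2 * v s)) (at s)" for s
    unfolding p_def by (rule derivative_eq_intros d refl)+ (simp add: algebra_simps power2_eq_square)
  have ee: "exp (2 * m * s) * exp (- m * s) = exp (m * s)" for s
    by (simp flip: exp_add)
  have dg: "(g has_real_derivative exp (2 * m * s) * p s) (at s)" for s
  proof -
    have "(g has_real_derivative exp (m * s) * (v' s + m * v s)) (at s)"
      unfolding g_def by (rule derivative_eq_intros d refl)+ (simp add: algebra_simps)
    then show ?thesis unfolding p_def mult.assoc[symmetric] ee .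
  qed
  have p_mono: "p t \<le> p s" if "0 < s" "s \<le> t" for s t
  proof (rule DERIV_nonpos_imp_nonincreasing[OF \<open>s \<le> t\<close>])
    fix x assume "s \<le> x"
    with that have "v'' x - m\<^sup>2 * v x \<le> 0" using le[of x] by simp
    then have "exp (- m * x) * (v'' x - m\<^sup>2 * v x) \<le> 0" by (simp add: mult_le_0_iff)
    then show "\<exists>y. (p has_real_derivative y) (at x) \<and> y \<le> 0" using dp by blast
  qed
  obtain \<xi> where \<xi>: "0 < \<xi>" "\<xi> < r" "g r - g 0 = (r - 0) * (exp (2 * m * \<xi>) * p \<xi>)"
    using MVT2[OF \<open>r > 0\<close> dg] by blast
  have "g r < 0" using neg by (simp add: g_def mult_less_0_iff)
  then have "r * (exp (2 * m * \<xi>) * p \<xi>) < 0" using \<xi>(3) v0 by (simp add: g_def)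
  then have "p \<xi> < 0" using \<open>r > 0\<close> by (simp add: mult_less_0_iff zero_less_mult_iff)
  define c where "c = - p \<xi>"
  have c: "c > 0" using \<open>p \<xi> < 0\<close> by (simp add: c_def)
  have grow: "g s \<le> - c * (exp (2 * m * s) - exp (2 * m * r)) / (2 * m)" if "s \<ge> r" for s
  proof -
    define k where "k s = g s + c * exp (2 * m * s) / (2 * m)" for s
    have "k s \<le> k r"
    proof (rule DERIV_nonpos_imp_nonincreasing[OF that])
      fix x assume "r \<le> x"
      have "(k has_real_derivative exp (2 * m * x) * p x + c * exp (2 * m * x)) (at x)"
        unfolding k_def using m by (auto intro!: derivative_eq_intros dg)
      moreover have "p x \<le> - c" using p_mono[of \<xi> x] \<xi> \<open>r \<le> x\<close> by (simp add: c_def)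
      then have "exp (2 * m * x) * (p x + c) \<le> 0" by (simp add: mult_le_0_iff)
      ultimately show "\<exists>y. (k has_real_derivative y) (at x) \<and> y \<le> 0"
        by (auto simp: algebra_simps)
    qed
    then have "g s \<le> g r + c * exp (2 * m * r) / (2 * m) - c * exp (2 * m * s) / (2 * m)" by (simp add: k_def)
    also have "\<dots> = g r + - c * (exp (2 * m * s) - exp (2 * m * r)) / (2 * m)"
      using m by (simp add: field_simps)
    finally show ?thesis using \<open>g r < 0\<close> by simp
  qed
  \<comment> \<open>The summand \<open>2 * r\<close> gives
    \<open>exp (2 m r) \<le> exp (m s)\<close>; the other makes \<open>c * s / 2\<close> exceed
    \<open>\<bar>M\<bar>\<close>.\<close>
  define s where "s = 2 * r + 2 * (\<bar>M\<bar> + 1) / c"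
  have s: "s \<ge> 2 * r" "s > 0" "s \<ge> r" using c \<open>r > 0\<close> by (auto simp: s_def intro: add_pos_nonneg)
  have "exp (m * s) * v s \<le> - c * (exp (2 * m * s) - exp (2 * m * r)) / (2 * m)"
    using grow[OF \<open>s \<ge> r\<close>] by (simp add: g_def)
  moreover have "exp (2 * m * s) = exp (m * s) * exp (m * s)" by (simp flip: exp_add)
  moreover have "exp (2 * m * r) \<le> exp (m * s)" using m s by (simp add: mult.assoc)
  ultimately have "exp (m * s) * v s \<le> - c * (exp (m * s) * exp (m * s) - exp (m * s)) / (2 * m)"
    using c m by (smt (verit) divide_right_mono mult_minus_left mult_left_mono)
  also have "\<dots> = exp (m * s) * (- c * (exp (m * s) - 1) / (2 * m))" by (simp add: algebra_simps diff_divide_distrib)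
  finally have "v s \<le> - c * (exp (m * s) - 1) / (2 * m)"
    by (simp only: mult_le_cancel_left_pos exp_gt_zero)
  also have "\<dots> \<le> - c * (m * s) / (2 * m)"
  proof -
    have "m * s \<le> exp (m * s) - 1" using exp_ge_add_one_self[of "m * s"] by linarith
    then show ?thesis using c m by (intro divide_right_mono mult_left_mono_neg) auto
  qed
  also have "\<dots> = - (c * s / 2)" using m by simp
  also have "\<dots> < - \<bar>M\<bar>"
  proof -
    have "c * s / 2 = c * r + (\<bar>M\<bar> + 1)" using c by (simp add: s_def field_simps)
    moreover have "c * r > 0" using c \<open>r > 0\<close> by simp
    ultimately show ?thesis by linarith
  qed
  finally show False using bdd[OF \<open>s > 0\<close>] by linarith
qed

text \<open>\<open>p\<close> is the right-hand side of \<open>- w'' + m^2 w = p r w\<close>. Oddness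
  on the whole line encodes \<open>w 0 = 0\<close>, that is, regularity of \<open>w r / r\<close> at
  the origin. The intended \<open>p\<close> is singular at \<open>r = 0\<close>; the slope bound
  \<open>L\<close> tames it, and \<open>p_cont2\<close> therefore asks for continuity only along
  functions below \<open>L * \<bar>r\<bar>\<close>.\<close>

locale sub_super_solution =
  fixes m C L M :: real and p :: "real \<Rightarrow> real \<Rightarrow> real" and a a' a'' b b' b'' :: "real \<Rightarrow> real"
  assumes m: "m > 0"
    and odd_ab: "\<And>r. a (- r) = - a r" "\<And>r. b (- r) = - b r"
    and deriv_a: "\<And>r. (a has_real_derivative a' r) (at r)" "\<And>r. (a' has_real_derivative a'' r) (at r)"
    and deriv_b: "\<And>r. (b has_real_derivative b' r) (at r)" "\<And>r. (b' has_real_derivative b'' r) (at r)"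
    and bound_ab: "\<And>r. \<bar>a r\<bar> \<le> M" "\<And>r. \<bar>b r\<bar> \<le> M"
      "\<And>r. r > 0 \<Longrightarrow> - L * r \<le> a r" "\<And>r. r > 0 \<Longrightarrow> b r \<le> L * r"
    and a_le_b: "\<And>r. r > 0 \<Longrightarrow> a r \<le> b r"
    and p_odd: "\<And>r x. p (- r) (- x) = - p r x"
    and p_cont: "\<And>r. continuous_on UNIV (p r)"
    and p_cont2: "\<And>w. continuous_on UNIV w \<Longrightarrow> (\<And>r. \<bar>w r\<bar> \<le> L * \<bar>r\<bar>) \<Longrightarrow> continuous_on UNIV (\<lambda>r. p r (w r))"
    and p_mono: "\<And>r x y. r > 0 \<Longrightarrow> a r \<le> x \<Longrightarrow> x \<le> y \<Longrightarrow> y \<le> b r \<Longrightarrow> p r x \<le> p r y"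
    and p_bound: "\<And>r x. r > 0 \<Longrightarrow> a r \<le> x \<Longrightarrow> x \<le> b r \<Longrightarrow> \<bar>p r x\<bar> \<le> C"
    and sub: "\<And>r. r > 0 \<Longrightarrow> m\<^sup>2 * a r - p r (a r) \<le> a'' r"
    and super: "\<And>r. r > 0 \<Longrightarrow> b'' r \<le> m\<^sup>2 * b r - p r (b r)"
begin

definition admissible :: "(real \<Rightarrow> real) \<Rightarrow> bool"
  where "admissible w \<longleftrightarrow> continuous_on UNIV w \<and> (\<forall>r. w (- r) = - w r) \<and> (\<forall>r>0. a r \<le> w r \<and> w r \<le> b r)"

definition step :: "(real \<Rightarrow> real) \<Rightarrow> real \<Rightarrow> real"
  where "step w = resolvent m (\<lambda>r. p r (w r))"

text \<open>Assumes no continuity of \<open>w\<close>, because it is also applied to the pointwise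
  limit of the iterates before that limit is known to be continuous.\<close>

lemma rhs_bound:
  assumes odd: "\<And>r. w (- r) = - w r" and tube: "\<And>r. r > 0 \<Longrightarrow> a r \<le> w r \<and> w r \<le> b r"
  shows "p (- r) (w (- r)) = - p r (w r)" "\<bar>p r (w r)\<bar> \<le> C" "\<bar>w r\<bar> \<le> L * \<bar>r\<bar>"
proof -
  show "p (- r) (w (- r)) = - p r (w r)" for r by (simp add: odd p_odd)
  note podd = this
  have w0: "w 0 = 0" using odd[of 0] by simp
  have p0: "p 0 (w 0) = 0" using podd[of 0] by simp
  have pos: "\<bar>p r (w r)\<bar> \<le> C" if "r > 0" for r using p_bound tube that by blast
  have "C \<ge> 0" using pos[of 1] by linarith
  show "\<bar>p r (w r)\<bar> \<le> C"
  proof (cases r "0 :: real" rule: linorder_cases)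
    case less
    then show ?thesis using pos[of "- r"] podd[of r] by simp
  qed (use p0 pos \<open>C \<ge> 0\<close> in auto)
  have wpos: "\<bar>w r\<bar> \<le> L * r" if "r > 0" for r
    using tube[OF that] bound_ab(3,4)[OF that] by linarith
  show "\<bar>w r\<bar> \<le> L * \<bar>r\<bar>"
  proof (cases r "0 :: real" rule: linorder_cases)
    case less
    then show ?thesis using wpos[of "- r"] odd[of r] by simp
  qed (use w0 wpos in auto)
qed

lemma admissible_rhs:
  assumes "admissible w"
  shows "p (- r) (w (- r)) = - p r (w r)" "\<bar>p r (w r)\<bar> \<le> C" "\<bar>w r\<bar> \<le> L * \<bar>r\<bar>"
    "continuous_on UNIV (\<lambda>r. p r (w r))" "w 0 = 0"
proof -
  note * = rhs_bound[of w] assms[unfolded admissible_def]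
  show "p (- r) (w (- r)) = - p r (w r)" "\<bar>p r (w r)\<bar> \<le> C" "\<bar>w r\<bar> \<le> L * \<bar>r\<bar>" for r
    using * by blast+
  then show "continuous_on UNIV (\<lambda>r. p r (w r))"
    using * by (intro p_cont2) auto
  show "w 0 = 0" using * by (metis equal_neg_zero neg_0_equal_iff_equal)
qed

lemma step_DERIV:
  assumes "admissible w"
  shows "(step w has_real_derivative resolvent_deriv m (\<lambda>r. p r (w r)) r) (at r)"
    and "(resolvent_deriv m (\<lambda>r. p r (w r)) has_real_derivative m\<^sup>2 * step w r - p r (w r)) (at r)"
    and "\<bar>step w r\<bar> \<le> C / m\<^sup>2" and "step w 0 = 0"
proof -
  note F = admissible_rhs[OF assms]
  show "(step w has_real_derivative resolvent_deriv m (\<lambda>r. p r (w r)) r) (at r)"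
    "(resolvent_deriv m (\<lambda>r. p r (w r)) has_real_derivative m\<^sup>2 * step w r - p r (w r)) (at r)"
    unfolding step_def using resolvent_DERIV[OF m F(4,2,1)] by simp_all
  show "\<bar>step w r\<bar> \<le> C / m\<^sup>2"
    unfolding step_def using F by (intro resolvent_bound m) (auto intro: borel_measurable_continuous_onI)
  show "step w 0 = 0" unfolding step_def using resolvent_odd[of m _ 0] by simp
qed

lemma step_mono:
  assumes w: "admissible w" and z: "admissible z" and le: "\<And>r. r > 0 \<Longrightarrow> w r \<le> z r" and "r > 0"
  shows "step w r \<le> step z r"
proof -
  have "0 \<le> step z r - step w r"
  proof (rule half_line_maximum_principle[where v = "\<lambda>r. step z r - step w r" and r = r, OF m])
    show "((\<lambda>r. step z r - step w r) has_real_derivative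
        resolvent_deriv m (\<lambda>r. p r (z r)) r - resolvent_deriv m (\<lambda>r. p r (w r)) r) (at r)" for r
      by (intro DERIV_diff step_DERIV w z)
    show "((\<lambda>r. resolvent_deriv m (\<lambda>r. p r (z r)) r - resolvent_deriv m (\<lambda>r. p r (w r)) r) has_real_derivative
        (m\<^sup>2 * step z r - p r (z r)) - (m\<^sup>2 * step w r - p r (w r))) (at r)" for r
      by (intro DERIV_diff step_DERIV w z)
    show "\<bar>step z r - step w r\<bar> \<le> C / m\<^sup>2 + C / m\<^sup>2" for r
      using step_DERIV(3)[OF w, of r] step_DERIV(3)[OF z, of r] by linarith
    show "(m\<^sup>2 * step z r - p r (z r)) - (m\<^sup>2 * step w r - p r (w r)) \<le> m\<^sup>2 * (step z r - step w r)"
      if "r > 0" for r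
      using p_mono[OF that, of "w r" "z r"] w z le[OF that] that by (simp add: admissible_def algebra_simps)
  qed (use step_DERIV(4) w z \<open>r > 0\<close> in auto)
  then show ?thesis by simp
qed

lemma admissible_b: "admissible b"
  unfolding admissible_def using odd_ab a_le_b DERIV_isCont[OF deriv_b(1)]
  by (auto intro: continuous_at_imp_continuous_on)

lemma step_admissible:
  assumes w: "admissible w"
  shows "admissible (step w)"
  unfolding admissible_def
proof (intro conjI allI impI)
  show "continuous_on UNIV (step w)"
    using DERIV_isCont[OF step_DERIV(1)[OF w]] by (auto intro: continuous_at_imp_continuous_on)
  show "step w (- r) = - step w r" for r by (simp add: step_def resolvent_odd)
  have ab0: "a 0 = 0" "b 0 = 0" using odd_ab[of 0] by auto
  fix r :: real assume "r > 0"
  have "0 \<le> b r - step w r"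
  proof (rule half_line_maximum_principle[where v = "\<lambda>r. b r - step w r" and r = r, OF m])
    show "((\<lambda>r. b r - step w r) has_real_derivative b' r - resolvent_deriv m (\<lambda>r. p r (w r)) r) (at r)" for r
      by (intro DERIV_diff step_DERIV w deriv_b)
    show "((\<lambda>r. b' r - resolvent_deriv m (\<lambda>r. p r (w r)) r) has_real_derivative
        b'' r - (m\<^sup>2 * step w r - p r (w r))) (at r)" for r
      by (intro DERIV_diff step_DERIV w deriv_b)
    show "\<bar>b r - step w r\<bar> \<le> M + C / m\<^sup>2" for r
      using step_DERIV(3)[OF w, of r] bound_ab(2)[of r] by linarith
    show "b'' r - (m\<^sup>2 * step w r - p r (w r)) \<le> m\<^sup>2 * (b r - step w r)" if "r > 0" for r
      using p_mono[OF that, of "w r" "b r"] w super[OF that] that by (simp add: admissible_def algebra_simps)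
  qed (use step_DERIV(4)[OF w] ab0 \<open>r > 0\<close> in auto)
  then show "step w r \<le> b r" by simp
  have "0 \<le> step w r - a r"
  proof (rule half_line_maximum_principle[where v = "\<lambda>r. step w r - a r" and r = r, OF m])
    show "((\<lambda>r. step w r - a r) has_real_derivative resolvent_deriv m (\<lambda>r. p r (w r)) r - a' r) (at r)" for r
      by (intro DERIV_diff step_DERIV w deriv_a)
    show "((\<lambda>r. resolvent_deriv m (\<lambda>r. p r (w r)) r - a' r) has_real_derivative
        (m\<^sup>2 * step w r - p r (w r)) - a'' r) (at r)" for r
      by (intro DERIV_diff step_DERIV w deriv_a)
    show "\<bar>step w r - a r\<bar> \<le> M + C / m\<^sup>2" for r
      using step_DERIV(3)[OF w, of r] bound_ab(1)[of r] by linarith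
    show "(m\<^sup>2 * step w r - p r (w r)) - a'' r \<le> m\<^sup>2 * (step w r - a r)" if "r > 0" for r
      using p_mono[OF that, of "a r" "w r"] w sub[OF that] that by (simp add: admissible_def algebra_simps)
  qed (use step_DERIV(4)[OF w] ab0 \<open>r > 0\<close> in auto)
  then show "a r \<le> step w r" by simp
qed

text \<open>Iterating from the supersolution \<open>b\<close> gives a sequence that decreases on the
  positive half-line and stays above \<open>a\<close>. Pointwise convergence is enough: dominated
  convergence passes to the limit in the integral formula of \<open>resolvent\<close>, so no
  compactness argument is involved.\<close>

theorem solution_exists:
  "\<exists>w w'. (\<forall>r. w (- r) = - w r) \<and> (\<forall>r. (w has_real_derivative w' r) (at r)) \<and>
    (\<forall>r. (w' has_real_derivative m\<^sup>2 * w r - p r (w r)) (at r)) \<and> (\<forall>r>0. a r \<le> w r \<and> w r \<le> b r)"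
proof -
  define W where "W n = (step ^^ n) b" for n
  have W_Suc: "W (Suc n) = step (W n)" for n by (simp add: W_def)
  have adm: "admissible (W n)" for n
    by (induction n) (auto simp: W_def admissible_b step_admissible)
  have dec: "W (Suc n) r \<le> W n r" if "r > 0" for n r
    using that
  proof (induction n arbitrary: r)
    case 0
    then show ?case using step_admissible[OF admissible_b] by (simp add: W_def admissible_def)
  next
    case (Suc n)
    then show ?case unfolding W_Suc using adm Suc.IH by (intro step_mono) (auto simp flip: W_Suc)
  qed
  have conv: "convergent (\<lambda>n. W n r)" for r
  proof -
    have pos: "convergent (\<lambda>n. W n r)" if "r > 0" for r
    proof (rule Bseq_monoseq_convergent)
      show "monoseq (\<lambda>n. W n r)" using dec[OF that] by (intro decseq_imp_monoseq decseq_SucI)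
      show "Bseq (\<lambda>n. W n r)"
        using admissible_rhs(3)[OF adm] by (intro BseqI'[of _ "L * \<bar>r\<bar>"]) simp
    qed
    show ?thesis
    proof (cases r "0 :: real" rule: linorder_cases)
      case less
      have "(\<lambda>n. W n r) = (\<lambda>n. - W n (- r))" using adm by (auto simp: admissible_def)
      then show ?thesis using pos[of "- r"] less convergent_minus_iff[of "\<lambda>n. W n (- r)"] by simp
    next
      case equal
      then show ?thesis using admissible_rhs(5)[OF adm] by (simp add: convergent_const)
    qed (rule pos)
  qed
  define w where "w r = lim (\<lambda>n. W n r)" for r
  have lim: "(\<lambda>n. W n r) \<longlonglongrightarrow> w r" for r
    using conv[of r] by (simp add: w_def convergent_LIMSEQ_iff)
  have w_odd: "w (- r) = - w r" for r
  proof -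
    have "(\<lambda>n. W n (- r)) \<longlonglongrightarrow> - w r"
      using tendsto_minus[OF lim[of r]] adm by (simp add: admissible_def)
    then show ?thesis using LIMSEQ_unique lim by blast
  qed
  have tube: "a r \<le> w r \<and> w r \<le> b r" if "r > 0" for r
    using adm that lim[of r] unfolding admissible_def
    by (meson LIMSEQ_le_const LIMSEQ_le_const2)
  define F where "F n r = p r (W n r)" for n r
  define G where "G r = p r (w r)" for r
  have F_cont: "continuous_on UNIV (F n)" for n
    unfolding F_def by (rule admissible_rhs(4)[OF adm])
  have FG: "(\<lambda>n. F n r) \<longlonglongrightarrow> G r" for r
    unfolding F_def G_def using continuous_on_tendsto_compose[OF p_cont lim] by simp
  have [measurable]: "F n \<in> borel_measurable borel" for n
    using F_cont by (rule borel_measurable_continuous_onI)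
  have [measurable]: "G \<in> borel_measurable borel"
    using FG by (rule borel_measurable_LIMSEQ_real) measurable
  have F_bound: "\<bar>F n r\<bar> \<le> C" for n r unfolding F_def by (rule admissible_rhs(2)[OF adm])
  have G_bound: "\<bar>G r\<bar> \<le> C" for r unfolding G_def by (rule rhs_bound[OF w_odd tube])
  have "(\<lambda>n. resolvent m (F n) r) \<longlonglongrightarrow> resolvent m G r" for r
    unfolding resolvent_def using m
    by (intro tendsto_intros exp_integral_tendsto[OF m _ _ F_bound FG]) auto
  moreover have "F n = (\<lambda>r. p r (W n r))" for n by (simp add: F_def fun_eq_iff)
  then have "resolvent m (F n) r = W (Suc n) r" for n r
    by (simp add: W_Suc step_def)
  ultimately have "(\<lambda>n. W (Suc n) r) \<longlonglongrightarrow> resolvent m G r" for r by simp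
  then have w_eq: "w = resolvent m G"
    using LIMSEQ_unique LIMSEQ_Suc[OF lim] by blast
  \<comment> \<open>Continuity of the limit comes only from its integral representation; as a fixed
    point of \<open>step\<close> it then inherits two derivatives.\<close>
  have w_adm: "admissible w"
    unfolding admissible_def using tube w_odd resolvent_continuous[OF m _ G_bound] by (auto simp: w_eq)
  have "G = (\<lambda>r. p r (w r))" by (simp add: G_def fun_eq_iff)
  then have "step w = w" unfolding step_def using w_eq by metis
  then show ?thesis
    using step_DERIV(1,2)[OF w_adm] w_odd tube by metis
qed

end

section \<open>Barriers for an explicit potential\<close>

text \<open>Indexed by decay: evaluated at \<open>s = \<bar>x\<bar>^2\<close> it behaves like the
  power \<open>- a\<close> of \<open>\<bar>x\<bar>\<close> at infinity and is smooth at the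
  origin.\<close>

definition pw :: "real \<Rightarrow> real \<Rightarrow> real"
  where "pw a s = (1 + s) powr (- a / 2)"

lemma pw_pos: "s \<ge> 0 \<Longrightarrow> pw a s > 0"
  by (simp add: pw_def)

lemma pw_le_1: "s \<ge> 0 \<Longrightarrow> a \<ge> 0 \<Longrightarrow> pw a s \<le> 1"
  using powr_mono2'[of "- a / 2" 1 "1 + s"] by (simp add: pw_def)

lemma pw_add: "s \<ge> 0 \<Longrightarrow> pw (a + b) s = pw a s * pw b s"
  by (simp add: pw_def powr_add[symmetric] add_divide_distrib diff_divide_distrib)

lemma pw_mono: "s \<ge> 0 \<Longrightarrow> a \<le> b \<Longrightarrow> pw b s \<le> pw a s"
  unfolding pw_def by (intro powr_mono) auto

lemma pw_2: "s \<ge> 0 \<Longrightarrow> pw 2 s = 1 / (1 + s)"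
  by (simp add: pw_def powr_minus_divide)

lemma pw_odd:
  assumes "s \<ge> 0"
  shows "pw 3 s = pw 1 s * pw 2 s" "pw 5 s = pw 1 s * pw 2 s ^ 2" "pw 7 s = pw 1 s * pw 2 s ^ 3"
    "pw 9 s = pw 1 s * pw 2 s ^ 4" "pw 11 s = pw 1 s * pw 2 s ^ 5" "pw 13 s = pw 1 s * pw 2 s ^ 6"
    "(pw 1 s)\<^sup>2 = pw 2 s"
proof -
  have *: "pw (a + 2) s = pw a s * pw 2 s" for a using assms by (rule pw_add)
  show 3: "pw 3 s = pw 1 s * pw 2 s" using *[of 1] by simp
  show 5: "pw 5 s = pw 1 s * pw 2 s ^ 2" using *[of 3] 3 by (simp add: power_numeral_reduce)
  show 7: "pw 7 s = pw 1 s * pw 2 s ^ 3" using *[of 5] 5 by (simp add: power_numeral_reduce)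
  show 9: "pw 9 s = pw 1 s * pw 2 s ^ 4" using *[of 7] 7 by (simp add: power_numeral_reduce)
  show 11: "pw 11 s = pw 1 s * pw 2 s ^ 5" using *[of 9] 9 by (simp add: power_numeral_reduce)
  show "pw 13 s = pw 1 s * pw 2 s ^ 6" using *[of 11] 11 by (simp add: power_numeral_reduce)
  show "(pw 1 s)\<^sup>2 = pw 2 s" using pw_add[OF assms, of 1 1] by (simp add: power2_eq_square)
qed

lemma pw_DERIV:
  assumes "s > - 1"
  shows "(pw a has_real_derivative - (1 / 2) * (a * pw (a + 2) s)) (at s)"
proof -
  have "((\<lambda>s. (1 + s) powr (- a / 2)) has_real_derivative (- a / 2) * (1 + s) powr (- a / 2 - 1)) (at s)"
    using assms by (auto intro!: derivative_eq_intros has_real_derivative_powr simp: powr_diff)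
  moreover have "(- a / 2) * (1 + s) powr (- a / 2 - 1) = - (1 / 2) * (a * pw (a + 2) s)"
  proof -
    have "- (a + 2) / 2 = - a / 2 - 1" by (simp add: field_simps)
    then have "pw (a + 2) s = (1 + s) powr (- a / 2 - 1)" by (simp only: pw_def)
    then show ?thesis by simp
  qed
  ultimately show ?thesis unfolding pw_def[abs_def] by (rule DERIV_cong)
qed

text \<open>The list \<open>cs\<close> of pairs \<open>(c, a)\<close> stands for the radial function \<open>\<Sum> c (1 + \<bar>x\<bar>\<^sup>2) powr (- a / 2)\<close>,
  evaluated at \<open>s = \<bar>x\<bar>\<^sup>2\<close>; \<^term>\<open>pw_lap\<close> is its Laplacian.\<close>

definition pw_comb :: "(real \<times> real) list \<Rightarrow> real \<Rightarrow> real"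
  where "pw_comb cs s = (\<Sum>(c, a)\<leftarrow>cs. c * pw a s)"

text \<open>Represents -2 d/ds, so that for \<open>s = \<bar>x\<bar>^2\<close> the gradient of
  \<open>pw_comb cs\<close> is \<open>- x\<close> times \<open>pw_comb (pw_diff cs)\<close>.\<close>

definition pw_diff :: "(real \<times> real) list \<Rightarrow> (real \<times> real) list"
  where "pw_diff cs = map (\<lambda>(c, a). (c * a, a + 2)) cs"

definition pw_lap :: "(real \<times> real) list \<Rightarrow> real \<Rightarrow> real"
  where "pw_lap cs s = s * pw_comb (pw_diff (pw_diff cs)) s - 3 * pw_comb (pw_diff cs) s"

lemma pw_comb_DERIV:
  assumes "s > - 1"
  shows "(pw_comb cs has_real_derivative - (1 / 2) * pw_comb (pw_diff cs) s) (at s)"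
proof (induction cs)
  case Nil
  then show ?case by (simp add: pw_comb_def[abs_def] pw_diff_def)
next
  case (Cons ca cs)
  obtain c a where ca: "ca = (c, a)" by force
  have "((\<lambda>s. c * pw a s + pw_comb cs s) has_real_derivative
      c * (- (1 / 2) * (a * pw (a + 2) s)) + - (1 / 2) * pw_comb (pw_diff cs) s) (at s)"
    by (intro DERIV_add DERIV_cmult pw_DERIV assms Cons)
  moreover have "pw_comb (ca # cs) = (\<lambda>s. c * pw a s + pw_comb cs s)"
    by (auto simp: pw_comb_def ca)
  moreover have "pw_comb (pw_diff (ca # cs)) s = c * a * pw (a + 2) s + pw_comb (pw_diff cs) s"
    by (simp add: pw_comb_def pw_diff_def ca)
  ultimately show ?case by (simp add: algebra_simps)
qed

lemma pw_comb_continuous: "continuous_on {0..} (pw_comb cs)"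
  by (intro continuous_at_imp_continuous_on ballI DERIV_isCont[OF pw_comb_DERIV]) auto

text \<open>In dimension three the Laplacian of a radial \<open>f\<close> is
  \<open>(r f)'' / r\<close>; this links the half-line equation to \<open>pw_lap\<close>.\<close>

lemma pw_comb_radial_DERIV:
  shows "((\<lambda>r. r * pw_comb cs (r\<^sup>2)) has_real_derivative
      pw_comb cs (r\<^sup>2) - r\<^sup>2 * pw_comb (pw_diff cs) (r\<^sup>2)) (at r)"
    and "((\<lambda>r. pw_comb cs (r\<^sup>2) - r\<^sup>2 * pw_comb (pw_diff cs) (r\<^sup>2)) has_real_derivative
      r * pw_lap cs (r\<^sup>2)) (at r)"
proof -
  have gt: "r\<^sup>2 > - 1" using zero_le_power2[of r] by linarith
  have d: "((\<lambda>r. pw_comb cs (r\<^sup>2)) has_real_derivative - r * pw_comb (pw_diff cs) (r\<^sup>2)) (at r)" for cs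
  proof -
    have "((\<lambda>r :: real. r\<^sup>2) has_real_derivative 2 * r) (at r)" by (auto intro!: derivative_eq_intros)
    from DERIV_chain2[where f = "pw_comb cs" and g = "\<lambda>r. r\<^sup>2" and x = r, OF pw_comb_DERIV[OF gt] this]
    show ?thesis by (rule DERIV_cong) simp
  qed
  show "((\<lambda>r. r * pw_comb cs (r\<^sup>2)) has_real_derivative
      pw_comb cs (r\<^sup>2) - r\<^sup>2 * pw_comb (pw_diff cs) (r\<^sup>2)) (at r)"
    by (rule derivative_eq_intros d refl)+ (simp add: power2_eq_square)
  show "((\<lambda>r. pw_comb cs (r\<^sup>2) - r\<^sup>2 * pw_comb (pw_diff cs) (r\<^sup>2)) has_real_derivative
      r * pw_lap cs (r\<^sup>2)) (at r)"
    by (rule derivative_eq_intros d refl)+ (simp add: pw_lap_def power2_eq_square algebra_simps)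
qed

text \<open>In stereographic coordinates \<open>z0\<close> at \<open>s = \<bar>x\<bar>^2\<close> is
  the height (s - 1) / (s + 1) on the three-sphere, and \<open>2 * y0\<close> is the conformal
  factor.\<close>

definition y0 :: "real \<Rightarrow> real" where "y0 s = pw 2 s"
definition z0 :: "real \<Rightarrow> real" where "z0 s = 1 - 2 * pw 2 s"

definition profile :: "(real \<times> real) list" where "profile = [(6, 1), (- 12, 3)]"

text \<open>In terms of \<open>z = z0 s\<close> this is \<open>pw 1 s * (1 - 2 z\<^sup>2 + 2 z\<^sup>4) - pw (\<beta> - 1) s / 5200\<close>; the second term
  supplies the \<open>pw (\<beta> + 1)\<close> in the gain that absorbs a perturbation of the potential of decay \<open>\<beta>\<close>.\<close>

definition barrier :: "real \<Rightarrow> (real \<times> real) list"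
  where "barrier \<beta> = [(1, 1), (- 8, 3), (40, 5), (- 64, 7), (32, 9), (- (1 / 5200), \<beta> - 1)]"

text \<open>15 = 4 * (3 + 3/4): the eigenvalue 3 of the first harmonic on the three-sphere plus the
  constant 3/4 of the conformal Laplacian there, times the squared conformal factor
  \<open>4 * y0^2\<close>. The other constant is 1296 = 6^4, from \<phi>0^4.\<close>

definition base_potential :: "real \<Rightarrow> real"
  where "base_potential s = (y0 s)\<^sup>2 * (15 + 1296 * (z0 s) ^ 4)"

text \<open>Coefficient of the slowest decaying term, \<open>pw (\<beta> + 1)\<close>, in the
  Laplacian of \<open>pw (\<beta> - 1) / 5200\<close>. It is positive because \<beta> > 2, and since
  that function is subtracted in the barrier it counts in favour of a supersolution.\<close>

definition barrier_gain :: "real \<Rightarrow> real"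
  where "barrier_gain \<beta> = (1 / 5200) * ((\<beta> - 1) * (\<beta> - 2))"

lemma y0_bounds: "s \<ge> 0 \<Longrightarrow> 0 < y0 s" "s \<ge> 0 \<Longrightarrow> y0 s \<le> 1" "s \<ge> 0 \<Longrightarrow> s * y0 s = 1 - y0 s"
  by (auto simp: y0_def pw_2 field_simps)

lemma z0_bounds: "s \<ge> 0 \<Longrightarrow> \<bar>z0 s\<bar> \<le> 1" "s \<ge> 0 \<Longrightarrow> (z0 s)\<^sup>2 \<le> 1" "s \<ge> 0 \<Longrightarrow> (z0 s) ^ 4 \<le> 1"
proof -
  assume "s \<ge> 0"
  then show *: "\<bar>z0 s\<bar> \<le> 1" using y0_bounds[of s] by (auto simp: z0_def y0_def)
  show "(z0 s)\<^sup>2 \<le> 1" "(z0 s) ^ 4 \<le> 1"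
    using power_le_one[OF abs_ge_zero *, of 2] power_le_one[OF abs_ge_zero *, of 4] by (simp_all add: power_even_abs)
qed

lemma profile_eq:
  assumes "s \<ge> 0"
  shows "pw_comb profile s = 6 * pw 1 s * z0 s" "pw_lap profile s = - 15 * (y0 s)\<^sup>2 * pw_comb profile s"
    "\<bar>pw_comb profile s\<bar> \<le> 6 * pw 1 s"
proof -
  define t where "t = pw 1 s"
  define y where "y = pw 2 s"
  have sy: "s * y = 1 - y" using y0_bounds(3)[OF assms] by (simp add: y_def y0_def)
  note e = pw_odd[OF assms, folded t_def y_def]
  show 1: "pw_comb profile s = 6 * pw 1 s * z0 s"
    by (simp add: pw_comb_def profile_def e z0_def t_def[symmetric] y_def[symmetric] algebra_simps)
  have "pw_lap profile s = t * (s * (18 * y ^ 2 - 180 * y ^ 3) - 3 * (6 * y - 36 * y ^ 2))"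
    by (simp add: pw_lap_def pw_comb_def pw_diff_def profile_def e t_def[symmetric] y_def[symmetric] algebra_simps)
  also have "\<dots> = - 15 * y\<^sup>2 * (6 * t * (1 - 2 * y))" using sy by algebra
  finally show "pw_lap profile s = - 15 * (y0 s)\<^sup>2 * pw_comb profile s"
    by (simp add: 1 y0_def z0_def y_def t_def)
  have "\<bar>pw_comb profile s\<bar> = 6 * t * \<bar>z0 s\<bar>"
    using pw_pos[OF assms, of 1] by (simp add: 1 abs_mult t_def)
  also have "\<dots> \<le> 6 * t * 1"
    using z0_bounds[OF assms] pw_pos[OF assms, of 1] by (intro mult_left_mono) (auto simp: t_def)
  finally show "\<bar>pw_comb profile s\<bar> \<le> 6 * pw 1 s" by (simp add: t_def)
qed

text \<open>The potential \<open>- base_potential + 5 profile\<^sup>4\<close> equals \<open>y\<^sup>2 (5184 z\<^sup>4 - 15)\<close>; the well of depth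
  \<open>15 / 4\<close> at the nodal sphere \<open>z = 0\<close> is overcome by the concavity of \<open>1 - 2 z\<^sup>2 + 2 z\<^sup>4\<close> in \<open>z\<close>.\<close>

lemma barrier_bounds:
  assumes s: "s \<ge> 0" and \<beta>: "2 < \<beta>" "\<beta> \<le> 5 / 2"
  shows "0 < pw_comb (barrier \<beta>) s" "pw_comb (barrier \<beta>) s \<le> pw 1 s"
    "- pw_lap (barrier \<beta>) s + (y0 s)\<^sup>2 * (5184 * (z0 s) ^ 4 - 15) * pw_comb (barrier \<beta>) s
      \<ge> pw 1 s * (y0 s)\<^sup>2 + barrier_gain \<beta> * pw (\<beta> + 1) s"
proof -
  define t where "t = pw 1 s"
  define y where "y = pw 2 s"
  define z where "z = 1 - 2 * y"
  define g where "g = pw (\<beta> - 1) s"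
  \<comment> \<open>Equal to \<open>1 / 2 + 2 * (z^2 - 1 / 2)^2\<close>, hence between 1/2 and 1 for
    \<open>z^2 \<le> 1\<close>.\<close>
  define P where "P = 1 - 2 * z\<^sup>2 + 2 * z ^ 4"
  have sy: "s * y = 1 - y" using y0_bounds(3)[OF s] by (simp add: y_def y0_def)
  have y: "0 < y" "y \<le> 1" using y0_bounds[OF s] by (auto simp: y_def y0_def)
  have t: "t > 0" using pw_pos[OF s] by (simp add: t_def)
  have z2: "0 \<le> z\<^sup>2" "z\<^sup>2 \<le> 1" using z0_bounds[OF s] by (auto simp: z_def z0_def y_def)
  have z4: "z ^ 4 = z\<^sup>2 * z\<^sup>2" by (simp add: power_numeral_reduce)
  note e = pw_odd[OF s, folded t_def y_def]
  have g_shift: "pw (\<beta> + 1) s = g * y" "pw (\<beta> + 3) s = g * y * y"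
  proof -
    have "\<beta> + 1 = (\<beta> - 1) + 2" "\<beta> + 3 = (\<beta> - 1) + 2 + 2" by simp_all
    then show "pw (\<beta> + 1) s = g * y" "pw (\<beta> + 3) s = g * y * y"
      by (simp_all only: pw_add[OF s] g_def y_def)
  qed
  have g: "0 < g" "g \<le> t"
    using pw_pos[OF s] pw_mono[OF s, of 1 "\<beta> - 1"] \<beta> by (auto simp: g_def t_def)
  have P: "1 / 2 \<le> P" "P \<le> 1"
  proof -
    have "P - 1 / 2 = 2 * (z\<^sup>2 - 1 / 2)\<^sup>2" unfolding P_def z4 by (simp add: power2_eq_square algebra_simps)
    then show "1 / 2 \<le> P" by (metis diff_ge_0_iff_ge zero_le_mult_iff zero_le_numeral zero_le_power2)
    have "z\<^sup>2 * z\<^sup>2 \<le> 1 * z\<^sup>2" using z2 by (intro mult_right_mono) auto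
    then show "P \<le> 1" unfolding P_def z4 by simp
  qed
  have h: "pw_comb (barrier \<beta>) s = t * P - g / 5200"
    by (simp add: pw_comb_def barrier_def e g_def[symmetric] t_def[symmetric] y_def[symmetric] P_def z_def)
       (simp add: algebra_simps power_numeral_reduce)
  have tP: "t * (1 / 2) \<le> t * P" "t * P \<le> t * 1" using P t by (auto intro!: mult_left_mono)
  show "0 < pw_comb (barrier \<beta>) s" "pw_comb (barrier \<beta>) s \<le> pw 1 s"
    unfolding h t_def[symmetric] using tP g t by linarith+
  have lap: "pw_lap (barrier \<beta>) s
      = t * (s * (3 * y ^ 2 - 120 * y ^ 3 + 1400 * y ^ 4 - 4032 * y ^ 5 + 3168 * y ^ 6)
          - 3 * (y - 24 * y ^ 2 + 200 * y ^ 3 - 448 * y ^ 4 + 288 * y ^ 5))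
        - (\<beta> - 1) / 5200 * (s * ((\<beta> + 1) * g * y * y) - 3 * g * y)"
    by (simp add: pw_lap_def pw_comb_def pw_diff_def barrier_def e t_def[symmetric] y_def[symmetric])
       (simp add: field_simps g_shift g_shift[unfolded add.commute[of \<beta>]])
  \<comment> \<open>The term \<open>15 * y^2 * t * P\<close> is split off because it cancels the
    well exactly. What remains of minus the Laplacian,
    \<open>4 * t * y^2 * (1 - 34 z^2 + 42 z^4)\<close>, is positive near the nodal sphere; further
    away the quartic potential takes over.\<close>
  have part1: "t * (s * (3 * y ^ 2 - 120 * y ^ 3 + 1400 * y ^ 4 - 4032 * y ^ 5 + 3168 * y ^ 6)
          - 3 * (y - 24 * y ^ 2 + 200 * y ^ 3 - 448 * y ^ 4 + 288 * y ^ 5))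
      = - t * y\<^sup>2 * 4 * (1 - 34 * z\<^sup>2 + 42 * z ^ 4) - 15 * y\<^sup>2 * t * P"
    unfolding z_def P_def using sy by algebra
  have part2: "s * ((\<beta> + 1) * g * y * y) - 3 * g * y = (\<beta> - 2) * (g * y) - (\<beta> + 1) * (g * y\<^sup>2)"
    using sy by algebra
  have "- pw_lap (barrier \<beta>) s + y\<^sup>2 * (5184 * z ^ 4 - 15) * pw_comb (barrier \<beta>) s
      = t * y\<^sup>2 * (4 * (1 - 34 * z\<^sup>2 + 42 * z ^ 4) + 5184 * z ^ 4 * P)
        + (\<beta> - 1) / 5200 * ((\<beta> - 2) * (g * y) - (\<beta> + 1) * (g * y\<^sup>2))
        - (5184 * z ^ 4 - 15) / 5200 * (g * y\<^sup>2)"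
    unfolding lap part1 part2 h by (simp add: field_simps)
  also have "\<dots> = t * y\<^sup>2 * (4 * (1 - 34 * z\<^sup>2 + 42 * z ^ 4) + 5184 * z ^ 4 * P)
        + barrier_gain \<beta> * (g * y) - ((\<beta> - 1) * (\<beta> + 1) + 5184 * z ^ 4 - 15) / 5200 * (g * y\<^sup>2)"
    by (simp add: barrier_gain_def field_simps)
  also have "\<dots> \<ge> t * y\<^sup>2 * 2 + barrier_gain \<beta> * (g * y) - 1 * (t * y\<^sup>2)"
  proof -
    have "5184 * z ^ 4 * (1 / 2) \<le> 5184 * z ^ 4 * P"
      using P z4 by (intro mult_left_mono) auto
    \<comment> \<open>This is where the amplitude 6 is needed: 2760 = 168 + 5184 / 2 with
      \<open>P \<ge> 1 / 2\<close>, and the quadratic in \<open>z^2\<close> stays above 2 because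
      136^2 \<le> 8 * 2760. Amplitude 5 would give 1418 in place of 2760 and fail this test.\<close>
    moreover have "0 \<le> 2760 * (z\<^sup>2 - 136 / 5520)\<^sup>2" by simp
    then have "2 \<le> 4 - 136 * z\<^sup>2 + 2760 * (z\<^sup>2 * z\<^sup>2)"
      by (simp add: power2_eq_square algebra_simps)
    ultimately have "2 \<le> 4 * (1 - 34 * z\<^sup>2 + 42 * z ^ 4) + 5184 * z ^ 4 * P"
      unfolding z4 by (simp add: algebra_simps)
    then have 1: "t * y\<^sup>2 * 2 \<le> t * y\<^sup>2 * (4 * (1 - 34 * z\<^sup>2 + 42 * z ^ 4) + 5184 * z ^ 4 * P)"
      using t by (intro mult_left_mono) auto
    \<comment> \<open>Explains 5200: the side effects of the correction term have coefficient at
      most 21/4 + 5184 - 15, so after division they cost no more than one unit of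
      \<open>t * y^2\<close>.\<close>
    have "(\<beta> - 1) * (\<beta> + 1) \<le> (3 / 2) * (7 / 2)" using \<beta> by (intro mult_mono) auto
    moreover have "z ^ 4 \<le> 1" using z0_bounds[OF s] by (simp add: z_def z0_def y_def)
    ultimately have c: "((\<beta> - 1) * (\<beta> + 1) + 5184 * z ^ 4 - 15) / 5200 \<le> 1" by simp
    have "((\<beta> - 1) * (\<beta> + 1) + 5184 * z ^ 4 - 15) / 5200 * (g * y\<^sup>2) \<le> 1 * (g * y\<^sup>2)"
      using g by (intro mult_right_mono c) auto
    also have "\<dots> \<le> 1 * (t * y\<^sup>2)" using g by (intro mult_left_mono mult_right_mono) auto
    finally show ?thesis using 1 by simp
  qed
  finally have "t * y\<^sup>2 * 2 + barrier_gain \<beta> * (g * y) - 1 * (t * y\<^sup>2)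
      \<le> - pw_lap (barrier \<beta>) s + y\<^sup>2 * (5184 * z ^ 4 - 15) * pw_comb (barrier \<beta>) s" .
  then show "- pw_lap (barrier \<beta>) s + (y0 s)\<^sup>2 * (5184 * (z0 s) ^ 4 - 15) * pw_comb (barrier \<beta>) s
      \<ge> pw 1 s * (y0 s)\<^sup>2 + barrier_gain \<beta> * pw (\<beta> + 1) s"
    by (simp add: y0_def z0_def y_def[symmetric] t_def[symmetric] z_def[symmetric] g_shift(1))
qed

text \<open>The remainder has the factor \<open>d^2\<close>, so it is quadratic in the tube width,
  whereas the gain of the barrier is linear in it. The constant is 2551 = 10 * 6^3 + 10 * 6^2 + 5 *
  6 + 1.\<close>

lemma quintic_remainder:
  fixes A d T :: real
  assumes "\<bar>A\<bar> \<le> 6 * T" "\<bar>d\<bar> \<le> e * T" "0 \<le> e" "e \<le> 1" "0 \<le> T"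
  shows "\<bar>(A + d) ^ 5 - A ^ 5 - 5 * A ^ 4 * d\<bar> \<le> 2551 * e\<^sup>2 * T ^ 5"
proof -
  have e: "(A + d) ^ 5 - A ^ 5 - 5 * A ^ 4 * d = d\<^sup>2 * (10 * A ^ 3 + 10 * A\<^sup>2 * d + 5 * A * d\<^sup>2 + d ^ 3)"
    by algebra
  have dT: "\<bar>d\<bar> \<le> T" using assms mult_left_le_one_le[of T e] by linarith
  have "\<bar>10 * A ^ 3 + 10 * A\<^sup>2 * d + 5 * A * d\<^sup>2 + d ^ 3\<bar>
      \<le> 10 * \<bar>A\<bar> ^ 3 + 10 * (\<bar>A\<bar>\<^sup>2 * \<bar>d\<bar>) + 5 * (\<bar>A\<bar> * \<bar>d\<bar>\<^sup>2) + \<bar>d\<bar> ^ 3"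
  proof -
    have "\<bar>10 * A ^ 3\<bar> = 10 * \<bar>A\<bar> ^ 3" "\<bar>10 * A\<^sup>2 * d\<bar> = 10 * (\<bar>A\<bar>\<^sup>2 * \<bar>d\<bar>)"
      "\<bar>5 * A * d\<^sup>2\<bar> = 5 * (\<bar>A\<bar> * \<bar>d\<bar>\<^sup>2)" "\<bar>d ^ 3\<bar> = \<bar>d\<bar> ^ 3"
      by (simp_all add: abs_mult power_abs)
    then show ?thesis by linarith
  qed
  also have "\<dots> \<le> 10 * (6 * T) ^ 3 + 10 * ((6 * T)\<^sup>2 * T) + 5 * ((6 * T) * T\<^sup>2) + T ^ 3"
    using assms dT by (intro add_mono mult_mono power_mono) auto
  also have "\<dots> = 2551 * T ^ 3" by (simp add: power_numeral_reduce)
  finally have 1: "\<bar>10 * A ^ 3 + 10 * A\<^sup>2 * d + 5 * A * d\<^sup>2 + d ^ 3\<bar> \<le> 2551 * T ^ 3" .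
  have "d\<^sup>2 \<le> (e * T)\<^sup>2" using assms power_mono[of "\<bar>d\<bar>" "e * T" 2] by simp
  then have "\<bar>(A + d) ^ 5 - A ^ 5 - 5 * A ^ 4 * d\<bar> \<le> (e * T)\<^sup>2 * (2551 * T ^ 3)"
    unfolding e abs_mult using 1 by (intro mult_mono) auto
  also have "\<dots> = 2551 * e\<^sup>2 * T ^ 5" by (simp add: power_numeral_reduce)
  finally show ?thesis .
qed

text \<open>\<open>v\<close> is the potential along a full line through the origin, hence even, to
  match the odd half-line functions. The constant 70000 = 7 * 10000 is dictated by
  \<open>barrier_inequality\<close>: functions in the tube are at most \<open>7 * pw 1\<close>, and
  the barrier enters with the factor 1/10000.\<close>

locale near_base_potential =
  fixes \<beta> \<delta> :: real and v :: "real \<Rightarrow> real"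
  assumes \<beta>: "2 < \<beta>" "\<beta> \<le> 5 / 2"
    and \<delta>: "0 \<le> \<delta>" "\<delta> \<le> barrier_gain \<beta> / 70000"
    and v_cont: "continuous_on UNIV v" and v_even: "\<And>r. v (- r) = v r"
    and v_near: "\<And>r. \<bar>v r - base_potential (r\<^sup>2)\<bar> \<le> \<delta> * pw \<beta> (r\<^sup>2)"
begin

text \<open>Two demands: the linear gain \<epsilon> must beat \<open>2551 * \<epsilon>^2\<close>
  from \<open>quintic_remainder\<close>, and \<open>5 * 1372 * \<epsilon>\<close>, the relative
  change of \<open>5 \<phi>^4\<close> inside the tube, must stay below the unit gain in
  \<open>linearized_positive\<close>. The second is the stricter one.\<close>

abbreviation "\<epsilon> \<equiv> 1 / 10000 :: real"
abbreviation "f0 r \<equiv> pw_comb profile (r\<^sup>2)"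
abbreviation "h0 r \<equiv> pw_comb (barrier \<beta>) (r\<^sup>2)"
abbreviation "tt r \<equiv> pw 1 (r\<^sup>2)"

definition tube :: "real \<Rightarrow> (real \<times> real) list"
  where "tube \<sigma> = profile @ map (\<lambda>(c, a). (\<sigma> * \<epsilon> * c, a)) (barrier \<beta>)"

section \<open>The tube around the base profile\<close>

lemma pw_comb_scale: "pw_comb (map (\<lambda>(c, a). (k * c, a)) cs) s = k * pw_comb cs s"
  by (induction cs) (auto simp: pw_comb_def algebra_simps)

lemma pw_comb_append: "pw_comb (cs @ ds) s = pw_comb cs s + pw_comb ds s"
  by (simp add: pw_comb_def)

lemma tube_eq: "pw_comb (tube \<sigma>) s = pw_comb profile s + \<sigma> * \<epsilon> * pw_comb (barrier \<beta>) s"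
  by (simp only: tube_def pw_comb_append pw_comb_scale)

lemma tube_lap: "pw_lap (tube \<sigma>) s = pw_lap profile s + \<sigma> * \<epsilon> * pw_lap (barrier \<beta>) s"
proof -
  have app: "pw_diff (cs @ ds) = pw_diff cs @ pw_diff ds" for cs ds by (simp add: pw_diff_def)
  have sc: "pw_diff (map (\<lambda>(c, a). (k * c, a)) cs) = map (\<lambda>(c, a). (k * c, a)) (pw_diff cs)" for k cs
    by (auto simp: pw_diff_def)
  show ?thesis
    unfolding pw_lap_def tube_def app sc pw_comb_append pw_comb_scale by (simp add: algebra_simps)
qed

lemma gain_nonneg: "barrier_gain \<beta> \<ge> 0" "barrier_gain \<beta> \<le> 1" "\<delta> \<le> 1"
proof -
  show 0: "barrier_gain \<beta> \<ge> 0" using \<beta> by (simp add: barrier_gain_def)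
  have "(\<beta> - 1) * (\<beta> - 2) \<le> (3 / 2) * (1 / 2)" using \<beta> by (intro mult_mono) auto
  then show "barrier_gain \<beta> \<le> 1" by (simp add: barrier_gain_def)
  then show "\<delta> \<le> 1" using \<delta> by simp
qed

lemma pw_\<beta>: "pw \<beta> (r\<^sup>2) * tt r = pw (\<beta> + 1) (r\<^sup>2)"
  by (simp add: pw_add)

lemma f0_4: "f0 r ^ 4 = 1296 * (y0 (r\<^sup>2))\<^sup>2 * (z0 (r\<^sup>2)) ^ 4"
proof -
  have "(tt r) ^ 4 = (y0 (r\<^sup>2))\<^sup>2"
    using pw_odd(7)[of "r\<^sup>2"] power_mult[of "tt r" 2 2] by (simp add: y0_def)
  then show ?thesis by (simp add: profile_eq power_mult_distrib)
qed

text \<open>The zeroth-order part vanishes and the first-order part is \<epsilon> times the gain of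
  the barrier. Of that gain, \<open>T * Y^2\<close> absorbs the quintic remainder and the
  \<open>pw (\<beta> + 1)\<close> term absorbs the change of potential. The sign \<sigma> covers the
  supersolution and the subsolution together.\<close>

lemma barrier_inequality:
  assumes \<sigma>: "\<sigma> = 1 \<or> \<sigma> = - 1"
  shows "\<sigma> * (- pw_lap (tube \<sigma>) (r\<^sup>2) - v r * pw_comb (tube \<sigma>) (r\<^sup>2) + pw_comb (tube \<sigma>) (r\<^sup>2) ^ 5) \<ge> 0"
proof -
  define A where "A = f0 r"
  define H where "H = h0 r"
  define T where "T = tt r"
  define Y where "Y = y0 (r\<^sup>2)"
  define V where "V = base_potential (r\<^sup>2)"
  define Z where "Z = (z0 (r\<^sup>2)) ^ 4"
  define d where "d = \<sigma> * \<epsilon> * H"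
  define N where "N = (A + d) ^ 5 - A ^ 5 - 5 * A ^ 4 * d"
  have s: "r\<^sup>2 \<ge> 0" by simp
  have T: "T > 0" using pw_pos by (simp add: T_def)
  have A: "\<bar>A\<bar> \<le> 6 * T" using profile_eq(3) by (simp add: A_def T_def)
  have H: "0 < H" "H \<le> T" using barrier_bounds(1,2)[OF s \<beta>] by (auto simp: H_def T_def)
  have A4: "A ^ 4 = 1296 * Y\<^sup>2 * Z" using f0_4 by (simp add: A_def Y_def Z_def)
  have d: "\<bar>d\<bar> \<le> \<epsilon> * T" using H \<sigma> by (auto simp: d_def)
  have T5: "T ^ 5 = T * Y\<^sup>2"
    using pw_odd(7)[of "r\<^sup>2"] power_mult[of T 2 2] by (simp add: T_def Y_def y0_def power_numeral_reduce)
  have N: "\<bar>N\<bar> \<le> 2551 * \<epsilon>\<^sup>2 * (T * Y\<^sup>2)"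
    using quintic_remainder[OF A d] T unfolding N_def T5 by simp
  have "A ^ 5 = A ^ 4 * A" by (simp add: power_numeral_reduce)
  then have A5: "A ^ 5 = 1296 * Y\<^sup>2 * Z * A" by (simp add: A4)
  have V: "V = Y\<^sup>2 * (15 + 1296 * Z)" by (simp add: V_def base_potential_def Y_def Z_def)
  have "- pw_lap (tube \<sigma>) (r\<^sup>2) - v r * (A + d) + (A + d) ^ 5
      = (15 * Y\<^sup>2 * A - V * A + A ^ 5) + (- (\<sigma> * \<epsilon> * pw_lap (barrier \<beta>) (r\<^sup>2)) - V * d + 5 * A ^ 4 * d)
        + N - (v r - V) * (A + d)"
    by (simp add: N_def tube_lap profile_eq(2) A_def Y_def algebra_simps)
  \<comment> \<open>The base profile solves its own equation exactly; \<open>base_potential\<close>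
    is defined by this requirement.\<close>
  also have "15 * Y\<^sup>2 * A - V * A + A ^ 5 = 0" by (simp add: V A5 algebra_simps)
  also have "- (\<sigma> * \<epsilon> * pw_lap (barrier \<beta>) (r\<^sup>2)) - V * d + 5 * A ^ 4 * d
      = \<sigma> * \<epsilon> * (- pw_lap (barrier \<beta>) (r\<^sup>2) + Y\<^sup>2 * (5184 * Z - 15) * H)"
    by (simp add: V A4 d_def algebra_simps)
  finally have eq: "\<sigma> * (- pw_lap (tube \<sigma>) (r\<^sup>2) - v r * (A + d) + (A + d) ^ 5)
      = \<epsilon> * (- pw_lap (barrier \<beta>) (r\<^sup>2) + Y\<^sup>2 * (5184 * Z - 15) * H) + \<sigma> * (N - (v r - V) * (A + d))"
    using \<sigma> by (auto simp: algebra_simps)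
  define W where "W = pw (\<beta> + 1) (r\<^sup>2)"
  have "\<epsilon> * (T * Y\<^sup>2 + barrier_gain \<beta> * W) \<le> \<epsilon> * (- pw_lap (barrier \<beta>) (r\<^sup>2) + Y\<^sup>2 * (5184 * Z - 15) * H)"
    using barrier_bounds(3)[OF s \<beta>] by (intro mult_left_mono) (auto simp: T_def Y_def Z_def H_def W_def)
  moreover have "\<bar>\<sigma> * (N - (v r - V) * (A + d))\<bar> \<le> \<epsilon> * (T * Y\<^sup>2 + barrier_gain \<beta> * W)"
  proof -
    have "\<bar>(v r - V) * (A + d)\<bar> \<le> (\<delta> * pw \<beta> (r\<^sup>2)) * (7 * T)"
      unfolding abs_mult using v_near[of r] A d T by (intro mult_mono) (auto simp: V_def)
    also have "\<dots> = 7 * \<delta> * W" using pw_\<beta>[of r] by (simp add: W_def T_def)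
    also have "\<dots> \<le> 7 * (barrier_gain \<beta> / 70000) * W"
      using \<delta> pw_pos[of "r\<^sup>2" "\<beta> + 1"] by (intro mult_right_mono mult_left_mono) (auto simp: W_def)
    finally have "\<bar>(v r - V) * (A + d)\<bar> \<le> \<epsilon> * (barrier_gain \<beta> * W)" by simp
    moreover have "2551 * \<epsilon>\<^sup>2 * (T * Y\<^sup>2) \<le> \<epsilon> * (T * Y\<^sup>2)"
      using T by (intro mult_right_mono) (auto simp: power2_eq_square)
    moreover have "\<bar>\<sigma> * (N - (v r - V) * (A + d))\<bar> \<le> \<bar>N\<bar> + \<bar>(v r - V) * (A + d)\<bar>"
      using \<sigma> abs_triangle_ineq4[of N "(v r - V) * (A + d)"] by auto
    ultimately show ?thesis using N by (simp only: distrib_left)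
  qed
  ultimately have "0 \<le> \<sigma> * (- pw_lap (tube \<sigma>) (r\<^sup>2) - v r * (A + d) + (A + d) ^ 5)"
    unfolding eq by linarith
  moreover have "pw_comb (tube \<sigma>) (r\<^sup>2) = A + d" by (simp add: tube_eq A_def d_def H_def)
  ultimately show ?thesis by simp
qed

lemma tube_bound:
  assumes "\<sigma> = 1 \<or> \<sigma> = - 1"
  shows "\<bar>pw_comb (tube \<sigma>) (r\<^sup>2)\<bar> \<le> 7 * tt r" "\<bar>r * pw_comb (tube \<sigma>) (r\<^sup>2)\<bar> \<le> 7"
    "\<bar>pw_comb (tube \<sigma>) (r\<^sup>2)\<bar> \<le> 7"
proof -
  have s: "r\<^sup>2 \<ge> 0" by simp
  have "\<bar>\<sigma> * \<epsilon> * h0 r\<bar> \<le> tt r"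
    using barrier_bounds(1,2)[OF s \<beta>] assms by (auto simp: abs_mult)
  then show 1: "\<bar>pw_comb (tube \<sigma>) (r\<^sup>2)\<bar> \<le> 7 * tt r"
    using profile_eq(3)[OF s] unfolding tube_eq by linarith
  have "(\<bar>r\<bar> * tt r)\<^sup>2 \<le> 1\<^sup>2"
    using pw_odd(7)[OF s] y0_bounds[OF s] by (simp add: power_mult_distrib y0_def)
  then have rt: "\<bar>r\<bar> * tt r \<le> 1" by (rule power2_le_imp_le) simp
  have "\<bar>r\<bar> * \<bar>pw_comb (tube \<sigma>) (r\<^sup>2)\<bar> \<le> \<bar>r\<bar> * (7 * tt r)" by (intro mult_left_mono 1) auto
  then show "\<bar>r * pw_comb (tube \<sigma>) (r\<^sup>2)\<bar> \<le> 7" using rt by (simp add: abs_mult)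
  show "\<bar>pw_comb (tube \<sigma>) (r\<^sup>2)\<bar> \<le> 7" using 1 pw_le_1[OF s, of 1] by linarith
qed

lemma v_bound: "\<bar>v r\<bar> \<le> 1312"
proof -
  have s: "r\<^sup>2 \<ge> 0" by simp
  have "\<delta> * pw \<beta> (r\<^sup>2) \<le> 1 * 1"
    using gain_nonneg(3) pw_le_1[OF s, of \<beta>] pw_pos[OF s, of \<beta>] \<delta> \<beta> by (intro mult_mono) auto
  moreover have "(y0 (r\<^sup>2))\<^sup>2 \<le> 1" using y0_bounds[OF s] by (simp add: power_le_one)
  then have "(y0 (r\<^sup>2))\<^sup>2 * (15 + 1296 * (z0 (r\<^sup>2)) ^ 4) \<le> 1 * (15 + 1296 * 1)"
    using z0_bounds[OF s] by (intro mult_mono add_mono) auto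
  then have "base_potential (r\<^sup>2) \<le> 1311" "0 \<le> base_potential (r\<^sup>2)"
    by (auto simp: base_potential_def)
  ultimately show ?thesis using v_near[of r] by linarith
qed

text \<open>The equation for \<open>w r = r \<phi> r\<close> after adding \<open>200^2 * w\<close>
  on both sides. The shift 40000 makes the right-hand side increasing on the tube, where the quintic
  term has slope at most 5 * 7^4 = 12005 and the potential is at most 1312 in absolute
  value.\<close>

definition nonlinearity :: "real \<Rightarrow> real \<Rightarrow> real"
  where "nonlinearity r x = (40000 + v r) * x - x ^ 5 / r ^ 4"

text \<open>At \<open>r = 0\<close> the quotient takes the default value 0, and the slope bound 7
  makes it at most \<open>7^5 * \<bar>r\<bar>\<close> nearby, with 7^5 = 16807, so there is no
  jump.\<close>

lemma nonlinearity_continuous: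
  assumes w: "continuous_on UNIV w" "\<And>r. \<bar>w r\<bar> \<le> 7 * \<bar>r\<bar>"
  shows "continuous_on UNIV (\<lambda>r. nonlinearity r (w r))"
proof -
  have "isCont (\<lambda>r. w r ^ 5 / r ^ 4) r" for r
  proof (cases "r = 0")
    case True
    have "w 0 = 0" using w(2)[of 0] by simp
    have le: "norm (w r ^ 5 / r ^ 4) \<le> 16807 * \<bar>r\<bar>" for r
    proof (cases "r = 0")
      case False
      have "\<bar>w r\<bar> ^ 5 \<le> (7 * \<bar>r\<bar>) ^ 5" by (intro power_mono w) auto
      then have "\<bar>w r\<bar> ^ 5 / \<bar>r\<bar> ^ 4 \<le> (7 * \<bar>r\<bar>) ^ 5 / \<bar>r\<bar> ^ 4" by (intro divide_right_mono) auto
      also have "\<dots> = 16807 * \<bar>r\<bar>" using False by (simp add: power_numeral_reduce)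
      finally show ?thesis by (simp add: power_abs)
    qed simp
    have "((\<lambda>r. w r ^ 5 / r ^ 4) \<longlongrightarrow> 0) (at 0)"
    proof (rule Lim_null_comparison[OF always_eventually])
      show "\<forall>r. norm (w r ^ 5 / r ^ 4) \<le> 16807 * \<bar>r\<bar>" using le by blast
      show "((\<lambda>r :: real. 16807 * \<bar>r\<bar>) \<longlongrightarrow> 0) (at 0)"
        by (auto intro!: tendsto_eq_intros)
    qed
    then show ?thesis using True \<open>w 0 = 0\<close> by (simp add: isCont_def)
  next
    case False
    then show ?thesis using w(1) by (auto intro!: continuous_intros simp: continuous_on_eq_continuous_at)
  qed
  then have "continuous_on UNIV (\<lambda>r. w r ^ 5 / r ^ 4)" by (simp add: continuous_at_imp_continuous_on)
  then show ?thesis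
    unfolding nonlinearity_def
    by (intro continuous_on_diff continuous_on_mult continuous_on_add continuous_on_const v_cont w(1))
qed

lemma nonlinearity_mono:
  assumes "r > 0" "\<bar>x\<bar> \<le> 7 * r" "\<bar>y\<bar> \<le> 7 * r" "x \<le> y"
  shows "nonlinearity r x \<le> nonlinearity r y"
proof -
  have "\<bar>y ^ 4 + y ^ 3 * x + y\<^sup>2 * x\<^sup>2 + y * x ^ 3 + x ^ 4\<bar>
      \<le> \<bar>y\<bar> ^ 4 + \<bar>y\<bar> ^ 3 * \<bar>x\<bar> + \<bar>y\<bar>\<^sup>2 * \<bar>x\<bar>\<^sup>2 + \<bar>y\<bar> * \<bar>x\<bar> ^ 3 + \<bar>x\<bar> ^ 4"
    by (rule order_trans[OF abs_triangle_ineq] add_mono)+ (simp_all add: abs_mult power_abs)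
  also have "\<dots> \<le> (7 * r) ^ 4 + (7 * r) ^ 3 * (7 * r) + (7 * r)\<^sup>2 * (7 * r)\<^sup>2 + (7 * r) * (7 * r) ^ 3 + (7 * r) ^ 4"
    using assms by (intro add_mono mult_mono power_mono) auto
  also have "\<dots> = 12005 * r ^ 4" by (simp add: power_numeral_reduce)
  finally have "y ^ 4 + y ^ 3 * x + y\<^sup>2 * x\<^sup>2 + y * x ^ 3 + x ^ 4 \<le> 12005 * r ^ 4" by linarith
  then have "(y - x) * (y ^ 4 + y ^ 3 * x + y\<^sup>2 * x\<^sup>2 + y * x ^ 3 + x ^ 4) \<le> (y - x) * (12005 * r ^ 4)"
    using assms by (intro mult_left_mono) auto
  moreover have "(y - x) * (y ^ 4 + y ^ 3 * x + y\<^sup>2 * x\<^sup>2 + y * x ^ 3 + x ^ 4) = y ^ 5 - x ^ 5" by algebra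
  ultimately have "(y ^ 5 - x ^ 5) / r ^ 4 \<le> (y - x) * 12005" using assms by (simp add: field_simps)
  also have "\<dots> \<le> (y - x) * (40000 + v r)"
    using v_bound[of r] assms by (intro mult_left_mono) auto
  finally show ?thesis by (simp add: nonlinearity_def algebra_simps diff_divide_distrib)
qed

lemma nonlinearity_bound:
  assumes "r > 0" "\<bar>x\<bar> \<le> 7 * r" "\<bar>x\<bar> \<le> 7"
  shows "\<bar>nonlinearity r x\<bar> \<le> 41312 * 7 + 7 * 2401"
proof -
  have "\<bar>(40000 + v r) * x\<bar> \<le> 41312 * 7"
    unfolding abs_mult using v_bound[of r] assms by (intro mult_mono) auto
  moreover have "\<bar>x ^ 5 / r ^ 4\<bar> \<le> 7 * 2401"
  proof -
    have "\<bar>x\<bar> ^ 4 \<le> (7 * r) ^ 4" using assms by (intro power_mono) auto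
    then have "\<bar>x\<bar> ^ 4 / r ^ 4 \<le> 2401" using assms by (simp add: field_simps power_numeral_reduce)
    then have "\<bar>x\<bar> * (\<bar>x\<bar> ^ 4 / r ^ 4) \<le> 7 * 2401" using assms by (intro mult_mono) auto
    moreover have "x ^ 5 = x * x ^ 4" using power_Suc[of x 4] by simp
    then have "\<bar>x ^ 5 / r ^ 4\<bar> = \<bar>x\<bar> * (\<bar>x\<bar> ^ 4 / r ^ 4)"
      using assms by (simp add: abs_mult)
    ultimately show ?thesis by metis
  qed
  ultimately show ?thesis unfolding nonlinearity_def by linarith
qed

theorem radial_solution_exists:
  "\<exists>w w'. (\<forall>r. w (- r) = - w r) \<and> (\<forall>r. (w has_real_derivative w' r) (at r)) \<and>
    (\<forall>r. (w' has_real_derivative - v r * w r + w r ^ 5 / r ^ 4) (at r)) \<and>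
    (\<forall>r>0. \<bar>w r - r * f0 r\<bar> \<le> r * (\<epsilon> * tt r))"
proof -
  let ?a = "\<lambda>\<sigma> r. r * pw_comb (tube \<sigma>) (r\<^sup>2)"
  let ?a' = "\<lambda>\<sigma> r. pw_comb (tube \<sigma>) (r\<^sup>2) - r\<^sup>2 * pw_comb (pw_diff (tube \<sigma>)) (r\<^sup>2)"
  let ?a'' = "\<lambda>\<sigma> r. r * pw_lap (tube \<sigma>) (r\<^sup>2)"
  have ab: "\<bar>?a \<sigma> r\<bar> \<le> 7 * r" "\<bar>?a \<sigma> r\<bar> \<le> 7" if "r > 0" "\<sigma> = 1 \<or> \<sigma> = - 1" for r \<sigma>
    using tube_bound[OF that(2), of r] that(1) by (auto simp: abs_mult)
  have le: "?a (- 1) r \<le> ?a 1 r" if "r > 0" for r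
    using that barrier_bounds(1)[OF zero_le_power2 \<beta>, of r] by (intro mult_left_mono) (auto simp: tube_eq)
  have between: "\<bar>x\<bar> \<le> 7 * r" "\<bar>x\<bar> \<le> 7" if "r > 0" "?a (- 1) r \<le> x" "x \<le> ?a 1 r" for r x
    using ab[OF that(1), of 1] ab[OF that(1), of "- 1"] that by linarith+
  interpret sub_super_solution 200 "41312 * 7 + 7 * 2401" 7 7 nonlinearity "?a (- 1)" "?a' (- 1)" "?a'' (- 1)"
    "?a 1" "?a' 1" "?a'' 1"
  proof
    fix r :: real assume r: "r > 0"
    show "- 7 * r \<le> ?a (- 1) r" "?a 1 r \<le> 7 * r" using ab[OF r, of 1] ab[OF r, of "- 1"] by linarith+
    show "?a (- 1) r \<le> ?a 1 r" by (rule le[OF r])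
    show "nonlinearity r x \<le> nonlinearity r y" if "?a (- 1) r \<le> x" "x \<le> y" "y \<le> ?a 1 r" for x y
      using between[OF r, of x] between[OF r, of y] that r by (intro nonlinearity_mono) auto
    show "\<bar>nonlinearity r x\<bar> \<le> 41312 * 7 + 7 * 2401" if "?a (- 1) r \<le> x" "x \<le> ?a 1 r" for x
      using between[OF r that] r by (intro nonlinearity_bound)
    have nl: "200\<^sup>2 * (r * x) - nonlinearity r (r * x) = r * (- v r * x + x ^ 5)" for x
      using r by (simp add: nonlinearity_def power_mult_distrib algebra_simps power_numeral_reduce)
    show "200\<^sup>2 * ?a (- 1) r - nonlinearity r (?a (- 1) r) \<le> ?a'' (- 1) r"
      unfolding nl using barrier_inequality[of "- 1" r] r by (intro mult_left_mono) auto
    show "?a'' 1 r \<le> 200\<^sup>2 * ?a 1 r - nonlinearity r (?a 1 r)"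
      unfolding nl using barrier_inequality[of 1 r] r by (intro mult_left_mono) auto
  next
    fix r x :: real
    show "nonlinearity (- r) (- x) = - nonlinearity r x" by (simp add: nonlinearity_def v_even)
    show "continuous_on UNIV (nonlinearity r)"
      unfolding nonlinearity_def[abs_def] divide_inverse by (intro continuous_intros)
  qed (use tube_bound(2) pw_comb_radial_DERIV nonlinearity_continuous in auto)
  obtain w w' where w: "\<And>r. w (- r) = - w r" "\<And>r. (w has_real_derivative w' r) (at r)"
    "\<And>r. (w' has_real_derivative 200\<^sup>2 * w r - nonlinearity r (w r)) (at r)"
    "\<And>r. r > 0 \<Longrightarrow> ?a (- 1) r \<le> w r \<and> w r \<le> ?a 1 r"
    using solution_exists by blast
  have "200\<^sup>2 * w r - nonlinearity r (w r) = - v r * w r + w r ^ 5 / r ^ 4" for r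
    by (simp add: nonlinearity_def algebra_simps)
  with w(3) have "(w' has_real_derivative - v r * w r + w r ^ 5 / r ^ 4) (at r)" for r by metis
  moreover have "\<bar>w r - r * f0 r\<bar> \<le> r * (\<epsilon> * tt r)" if r: "r > 0" for r
  proof -
    have "r * (\<epsilon> * h0 r) \<le> r * (\<epsilon> * tt r)"
      using r barrier_bounds(2)[OF zero_le_power2 \<beta>, of r] by (intro mult_left_mono) auto
    moreover have "?a 1 r = r * f0 r + r * (\<epsilon> * h0 r)" "?a (- 1) r = r * f0 r - r * (\<epsilon> * h0 r)"
      by (simp_all add: tube_eq algebra_simps)
    ultimately show ?thesis using w(4)[OF r] by linarith
  qed
  ultimately show ?thesis using w(1,2) by blast
qed

end

section \<open>Decay and the energy space\<close>

lemma pw_continuous: "continuous_on {0..} (pw a)"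
  by (intro continuous_at_imp_continuous_on ballI DERIV_isCont[OF pw_DERIV]) auto

lemma pw_radial_continuous: "continuous_on UNIV (\<lambda>x :: 'a::real_inner. pw a (x \<bullet> x))"
  by (rule continuous_on_compose2[OF pw_continuous]) (auto intro!: continuous_intros)

lemma pw_radial_measurable [measurable]: "(\<lambda>x :: real ^ 3. pw a (x \<bullet> x)) \<in> borel_measurable borel"
  by (intro borel_measurable_continuous_onI pw_radial_continuous)

lemma pw_4: "s \<ge> 0 \<Longrightarrow> pw 4 s = 1 / (1 + s)\<^sup>2"
  using pw_add[of s 2 2] by (simp add: pw_2 power2_eq_square)

text \<open>The function is at most \<open>16 / 16\<^sup>k\<close> on the smallest ball of radius \<open>2\<^sup>k\<close> containing the point.\<close>

lemma integrable_pw_4: "integrable lborel (\<lambda>x :: real ^ 3. pw 4 (x \<bullet> x))"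
proof -
  define v where "v = unit_ball_vol (real DIM(real ^ 3))"
  have "v \<ge> 0" by (simp add: v_def)
  have [measurable]: "ball (0 :: real ^ 3) R \<in> sets borel" for R by simp
  let ?f = "\<lambda>k (x :: real ^ 3). ennreal (16 / 16 ^ k) * indicator (ball 0 (2 ^ k)) x"
  have le: "ennreal (pw 4 (x \<bullet> x)) \<le> (\<Sum>k. ?f k x)" for x :: "real ^ 3"
  proof -
    define k where "k = (LEAST k. norm x < 2 ^ k)"
    have "\<exists>k. norm x < 2 ^ k" by (rule real_arch_pow) simp
    then have k: "norm x < 2 ^ k" unfolding k_def by (rule LeastI_ex)
    have "pw 4 (x \<bullet> x) \<le> 16 / 16 ^ k"
    proof (cases k)
      case 0
      then show ?thesis using pw_le_1[of "x \<bullet> x" 4] by simp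
    next
      case (Suc j)
      have "\<not> norm x < 2 ^ j" using Suc not_less_Least[of j "\<lambda>k. norm x < 2 ^ k"] by (simp add: k_def)
      then have "(2 ^ j)\<^sup>2 \<le> (norm x)\<^sup>2" by (intro power_mono) auto
      then have "((2 ^ j)\<^sup>2)\<^sup>2 \<le> (1 + x \<bullet> x)\<^sup>2"
        by (intro power_mono) (auto simp: power2_norm_eq_inner)
      moreover have "((2 ^ j)\<^sup>2)\<^sup>2 = (16 :: real) ^ j"
        by (simp flip: power_mult) (simp add: power_mult mult.commute[of j])
      moreover have "1 + x \<bullet> x > 0" by (simp add: add_pos_nonneg)
      ultimately have "1 / (1 + x \<bullet> x)\<^sup>2 \<le> 1 / 16 ^ j"
        by (intro divide_left_mono mult_pos_pos zero_less_power) auto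
      then show ?thesis using Suc by (simp add: pw_4)
    qed
    then have "ennreal (pw 4 (x \<bullet> x)) \<le> ?f k x" using k by (simp add: ennreal_leI)
    also have "\<dots> \<le> (\<Sum>k. ?f k x)"
    proof -
      define F where "F = (\<lambda>k. ?f k x)"
      have "sum F {k} \<le> suminf F" by (rule sum_le_suminf) auto
      then have "F k \<le> suminf F" by simp
      then show ?thesis unfolding F_def .
    qed
    finally show ?thesis .
  qed
  have "(\<integral>\<^sup>+x. ennreal (pw 4 (x \<bullet> x)) \<partial>(lborel :: (real ^ 3) measure)) \<le> (\<integral>\<^sup>+x. (\<Sum>k. ?f k x) \<partial>(lborel :: (real ^ 3) measure))"
    by (intro nn_integral_mono le)
  also have "\<dots> = (\<Sum>k. \<integral>\<^sup>+x. ?f k x \<partial>(lborel :: (real ^ 3) measure))"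
    by (rule nn_integral_suminf) measurable
  also have "\<dots> = (\<Sum>k. ennreal (16 * v * (1 / 2) ^ k))"
  proof (rule suminf_cong)
    fix k
    have "(\<integral>\<^sup>+x. ?f k x \<partial>(lborel :: (real ^ 3) measure)) = ennreal (16 / 16 ^ k) * ennreal (v * (2 ^ k) ^ 3)"
      using emeasure_ball[of "2 ^ k" "0 :: real ^ 3"] by (simp add: nn_integral_cmult_indicator v_def)
    also have "\<dots> = ennreal (16 / 16 ^ k * (v * (2 ^ k) ^ 3))"
      by (rule ennreal_mult[symmetric]) (use \<open>v \<ge> 0\<close> in auto)
    also have "16 / 16 ^ k * (v * (2 ^ k) ^ 3) = 16 * v * (1 / 2) ^ k"
    proof -
      have "((2 :: real) ^ k) ^ 3 = 8 ^ k" by (simp flip: power_mult) (simp add: power_mult mult.commute[of k])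
      moreover have "(8 :: real) ^ k / 16 ^ k = (1 / 2) ^ k" by (simp flip: power_divide)
      ultimately show ?thesis by (simp add: field_simps)
    qed
    finally show "(\<integral>\<^sup>+x. ?f k x \<partial>(lborel :: (real ^ 3) measure)) = ennreal (16 * v * (1 / 2) ^ k)" .
  qed
  also have "\<dots> = ennreal (\<Sum>k. 16 * v * (1 / 2) ^ k)"
    using \<open>v \<ge> 0\<close> by (intro suminf_ennreal2 summable_mult summable_geometric) auto
  also have "\<dots> < \<infinity>" by simp
  finally show ?thesis
    by (intro integrableI_bounded) (auto simp: less_imp_le[OF pw_pos])
qed

lemma integrable_pw_dominated:
  fixes f :: "real ^ 3 \<Rightarrow> real"
  assumes "f \<in> borel_measurable borel" "\<And>x. \<bar>f x\<bar> \<le> C * pw 4 (x \<bullet> x)"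
  shows "integrable lborel f"
proof (rule Bochner_Integration.integrable_bound)
  show "integrable lborel (\<lambda>x :: real ^ 3. C * pw 4 (x \<bullet> x))" using integrable_pw_4 by simp
  show "AE x in lborel. norm (f x) \<le> norm (C * pw 4 (x \<bullet> x))"
    using assms(2) by (auto intro: order_trans[OF _ abs_ge_self])
qed (use assms in auto)

text \<open>The exceptional set for derivatives in direction \<open>i\<close>: a line parallel to
  that axis meets the origin, where the norm is not differentiable, only if it starts here.\<close>

definition axis_line :: "3 \<Rightarrow> (real ^ 3) set"
  where "axis_line i = {x. \<forall>j. j \<noteq> i \<longrightarrow> x $ j = 0}"

lemma axis_line_null: "axis_line i \<in> null_sets lborel"
proof -
  obtain j :: 3 where "j \<noteq> i" by (metis zero_neq_one)
  have "closed (axis_line i)"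
    unfolding axis_line_def Collect_all_eq
    by (intro closed_INT ballI closed_Collect_imp open_Collect_const closed_Collect_eq continuous_intros)
  then have "axis_line i \<in> sets lborel" by simp
  moreover have "negligible (axis_line i)"
    by (rule negligible_subset[OF negligible_standard_hyperplane_cart[of j]])
       (use \<open>j \<noteq> i\<close> in \<open>auto simp: axis_line_def\<close>)
  ultimately show ?thesis by (simp add: negligible_iff_null_sets null_sets_completion_iff)
qed

lemma off_axis_line:
  assumes "x \<notin> axis_line i"
  shows "x + t *\<^sub>R axis i 1 \<noteq> 0"
proof
  assume z: "x + t *\<^sub>R axis i 1 = 0"
  obtain j where "j \<noteq> i" "x $ j \<noteq> 0" using assms by (auto simp: axis_line_def)
  moreover have "(x + t *\<^sub>R axis i 1) $ j = x $ j" using \<open>j \<noteq> i\<close> by (simp add: axis_def)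
  ultimately show False using z by simp
qed

lemma norm_line_DERIV:
  assumes "x + t *\<^sub>R axis i 1 \<noteq> (0 :: real ^ 3)"
  shows "((\<lambda>t. norm (x + t *\<^sub>R axis i 1)) has_real_derivative
    (x + t *\<^sub>R axis i 1) $ i / norm (x + t *\<^sub>R axis i 1)) (at t)"
proof -
  let ?z = "x + t *\<^sub>R axis i 1"
  have "?z \<bullet> ?z > 0" using assms by simp
  note deriv = DERIV_chain2[where f = sqrt and g = "\<lambda>t. (x + t *\<^sub>R axis i 1) \<bullet> (x + t *\<^sub>R axis i 1)" and x = t,
      OF DERIV_real_sqrt[OF this] inner_line_DERIV]
  have "inverse a / 2 * (2 * c) = c / a" for a c :: real
    by (simp add: field_simps)
  then show ?thesis unfolding norm_eq_sqrt_inner by (intro DERIV_cong[OF deriv])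
qed

text \<open>Decay 1 of the function and decay 2 of the gradient put the sixth power and the square,
  respectively, below multiples of the integrable \<open>pw 4\<close>. Serves both the steady state
  and its competitor.\<close>

lemma has_weak_gradient_classical:
  fixes f :: "real ^ 3 \<Rightarrow> real" and G :: "real ^ 3 \<Rightarrow> real ^ 3"
  assumes [measurable]: "f \<in> borel_measurable borel" "G \<in> borel_measurable borel"
    and f: "\<And>x. \<bar>f x\<bar> \<le> C * pw 1 (x \<bullet> x)" and G: "\<And>x. norm (G x) \<le> C * pw 2 (x \<bullet> x)"
    and deriv: "\<And>i x t. x \<notin> axis_line i \<Longrightarrow>
      ((\<lambda>t. f (x + t *\<^sub>R axis i 1)) has_real_derivative G (x + t *\<^sub>R axis i 1) $ i) (at t)"
  shows "has_weak_gradient f G" "in_Lp 6 f" "in_Lp 2 G" "in_Hdot1 f"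
proof -
  have "0 \<le> C * pw 2 (0 \<bullet> (0 :: real ^ 3))" by (rule order_trans[OF norm_ge_zero G])
  then have "C \<ge> 0" using pw_pos[of 0 2] by (simp add: zero_le_mult_iff)
  have G_bd: "norm (G x) \<le> C" for x
  proof -
    have "norm (G x) \<le> C * pw 2 (x \<bullet> x)" by (rule G)
    also have "\<dots> \<le> C" using pw_le_1[of "x \<bullet> x" 2] \<open>C \<ge> 0\<close> by (simp add: mult_left_le)
    finally show ?thesis .
  qed
  have G_comp: "\<bar>G x $ i\<bar> \<le> C" for x i
    using component_le_norm_cart[of "G x" i] G_bd[of x] by linarith
  have f_bd: "\<bar>f x\<bar> \<le> C" for x
    using f[of x] pw_le_1[of "x \<bullet> x" 1] \<open>C \<ge> 0\<close> by (meson mult_left_le order_trans inner_ge_zero zero_le_one)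
  have comp_meas: "(\<lambda>x. G x $ i) \<in> borel_measurable borel" for i
  proof -
    have "(\<lambda>x. G x \<bullet> axis i 1) \<in> borel_measurable borel" by measurable
    then show ?thesis by (simp add: inner_axis)
  qed
  have li: "locally_integrable f"
    by (rule loc_bounded_imp_locally_integrable) (use f_bd loc_bounded_bounded in auto)
  have liG: "locally_integrable G"
    unfolding locally_integrable_def
  proof (intro conjI allI impI)
    fix K :: "(real ^ 3) set" assume K: "compact K"
    have "locally_integrable (\<lambda>x. norm (G x))"
      by (rule loc_bounded_imp_locally_integrable) (use G_bd in \<open>auto intro!: loc_bounded_bounded[of _ C]\<close>)
    then have "set_integrable lborel K (\<lambda>x. norm (G x))"
      using K by (simp add: locally_integrable_def)
    moreover have [measurable]: "K \<in> sets borel" using K by (simp add: borel_compact)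
    ultimately show "set_integrable lborel K G"
      unfolding set_integrable_def
      by (elim Bochner_Integration.integrable_bound) simp_all
  qed auto
  show wg: "has_weak_gradient f G"
    unfolding has_weak_gradient_def
  proof (intro conjI allI impI li liG)
    fix \<eta> :: "real ^ 3 \<Rightarrow> real" and i assume \<eta>: "test_function \<eta>"
    have lb: "loc_bounded f" "loc_bounded (\<lambda>x. G x $ i)"
      using f_bd G_comp by (auto intro!: loc_bounded_bounded[of _ C])
    show "(\<integral>x. f x * partial i \<eta> x \<partial>lborel) = - (\<integral>x. G x $ i * \<eta> x \<partial>lborel)"
      by (rule integration_by_parts[OF assms(1) comp_meas lb axis_line_null deriv \<eta>])
  qed
  have p4: "pw 1 (x \<bullet> x) ^ 6 \<le> pw 4 (x \<bullet> x)" for x :: "real ^ 3"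
  proof -
    have "pw 1 (x \<bullet> x) ^ 6 = pw 2 (x \<bullet> x) * pw 4 (x \<bullet> x)"
      using pw_odd(7)[of "x \<bullet> x"] power_mult[of "pw 1 (x \<bullet> x)" 2 3] pw_add[of "x \<bullet> x" 2 2]
      by (simp add: power3_eq_cube)
    also have "\<dots> \<le> 1 * pw 4 (x \<bullet> x)"
      using pw_le_1[of "x \<bullet> x" 2] pw_pos[of "x \<bullet> x" 4] by (intro mult_right_mono) auto
    finally show ?thesis by simp
  qed
  have "integrable lborel (\<lambda>x. norm (f x) ^ 6)"
  proof (rule integrable_pw_dominated[of _ "C ^ 6"])
    fix x
    have "\<bar>f x\<bar> ^ 6 \<le> (C * pw 1 (x \<bullet> x)) ^ 6" by (intro power_mono f) auto
    also have "\<dots> \<le> C ^ 6 * pw 4 (x \<bullet> x)"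
      using p4[of x] \<open>C \<ge> 0\<close> by (simp add: power_mult_distrib mult_left_mono)
    finally show "\<bar>norm (f x) ^ 6\<bar> \<le> C ^ 6 * pw 4 (x \<bullet> x)" by simp
  qed measurable
  then show L6: "in_Lp 6 f" by (simp add: in_Lp_def)
  have "integrable lborel (\<lambda>x. norm (G x) ^ 2)"
  proof (rule integrable_pw_dominated[of _ "C\<^sup>2"])
    fix x
    have "norm (G x) ^ 2 \<le> (C * pw 2 (x \<bullet> x)) ^ 2" by (intro power_mono G) auto
    also have "\<dots> = C\<^sup>2 * pw 4 (x \<bullet> x)"
      using pw_add[of "x \<bullet> x" 2 2] by (simp add: power2_eq_square)
    finally show "\<bar>norm (G x) ^ 2\<bar> \<le> C\<^sup>2 * pw 4 (x \<bullet> x)" by simp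
  qed measurable
  then show L2: "in_Lp 2 G" by (simp add: in_Lp_def)
  show "in_Hdot1 f" unfolding in_Hdot1_def using L6 wg L2 by blast
qed

section \<open>Radial steady states\<close>

locale radial_steady_state = near_base_potential +
  fixes w w' :: "real \<Rightarrow> real"
  assumes w_odd: "\<And>r. w (- r) = - w r"
    and w_deriv: "\<And>r. (w has_real_derivative w' r) (at r)"
    and w'_deriv: "\<And>r. (w' has_real_derivative - v r * w r + w r ^ 5 / r ^ 4) (at r)"
    and w_near: "\<And>r. r > 0 \<Longrightarrow> \<bar>w r - r * pw_comb profile (r\<^sup>2)\<bar> \<le> r * ((1 / 10000) * pw 1 (r\<^sup>2))"
begin

definition p :: "real \<Rightarrow> real" where "p r = (if r = 0 then w' 0 else w r / r)"
definition g :: "real \<Rightarrow> real" where "g r = - v r * p r + p r ^ 5"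
text \<open>For \<open>r > 0\<close> this is \<open>r^2 * p' r\<close>, the flux of the gradient of
  \<phi> through the sphere of radius \<open>r\<close> up to the factor 4 pi. Without a quotient it
  is differentiable at 0 as well. The function \<open>q\<close> is then \<open>p' r / r\<close>, and
  \<open>G\<close> the gradient.\<close>

definition D :: "real \<Rightarrow> real" where "D r = r * w' r - w r"
definition q :: "real \<Rightarrow> real" where "q r = D r / r ^ 3"
definition \<phi> :: "real ^ 3 \<Rightarrow> real" where "\<phi> x = p (norm x)"
definition G :: "real ^ 3 \<Rightarrow> real ^ 3" where "G x = q (norm x) *\<^sub>R x"
definition V :: "real ^ 3 \<Rightarrow> real" where "V x = v (norm x)"

section \<open>Regularity and decay of the radial profile\<close>

lemma w_0: "w 0 = 0"
  using w_odd[of 0] by simp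

lemma w_cont: "continuous_on UNIV w" "continuous_on UNIV w'"
  using DERIV_isCont[OF w_deriv] DERIV_isCont[OF w'_deriv] by (auto intro: continuous_at_imp_continuous_on)

lemma p_0: "p 0 = w' 0"
  by (simp add: p_def)

lemma p_cont: "continuous_on UNIV p"
proof (rule continuous_at_imp_continuous_on, rule ballI)
  fix r
  show "isCont p r"
  proof (cases "r = 0")
    case True
    have "((\<lambda>h. (w (0 + h) - w 0) / h) \<longlongrightarrow> w' 0) (at 0)"
      using w_deriv[of 0] by (simp add: DERIV_def)
    then have "(p \<longlongrightarrow> w' 0) (at 0)"
      by (rule Lim_transform_eventually) (auto simp: eventually_at_filter p_def w_0)
    then show ?thesis using True by (simp add: isCont_def p_0)
  next
    case False
    then have "isCont (\<lambda>r. w r / r) r" using w_deriv DERIV_isCont by (auto intro!: continuous_intros)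
    moreover have "eventually (\<lambda>s. p s = w s / s) (nhds r)"
      using False by (auto simp: eventually_nhds p_def intro!: exI[of _ "- {0}"])
    ultimately show ?thesis by (simp add: isCont_cong)
  qed
qed

text \<open>At \<open>r = 0\<close>, where \<open>w_near\<close> gives no information, the bound
  follows by continuity.\<close>

lemma p_near: "r \<ge> 0 \<Longrightarrow> \<bar>p r - pw_comb profile (r\<^sup>2)\<bar> \<le> (1 / 10000) * pw 1 (r\<^sup>2)"
proof -
  have pos: "\<bar>p r - pw_comb profile (r\<^sup>2)\<bar> \<le> (1 / 10000) * pw 1 (r\<^sup>2)" if "r > 0" for r
  proof -
    have "r * \<bar>p r - pw_comb profile (r\<^sup>2)\<bar> = \<bar>r * (p r - pw_comb profile (r\<^sup>2))\<bar>"
      using that by (simp add: abs_mult)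
    also have "r * (p r - pw_comb profile (r\<^sup>2)) = w r - r * pw_comb profile (r\<^sup>2)"
      using that by (simp add: p_def right_diff_distrib)
    also have "\<bar>w r - r * pw_comb profile (r\<^sup>2)\<bar> \<le> r * ((1 / 10000) * pw 1 (r\<^sup>2))" by (rule w_near[OF that])
    finally show ?thesis using that by (simp only: mult_le_cancel_left_pos)
  qed
  assume "r \<ge> 0"
  show ?thesis
  proof (cases "r = 0")
    case True
    have cont: "continuous_on UNIV (\<lambda>r. pw_comb profile (r\<^sup>2))" "continuous_on UNIV (\<lambda>r :: real. pw 1 (r\<^sup>2))"
      by (rule continuous_on_compose2[OF pw_comb_continuous] continuous_on_compose2[OF pw_continuous];
          auto intro!: continuous_intros)+
    have "isCont (\<lambda>r. \<bar>p r - pw_comb profile (r\<^sup>2)\<bar>) 0" "isCont (\<lambda>r :: real. (1 / 10000) * pw 1 (r\<^sup>2)) 0"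
      using cont p_cont by (auto intro!: continuous_intros simp: continuous_on_eq_continuous_at)
    then have lims: "((\<lambda>r. \<bar>p r - pw_comb profile (r\<^sup>2)\<bar>) \<longlongrightarrow> \<bar>p 0 - pw_comb profile (0\<^sup>2)\<bar>) (at_right 0)"
      "((\<lambda>r. (1 / 10000) * pw 1 (r\<^sup>2)) \<longlongrightarrow> (1 / 10000) * pw 1 (0\<^sup>2)) (at_right (0 :: real))"
      by (auto simp: isCont_def intro: filterlim_mono at_le)
    have "\<bar>p 0 - pw_comb profile (0\<^sup>2)\<bar> \<le> (1 / 10000) * pw 1 (0\<^sup>2)"
      by (rule tendsto_le[OF trivial_limit_at_right_real lims(2,1)])
         (use pos in \<open>auto simp: eventually_at_right_field intro!: exI[of _ 1]\<close>)
    then show ?thesis using True by simp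
  next
    case False
    then show ?thesis using \<open>r \<ge> 0\<close> pos by simp
  qed
qed

lemma p_bound: "r \<ge> 0 \<Longrightarrow> \<bar>p r\<bar> \<le> 7 * pw 1 (r\<^sup>2)"
  using p_near[of r] profile_eq(3)[of "r\<^sup>2"] pw_pos[of "r\<^sup>2" 1] zero_le_power2[of r] by linarith

lemma g_cont: "continuous_on UNIV g"
  unfolding g_def by (intro continuous_intros v_cont p_cont)

lemma w'_deriv': "(w' has_real_derivative r * g r) (at r)"
proof -
  have "- v r * w r + w r ^ 5 / r ^ 4 = r * g r"
    by (cases "r = 0") (auto simp: g_def p_def w_0 power_divide algebra_simps power_numeral_reduce)
  then show ?thesis using w'_deriv[of r] by simp
qed

lemma v_decay: "\<bar>v r\<bar> \<le> 1312 * pw \<beta> (r\<^sup>2)"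
proof -
  have s: "r\<^sup>2 \<ge> 0" by simp
  have "(y0 (r\<^sup>2))\<^sup>2 = pw 4 (r\<^sup>2)"
    using pw_add[OF s, of 2 2] by (simp add: y0_def power2_eq_square)
  also have "\<dots> \<le> pw \<beta> (r\<^sup>2)" using \<beta> by (intro pw_mono) auto
  finally have "(y0 (r\<^sup>2))\<^sup>2 * (15 + 1296 * (z0 (r\<^sup>2)) ^ 4) \<le> pw \<beta> (r\<^sup>2) * (15 + 1296 * 1)"
    using z0_bounds[OF s] pw_pos[OF s, of \<beta>] by (intro mult_mono add_mono) auto
  then have "base_potential (r\<^sup>2) \<le> 1311 * pw \<beta> (r\<^sup>2)" "0 \<le> base_potential (r\<^sup>2)"
    by (auto simp: base_potential_def)
  moreover have "\<delta> * pw \<beta> (r\<^sup>2) \<le> 1 * pw \<beta> (r\<^sup>2)"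
    using gain_nonneg(3) pw_pos[OF s, of \<beta>] by (intro mult_right_mono) auto
  ultimately show ?thesis using v_near[of r] by linarith
qed

text \<open>The potential term decays with exponent \<open>\<beta> + 1\<close>, and \<phi>^5 with
  exponent 5, which is no smaller since \<beta> is at most 5/2. Here 25991 = 7 * 1312 + 7^5. An
  exponent above 3 makes the total flux finite.\<close>

lemma g_decay: "r \<ge> 0 \<Longrightarrow> \<bar>g r\<bar> \<le> 25991 * pw (\<beta> + 1) (r\<^sup>2)"
proof -
  assume r: "r \<ge> 0"
  have s: "r\<^sup>2 \<ge> 0" by simp
  note pos = pw_pos[OF s]
  have "\<bar>v r * p r\<bar> \<le> (1312 * pw \<beta> (r\<^sup>2)) * (7 * pw 1 (r\<^sup>2))"
    unfolding abs_mult using v_decay[of r] p_bound[OF r] pos[of \<beta>] by (intro mult_mono) auto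
  also have "\<dots> = 9184 * pw (\<beta> + 1) (r\<^sup>2)" by (simp add: pw_add)
  finally have 1: "\<bar>v r * p r\<bar> \<le> 9184 * pw (\<beta> + 1) (r\<^sup>2)" .
  have "\<bar>p r ^ 5\<bar> \<le> (7 * pw 1 (r\<^sup>2)) ^ 5"
    unfolding power_abs using p_bound[OF r] by (intro power_mono) auto
  also have "\<dots> = 16807 * pw 5 (r\<^sup>2)"
    using pw_odd(2,7)[OF s] by (simp add: power_mult_distrib power_numeral_reduce)
  also have "\<dots> \<le> 16807 * pw (\<beta> + 1) (r\<^sup>2)" using \<beta> by (intro mult_left_mono pw_mono) auto
  finally have "\<bar>p r ^ 5\<bar> \<le> 16807 * pw (\<beta> + 1) (r\<^sup>2)" .
  with 1 show ?thesis unfolding g_def by linarith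
qed

lemma D_0: "D 0 = 0"
  by (simp add: D_def w_0)

lemma D_deriv: "(D has_real_derivative r\<^sup>2 * g r) (at r)"
  unfolding D_def by (rule derivative_eq_intros w_deriv w'_deriv' refl)+ (simp add: power2_eq_square)

lemma D_compare:
  assumes "r \<ge> 0" and B: "\<And>s. s \<ge> 0 \<Longrightarrow> (B has_real_derivative B' s) (at s)"
    and le: "\<And>s. s \<ge> 0 \<Longrightarrow> s\<^sup>2 * \<bar>g s\<bar> \<le> B' s"
  shows "\<bar>D r\<bar> \<le> B r - B 0"
proof -
  have "\<sigma> * D r - B r \<le> \<sigma> * D 0 - B 0" if "\<sigma> = 1 \<or> \<sigma> = - 1" for \<sigma>
  proof (rule DERIV_nonpos_imp_nonincreasing[OF \<open>r \<ge> 0\<close>])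
    fix s :: real assume s: "0 \<le> s"
    have "((\<lambda>r. \<sigma> * D r - B r) has_real_derivative \<sigma> * (s\<^sup>2 * g s) - B' s) (at s)"
      by (intro DERIV_diff DERIV_cmult D_deriv B s)
    moreover have "s\<^sup>2 * (\<sigma> * g s) \<le> s\<^sup>2 * \<bar>g s\<bar>"
      using that by (intro mult_left_mono) auto
    then have "\<sigma> * (s\<^sup>2 * g s) \<le> s\<^sup>2 * \<bar>g s\<bar>" by (simp add: mult.left_commute)
    ultimately show "\<exists>y. ((\<lambda>r. \<sigma> * D r - B r) has_real_derivative y) (at s) \<and> y \<le> 0"
      using le[OF s] by (intro exI conjI) auto
  qed
  from this[of 1] this[of "- 1"] show ?thesis by (simp add: D_0)
qed

text \<open>The flux is the integral of \<open>s^2 * g s\<close> from 0. Bounded \<open>g\<close>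
  gives the cubic bound near the origin; \<open>s^2 * g s\<close> is of order
  \<open>s powr (1 - \<beta>)\<close> at infinity and thus integrable for \<beta> > 2, so the flux
  stays bounded.\<close>

lemma D_bounds:
  obtains K where "K > 0" "\<And>r. r \<ge> 0 \<Longrightarrow> \<bar>D r\<bar> \<le> K" "\<And>r. r \<ge> 0 \<Longrightarrow> \<bar>D r\<bar> \<le> K * r ^ 3"
proof -
  have C: "\<bar>D r\<bar> \<le> 25991 * r ^ 3" if "r \<ge> 0" for r
  proof -
    have "\<bar>D r\<bar> \<le> 25991 * r ^ 3 - 25991 * 0 ^ 3"
    proof (rule D_compare[OF that])
      show "((\<lambda>s. 25991 * s ^ 3) has_real_derivative 77973 * s\<^sup>2) (at s)" for s :: real
        by (auto intro!: derivative_eq_intros)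
      fix s :: real assume "s \<ge> 0"
      have "\<bar>g s\<bar> \<le> 25991 * 1"
        using g_decay[OF \<open>s \<ge> 0\<close>] pw_le_1[of "s\<^sup>2" "\<beta> + 1"] \<beta> by (smt (verit) zero_le_power2)
      then have "s\<^sup>2 * \<bar>g s\<bar> \<le> s\<^sup>2 * 77973" by (intro mult_left_mono) auto
      then show "s\<^sup>2 * \<bar>g s\<bar> \<le> 77973 * s\<^sup>2" by simp
    qed
    then show ?thesis by simp
  qed
  \<comment> \<open>Chosen so that \<open>- k * (1 + s) powr (2 - \<beta>)\<close> has derivative
    \<open>51982 * (1 + s) powr (1 - \<beta>)\<close>. The doubling of 25991 comes from comparing
    \<open>1 + s^2\<close> with \<open>(1 + s)^2\<close>.\<close>
  define k where "k = 2 * 25991 / (\<beta> - 2)"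
  have k: "k > 0" using \<beta> by (simp add: k_def)
  have bounded: "\<bar>D r\<bar> \<le> k" if "r \<ge> 0" for r
  proof -
    have "\<bar>D r\<bar> \<le> - k * (1 + r) powr (2 - \<beta>) - (- k * (1 + 0) powr (2 - \<beta>))"
    proof (rule D_compare[OF that])
      fix s :: real assume s: "s \<ge> 0"
      have "((\<lambda>s. (1 + s) powr (2 - \<beta>)) has_real_derivative (2 - \<beta>) * (1 + s) powr (2 - \<beta> - 1)) (at s)"
      proof -
        have "((\<lambda>s. 1 + s) has_real_derivative 1) (at s)" by (auto intro!: derivative_eq_intros)
        from DERIV_chain2[where f = "\<lambda>z. z powr (2 - \<beta>)" and g = "\<lambda>s. 1 + s" and x = s,
            OF has_real_derivative_powr this] s
        show ?thesis by simp
      qed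
      then have "((\<lambda>s. - k * (1 + s) powr (2 - \<beta>)) has_real_derivative - k * ((2 - \<beta>) * (1 + s) powr (2 - \<beta> - 1))) (at s)"
        by (rule DERIV_cmult)
      moreover have "- k * ((2 - \<beta>) * (1 + s) powr (2 - \<beta> - 1)) = 51982 * (1 + s) powr (1 - \<beta>)"
        using \<beta> by (simp add: k_def field_simps)
      ultimately show "((\<lambda>s. - k * (1 + s) powr (2 - \<beta>)) has_real_derivative 51982 * (1 + s) powr (1 - \<beta>)) (at s)" by simp
      have s2: "s\<^sup>2 \<ge> 0" by simp
      have "(1 + s)\<^sup>2 / 2 \<le> 1 + s\<^sup>2"
      proof -
        have "0 \<le> (1 - s)\<^sup>2" by simp
        then show ?thesis by (simp add: power2_eq_square algebra_simps)
      qed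
      then have "pw (\<beta> - 1) (s\<^sup>2) \<le> ((1 + s)\<^sup>2 / 2) powr (- (\<beta> - 1) / 2)"
        unfolding pw_def using s \<beta> by (intro powr_mono2') auto
      also have "\<dots> = ((1 + s)\<^sup>2) powr (- (\<beta> - 1) / 2) / 2 powr (- (\<beta> - 1) / 2)"
        using s by (simp add: powr_divide)
      also have "((1 + s)\<^sup>2) powr (- (\<beta> - 1) / 2) = (1 + s) powr (1 - \<beta>)"
      proof -
        have "(1 + s)\<^sup>2 = (1 + s) powr 2" using s by simp
        moreover have "2 * (- (\<beta> - 1) / 2) = 1 - \<beta>"
          unfolding times_divide_eq_right by (subst nonzero_mult_div_cancel_left) auto
        ultimately show ?thesis by (simp only: powr_powr)
      qed
      also have "(1 + s) powr (1 - \<beta>) / 2 powr (- (\<beta> - 1) / 2) = (1 + s) powr (1 - \<beta>) * 2 powr ((\<beta> - 1) / 2)"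
      proof -
        have e: "2 powr (- (\<beta> - 1) / 2) = 1 / 2 powr ((\<beta> - 1) / 2)"
          unfolding minus_divide_left[symmetric] by (rule powr_minus_divide)
        have "a / (1 / b) = a * b" for a b :: real by simp
        then show ?thesis unfolding e .
      qed
      also have "\<dots> \<le> (1 + s) powr (1 - \<beta>) * 2"
      proof -
        have "2 powr ((\<beta> - 1) / 2) \<le> (2 :: real) powr 1" using \<beta> by (intro powr_mono) auto
        then show ?thesis by (intro mult_left_mono) auto
      qed
      finally have 1: "pw (\<beta> - 1) (s\<^sup>2) \<le> (1 + s) powr (1 - \<beta>) * 2" .
      have "\<beta> + 1 = (\<beta> - 1) + 2" by simp
      then have "pw (\<beta> + 1) (s\<^sup>2) = pw (\<beta> - 1) (s\<^sup>2) * y0 (s\<^sup>2)" by (simp only: pw_add[OF s2] y0_def)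
      then have "s\<^sup>2 * pw (\<beta> + 1) (s\<^sup>2) = pw (\<beta> - 1) (s\<^sup>2) * (s\<^sup>2 * y0 (s\<^sup>2))" by simp
      also have "\<dots> \<le> pw (\<beta> - 1) (s\<^sup>2) * 1"
        using y0_bounds[OF s2] pw_pos[OF s2, of "\<beta> - 1"] by (intro mult_left_mono) auto
      finally have "s\<^sup>2 * pw (\<beta> + 1) (s\<^sup>2) \<le> (1 + s) powr (1 - \<beta>) * 2" using 1 by simp
      then have "25991 * (s\<^sup>2 * pw (\<beta> + 1) (s\<^sup>2)) \<le> 25991 * ((1 + s) powr (1 - \<beta>) * 2)" by simp
      moreover have "s\<^sup>2 * \<bar>g s\<bar> \<le> s\<^sup>2 * (25991 * pw (\<beta> + 1) (s\<^sup>2))"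
        by (intro mult_left_mono g_decay s) auto
      ultimately show "s\<^sup>2 * \<bar>g s\<bar> \<le> 51982 * (1 + s) powr (1 - \<beta>)" by simp
    qed
    also have "\<dots> \<le> k" using k by simp
    finally show ?thesis .
  qed
  show ?thesis
  proof (rule that[of "max k 25991"])
    show "max k 25991 > 0" by simp
    show "\<bar>D r\<bar> \<le> max k 25991" if "r \<ge> 0" for r using bounded[OF that] by simp
    show "\<bar>D r\<bar> \<le> max k 25991 * r ^ 3" if "r \<ge> 0" for r
    proof -
      have "25991 * r ^ 3 \<le> max k 25991 * r ^ 3" using that by (intro mult_right_mono) auto
      then show ?thesis using C[OF that] by linarith
    qed
  qed
qed

text \<open>The bounded flux gives decay 3 at infinity and the cubic bound gives boundedness at the
  origin; they are joined at \<open>r = 1\<close>, where \<open>2 * sqrt 2 \<le> 3\<close> supplies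
  the factor 3.\<close>

lemma q_bounds:
  obtains K where "K > 0" "\<And>r. r \<ge> 0 \<Longrightarrow> \<bar>q r\<bar> \<le> K * pw 3 (r\<^sup>2)" "\<And>r. r \<ge> 0 \<Longrightarrow> \<bar>q r\<bar> \<le> K"
    "\<And>r. r > 0 \<Longrightarrow> \<bar>D r / r\<^sup>2\<bar> \<le> K"
proof -
  obtain K where K: "K > 0" "\<And>r. r \<ge> 0 \<Longrightarrow> \<bar>D r\<bar> \<le> K" "\<And>r. r \<ge> 0 \<Longrightarrow> \<bar>D r\<bar> \<le> K * r ^ 3"
    by (rule D_bounds) (rule that)
  have q1: "\<bar>q r\<bar> \<le> K" if "r \<ge> 0" for r
    using K(3)[OF that] that K(1) by (cases "r = 0") (auto simp: q_def field_simps)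
  have q2: "\<bar>q r\<bar> \<le> K / r ^ 3" if "r > 0" for r
    using K(2)[of r] that by (simp add: q_def divide_right_mono)
  have pw3: "pw 3 (r\<^sup>2) = 1 / sqrt (1 + r\<^sup>2) ^ 3" for r :: real
  proof -
    have "1 + r\<^sup>2 > 0" using zero_le_power2[of r] by linarith
    then have "(1 + r\<^sup>2) powr (3 / 2) = sqrt (1 + r\<^sup>2) ^ 3"
      by (simp add: powr_half_sqrt[symmetric] powr_powr flip: powr_numeral)
    then show ?thesis by (simp add: pw_def powr_minus_divide)
  qed
  have q3: "\<bar>q r\<bar> \<le> 3 * K * pw 3 (r\<^sup>2)" if "r \<ge> 0" for r
  proof (cases "r \<le> 1")
    case True
    have "r\<^sup>2 \<le> 1" using True that by (simp add: power_le_one)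
    then have "sqrt (1 + r\<^sup>2) \<le> sqrt 2" by (intro real_sqrt_le_mono) simp
    then have "sqrt (1 + r\<^sup>2) ^ 3 \<le> sqrt 2 ^ 3" by (intro power_mono) auto
    also have "sqrt 2 ^ 3 = 2 * sqrt 2" by (simp add: power3_eq_cube)
    also have "\<dots> \<le> 3" by (rule power2_le_imp_le) (auto simp: power_mult_distrib)
    finally have le: "sqrt (1 + r\<^sup>2) ^ 3 \<le> 3" .
    have pos: "sqrt (1 + r\<^sup>2) ^ 3 > 0" using zero_le_power2[of r] by (intro zero_less_power) (simp add: add_pos_nonneg)
    have "1 \<le> 3 * pw 3 (r\<^sup>2)" using le pos by (simp add: pw3 field_simps)
    then have "K * 1 \<le> K * (3 * pw 3 (r\<^sup>2))" using K(1) by (intro mult_left_mono) auto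
    then show ?thesis using q1[OF that] by simp
  next
    case False
    then have r: "r > 1" by simp
    have "r\<^sup>2 > 1" using r by simp
    then have "sqrt (1 + r\<^sup>2) \<le> sqrt (2 * r\<^sup>2)" by (intro real_sqrt_le_mono) simp
    also have "\<dots> = sqrt 2 * r" using r by (simp add: real_sqrt_mult)
    finally have "sqrt (1 + r\<^sup>2) ^ 3 \<le> (sqrt 2 * r) ^ 3" by (intro power_mono) auto
    also have "\<dots> = 2 * sqrt 2 * r ^ 3" by (simp add: power3_eq_cube)
    also have "\<dots> \<le> 3 * r ^ 3"
    proof -
      have "2 * sqrt 2 \<le> 3" by (rule power2_le_imp_le) (auto simp: power_mult_distrib)
      then show ?thesis using r by (intro mult_right_mono) auto
    qed
    finally have le: "sqrt (1 + r\<^sup>2) ^ 3 \<le> 3 * r ^ 3" .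
    have pos: "sqrt (1 + r\<^sup>2) ^ 3 > 0" using \<open>r\<^sup>2 > 1\<close> by simp
    have "1 / r ^ 3 \<le> 3 * pw 3 (r\<^sup>2)" using le pos r by (simp add: pw3 field_simps)
    then have "K * (1 / r ^ 3) \<le> K * (3 * pw 3 (r\<^sup>2))" using K(1) by (intro mult_left_mono) auto
    then show ?thesis using q2[of r] r by simp
  qed
  have q4: "\<bar>D r / r\<^sup>2\<bar> \<le> K" if "r > 0" for r
  proof (cases "r \<le> 1")
    case True
    have "\<bar>D r / r\<^sup>2\<bar> = \<bar>q r\<bar> * r" using that by (simp add: q_def abs_mult power2_eq_square power3_eq_cube)
    also have "\<dots> \<le> K * 1" using q1[of r] that True K(1) by (intro mult_mono) auto
    finally show ?thesis by simp
  next
    case False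
    then have "\<bar>D r / r\<^sup>2\<bar> \<le> \<bar>D r\<bar>" using that by (simp add: divide_le_eq mult_le_cancel_left1)
    then show ?thesis using K(2)[of r] that by linarith
  qed
  have "K \<le> 3 * K" using K(1) by simp
  then show ?thesis
    using K(1) q3 order_trans[OF q1] order_trans[OF q4] by (intro that[of "3 * K"]) auto
qed

lemma p_deriv: "r > 0 \<Longrightarrow> (p has_real_derivative D r / r\<^sup>2) (at r)"
proof -
  assume r: "r > 0"
  have "((\<lambda>r. w r / r) has_real_derivative D r / r\<^sup>2) (at r)"
    using r by (auto intro!: derivative_eq_intros w_deriv simp: D_def power2_eq_square algebra_simps)
  then show ?thesis
    by (rule has_field_derivative_transform_within_open[of _ _ _ "{0<..}"]) (use r in \<open>auto simp: p_def\<close>)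
qed

lemma q_deriv: "r > 0 \<Longrightarrow> (q has_real_derivative g r / r - 3 * D r / r ^ 4) (at r)"
  unfolding q_def
  by (rule derivative_eq_intros D_deriv refl | simp)+ (simp add: field_simps power_numeral_reduce)

definition dG :: "3 \<Rightarrow> real ^ 3 \<Rightarrow> real"
  where "dG i x = q (norm x) + (g (norm x) / norm x - 3 * D (norm x) / norm x ^ 4) * ((x $ i)\<^sup>2 / norm x)"

section \<open>From the radial profile to functions on three-space\<close>

lemma measurables [measurable]:
  "w \<in> borel_measurable borel" "w' \<in> borel_measurable borel" "p \<in> borel_measurable borel"
  "g \<in> borel_measurable borel" "D \<in> borel_measurable borel" "q \<in> borel_measurable borel"
  "v \<in> borel_measurable borel" "\<phi> \<in> borel_measurable borel" "G \<in> borel_measurable borel"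
  "V \<in> borel_measurable borel" "dG i \<in> borel_measurable borel"
proof -
  show [measurable]: "w \<in> borel_measurable borel" "w' \<in> borel_measurable borel" "p \<in> borel_measurable borel"
    "g \<in> borel_measurable borel" "v \<in> borel_measurable borel"
    using w_cont p_cont g_cont v_cont by (auto intro: borel_measurable_continuous_onI)
  show [measurable]: "D \<in> borel_measurable borel" unfolding D_def by measurable
  show [measurable]: "q \<in> borel_measurable borel" unfolding q_def by measurable
  show "\<phi> \<in> borel_measurable borel" "G \<in> borel_measurable borel" "V \<in> borel_measurable borel"
    unfolding \<phi>_def G_def V_def by measurable
  have [measurable]: "(\<lambda>x :: real ^ 3. x $ i) \<in> borel_measurable borel"
    by (intro borel_measurable_continuous_onI continuous_intros)
  show "dG i \<in> borel_measurable borel" unfolding dG_def by measurable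
qed

lemma continuous_\<phi>_V: "continuous_on UNIV \<phi>" "continuous_on UNIV V"
  unfolding \<phi>_def V_def
  by (rule continuous_on_compose2[OF p_cont] continuous_on_compose2[OF v_cont]; auto intro!: continuous_intros)+

lemma \<phi>_bound: "\<bar>\<phi> x\<bar> \<le> 7 * pw 1 (x \<bullet> x)"
  using p_bound[of "norm x"] by (simp add: \<phi>_def power2_norm_eq_inner)

lemma V_bound: "\<bar>V x\<bar> \<le> 1312 * pw \<beta> (x \<bullet> x)"
  using v_decay[of "norm x"] by (simp add: V_def power2_norm_eq_inner)

lemma norm_pw: "norm x * pw 3 (x \<bullet> x) \<le> pw 2 (x \<bullet> x)"
proof -
  have s: "x \<bullet> x \<ge> 0" by simp
  have "(norm x * pw 1 (x \<bullet> x))\<^sup>2 = (x \<bullet> x) * y0 (x \<bullet> x)"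
    using pw_odd(7)[OF s] by (simp add: power_mult_distrib power2_norm_eq_inner y0_def)
  also have "\<dots> \<le> 1\<^sup>2" using y0_bounds[OF s] by simp
  finally have "norm x * pw 1 (x \<bullet> x) \<le> 1" by (rule power2_le_imp_le) simp
  then have "norm x * pw 1 (x \<bullet> x) * pw 2 (x \<bullet> x) \<le> 1 * pw 2 (x \<bullet> x)"
    using pw_pos[OF s, of 2] by (intro mult_right_mono) auto
  then show ?thesis using pw_odd(1)[OF s] by simp
qed

lemma G_bound:
  obtains K where "K > 0" "\<And>x. norm (G x) \<le> K * pw 2 (x \<bullet> x)"
proof -
  obtain K where K: "K > 0" "\<And>r. r \<ge> 0 \<Longrightarrow> \<bar>q r\<bar> \<le> K * pw 3 (r\<^sup>2)" "\<And>r. r \<ge> 0 \<Longrightarrow> \<bar>q r\<bar> \<le> K"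
    "\<And>r. r > 0 \<Longrightarrow> \<bar>D r / r\<^sup>2\<bar> \<le> K"
    by (rule q_bounds) (rule that)
  have "norm (G x) \<le> K * pw 2 (x \<bullet> x)" for x
  proof -
    have "norm (G x) = \<bar>q (norm x)\<bar> * norm x" by (simp add: G_def)
    also have "\<dots> \<le> K * pw 3 (x \<bullet> x) * norm x"
      using K(2)[of "norm x"] by (intro mult_right_mono) (auto simp: power2_norm_eq_inner)
    also have "\<dots> \<le> K * pw 2 (x \<bullet> x)"
      using mult_left_mono[OF norm_pw[of x], of K] K(1) by (simp add: mult_ac)
    finally show ?thesis .
  qed
  with K(1) show ?thesis by (rule that)
qed

lemma \<phi>_line_DERIV:
  assumes "x + t *\<^sub>R axis i 1 \<noteq> 0"
  shows "((\<lambda>t. \<phi> (x + t *\<^sub>R axis i 1)) has_real_derivative G (x + t *\<^sub>R axis i 1) $ i) (at t)"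
proof -
  let ?z = "x + t *\<^sub>R axis i 1"
  have r: "norm ?z > 0" using assms by simp
  have "((\<lambda>t. p (norm (x + t *\<^sub>R axis i 1))) has_real_derivative D (norm ?z) / (norm ?z)\<^sup>2 * (?z $ i / norm ?z)) (at t)"
    by (rule DERIV_chain2[OF p_deriv[OF r] norm_line_DERIV[OF assms]])
  moreover have "D (norm ?z) / (norm ?z)\<^sup>2 * (?z $ i / norm ?z) = G ?z $ i"
    by (simp add: G_def q_def power2_eq_square power3_eq_cube)
  ultimately show ?thesis unfolding \<phi>_def by simp
qed

lemma G_line_DERIV:
  assumes "x + t *\<^sub>R axis i 1 \<noteq> 0"
  shows "((\<lambda>t. G (x + t *\<^sub>R axis i 1) $ i) has_real_derivative dG i (x + t *\<^sub>R axis i 1)) (at t)"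
proof -
  let ?z = "x + t *\<^sub>R axis i 1"
  have r: "norm ?z > 0" using assms by simp
  have 1: "((\<lambda>t. q (norm (x + t *\<^sub>R axis i 1))) has_real_derivative
      (g (norm ?z) / norm ?z - 3 * D (norm ?z) / norm ?z ^ 4) * (?z $ i / norm ?z)) (at t)"
    by (rule DERIV_chain2[OF q_deriv[OF r] norm_line_DERIV[OF assms]])
  have "((\<lambda>t. q (norm (x + t *\<^sub>R axis i 1)) * (x + t *\<^sub>R axis i 1) $ i) has_real_derivative
      (g (norm ?z) / norm ?z - 3 * D (norm ?z) / norm ?z ^ 4) * (?z $ i / norm ?z) * ?z $ i + 1 * q (norm ?z)) (at t)"
    by (rule DERIV_mult[OF 1 component_line_DERIV])
  then have "((\<lambda>t. q (norm (x + t *\<^sub>R axis i 1)) * (x + t *\<^sub>R axis i 1) $ i) has_real_derivative dG i ?z) (at t)"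
    by (rule DERIV_cong) (simp add: dG_def power2_eq_square)
  then show ?thesis by (simp add: G_def)
qed

lemma sum_dG: "x \<noteq> 0 \<Longrightarrow> (\<Sum>i\<in>UNIV. dG i x) = g (norm x)"
proof -
  assume "x \<noteq> 0"
  then have r: "norm x > 0" by simp
  have sum: "(\<Sum>i\<in>UNIV. (x $ i)\<^sup>2) = (norm x)\<^sup>2"
    unfolding power2_norm_eq_inner by (simp add: inner_vec_def power2_eq_square)
  have "(\<Sum>i\<in>UNIV. dG i x) = 3 * q (norm x)
      + (g (norm x) / norm x - 3 * D (norm x) / norm x ^ 4) * ((norm x)\<^sup>2 / norm x)"
    unfolding dG_def sum.distrib sum_distrib_left[symmetric] sum_divide_distrib[symmetric] sum by simp
  also have "\<dots> = g (norm x)"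
    using r by (simp add: q_def field_simps power_numeral_reduce)
  finally show ?thesis .
qed

lemma dG_bounded: "loc_bounded (dG i)"
proof -
  obtain K where K: "K > 0" "\<And>r. r \<ge> 0 \<Longrightarrow> \<bar>q r\<bar> \<le> K * pw 3 (r\<^sup>2)" and Kq: "\<And>r. r \<ge> 0 \<Longrightarrow> \<bar>q r\<bar> \<le> K"
    "\<And>r. r > 0 \<Longrightarrow> \<bar>D r / r\<^sup>2\<bar> \<le> K"
    by (rule q_bounds) (rule that)
  have "\<bar>dG i x\<bar> \<le> K + (25991 + 3 * K)" for x
  proof (cases "x = 0")
    case True
    then show ?thesis using Kq(1)[of 0] K(1) by (simp add: dG_def)
  next
    case False
    define r where "r = norm x"
    have r: "r > 0" using False by (simp add: r_def)
    have "\<bar>x $ i\<bar> \<le> r" unfolding r_def by (rule component_le_norm_cart)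
    then have "(x $ i)\<^sup>2 \<le> r\<^sup>2" using abs_le_square_iff[of "x $ i" r] r by simp
    then have xi: "(x $ i)\<^sup>2 / r \<le> r" using r by (simp add: field_simps power2_eq_square)
    have "\<bar>g r\<bar> \<le> 25991 * 1"
      using g_decay[of r] pw_le_1[of "r\<^sup>2" "\<beta> + 1"] \<beta> r by (smt (verit) zero_le_power2)
    moreover have "\<bar>3 * q r\<bar> \<le> 3 * K" using Kq(1)[of r] r by simp
    ultimately have "\<bar>g r - 3 * q r\<bar> \<le> 25991 + 3 * K"
      using abs_triangle_ineq4[of "g r" "3 * q r"] by linarith
    \<comment> \<open>The two terms that look singular at the origin combine, after multiplication
      by \<open>r\<close>, into \<open>g - 3 q\<close>, which is bounded.\<close>
    moreover have "r * (g r / r - 3 * D r / r ^ 4) = g r - 3 * q r"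
      using r by (simp add: q_def field_simps power_numeral_reduce)
    then have "r * \<bar>g r / r - 3 * D r / r ^ 4\<bar> = \<bar>g r - 3 * q r\<bar>"
      using r by (metis abs_mult abs_of_pos)
    ultimately have le: "r * \<bar>g r / r - 3 * D r / r ^ 4\<bar> \<le> 25991 + 3 * K" by metis
    have "\<bar>(g r / r - 3 * D r / r ^ 4) * ((x $ i)\<^sup>2 / r)\<bar> \<le> \<bar>g r / r - 3 * D r / r ^ 4\<bar> * r"
      unfolding abs_mult using xi r by (intro mult_left_mono) auto
    then have b: "\<bar>(g r / r - 3 * D r / r ^ 4) * ((x $ i)\<^sup>2 / r)\<bar> \<le> 25991 + 3 * K" using le by (simp add: mult.commute)
    have a: "\<bar>q r\<bar> \<le> K" using Kq(1)[of r] r by simp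
    show ?thesis
      unfolding dG_def r_def[symmetric] by (rule order_trans[OF abs_triangle_ineq add_mono[OF a b]])
  qed
  then show ?thesis by (rule loc_bounded_bounded)
qed

lemma weak_gradient_\<phi>: "has_weak_gradient \<phi> G" "in_Lp 2 G" "in_Hdot1 \<phi>"
proof -
  obtain K where K: "K > 0" "\<And>x. norm (G x) \<le> K * pw 2 (x \<bullet> x)" by (rule G_bound) (rule that)
  have bounds: "\<bar>\<phi> x\<bar> \<le> max K 7 * pw 1 (x \<bullet> x)" "norm (G x) \<le> max K 7 * pw 2 (x \<bullet> x)" for x
  proof -
    have "7 * pw 1 (x \<bullet> x) \<le> max K 7 * pw 1 (x \<bullet> x)" "K * pw 2 (x \<bullet> x) \<le> max K 7 * pw 2 (x \<bullet> x)"
      using pw_pos[of "x \<bullet> x"] by (intro mult_right_mono; simp add: less_imp_le)+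
    then show "\<bar>\<phi> x\<bar> \<le> max K 7 * pw 1 (x \<bullet> x)" "norm (G x) \<le> max K 7 * pw 2 (x \<bullet> x)"
      using \<phi>_bound[of x] K(2)[of x] by linarith+
  qed
  note * = has_weak_gradient_classical[OF _ _ bounds \<phi>_line_DERIV[OF off_axis_line]]
  show "has_weak_gradient \<phi> G" "in_Lp 2 G" "in_Hdot1 \<phi>" by (rule *; simp)+
qed

lemma g_norm: "g (norm x) = - V x * \<phi> x + \<phi> x ^ 5"
  by (simp add: g_def V_def \<phi>_def)

text \<open>Two integrations by parts leave no contribution at the origin: \<phi>, its gradient and
  the second derivatives are locally bounded, and lines parallel to an axis miss the origin outside
  a null set of starting points.\<close>

lemma steady_state_\<phi>: "steady_state V \<phi>"
  unfolding steady_state_def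
proof (intro conjI allI impI)
  show "in_Hdot1 \<phi>" by (rule weak_gradient_\<phi>)
  fix \<eta> :: "real ^ 3 \<Rightarrow> real" assume \<eta>: "test_function \<eta>"
  note \<eta>1 = test_function_partial[OF \<eta>] and \<eta>2 = test_function_partial[OF test_function_partial[OF \<eta>]]
  have lb\<phi>: "loc_bounded \<phi>" "loc_bounded V"
    using continuous_\<phi>_V by (auto intro: loc_bounded_continuous)
  have comp_meas: "(\<lambda>x. G x $ i) \<in> borel_measurable borel" for i
  proof -
    have "(\<lambda>x. G x \<bullet> axis i 1) \<in> borel_measurable borel" by measurable
    then show ?thesis by (simp add: inner_axis)
  qed
  have lbG: "loc_bounded (\<lambda>x. G x $ i)" for i
  proof -
    obtain K where K: "K > 0" "\<And>x. norm (G x) \<le> K * pw 2 (x \<bullet> x)" by (rule G_bound) (rule that)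
    have "\<bar>G x $ i\<bar> \<le> K" for x
    proof -
      have "K * pw 2 (x \<bullet> x) \<le> K" using pw_le_1[of "x \<bullet> x" 2] K(1) by (simp add: mult_left_le)
      then show ?thesis using component_le_norm_cart[of "G x" i] K(2)[of x] by linarith
    qed
    then show ?thesis by (rule loc_bounded_bounded)
  qed
  have ibp: "(\<integral>x. \<phi> x * partial i (partial i \<eta>) x \<partial>lborel) = (\<integral>x. dG i x * \<eta> x \<partial>lborel)" for i
  proof -
    have "(\<integral>x. \<phi> x * partial i (partial i \<eta>) x \<partial>lborel) = - (\<integral>x. G x $ i * partial i \<eta> x \<partial>lborel)"
      by (rule integration_by_parts[OF _ comp_meas lb\<phi>(1) lbG axis_line_null \<phi>_line_DERIV[OF off_axis_line] \<eta>1]) simp_all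
    also have "(\<integral>x. G x $ i * partial i \<eta> x \<partial>lborel) = - (\<integral>x. dG i x * \<eta> x \<partial>lborel)"
      by (rule integration_by_parts[OF comp_meas _ lbG dG_bounded axis_line_null G_line_DERIV[OF off_axis_line] \<eta>]) simp_all
    finally show ?thesis by simp
  qed
  have int1: "integrable lborel (\<lambda>x. \<phi> x * partial i (partial i \<eta>) x)" for i
    by (rule integrable_mult_test_function[OF _ lb\<phi>(1) \<eta>2]) simp
  have int2: "integrable lborel (\<lambda>x. dG i x * \<eta> x)" for i
    by (rule integrable_mult_test_function[OF _ dG_bounded \<eta>]) simp
  have int3: "integrable lborel (\<lambda>x. g (norm x) * \<eta> x)"
    by (rule integrable_mult_test_function[OF _ _ \<eta>])
       (auto simp: g_norm lb\<phi> intro!: loc_bounded_intros)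
  have "(\<integral>x. \<phi> x * laplacian \<eta> x \<partial>lborel) = (\<Sum>i\<in>UNIV. \<integral>x. \<phi> x * partial i (partial i \<eta>) x \<partial>lborel)"
    unfolding laplacian_def sum_distrib_left by (rule Bochner_Integration.integral_sum) (rule int1)
  also have "\<dots> = (\<integral>x. (\<Sum>i\<in>UNIV. dG i x * \<eta> x) \<partial>lborel)"
    unfolding ibp by (rule Bochner_Integration.integral_sum[symmetric]) (rule int2)
  also have "\<dots> = (\<integral>x. g (norm x) * \<eta> x \<partial>lborel)"
  proof (rule integral_cong_AE)
    note [measurable] = test_function_measurable[OF \<eta>]
    show "(\<lambda>x. \<Sum>i\<in>UNIV. dG i x * \<eta> x) \<in> borel_measurable lborel"
      "(\<lambda>x. g (norm x) * \<eta> x) \<in> borel_measurable lborel" by measurable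
    show "AE x in lborel. (\<Sum>i\<in>UNIV. dG i x * \<eta> x) = g (norm x) * \<eta> x"
      using AE_lborel_singleton[of 0]
      by eventually_elim (simp add: sum_dG flip: sum_distrib_right)
  qed
  finally have eq: "(\<integral>x. \<phi> x * laplacian \<eta> x \<partial>lborel) = (\<integral>x. g (norm x) * \<eta> x \<partial>lborel)" .
  have int4: "integrable lborel (\<lambda>x. \<phi> x * laplacian \<eta> x)"
    unfolding laplacian_def sum_distrib_left by (intro Bochner_Integration.integrable_sum int1)
  have "(\<integral>x. - \<phi> x * laplacian \<eta> x - V x * \<phi> x * \<eta> x + \<phi> x ^ 5 * \<eta> x \<partial>lborel)
      = (\<integral>x. g (norm x) * \<eta> x - \<phi> x * laplacian \<eta> x \<partial>lborel)"
    by (simp add: g_norm algebra_simps)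
  also have "\<dots> = 0" using int3 int4 eq by simp
  finally show "(\<integral>x. - \<phi> x * laplacian \<eta> x - V x * \<phi> x * \<eta> x + \<phi> x ^ 5 * \<eta> x \<partial>lborel) = 0" .
qed

section \<open>Stability\<close>

abbreviation "H x \<equiv> pw_comb (barrier \<beta>) (x \<bullet> x)"
abbreviation "H1 x \<equiv> pw_comb (pw_diff (barrier \<beta>)) (x \<bullet> x)"
abbreviation "H2 x \<equiv> pw_comb (pw_diff (pw_diff (barrier \<beta>))) (x \<bullet> x)"

lemma pw_comb_inner_continuous: "continuous_on UNIV (\<lambda>x :: real ^ 3. pw_comb cs (x \<bullet> x))"
  by (rule continuous_on_compose2[OF pw_comb_continuous]) (auto intro!: continuous_intros)

lemma pw_comb_line_DERIV:
  "((\<lambda>t. pw_comb cs ((x + t *\<^sub>R axis i 1) \<bullet> (x + t *\<^sub>R axis i 1))) has_real_derivative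
    - (x + t *\<^sub>R axis i 1 :: real ^ 3) $ i * pw_comb (pw_diff cs) ((x + t *\<^sub>R axis i 1) \<bullet> (x + t *\<^sub>R axis i 1))) (at t)"
proof -
  let ?z = "x + t *\<^sub>R axis i 1"
  have "?z \<bullet> ?z > - 1" by (rule less_le_trans[of _ 0]) auto
  from DERIV_chain2[where f = "pw_comb cs" and g = "\<lambda>t. (x + t *\<^sub>R axis i 1) \<bullet> (x + t *\<^sub>R axis i 1)" and x = t,
      OF pw_comb_DERIV[OF this] inner_line_DERIV]
  show ?thesis
  proof (rule DERIV_cong)
    have "- (1 / 2) * a * (2 * c) = - c * a" for a c :: real by simp
    then show "- (1 / 2) * pw_comb (pw_diff cs) (?z \<bullet> ?z) * (2 * ?z $ i) = - ?z $ i * pw_comb (pw_diff cs) (?z \<bullet> ?z)" .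
  qed
qed

text \<open>Passing from the base profile to \<phi> and from the base potential to \<open>V\<close>
  perturbs the zeroth-order coefficient; the two halves of the gain in \<open>barrier_bounds\<close>
  absorb these changes with something left over, so strictness survives.\<close>

lemma linearized_positive: "pw_lap (barrier \<beta>) (x \<bullet> x) < (- V x + 5 * \<phi> x ^ 4) * H x"
proof -
  define r where "r = norm x"
  have r: "r \<ge> 0" "x \<bullet> x = r\<^sup>2" by (simp_all add: r_def power2_norm_eq_inner)
  have s: "r\<^sup>2 \<ge> 0" by simp
  define T where "T = pw 1 (r\<^sup>2)"
  define A where "A = pw_comb profile (r\<^sup>2)"
  define h where "h = pw_comb (barrier \<beta>) (r\<^sup>2)"
  define Y where "Y = y0 (r\<^sup>2)"
  define W where "W = pw (\<beta> + 1) (r\<^sup>2)"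
  have T: "T > 0" using pw_pos[OF s] by (simp add: T_def)
  have Y: "Y > 0" using y0_bounds[OF s] by (simp add: Y_def)
  have h: "0 < h" "h \<le> T" using barrier_bounds(1,2)[OF s \<beta>] by (auto simp: h_def T_def)
  have T4: "T ^ 4 = Y\<^sup>2" using pw_odd(7)[OF s] power_mult[of T 2 2] by (simp add: T_def Y_def y0_def)
  have A: "\<bar>A\<bar> \<le> 7 * T" using profile_eq(3)[OF s] T by (simp add: A_def T_def)
  have P: "\<bar>p r\<bar> \<le> 7 * T" "\<bar>p r - A\<bar> \<le> (1 / 10000) * T"
    using p_bound[OF r(1)] p_near[OF r(1)] by (auto simp: A_def T_def)
  \<comment> \<open>1372 = 4 * 7^3 bounds the cubic cofactor of \<open>p r - A\<close>, both terms
    being at most \<open>7 * T\<close>. Five times 1372/10000 is below 1.\<close>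
  have "\<bar>p r ^ 4 - A ^ 4\<bar> \<le> (1 / 10000) * T * (1372 * T ^ 3)"
  proof -
    have "p r ^ 4 - A ^ 4 = (p r - A) * (p r ^ 3 + (p r)\<^sup>2 * A + p r * A\<^sup>2 + A ^ 3)" by algebra
    moreover have "\<bar>p r ^ 3 + (p r)\<^sup>2 * A + p r * A\<^sup>2 + A ^ 3\<bar>
        \<le> \<bar>p r\<bar> ^ 3 + \<bar>p r\<bar>\<^sup>2 * \<bar>A\<bar> + \<bar>p r\<bar> * \<bar>A\<bar>\<^sup>2 + \<bar>A\<bar> ^ 3"
      by (rule order_trans[OF abs_triangle_ineq] add_mono)+ (simp_all add: abs_mult power_abs)
    moreover have "\<dots> \<le> (7 * T) ^ 3 + (7 * T)\<^sup>2 * (7 * T) + (7 * T) * (7 * T)\<^sup>2 + (7 * T) ^ 3"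
      using A P T by (intro add_mono mult_mono power_mono) auto
    moreover have "\<dots> = 1372 * T ^ 3" by (simp add: power_numeral_reduce)
    ultimately show ?thesis using P(2) T by (simp only: abs_mult) (intro mult_mono, auto)
  qed
  also have "\<dots> = 1372 / 10000 * Y\<^sup>2" unfolding T4[symmetric] by (simp add: power_numeral_reduce)
  finally have P4: "\<bar>p r ^ 4 - A ^ 4\<bar> \<le> 1372 / 10000 * Y\<^sup>2" .
  have A4: "A ^ 4 = 1296 * Y\<^sup>2 * (z0 (r\<^sup>2)) ^ 4" using f0_4 by (simp add: A_def Y_def)
  define U0 where "U0 = Y\<^sup>2 * (5184 * (z0 (r\<^sup>2)) ^ 4 - 15)"
  have U0: "U0 = - base_potential (r\<^sup>2) + 5 * A ^ 4"
    by (simp add: U0_def A4 base_potential_def Y_def algebra_simps)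
  have "- v r + 5 * p r ^ 4 \<ge> U0 - (\<delta> * pw \<beta> (r\<^sup>2) + 6860 / 10000 * Y\<^sup>2)"
    unfolding U0 using v_near[of r] P4 by linarith
  then have "(- v r + 5 * p r ^ 4) * h \<ge> (U0 - (\<delta> * pw \<beta> (r\<^sup>2) + 6860 / 10000 * Y\<^sup>2)) * h"
    using h by (intro mult_right_mono) auto
  moreover have "(\<delta> * pw \<beta> (r\<^sup>2) + 6860 / 10000 * Y\<^sup>2) * h \<le> (\<delta> * pw \<beta> (r\<^sup>2) + 6860 / 10000 * Y\<^sup>2) * T"
    using h \<delta> pw_pos[OF s, of \<beta>] by (intro mult_left_mono add_nonneg_nonneg) auto
  moreover have "(\<delta> * pw \<beta> (r\<^sup>2) + 6860 / 10000 * Y\<^sup>2) * T = \<delta> * W + 6860 / 10000 * (T * Y\<^sup>2)"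
    using pw_\<beta>[of r] by (simp add: W_def T_def algebra_simps)
  moreover have "\<delta> * W \<le> barrier_gain \<beta> * W"
  proof -
    have "\<delta> \<le> barrier_gain \<beta>" using \<delta> gain_nonneg(1) by linarith
    then show ?thesis using pw_pos[OF s, of "\<beta> + 1"] by (intro mult_right_mono) (auto simp: W_def)
  qed
  moreover have "T * Y\<^sup>2 + barrier_gain \<beta> * W \<le> - pw_lap (barrier \<beta>) (r\<^sup>2) + U0 * h"
    using barrier_bounds(3)[OF s \<beta>] by (simp add: T_def Y_def W_def U0_def h_def)
  moreover have "T * Y\<^sup>2 > 0" using T Y by simp
  ultimately have "pw_lap (barrier \<beta>) (r\<^sup>2) < (- v r + 5 * p r ^ 4) * h"
    by (simp only: left_diff_distrib)
  then show ?thesis by (simp add: V_def \<phi>_def r h_def r_def[symmetric])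
qed

text \<open>Since \<open>- \<mu>\<close> is nonnegative it only enlarges \<open>U\<close>, so one
  supersolution deals with every \<mu> \<le> 0; the two integrability classes cover eigenfunctions
  and resonances.\<close>

lemma no_nonpositive_mode:
  assumes \<psi>: "in_Lp 2 \<psi> \<or> in_Lp 6 \<psi>" and lin: "linearized_eq V \<phi> \<mu> \<psi>" and "\<mu> \<le> 0"
  shows "ae_zero \<psi>"
proof -
  define U where "U x = - V x + 5 * \<phi> x ^ 4 - \<mu>" for x
  \<comment> \<open>Logarithmic derivative of the barrier: its \<open>i\<close>-th partial
    derivative is \<open>- (x $ i) * H1 x\<close>.\<close>
  define q1 where "q1 i x = - (x $ i) * H1 x / H x" for i and x :: "real ^ 3"
  define q1' where "q1' i x = (- H1 x + (x $ i)\<^sup>2 * H2 x) / H x - (q1 i x)\<^sup>2" for i and x :: "real ^ 3"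
  have Hpos: "H x > 0" for x :: "real ^ 3" using barrier_bounds(1)[OF _ \<beta>] by simp
  note L1 = Lp_2_6_locally_integrable(1)[OF \<psi>]
  have Ucont: "continuous_on UNIV U"
    unfolding U_def by (intro continuous_intros continuous_\<phi>_V)
  show ?thesis
  proof (rule positivity_criterion[OF \<psi> Ucont])
    show c: "continuous_on UNIV (q1 i)" for i
      unfolding q1_def using Hpos
      by (intro continuous_intros pw_comb_inner_continuous) (metis less_irrefl)
    show "continuous_on UNIV (q1' i)" for i
      unfolding q1'_def using Hpos
      by (intro continuous_intros pw_comb_inner_continuous c) (metis less_irrefl)
    fix i t and x :: "real ^ 3"
    let ?z = "x + t *\<^sub>R axis i 1"
    have 1: "((\<lambda>t. - ((x + t *\<^sub>R axis i 1) $ i) * H1 (x + t *\<^sub>R axis i 1)) has_real_derivative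
        - 1 * H1 ?z + (- (?z $ i) * H2 ?z) * - (?z $ i)) (at t)"
      by (rule DERIV_mult[OF DERIV_minus[OF component_line_DERIV] pw_comb_line_DERIV])
    have "((\<lambda>t. q1 i (x + t *\<^sub>R axis i 1)) has_real_derivative
        ((- 1 * H1 ?z + (- (?z $ i) * H2 ?z) * - (?z $ i)) * H ?z
          - (- (?z $ i) * H1 ?z) * (- ?z $ i * H1 ?z)) / (H ?z * H ?z)) (at t)"
      unfolding q1_def by (rule DERIV_divide[OF 1 pw_comb_line_DERIV]) (use Hpos[of ?z] in simp)
    then show "((\<lambda>t. q1 i (x + t *\<^sub>R axis i 1)) has_real_derivative q1' i ?z) (at t)"
    proof (rule DERIV_cong)
      have "((- 1 * a + (- c * b) * - c) * d - (- c * a) * (- c * a)) / (d * d) = (- a + c\<^sup>2 * b) / d - (- c * a / d)\<^sup>2"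
        if "d > 0" for a b c d :: real
        using that by (simp add: field_simps power2_eq_square)
      note eq = this[OF Hpos[of ?z]]
      show "((- 1 * H1 ?z + (- (?z $ i) * H2 ?z) * - (?z $ i)) * H ?z
          - (- (?z $ i) * H1 ?z) * (- ?z $ i * H1 ?z)) / (H ?z * H ?z) = q1' i ?z"
        unfolding q1'_def q1_def by (rule eq)
    qed
  next
    fix x :: "real ^ 3"
    have sum: "(\<Sum>i\<in>UNIV. b * (x $ i * x $ i) - a) = b * (x \<bullet> x) - 3 * a" for a b
      by (simp add: sum_subtractf inner_vec_def sum_distrib_left)
    have "(\<Sum>i\<in>UNIV. q1' i x + (q1 i x)\<^sup>2) = (\<Sum>i\<in>UNIV. H2 x / H x * (x $ i * x $ i) - H1 x / H x)"
      by (intro sum.cong) (auto simp: q1'_def diff_divide_distrib power2_eq_square)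
    also have "\<dots> = H2 x / H x * (x \<bullet> x) - 3 * (H1 x / H x)" by (rule sum)
    also have "\<dots> = pw_lap (barrier \<beta>) (x \<bullet> x) / H x"
      by (simp add: pw_lap_def add_divide_distrib diff_divide_distrib)
    also have "\<dots> < - V x + 5 * \<phi> x ^ 4"
      using linearized_positive[of x] Hpos[of x] by (simp add: divide_less_eq)
    finally show "(\<Sum>i\<in>UNIV. q1' i x + (q1 i x)\<^sup>2) < U x" using \<open>\<mu> \<le> 0\<close> by (simp add: U_def)
  next
    fix \<eta> :: "real ^ 3 \<Rightarrow> real" assume \<eta>: "test_function \<eta>"
    obtain R where R: "\<And>x. norm x > R \<Longrightarrow> \<eta> x = 0" using test_function_support[OF \<eta>] by blast
    note [measurable] = test_function_measurable[OF \<eta>]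
    have int: "integrable lborel (\<lambda>x. \<psi> x * f x)" if "test_function f" for f
    proof -
      obtain R where R: "\<And>x. norm x > R \<Longrightarrow> f x = 0" using test_function_support[OF \<open>test_function f\<close>] by blast
      show ?thesis
        by (rule integrable_locally_integrable_mult[OF L1 _ _ R])
           (use that test_function_measurable test_function_loc_bounded in auto)
    qed
    have i1: "integrable lborel (\<lambda>x. \<psi> x * laplacian \<eta> x)"
      unfolding laplacian_def sum_distrib_left
      by (intro Bochner_Integration.integrable_sum int test_function_partial \<eta>)
    have i2: "integrable lborel (\<lambda>x. \<psi> x * ((- V x + 5 * \<phi> x ^ 4) * \<eta> x))"
    proof (rule integrable_locally_integrable_mult[OF L1, where R = R])
      show "loc_bounded (\<lambda>x. (- V x + 5 * \<phi> x ^ 4) * \<eta> x)"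
        by (intro loc_bounded_mult test_function_loc_bounded[OF \<eta>] loc_bounded_continuous continuous_intros continuous_\<phi>_V)
    qed (auto simp: R)
    have "(\<integral>x. - \<psi> x * laplacian \<eta> x - V x * \<psi> x * \<eta> x + 5 * \<phi> x ^ 4 * \<psi> x * \<eta> x \<partial>lborel)
        = (\<integral>x. \<psi> x * ((- V x + 5 * \<phi> x ^ 4) * \<eta> x) - \<psi> x * laplacian \<eta> x \<partial>lborel)"
      by (simp add: algebra_simps)
    also have "\<dots> = (\<integral>x. \<psi> x * ((- V x + 5 * \<phi> x ^ 4) * \<eta> x) \<partial>lborel) - (\<integral>x. \<psi> x * laplacian \<eta> x \<partial>lborel)"
      by (rule Bochner_Integration.integral_diff[OF i2 i1])
    finally have 1: "(\<integral>x. \<psi> x * laplacian \<eta> x \<partial>lborel)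
        = (\<integral>x. \<psi> x * ((- V x + 5 * \<phi> x ^ 4) * \<eta> x) \<partial>lborel) - (\<integral>x. \<mu> * (\<psi> x * \<eta> x) \<partial>lborel)"
      using lin \<eta> unfolding linearized_eq_def by (simp add: mult.assoc)
    also have "\<dots> = (\<integral>x. \<psi> x * ((- V x + 5 * \<phi> x ^ 4) * \<eta> x) - \<mu> * (\<psi> x * \<eta> x) \<partial>lborel)"
      using i2 int[OF \<eta>] by simp
    also have "\<dots> = (\<integral>x. U x * \<psi> x * \<eta> x \<partial>lborel)"
      by (simp add: U_def algebra_simps)
    finally show "(\<integral>x. \<psi> x * laplacian \<eta> x \<partial>lborel) = (\<integral>x. U x * \<psi> x * \<eta> x \<partial>lborel)" .
  qed
qed

theorem stable_\<phi>: "stable V \<phi>"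
proof -
  have "\<not> eigenvalue V \<phi> \<mu>" if "\<mu> \<le> 0" for \<mu>
    using no_nonpositive_mode that unfolding eigenvalue_def in_H2_def by blast
  moreover have "\<not> zero_resonance V \<phi>"
    using no_nonpositive_mode[of _ 0] unfolding zero_resonance_def in_Hdot1_def by blast
  ultimately show ?thesis unfolding stable_def by (meson less_imp_le order_refl)
qed

end

section \<open>The steady state is not a ground state\<close>

lemma energy_eq:
  assumes F: "has_weak_gradient f F" and [measurable]: "W \<in> borel_measurable borel"
  shows "J W f = (\<integral>x. (norm (F x))\<^sup>2 / 2 - W x * (f x)\<^sup>2 / 2 + f x ^ 6 / 6 \<partial>lborel)"
proof -
  have w: "has_weak_gradient f (weak_gradient f)"
    unfolding weak_gradient_def by (rule someI[of "has_weak_gradient f", OF F])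
  have [measurable]: "f \<in> borel_measurable borel" "F \<in> borel_measurable borel" "weak_gradient f \<in> borel_measurable borel"
    using F w by (auto simp: has_weak_gradient_def locally_integrable_def)
  show ?thesis
    unfolding J_def
  proof (rule integral_cong_AE)
    show "AE x in lborel. (norm (weak_gradient f x))\<^sup>2 / 2 - W x * (f x)\<^sup>2 / 2 + f x ^ 6 / 6
        = (norm (F x))\<^sup>2 / 2 - W x * (f x)\<^sup>2 / 2 + f x ^ 6 / 6"
      using AE_weak_gradient[OF F] by eventually_elim simp
  qed measurable
qed

context radial_steady_state
begin

text \<open>Closeness to the base profile forces opposite signs at 1/2 and 2, where
  \<open>z0\<close> is -3/5 and 3/5. A double zero would contradict uniqueness for the initial value
  problem, here in the form of a Gronwall estimate.\<close>

lemma simple_zero_exists: "\<exists>a>0. w a = 0 \<and> w' a \<noteq> 0"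
proof -
  have sign: "r > 0 \<Longrightarrow> \<bar>w r - r * (6 * pw 1 (r\<^sup>2) * z0 (r\<^sup>2))\<bar> \<le> r * ((1 / 10000) * pw 1 (r\<^sup>2))" for r
    using w_near[of r] by (simp add: profile_eq(1))
  have z: "z0 ((1 / 2)\<^sup>2) = - 3 / 5" "z0 (2\<^sup>2) = 3 / 5"
    by (simp_all add: z0_def pw_2 power2_eq_square)
  have "w (1 / 2) < 0"
    using order_trans[OF abs_ge_self sign[of "1 / 2"]] pw_pos[of "(1 / 2)\<^sup>2" 1] unfolding z by simp
  have "w 2 > 0"
    using order_trans[OF abs_ge_minus_self sign[of 2]] pw_pos[of "2\<^sup>2" 1] unfolding z by simp
  have "\<exists>a\<ge>1 / 2. a \<le> 2 \<and> w a = 0"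
    using \<open>w (1 / 2) < 0\<close> \<open>w 2 > 0\<close> DERIV_isCont[OF w_deriv] by (intro IVT) auto
  then obtain a where a: "a \<ge> 1 / 2" "a \<le> 2" "w a = 0" by blast
  have "w' a \<noteq> 0"
  proof
    assume "w' a = 0"
    \<comment> \<open>A bound for the coefficient in \<open>w'' = (- v + p^4) * w\<close>, with 2401
      = 7^4.\<close>
    define M :: real where "M = 1312 + 2401"
    \<comment> \<open>With this exponential weight the quantity is nonincreasing on the interval
      from \<open>a\<close> to 2; being 0 at \<open>a\<close>, it could not be positive at
      2.\<close>
    define E where "E r = ((w r)\<^sup>2 + (w' r)\<^sup>2) * exp (- (1 + M) * r)" for r
    have "E 2 \<le> E a"
    proof (rule DERIV_nonpos_imp_nonincreasing[OF a(2)])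
      fix r assume "a \<le> r"
      then have r: "r > 0" using a by linarith
      define k where "k = - v r + p r ^ 4"
      have rg: "r * g r = w r * k" using r by (simp add: g_def k_def p_def algebra_simps power_numeral_reduce)
      have "\<bar>p r\<bar> \<le> 7" using p_bound[of r] pw_le_1[of "r\<^sup>2" 1] r by (smt (verit) zero_le_power2)
      then have "\<bar>p r\<bar> ^ 4 \<le> 7 ^ 4" by (intro power_mono) auto
      then have "0 \<le> p r ^ 4" "p r ^ 4 \<le> 2401" by simp_all
      then have k: "\<bar>k\<bar> \<le> M" using v_bound[of r] unfolding k_def M_def by linarith
      have "(E has_real_derivative (2 * w r * w' r + 2 * w' r * (r * g r) - (1 + M) * ((w r)\<^sup>2 + (w' r)\<^sup>2)) * exp (- (1 + M) * r)) (at r)"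
        unfolding E_def
        by (rule derivative_eq_intros w_deriv w'_deriv' refl)+ (simp add: algebra_simps)
      moreover have "2 * w r * w' r + 2 * w' r * (r * g r) - (1 + M) * ((w r)\<^sup>2 + (w' r)\<^sup>2) \<le> 0"
      proof -
        have "2 * w r * w' r + 2 * w' r * (r * g r) = (2 * w r * w' r) * (1 + k)" unfolding rg by (simp add: algebra_simps)
        also have "\<dots> \<le> \<bar>2 * w r * w' r\<bar> * \<bar>1 + k\<bar>" by (simp flip: abs_mult)
        also have "\<dots> \<le> ((w r)\<^sup>2 + (w' r)\<^sup>2) * (1 + M)"
        proof (intro mult_mono)
          have "0 \<le> (\<bar>w r\<bar> - \<bar>w' r\<bar>)\<^sup>2" by simp
          then show "\<bar>2 * w r * w' r\<bar> \<le> (w r)\<^sup>2 + (w' r)\<^sup>2" by (simp add: power2_diff abs_mult)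
        qed (use k in auto)
        finally show ?thesis by (simp add: mult.commute)
      qed
      ultimately show "\<exists>y. (E has_real_derivative y) (at r) \<and> y \<le> 0"
        by (intro exI conjI) (assumption, simp add: mult_le_0_iff)
    qed
    moreover have "E a = 0" using a(3) \<open>w' a = 0\<close> by (simp add: E_def)
    moreover have "E 2 > 0" using \<open>w 2 > 0\<close> by (simp add: E_def add_pos_nonneg)
    ultimately show False by simp
  qed
  then show ?thesis using a by (intro exI[of _ a]) auto
qed

text \<open>The gradient of \<open>pw 1 (x \<bullet> x)\<close>.\<close>

definition Z :: "real ^ 3 \<Rightarrow> real ^ 3"
  where "Z x = - pw 3 (x \<bullet> x) *\<^sub>R x"

definition competitor :: "real \<Rightarrow> real ^ 3 \<Rightarrow> real"
  where "competitor t x = sqrt ((\<phi> x)\<^sup>2 + t\<^sup>2 * (pw 1 (x \<bullet> x))\<^sup>2)"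

definition competitor_grad :: "real \<Rightarrow> real ^ 3 \<Rightarrow> real ^ 3"
  where "competitor_grad t x = inverse (competitor t x) *\<^sub>R (\<phi> x *\<^sub>R G x + (t\<^sup>2 * pw 1 (x \<bullet> x)) *\<^sub>R Z x)"

text \<open>A squared Wronskian of \<phi> and the comparison function \<open>pw 1\<close>. On the
  nodal sphere it reduces to the squared gradient of \<phi> times a positive factor, so a simple
  zero keeps it positive there.\<close>

definition gap :: "real ^ 3 \<Rightarrow> real"
  where "gap x = (norm (\<phi> x *\<^sub>R Z x - pw 1 (x \<bullet> x) *\<^sub>R G x))\<^sup>2"

section \<open>Energy of the competitor\<close>

lemma pw1_pos [simp]: "pw 1 (x \<bullet> x) > 0"
  by (simp add: pw_pos)

lemma Z_measurable [measurable]: "Z \<in> borel_measurable borel"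
  unfolding Z_def by measurable

lemma competitor_measurable [measurable]:
  "competitor t \<in> borel_measurable borel" "competitor_grad t \<in> borel_measurable borel" "gap \<in> borel_measurable borel"
proof -
  show [measurable]: "competitor t \<in> borel_measurable borel" unfolding competitor_def by measurable
  show "competitor_grad t \<in> borel_measurable borel" "gap \<in> borel_measurable borel"
    unfolding competitor_grad_def gap_def by measurable
qed

lemma Z_norm: "norm (Z x) \<le> pw 2 (x \<bullet> x)"
  using norm_pw[of x] pw_pos[of "x \<bullet> x" 3] by (simp add: Z_def mult.commute)

lemma competitor_sq: "(competitor t x)\<^sup>2 = (\<phi> x)\<^sup>2 + t\<^sup>2 * (pw 1 (x \<bullet> x))\<^sup>2"
  by (simp add: competitor_def)

lemma competitor_bounds:
  assumes "0 < t" "t \<le> 1"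
  shows "competitor t x > 0" "\<bar>\<phi> x\<bar> \<le> competitor t x" "t * pw 1 (x \<bullet> x) \<le> competitor t x"
    "competitor t x \<le> 8 * pw 1 (x \<bullet> x)"
proof -
  have pos: "t\<^sup>2 * (pw 1 (x \<bullet> x))\<^sup>2 > 0" using assms pw1_pos[of x]
    by (intro mult_pos_pos zero_less_power)
  show "competitor t x > 0" unfolding competitor_def using pos by (simp add: add_nonneg_pos)
  show "\<bar>\<phi> x\<bar> \<le> competitor t x" unfolding competitor_def using pos by (intro real_le_rsqrt) auto
  show "t * pw 1 (x \<bullet> x) \<le> competitor t x"
    unfolding competitor_def by (intro real_le_rsqrt) (simp add: power_mult_distrib)
  have "(\<phi> x)\<^sup>2 \<le> 49 * (pw 1 (x \<bullet> x))\<^sup>2"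
    using power_mono[OF \<phi>_bound[of x], of 2] by (simp add: power_mult_distrib)
  moreover have "t\<^sup>2 * (pw 1 (x \<bullet> x))\<^sup>2 \<le> 1 * (pw 1 (x \<bullet> x))\<^sup>2"
    using assms by (intro mult_right_mono) (auto simp: power_le_one)
  moreover have "0 \<le> (pw 1 (x \<bullet> x))\<^sup>2" by (rule zero_le_power2)
  ultimately have "(\<phi> x)\<^sup>2 + t\<^sup>2 * (pw 1 (x \<bullet> x))\<^sup>2 \<le> 64 * (pw 1 (x \<bullet> x))\<^sup>2" by linarith
  then have "(\<phi> x)\<^sup>2 + t\<^sup>2 * (pw 1 (x \<bullet> x))\<^sup>2 \<le> (8 * pw 1 (x \<bullet> x))\<^sup>2"
    by (simp add: power_mult_distrib)
  then show "competitor t x \<le> 8 * pw 1 (x \<bullet> x)"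
    unfolding competitor_def using less_imp_le[OF pw1_pos[of x]] by (intro real_le_lsqrt) auto
qed

text \<open>Lagrange's identity for the pairs (\<phi>, t \<open>pw 1\<close>) and (\<open>G\<close>,
  t \<open>Z\<close>): taking the length of the pair loses exactly the Wronskian term in the
  Dirichlet density.\<close>

lemma competitor_grad_norm:
  assumes t: "0 < t" "t \<le> 1"
  shows "norm (competitor_grad t x) \<le> norm (G x) + norm (Z x)"
    and "(norm (competitor_grad t x))\<^sup>2 = (norm (G x))\<^sup>2 + t\<^sup>2 * (norm (Z x))\<^sup>2 - t\<^sup>2 * (gap x / (competitor t x)\<^sup>2)"
proof -
  define c where "c = competitor t x"
  define f where "f = \<phi> x"
  define s where "s = pw 1 (x \<bullet> x)"
  have s: "s > 0" by (simp add: s_def)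
  note b = competitor_bounds[OF t, of x, folded c_def f_def s_def]
  have c2: "c\<^sup>2 = f\<^sup>2 + t\<^sup>2 * s\<^sup>2" using competitor_sq by (simp add: c_def f_def s_def)
  have grad: "competitor_grad t x = inverse c *\<^sub>R (f *\<^sub>R G x + (t\<^sup>2 * s) *\<^sub>R Z x)"
    by (simp add: competitor_grad_def c_def f_def s_def)
  have "norm (competitor_grad t x) \<le> inverse c * (norm (f *\<^sub>R G x) + norm ((t\<^sup>2 * s) *\<^sub>R Z x))"
    unfolding grad norm_scaleR[of "inverse c"] using b(1) by (intro mult_mono norm_triangle_ineq) auto
  also have "\<dots> = (\<bar>f\<bar> / c) * norm (G x) + (t * (t * s) / c) * norm (Z x)"
    using s t b(1) by (simp add: abs_mult divide_inverse algebra_simps power2_eq_square)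
  also have "\<dots> \<le> 1 * norm (G x) + 1 * norm (Z x)"
  proof (intro add_mono mult_right_mono)
    show "\<bar>f\<bar> / c \<le> 1" using b by simp
    have "t * (t * s) \<le> 1 * c" using b t s by (intro mult_mono) auto
    then show "t * (t * s) / c \<le> 1" using b by simp
  qed auto
  finally show "norm (competitor_grad t x) \<le> norm (G x) + norm (Z x)" by simp
  have "(norm (f *\<^sub>R G x + (t\<^sup>2 * s) *\<^sub>R Z x))\<^sup>2 + t\<^sup>2 * (norm (f *\<^sub>R Z x - s *\<^sub>R G x))\<^sup>2
      = c\<^sup>2 * ((norm (G x))\<^sup>2 + t\<^sup>2 * (norm (Z x))\<^sup>2)"
    unfolding c2 power2_norm_eq_inner
    by (simp add: inner_simps inner_commute[of "Z x" "G x"] power2_eq_square algebra_simps)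
  then have "(norm (f *\<^sub>R G x + (t\<^sup>2 * s) *\<^sub>R Z x))\<^sup>2 = c\<^sup>2 * ((norm (G x))\<^sup>2 + t\<^sup>2 * (norm (Z x))\<^sup>2) - t\<^sup>2 * gap x"
    by (simp add: gap_def f_def s_def)
  then have "(norm (competitor_grad t x))\<^sup>2
      = (c\<^sup>2 * ((norm (G x))\<^sup>2 + t\<^sup>2 * (norm (Z x))\<^sup>2) - t\<^sup>2 * gap x) / c\<^sup>2"
    unfolding grad norm_scaleR power_mult_distrib by (simp add: field_simps)
  also have "\<dots> = (norm (G x))\<^sup>2 + t\<^sup>2 * (norm (Z x))\<^sup>2 - t\<^sup>2 * (gap x / c\<^sup>2)"
    using b(1) by (simp add: diff_divide_distrib)
  finally show "(norm (competitor_grad t x))\<^sup>2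
      = (norm (G x))\<^sup>2 + t\<^sup>2 * (norm (Z x))\<^sup>2 - t\<^sup>2 * (gap x / (competitor t x)\<^sup>2)" by (simp add: c_def)
qed

lemma competitor_line_DERIV:
  assumes t: "0 < t" "t \<le> 1" and z: "x + r *\<^sub>R axis i 1 \<noteq> 0"
  shows "((\<lambda>r. competitor t (x + r *\<^sub>R axis i 1)) has_real_derivative competitor_grad t (x + r *\<^sub>R axis i 1) $ i) (at r)"
proof -
  let ?z = "x + r *\<^sub>R axis i 1"
  have d\<zeta>: "((\<lambda>r. pw 1 ((x + r *\<^sub>R axis i 1) \<bullet> (x + r *\<^sub>R axis i 1))) has_real_derivative Z ?z $ i) (at r)"
    using pw_comb_line_DERIV[of "[(1, 1)]" x i r] by (rule DERIV_cong_ev[THEN iffD1, rotated 3]) (simp_all add: pw_comb_def pw_diff_def Z_def ring_distribs mult.commute)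
  have sq: "((\<lambda>r. (\<phi> (x + r *\<^sub>R axis i 1))\<^sup>2 + t\<^sup>2 * (pw 1 ((x + r *\<^sub>R axis i 1) \<bullet> (x + r *\<^sub>R axis i 1)))\<^sup>2) has_real_derivative
      2 * (\<phi> ?z * G ?z $ i + t\<^sup>2 * pw 1 (?z \<bullet> ?z) * Z ?z $ i)) (at r)"
    by (rule derivative_eq_intros \<phi>_line_DERIV[OF z] d\<zeta> refl)+ (simp add: algebra_simps)
  have pos: "(\<phi> ?z)\<^sup>2 + t\<^sup>2 * (pw 1 (?z \<bullet> ?z))\<^sup>2 > 0"
    using competitor_bounds(1)[OF t, of ?z] by (simp add: competitor_def)
  note deriv = DERIV_chain2[where f = sqrt and x = r
      and g = "\<lambda>r. (\<phi> (x + r *\<^sub>R axis i 1))\<^sup>2 + t\<^sup>2 * (pw 1 ((x + r *\<^sub>R axis i 1) \<bullet> (x + r *\<^sub>R axis i 1)))\<^sup>2",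
      OF DERIV_real_sqrt[OF pos] sq]
  have "inverse (competitor t ?z) / 2 * (2 * (\<phi> ?z * G ?z $ i + t\<^sup>2 * pw 1 (?z \<bullet> ?z) * Z ?z $ i))
      = competitor_grad t ?z $ i"
    by (simp add: competitor_grad_def)
  then show ?thesis
    unfolding competitor_def by (intro DERIV_cong[OF deriv])
qed

lemma competitor_in_energy_space:
  assumes t: "0 < t" "t \<le> 1"
  shows "has_weak_gradient (competitor t) (competitor_grad t)" "in_Hdot1 (competitor t)"
proof -
  obtain K where K: "K > 0" "\<And>x. norm (G x) \<le> K * pw 2 (x \<bullet> x)" by (rule G_bound) (rule that)
  have "\<bar>competitor t x\<bar> \<le> (K + 8) * pw 1 (x \<bullet> x)" for x
  proof -
    have "8 * pw 1 (x \<bullet> x) \<le> (K + 8) * pw 1 (x \<bullet> x)"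
      using K(1) by (intro mult_right_mono) (auto simp: less_imp_le)
    then show ?thesis using competitor_bounds(1,4)[OF t, of x] by linarith
  qed
  moreover have "norm (competitor_grad t x) \<le> (K + 8) * pw 2 (x \<bullet> x)" for x
    using competitor_grad_norm(1)[OF t, of x] K(2)[of x] Z_norm[of x] pw_pos[of "x \<bullet> x" 2]
    by (simp add: distrib_right)
  ultimately have "\<bar>competitor t x\<bar> \<le> (K + 8) * pw 1 (x \<bullet> x)" "norm (competitor_grad t x) \<le> (K + 8) * pw 2 (x \<bullet> x)" for x
    by auto
  note * = has_weak_gradient_classical[OF competitor_measurable(1,2) this competitor_line_DERIV[OF t off_axis_line]]
  show "has_weak_gradient (competitor t) (competitor_grad t)" "in_Hdot1 (competitor t)"
    by (rule *; assumption)+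
qed

lemma energy_density_integrable:
  fixes f :: "real ^ 3 \<Rightarrow> real" and F :: "real ^ 3 \<Rightarrow> real ^ 3"
  assumes [measurable]: "f \<in> borel_measurable borel" "F \<in> borel_measurable borel"
    and f: "\<And>x. \<bar>f x\<bar> \<le> 8 * pw 1 (x \<bullet> x)" and F: "\<And>x. norm (F x) \<le> C * pw 2 (x \<bullet> x)"
  shows "integrable lborel (\<lambda>x :: real ^ 3. (norm (F x))\<^sup>2 / 2 - V x * (f x)\<^sup>2 / 2 + f x ^ 6 / 6)"
proof (rule integrable_pw_dominated[where C = "C\<^sup>2 / 2 + 1312 * 64 / 2 + 8 ^ 6 / 6"])
  fix x :: "real ^ 3"
  define s where "s = x \<bullet> x"
  have s: "s \<ge> 0" by (simp add: s_def)
  have p2: "(pw 1 s)\<^sup>2 = pw 2 s" by (rule pw_odd(7)[OF s])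
  have p4: "(pw 2 s)\<^sup>2 = pw 4 s" using pw_add[OF s, of 2 2] by (simp add: power2_eq_square)
  have "(norm (F x))\<^sup>2 \<le> (C * pw 2 s)\<^sup>2" using F[of x] by (intro power_mono) (auto simp: s_def)
  then have 1: "(norm (F x))\<^sup>2 / 2 \<le> C\<^sup>2 / 2 * pw 4 s" by (simp add: power_mult_distrib p4)
  have f2: "(f x)\<^sup>2 \<le> 64 * pw 2 s"
    using power_mono[OF f[of x], of 2] by (simp add: power_mult_distrib s_def[symmetric] p2)
  have "\<bar>V x\<bar> \<le> 1312 * pw 2 s"
    using V_bound[of x] pw_mono[OF s, of 2 \<beta>] \<beta> by (simp add: s_def)
  then have "\<bar>V x * (f x)\<^sup>2\<bar> \<le> (1312 * pw 2 s) * (64 * pw 2 s)"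
    unfolding abs_mult using f2 pw_pos[OF s, of 2] by (intro mult_mono) auto
  then have 2: "\<bar>V x * (f x)\<^sup>2 / 2\<bar> \<le> 1312 * 64 / 2 * pw 4 s" by (simp add: p4[symmetric] power2_eq_square)
  have "f x ^ 6 = ((f x)\<^sup>2) ^ 3" by (simp flip: power_mult)
  also have "\<dots> \<le> (64 * pw 2 s) ^ 3" using f2 by (intro power_mono) auto
  also have "\<dots> = 8 ^ 6 * pw 4 s * pw 2 s" by (simp add: p4[symmetric] power_numeral_reduce)
  also have "\<dots> \<le> 8 ^ 6 * pw 4 s * 1"
    using pw_le_1[OF s, of 2] pw_pos[OF s, of 4] by (intro mult_left_mono) auto
  finally have 3: "f x ^ 6 / 6 \<le> 8 ^ 6 / 6 * pw 4 s" by simp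
  have "0 \<le> f x ^ 6" by simp
  then show "\<bar>(norm (F x))\<^sup>2 / 2 - V x * (f x)\<^sup>2 / 2 + f x ^ 6 / 6\<bar> \<le> (C\<^sup>2 / 2 + 1312 * 64 / 2 + 8 ^ 6 / 6) * pw 4 (x \<bullet> x)"
    using 1 2 3 zero_le_power2[of "norm (F x)"] unfolding s_def[symmetric] distrib_right by linarith
qed measurable

text \<open>Apart from the gap term, everything changes by a multiple of \<open>t^2 * pw 4\<close>.
  The contributions are 1/2 from \<open>Z\<close>, 656 = 1312 / 2 from the potential and 7351 / 6
  from the sixth power, where 7351 = 3 * 49^2 + 3 * 49 + 1; together they are below 2000.\<close>

lemma energy_density_le:
  assumes t: "0 < t" "t \<le> 1"
  shows "(norm (competitor_grad t x))\<^sup>2 / 2 - V x * (competitor t x)\<^sup>2 / 2 + competitor t x ^ 6 / 6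
    \<le> (norm (G x))\<^sup>2 / 2 - V x * (\<phi> x)\<^sup>2 / 2 + \<phi> x ^ 6 / 6
      + (t\<^sup>2 * (2000 * pw 4 (x \<bullet> x)) - t\<^sup>2 / 2 * (gap x / (competitor t x)\<^sup>2))"
proof -
  define s where "s = x \<bullet> x"
  have s: "s \<ge> 0" by (simp add: s_def)
  define b where "b = pw 2 s"
  define f where "f = (\<phi> x)\<^sup>2"
  have p2: "(pw 1 s)\<^sup>2 = b" unfolding b_def by (rule pw_odd(7)[OF s])
  have p4: "pw 4 s = b\<^sup>2" using pw_add[OF s, of 2 2] by (simp add: power2_eq_square b_def)
  have b: "0 < b" "b \<le> 1" using pw_pos[OF s] pw_le_1[OF s] by (auto simp: b_def)
  have f: "0 \<le> f" "f \<le> 49 * b"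
    using power_mono[OF \<phi>_bound[of x], of 2] by (auto simp: power_mult_distrib s_def[symmetric] p2 f_def)
  have t2: "0 \<le> t\<^sup>2" "t\<^sup>2 \<le> 1" using t by (auto simp: power_le_one)
  have c2: "(competitor t x)\<^sup>2 = f + t\<^sup>2 * b" by (simp add: competitor_sq f_def s_def[symmetric] p2)
  have "(norm (Z x))\<^sup>2 \<le> b\<^sup>2" using Z_norm[of x] by (intro power_mono) (auto simp: b_def s_def)
  then have 1: "t\<^sup>2 * (norm (Z x))\<^sup>2 / 2 \<le> t\<^sup>2 * (b\<^sup>2 / 2)" using t2 by (simp add: mult_left_mono)
  have "\<bar>V x\<bar> \<le> 1312 * b"
    using V_bound[of x] pw_mono[OF s, of 2 \<beta>] \<beta> by (simp add: s_def b_def)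
  then have "- V x * b \<le> 1312 * b * b" using b by (intro mult_right_mono) auto
  then have 2: "t\<^sup>2 * (- V x * b / 2) \<le> t\<^sup>2 * (656 * b\<^sup>2)" using t2 by (intro mult_left_mono) (auto simp: power2_eq_square)
  have "(f + t\<^sup>2 * b) ^ 3 - f ^ 3 = t\<^sup>2 * (3 * (f * f) * b + 3 * f * (t\<^sup>2 * b\<^sup>2) + (t\<^sup>2 * t\<^sup>2) * b ^ 3)" by algebra
  also have "\<dots> \<le> t\<^sup>2 * (3 * ((49 * b) * (49 * b)) * b + 3 * (49 * b) * (1 * b\<^sup>2) + (1 * 1) * b ^ 3)"
    using f b t2 by (intro mult_left_mono add_mono mult_mono) auto
  also have "\<dots> = t\<^sup>2 * (7351 * b\<^sup>2 * b)" by (simp add: power_numeral_reduce)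
  also have "\<dots> \<le> t\<^sup>2 * (7351 * b\<^sup>2 * 1)" using b t2 by (intro mult_left_mono) auto
  finally have 3: "(f + t\<^sup>2 * b) ^ 3 - f ^ 3 \<le> t\<^sup>2 * (7351 * b\<^sup>2)" by simp
  have six: "competitor t x ^ 6 = (f + t\<^sup>2 * b) ^ 3" "\<phi> x ^ 6 = f ^ 3"
    unfolding c2[symmetric] by (simp_all add: f_def flip: power_mult)
  define T where "T = t\<^sup>2 * b\<^sup>2"
  have "t\<^sup>2 * (norm (Z x))\<^sup>2 / 2 \<le> T / 2" "t\<^sup>2 * (- V x * b / 2) \<le> 656 * T"
    "(f + t\<^sup>2 * b) ^ 3 / 6 - f ^ 3 / 6 \<le> 7351 / 6 * T" "0 \<le> T"
    using 1 2 3 by (simp_all add: T_def algebra_simps)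
  then have "t\<^sup>2 * (norm (Z x))\<^sup>2 / 2 + t\<^sup>2 * (- V x * b / 2) + ((f + t\<^sup>2 * b) ^ 3 / 6 - f ^ 3 / 6) \<le> 2000 * T"
    by linarith
  then show ?thesis
    unfolding competitor_grad_norm(2)[OF t] six c2 s_def[symmetric] p4 f_def[symmetric] T_def
    by (simp add: algebra_simps add_divide_distrib diff_divide_distrib)
qed

lemma gap_quotient_integrable:
  assumes t: "0 < t" "t \<le> 1"
  shows "integrable lborel (\<lambda>x. gap x / (competitor t x)\<^sup>2)"
proof -
  obtain K where K: "K > 0" "\<And>x. norm (G x) \<le> K * pw 2 (x \<bullet> x)" by (rule G_bound) (rule that)
  show ?thesis
  proof (rule integrable_pw_dominated[where C = "(K + 7)\<^sup>2 / t\<^sup>2"])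
    fix x :: "real ^ 3"
    define s where "s = pw 1 (x \<bullet> x)"
    have s: "s > 0" by (simp add: s_def)
    have "norm (\<phi> x *\<^sub>R Z x - s *\<^sub>R G x) \<le> \<bar>\<phi> x\<bar> * norm (Z x) + s * norm (G x)"
      using norm_triangle_ineq4[of "\<phi> x *\<^sub>R Z x" "s *\<^sub>R G x"] s by simp
    also have "\<dots> \<le> (7 * s) * pw 2 (x \<bullet> x) + s * (K * pw 2 (x \<bullet> x))"
      using \<phi>_bound[of x] Z_norm[of x] K(2)[of x] s by (intro add_mono mult_mono) (auto simp: s_def)
    also have "\<dots> = (K + 7) * s * pw 2 (x \<bullet> x)" by (simp add: algebra_simps)
    finally have "gap x \<le> ((K + 7) * s * pw 2 (x \<bullet> x))\<^sup>2"
      unfolding gap_def s_def[symmetric] by (intro power_mono) auto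
    moreover have "(t * s)\<^sup>2 \<le> (competitor t x)\<^sup>2"
      using competitor_bounds(3)[OF t, of x] t s less_imp_le[OF pw1_pos[of x]] by (intro power_mono) (auto simp: s_def)
    ultimately have "gap x / (competitor t x)\<^sup>2 \<le> ((K + 7) * s * pw 2 (x \<bullet> x))\<^sup>2 / (t * s)\<^sup>2"
      using t s by (intro frac_le) auto
    also have "\<dots> = (K + 7)\<^sup>2 / t\<^sup>2 * (pw 2 (x \<bullet> x))\<^sup>2"
      using t s by (simp add: power_mult_distrib)
    also have "(pw 2 (x \<bullet> x))\<^sup>2 = pw 4 (x \<bullet> x)" using pw_add[of "x \<bullet> x" 2 2] by (simp add: power2_eq_square)
    finally show "\<bar>gap x / (competitor t x)\<^sup>2\<bar> \<le> (K + 7)\<^sup>2 / t\<^sup>2 * pw 4 (x \<bullet> x)"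
      by (simp add: gap_def)
  qed measurable
qed

text \<open>Minimality leaves only terms with the common factor \<open>t^2\<close>; dividing by it
  gives a bound that does not depend on \<open>t\<close>.\<close>

lemma gap_integral_le:
  assumes ground: "ground_state V \<phi>" and t: "0 < t" "t \<le> 1"
  shows "(\<integral>x. gap x / (competitor t x)\<^sup>2 \<partial>lborel) \<le> 4000 * (\<integral>x. pw 4 (x \<bullet> x) \<partial>(lborel :: (real ^ 3) measure))"
proof -
  obtain K where K: "K > 0" "\<And>x. norm (G x) \<le> K * pw 2 (x \<bullet> x)" by (rule G_bound) (rule that)
  let ?e = "\<lambda>x. (norm (G x))\<^sup>2 / 2 - V x * (\<phi> x)\<^sup>2 / 2 + \<phi> x ^ 6 / 6"
  let ?e' = "\<lambda>x. (norm (competitor_grad t x))\<^sup>2 / 2 - V x * (competitor t x)\<^sup>2 / 2 + competitor t x ^ 6 / 6"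
  have i: "integrable lborel ?e"
  proof (rule energy_density_integrable)
    show "\<bar>\<phi> x\<bar> \<le> 8 * pw 1 (x \<bullet> x)" for x using \<phi>_bound[of x] pw1_pos[of x] by linarith
    show "norm (G x) \<le> K * pw 2 (x \<bullet> x)" for x by (rule K)
  qed measurable
  have i': "integrable lborel ?e'"
  proof (rule energy_density_integrable)
    show "\<bar>competitor t x\<bar> \<le> 8 * pw 1 (x \<bullet> x)" for x
      using competitor_bounds(1,4)[OF t, of x] by linarith
    show "norm (competitor_grad t x) \<le> (K + 1) * pw 2 (x \<bullet> x)" for x
      using competitor_grad_norm(1)[OF t, of x] K(2)[of x] Z_norm[of x] by (simp add: distrib_right)
  qed measurable
  have ip: "integrable lborel (\<lambda>x :: real ^ 3. t\<^sup>2 * (2000 * pw 4 (x \<bullet> x)))"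
    by (intro integrable_mult_right integrable_pw_4)
  have ig': "integrable lborel (\<lambda>x. t\<^sup>2 / 2 * (gap x / (competitor t x)\<^sup>2))"
    by (rule integrable_mult_right[OF gap_quotient_integrable[OF t]])
  have "J V \<phi> \<le> J V (competitor t)"
    using ground competitor_in_energy_space(2)[OF t] by (simp add: ground_state_def)
  then have "(\<integral>x. ?e x \<partial>lborel) \<le> (\<integral>x. ?e' x \<partial>lborel)"
    using energy_eq[OF weak_gradient_\<phi>(1), of V] energy_eq[OF competitor_in_energy_space(1)[OF t], of V] by simp
  also have "\<dots> \<le> (\<integral>x. ?e x + (t\<^sup>2 * (2000 * pw 4 (x \<bullet> x)) - t\<^sup>2 / 2 * (gap x / (competitor t x)\<^sup>2)) \<partial>lborel)"
    by (intro integral_mono i' energy_density_le[OF t] Bochner_Integration.integrable_add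
        Bochner_Integration.integrable_diff i ip ig')
  also have "\<dots> = (\<integral>x. ?e x \<partial>lborel) + (t\<^sup>2 * (2000 * (\<integral>x. pw 4 (x \<bullet> x) \<partial>(lborel :: (real ^ 3) measure)))
      - t\<^sup>2 / 2 * (\<integral>x. gap x / (competitor t x)\<^sup>2 \<partial>lborel))"
    by (simp only: Bochner_Integration.integral_add[OF i Bochner_Integration.integrable_diff[OF ip ig']]
        Bochner_Integration.integral_diff[OF ip ig'] integral_mult_right_zero)
  finally have "t\<^sup>2 * ((\<integral>x. gap x / (competitor t x)\<^sup>2 \<partial>lborel) / 2)
      \<le> t\<^sup>2 * (2000 * (\<integral>x. pw 4 (x \<bullet> x) \<partial>(lborel :: (real ^ 3) measure)))" by simp
  then show ?thesis using t by simp
qed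

text \<open>On the shell \<open>a < \<bar>x\<bar> < a + t\<close> outside a simple zero \<open>a\<close>, both \<open>\<phi>\<close> and \<open>t * pw 1 (x \<bullet> x)\<close> are \<open>O(t)\<close>, so that
  the integral is at least of order \<open>1 / t\<close>.\<close>

lemma gap_integral_ge: "\<exists>c>0. \<exists>d>0. \<forall>t. 0 < t \<longrightarrow> t \<le> d \<longrightarrow> c / t \<le> (\<integral>x. gap x / (competitor t x)\<^sup>2 \<partial>lborel)"
proof -
  obtain a where a: "a > 0" "w a = 0" "w' a \<noteq> 0" using simple_zero_exists by blast
  obtain K where K: "K > 0" "\<And>r. r \<ge> 0 \<Longrightarrow> \<bar>q r\<bar> \<le> K * pw 3 (r\<^sup>2)" "\<And>r. r \<ge> 0 \<Longrightarrow> \<bar>q r\<bar> \<le> K"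
    "\<And>r. r > 0 \<Longrightarrow> \<bar>D r / r\<^sup>2\<bar> \<le> K"
    by (rule q_bounds) (rule that)
  \<comment> \<open>Radial profile of the gap. At \<open>a\<close> the factor \<open>p\<close>
    vanishes while \<open>q\<close> does not, so \<open>m a\<close> is positive.\<close>
  define m where "m r = (r * (p r * pw 3 (r\<^sup>2) + pw 1 (r\<^sup>2) * q r))\<^sup>2" for r
  have gap_m: "gap x = m (norm x)" for x
  proof -
    have "\<phi> x *\<^sub>R Z x - pw 1 (x \<bullet> x) *\<^sub>R G x = - (p (norm x) * pw 3 (x \<bullet> x) + pw 1 (x \<bullet> x) * q (norm x)) *\<^sub>R x"
      by (simp add: \<phi>_def Z_def G_def algebra_simps)
    then have "gap x = \<bar>p (norm x) * pw 3 (x \<bullet> x) + pw 1 (x \<bullet> x) * q (norm x)\<bar>\<^sup>2 * (norm x)\<^sup>2"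
      unfolding gap_def by (simp only: norm_scaleR power_mult_distrib abs_minus_cancel)
    then show ?thesis by (simp add: m_def power_mult_distrib power2_norm_eq_inner mult.commute)
  qed
  have pa: "p a = 0" using a by (simp add: p_def)
  have "q a = w' a / a\<^sup>2" using a by (simp add: q_def D_def power2_eq_square power3_eq_cube)
  then have "q a \<noteq> 0" using a by simp
  then have ma: "m a > 0" using a pw_pos[of "a\<^sup>2" 1] by (simp add: m_def pa)
  have pw_isCont: "isCont (\<lambda>r :: real. pw k (r\<^sup>2)) a" for k
  proof -
    have "continuous_on UNIV (\<lambda>r :: real. pw k (r\<^sup>2))"
      by (rule continuous_on_compose2[OF pw_continuous]) (auto intro!: continuous_intros)
    then show ?thesis by (simp add: continuous_on_eq_continuous_at)
  qed
  have "isCont m a"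
    unfolding m_def using DERIV_isCont[OF q_deriv[OF a(1)]] DERIV_isCont[OF p_deriv[OF a(1)]]
    by (intro continuous_intros pw_isCont)
  then have "eventually (\<lambda>r. m r > m a / 2) (at a)"
    using ma by (intro order_tendstoD(1)) (auto simp: isCont_def)
  then obtain d where d: "d > 0" "\<And>r. r \<noteq> a \<Longrightarrow> dist r a < d \<Longrightarrow> m r > m a / 2"
    unfolding eventually_at by auto
  define v3 where "v3 = unit_ball_vol (real DIM(real ^ 3))"
  have v3: "v3 > 0" by (simp add: v3_def)
  \<comment> \<open>The lower bound \<open>m a / 2\<close> on the gap, over the bound
    \<open>(K^2 + 1) * t^2\<close> on the squared competitor, times the shell volume, which is at
    least \<open>v3 * 3 * a^2 * t\<close>.\<close>
  define c where "c = m a / 2 / (K\<^sup>2 + 1) * (v3 * (3 * a\<^sup>2))"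
  have c: "c > 0" unfolding c_def using ma v3 a by (intro mult_pos_pos divide_pos_pos) (auto simp: add_nonneg_pos)
  have "c / t \<le> (\<integral>x. gap x / (competitor t x)\<^sup>2 \<partial>lborel)" if t: "0 < t" "t \<le> min (d / 2) 1" for t
  proof -
    have t1: "t \<le> 1" "t < d" using t d(1) by auto
    \<comment> \<open>The sphere of radius \<open>a\<close> is removed: both the limit statement for
      \<open>m\<close> and the mean value theorem need radii strictly above
      \<open>a\<close>.\<close>
    define S where "S = ball (0 :: real ^ 3) (a + t) - cball 0 a"
    have [measurable]: "S \<in> sets borel" by (simp add: S_def)
    have finS: "emeasure lborel S < \<infinity>"
      by (rule le_less_trans[OF emeasure_mono[of S "ball 0 (a + t)"]])
         (use emeasure_lborel_ball_finite[of "0 :: real ^ 3" "a + t"] in \<open>auto simp: S_def\<close>)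
    have meas: "v3 * (3 * a\<^sup>2 * t) \<le> measure lborel S"
    proof -
      have "measure lborel S = measure lborel (ball (0 :: real ^ 3) (a + t)) - measure lborel (cball (0 :: real ^ 3) a)"
        unfolding S_def using t a
        using emeasure_lborel_ball_finite[of "0 :: real ^ 3" "a + t"]
        by (intro measure_Diff) (auto simp: top.not_eq_extremum)
      also have "\<dots> = v3 * (a + t) ^ 3 - v3 * a ^ 3"
        using a t content_ball[of "a + t" "0 :: real ^ 3"] content_cball[of a "0 :: real ^ 3"] by (simp add: v3_def)
      also have "\<dots> = v3 * (3 * a\<^sup>2 * t + 3 * a * t\<^sup>2 + t ^ 3)" by algebra
      also have "\<dots> \<ge> v3 * (3 * a\<^sup>2 * t)" using v3 a t by (intro mult_left_mono) auto
      finally show ?thesis .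
    qed
    have lower: "m a / 2 / ((K\<^sup>2 + 1) * t\<^sup>2) * indicator S x \<le> gap x / (competitor t x)\<^sup>2" for x
    proof (cases "x \<in> S")
      case True
      define r where "r = norm x"
      have r: "a < r" "r < a + t" using True by (auto simp: S_def r_def)
      have gapx: "gap x \<ge> m a / 2" using d(2)[of r] r t1 by (simp add: gap_m r_def[symmetric] dist_real_def)
      have "\<exists>z. a < z \<and> z < r \<and> p r - p a = (r - a) * (D z / z\<^sup>2)"
        using a by (intro MVT2 r(1) p_deriv) auto
      then obtain z where z: "a < z" "z < r" "p r - p a = (r - a) * (D z / z\<^sup>2)" by blast
      have "\<bar>p r\<bar> = (r - a) * \<bar>D z / z\<^sup>2\<bar>" using z r pa by (simp add: abs_mult)
      also have "\<dots> \<le> t * K" using r K(4)[of z] z a by (intro mult_mono) auto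
      finally have "\<bar>\<phi> x\<bar> \<le> t * K" by (simp add: \<phi>_def r_def)
      then have "(\<phi> x)\<^sup>2 \<le> (t * K)\<^sup>2" using power_mono[of "\<bar>\<phi> x\<bar>" "t * K" 2] by simp
      moreover have "t\<^sup>2 * (pw 1 (x \<bullet> x))\<^sup>2 \<le> t\<^sup>2 * 1"
        using pw_le_1[of "x \<bullet> x" 1] less_imp_le[OF pw1_pos[of x]] by (intro mult_left_mono power_le_one) auto
      ultimately have "(competitor t x)\<^sup>2 \<le> (K\<^sup>2 + 1) * t\<^sup>2"
        by (simp add: competitor_sq power_mult_distrib algebra_simps)
      moreover have "(competitor t x)\<^sup>2 > 0" using competitor_bounds(1)[OF t(1) t1(1), of x] by simp
      ultimately have "m a / 2 / ((K\<^sup>2 + 1) * t\<^sup>2) \<le> gap x / (competitor t x)\<^sup>2"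
        using gapx ma by (intro frac_le) auto
      then show ?thesis using True by simp
    next
      case False
      then show ?thesis by (simp add: gap_def)
    qed
    have "A / B * (C * X) / t = A / (B * t\<^sup>2) * (C * (X * t))" for A B C X :: real
      using t by (simp add: power2_eq_square)
    from this[of "m a / 2" "K\<^sup>2 + 1" v3 "3 * a\<^sup>2"] have "c / t = m a / 2 / ((K\<^sup>2 + 1) * t\<^sup>2) * (v3 * (3 * a\<^sup>2 * t))"
      by (simp only: c_def)
    also have "\<dots> \<le> m a / 2 / ((K\<^sup>2 + 1) * t\<^sup>2) * measure lborel S"
      using meas ma by (intro mult_left_mono) auto
    also have "\<dots> = (\<integral>x. m a / 2 / ((K\<^sup>2 + 1) * t\<^sup>2) * indicator S x \<partial>lborel)" by simp
    also have "\<dots> \<le> (\<integral>x. gap x / (competitor t x)\<^sup>2 \<partial>lborel)"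
      using finS by (intro integral_mono lower gap_quotient_integrable[OF t(1) t1(1)] integrable_mult_right
          integrable_real_indicator) auto
    finally show ?thesis .
  qed
  moreover have "min (d / 2) 1 > 0" using d by simp
  ultimately show ?thesis using c by blast
qed

theorem excited_\<phi>: "excited_state V \<phi>"
  unfolding excited_state_def
proof
  show "steady_state V \<phi>" by (rule steady_state_\<phi>)
  show "\<not> ground_state V \<phi>"
  proof
    assume ground: "ground_state V \<phi>"
    obtain c d where c: "c > 0" "d > 0"
      "\<And>t. 0 < t \<Longrightarrow> t \<le> d \<Longrightarrow> c / t \<le> (\<integral>x. gap x / (competitor t x)\<^sup>2 \<partial>lborel)"
      using gap_integral_ge by blast
    define I where "I = 4000 * (\<integral>x. pw 4 (x \<bullet> x) \<partial>(lborel :: (real ^ 3) measure))"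
    have "I \<ge> 0" unfolding I_def by (intro mult_nonneg_nonneg Bochner_Integration.integral_nonneg) (auto simp: less_imp_le[OF pw_pos])
    \<comment> \<open>\<open>t \<le> c / (I + 1)\<close> pushes the lower bound \<open>c / t\<close>
      up to at least \<open>I + 1\<close>, beyond the upper bound \<open>I\<close>.\<close>
    define t where "t = min (min d 1) (c / (I + 1))"
    have t: "0 < t" "t \<le> d" "t \<le> 1" "t \<le> c / (I + 1)" using c \<open>I \<ge> 0\<close> by (auto simp: t_def)
    have "c / t \<le> I" using c(3)[OF t(1,2)] gap_integral_le[OF ground t(1,3)] by (simp add: I_def)
    moreover have "I + 1 \<le> c / t" using t(1,4) \<open>I \<ge> 0\<close> by (simp add: field_simps)
    ultimately show False by simp
  qed
qed

end

section \<open>The open set of potentials\<close>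

text \<open>5244 = 4 * (15 + 1296), the 4 being the square of the constant 2 in
  \<open>(1 + r)^2 \<le> 2 * (1 + r^2)\<close>.\<close>

lemma base_potential_decay:
  "\<bar>base_potential ((norm x)\<^sup>2)\<bar> \<le> 5244 * (1 + norm x) powr (- 4)" for x :: "real ^ 3"
proof -
  define r where "r = norm x"
  have r: "r \<ge> 0" by (simp add: r_def)
  have s: "r\<^sup>2 \<ge> 0" by simp
  have "1 / (1 + r\<^sup>2) \<le> 2 / (1 + r)\<^sup>2"
  proof -
    have "0 \<le> (1 - r)\<^sup>2" by simp
    then have "(1 + r)\<^sup>2 \<le> 2 * (1 + r\<^sup>2)" by (simp add: power2_eq_square algebra_simps)
    then have "2 * 1 / (2 * (1 + r\<^sup>2)) \<le> 2 / (1 + r)\<^sup>2" using r by (intro frac_le) (auto simp: add_pos_nonneg)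
    then show ?thesis by (subst (asm) mult_divide_mult_cancel_left) simp_all
  qed
  then have "(y0 (r\<^sup>2))\<^sup>2 \<le> (2 / (1 + r)\<^sup>2)\<^sup>2"
    using y0_bounds[OF s] by (intro power_mono) (auto simp: y0_def pw_2)
  also have "\<dots> = 4 * (1 + r) powr (- 4)"
    using r by (simp add: powr_minus_divide power_divide flip: power_mult)
  finally have "(y0 (r\<^sup>2))\<^sup>2 * (15 + 1296 * (z0 (r\<^sup>2)) ^ 4) \<le> (4 * (1 + r) powr (- 4)) * (15 + 1296 * 1)"
    using z0_bounds[OF s] by (intro mult_mono add_mono) auto
  moreover have "0 \<le> base_potential (r\<^sup>2)" by (simp add: base_potential_def)
  ultimately show ?thesis by (simp add: base_potential_def r_def)
qed

lemma base_potential_continuous: "continuous_on UNIV (\<lambda>x :: 'a::real_normed_vector. base_potential ((norm x)\<^sup>2))"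
proof -
  have "continuous_on UNIV (\<lambda>x :: 'a. pw 2 ((norm x)\<^sup>2))"
    by (rule continuous_on_compose2[OF pw_continuous]) (auto intro!: continuous_intros)
  then show ?thesis
    unfolding base_potential_def y0_def z0_def by (intro continuous_intros)
qed

lemma stable_excited_state_exists:
  fixes V :: "real ^ 3 \<Rightarrow> real"
  assumes b: "2 < b" "b \<le> 5 / 2" and V: "radial V" "continuous_on UNIV V"
    and near: "\<And>x. (1 + norm x) powr b * \<bar>V x - base_potential ((norm x)\<^sup>2)\<bar> \<le> d"
    and d: "d \<le> barrier_gain b / 70000"
  shows "\<exists>\<phi>. excited_state V \<phi> \<and> stable V \<phi>"
proof -
  define e :: "real ^ 3" where "e = axis 1 1"
  have e: "norm e = 1" by (simp add: e_def)
  define v where "v r = V (r *\<^sub>R e)" for r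
  have Vv: "V x = v (norm x)" for x
    using V(1)[unfolded radial_def, rule_format, of x "norm x *\<^sub>R e"] by (simp add: v_def e)
  interpret near_base_potential b d v
  proof
    show "2 < b" "b \<le> 5 / 2" "d \<le> barrier_gain b / 70000" by fact+
    show "0 \<le> d" using near[of 0] by (rule order_trans[rotated]) simp
    show "continuous_on UNIV v"
      unfolding v_def by (rule continuous_on_compose2[OF V(2)]) (auto intro!: continuous_intros)
    show "v (- r) = v r" for r using V(1) unfolding radial_def v_def by simp
    show "\<bar>v r - base_potential (r\<^sup>2)\<bar> \<le> d * pw b (r\<^sup>2)" for r
    proof -
      have n: "norm (r *\<^sub>R e) = \<bar>r\<bar>" by (simp add: e)
      have pos: "(1 + \<bar>r\<bar>) powr b > 0" by simp
      have "(1 + \<bar>r\<bar>) powr b * \<bar>v r - base_potential (r\<^sup>2)\<bar> \<le> d"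
        using near[of "r *\<^sub>R e"] unfolding n v_def by simp
      then have "\<bar>v r - base_potential (r\<^sup>2)\<bar> \<le> d * (1 / (1 + \<bar>r\<bar>) powr b)"
        using pos by (simp add: field_simps)
      also have "1 / (1 + \<bar>r\<bar>) powr b \<le> pw b (r\<^sup>2)"
      proof -
        have "1 + r\<^sup>2 \<le> (1 + \<bar>r\<bar>)\<^sup>2" by (simp add: power2_eq_square algebra_simps)
        then have "((1 + \<bar>r\<bar>)\<^sup>2) powr (- (b / 2)) \<le> (1 + r\<^sup>2) powr (- (b / 2))"
          using b by (intro powr_mono2') (auto simp: add_pos_nonneg)
        moreover have "((1 + \<bar>r\<bar>)\<^sup>2) powr (- (b / 2)) = (1 + \<bar>r\<bar>) powr (- b)"
        proof -
          have "(1 + \<bar>r\<bar>)\<^sup>2 = (1 + \<bar>r\<bar>) powr 2" by simp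
          then show ?thesis by (simp only: powr_powr) simp
        qed
        ultimately show ?thesis by (simp add: pw_def powr_minus_divide)
      qed
      finally show ?thesis using \<open>0 \<le> d\<close> by (simp add: mult_left_mono)
    qed
  qed
  obtain w w' where "\<And>r. w (- r) = - w r" "\<And>r. (w has_real_derivative w' r) (at r)"
    "\<And>r. (w' has_real_derivative - v r * w r + w r ^ 5 / r ^ 4) (at r)"
    "\<And>r. r > 0 \<Longrightarrow> \<bar>w r - r * pw_comb profile (r\<^sup>2)\<bar> \<le> r * ((1 / 10000) * pw 1 (r\<^sup>2))"
    using radial_solution_exists by blast
  then interpret rs: radial_steady_state b d v w w'
    by unfold_locales
  have "rs.V = V" by (simp add: fun_eq_iff rs.V_def Vv)
  then show ?thesis using rs.excited_\<phi> rs.stable_\<phi> by metis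
qed

theorem theorem1p1:
  fixes \<beta> :: real
  assumes "\<beta> > 2"
  shows "\<exists>\<O>. openin (Y_topology \<beta>) \<O> \<and> \<O> \<noteq> {} \<and>
           (\<forall>V\<in>\<O>. \<exists>\<phi>. excited_state V \<phi> \<and> stable V \<phi>)"
proof -
  \<comment> \<open>The barrier is built for exponents up to 5/2. The weight with exponent
    \<open>b\<close> is the weaker one, so closeness measured by it is an open condition in
    \<open>Y \<beta>\<close> too.\<close>
  define b where "b = min \<beta> (5 / 2)"
  have b: "2 < b" "b \<le> 5 / 2" "b \<le> \<beta>" using assms by (auto simp: b_def)
  define V0 where "V0 x = base_potential ((norm x)\<^sup>2)" for x :: "real ^ 3"
  define \<delta> where "\<delta> = barrier_gain b / 70000"
  have \<delta>: "\<delta> > 0" using b by (simp add: \<delta>_def barrier_gain_def)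
  \<comment> \<open>One uniform \<open>d < \<delta>\<close> instead of a strict inequality at each
    point: the difference \<open>\<delta> - d\<close> is the radius of a ball inside the
    set.\<close>
  define \<O> where "\<O> = {V \<in> Y \<beta>. \<exists>d<\<delta>. \<forall>x. (1 + norm x) powr b * \<bar>V x - V0 x\<bar> \<le> d}"
  have "openin (Y_topology \<beta>) \<O>"
    unfolding Metric_space.openin_mtopology[OF Metric_space_Y]
  proof (intro conjI allI impI)
    show "\<O> \<subseteq> Y \<beta>" by (auto simp: \<O>_def)
    fix V assume "V \<in> \<O>"
    then obtain d where V: "V \<in> Y \<beta>" and d: "d < \<delta>" "\<And>x. (1 + norm x) powr b * \<bar>V x - V0 x\<bar> \<le> d"
      by (auto simp: \<O>_def)
    have "Metric_space.mball (Y \<beta>) (Y_dist \<beta>) V (\<delta> - d) \<subseteq> \<O>"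
    proof
      fix W assume "W \<in> Metric_space.mball (Y \<beta>) (Y_dist \<beta>) V (\<delta> - d)"
      then have W: "W \<in> Y \<beta>" "Y_dist \<beta> V W < \<delta> - d"
        by (auto simp: Metric_space.in_mball[OF Metric_space_Y])
      define D where "D = Y_dist \<beta> V W"
      have "(1 + norm x) powr b * \<bar>W x - V0 x\<bar> \<le> d + D" for x
      proof -
        have "(1 + norm x) powr b * \<bar>V x - W x\<bar> \<le> (1 + norm x) powr \<beta> * \<bar>V x - W x\<bar>"
          using b(3) by (intro mult_right_mono powr_mono) auto
        also have "\<dots> \<le> D"
          using Y_norm_upper[OF Y_diff[OF V W(1)], of x] V W(1) by (simp add: D_def Y_dist_def)
        finally have "(1 + norm x) powr b * \<bar>V x - W x\<bar> \<le> D" .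
        moreover have "(1 + norm x) powr b * \<bar>W x - V0 x\<bar>
            \<le> (1 + norm x) powr b * (\<bar>V x - V0 x\<bar> + \<bar>V x - W x\<bar>)"
          by (intro mult_left_mono) auto
        ultimately show ?thesis using d(2)[of x] by (simp add: distrib_left)
      qed
      moreover have "d + D < \<delta>" using W(2) by (simp add: D_def)
      ultimately show "W \<in> \<O>" using W(1) by (auto simp: \<O>_def)
    qed
    then show "\<exists>r>0. Metric_space.mball (Y \<beta>) (Y_dist \<beta>) V r \<subseteq> \<O>"
      using d(1) by (intro exI[of _ "\<delta> - d"]) auto
  qed
  moreover have "\<O> \<noteq> {}"
  proof -
    \<comment> \<open>The base potential decays only like the fourth power and need not lie in
      \<open>Y \<beta>\<close>, so it is truncated between the radii \<open>R\<close> and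
      \<open>2 * R\<close>. The choice makes the truncation error at most
      \<open>5244 / R = \<delta> / 2\<close> in the weaker weight.\<close>
    define R where "R = 10488 / \<delta>"
    have R: "R > 0" using \<delta> by (simp add: R_def)
    define k where "k r = max 0 (min 1 (2 - r / R))" for r
    have k: "0 \<le> k r" "k r \<le> 1" for r by (auto simp: k_def)
    have k0: "k r = 0" if "r \<ge> 2 * R" for r using that R by (auto simp: k_def field_simps max_def min_def)
    have k1: "k r = 1" if "r \<le> R" for r using that R by (auto simp: k_def field_simps)
    define V1 where "V1 x = V0 x * k (norm x)" for x :: "real ^ 3"
    have V0_bound: "\<bar>V0 x\<bar> \<le> 5244 * (1 + norm x) powr (- 4)" for x
      using base_potential_decay by (simp add: V0_def)
    have "V1 \<in> Y \<beta>"
      unfolding Y_def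
    proof (intro CollectI conjI)
      show "radial V1" by (auto simp: radial_def V1_def V0_def)
      show "continuous_on UNIV V1"
        unfolding V1_def V0_def k_def using R
        by (intro continuous_intros base_potential_continuous) auto
      show "bdd_above (range (\<lambda>x. (1 + norm x) powr \<beta> * \<bar>V1 x\<bar>))"
      proof (rule bdd_aboveI2)
        fix x :: "real ^ 3"
        show "(1 + norm x) powr \<beta> * \<bar>V1 x\<bar> \<le> (1 + 2 * R) powr \<beta> * 5244"
        proof (cases "norm x \<ge> 2 * R")
          case True
          then show ?thesis by (simp add: V1_def k0)
        next
          case False
          have "(1 + norm x) powr (- 4) \<le> 1"
            using powr_mono2'[of "- 4" 1 "1 + norm x"] by simp
          then have "\<bar>V0 x\<bar> \<le> 5244" using V0_bound[of x] by simp
          then have "\<bar>V1 x\<bar> \<le> 5244 * 1"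
            unfolding V1_def abs_mult using k by (intro mult_mono) auto
          moreover have "(1 + norm x) powr \<beta> \<le> (1 + 2 * R) powr \<beta>"
            using False assms by (intro powr_mono2) auto
          ultimately show ?thesis by (intro mult_mono) auto
        qed
      qed
    qed
    moreover have "(1 + norm x) powr b * \<bar>V1 x - V0 x\<bar> \<le> \<delta> / 2" for x
    proof (cases "norm x \<le> R")
      case True
      then show ?thesis using \<delta> by (simp add: V1_def k1)
    next
      case False
      have "V1 x - V0 x = - (V0 x * (1 - k (norm x)))" by (simp add: V1_def algebra_simps)
      then have "\<bar>V1 x - V0 x\<bar> = \<bar>V0 x\<bar> * (1 - k (norm x))" using k by (simp add: abs_mult)
      also have "\<dots> \<le> (5244 * (1 + norm x) powr (- 4)) * 1"
        using k V0_bound by (intro mult_mono) auto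
      finally have "(1 + norm x) powr b * \<bar>V1 x - V0 x\<bar> \<le> (1 + norm x) powr b * (5244 * (1 + norm x) powr (- 4))"
        by (intro mult_left_mono) auto
      also have "\<dots> = 5244 * (1 + norm x) powr (b - 4)"
        by (simp add: powr_add[symmetric] mult.left_commute)
      also have "\<dots> \<le> 5244 * (1 + norm x) powr (- 1)"
        using b by (intro mult_left_mono powr_mono) auto
      also have "\<dots> \<le> 5244 * (1 / R)"
        using False R by (intro mult_left_mono) (auto simp: powr_minus_divide intro!: divide_left_mono)
      also have "\<dots> = \<delta> / 2" using \<delta> by (simp add: R_def)
      finally show ?thesis .
    qed
    ultimately have "V1 \<in> \<O>" using \<delta> unfolding \<O>_def by (auto intro!: exI[of _ "\<delta> / 2"])
    then show ?thesis by blast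
  qed
  moreover have "\<exists>\<phi>. excited_state V \<phi> \<and> stable V \<phi>" if V: "V \<in> \<O>" for V
  proof -
    obtain d where "V \<in> Y \<beta>" "d < \<delta>" "\<And>x. (1 + norm x) powr b * \<bar>V x - V0 x\<bar> \<le> d"
      using V by (auto simp: \<O>_def)
    then show ?thesis
      using b by (intro stable_excited_state_exists[of b V d]) (auto simp: Y_def V0_def \<delta>_def)
  qed
  ultimately show ?thesis by blast
qed

end
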